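(* Let $\Psi=(u,v)\in\boldsymbol X$ be a regular solution of the von Kármán equations and, for sufficiently large $\sigma_2$ and sufficiently small $h$, let $\Psi_{dG}=(u_{dG},v_{dG})\in\boldsymbol P_2(\mathcal T)$ be the local solution of the discrete problem $A_{dG}(\Psi_{dG},\Phi_{dG})+B_{dG}(\Psi_{dG},\Psi_{dG},\Phi_{dG})=L_{dG}(\Phi_{dG})$ for all $\Phi_{dG}\in\boldsymbol P_2(\mathcal T)$. There exists a positive constant $C_{\rm eff}$ independent of $h$ but dependent on $\Psi$ such that $$\sum_{K\in\mathcal T}\eta_K^2+\sum_{E\in\mathcal E(\Omega)}\eta_E^2\le C_{\rm eff}^2\Big(|||\Psi-\Psi_{dG}|||_{dG}^2+\mathrm{osc}^2(f)\Big),$$ where $\mathrm{osc}^2(f):=\sum_{K\in\mathcal T}h_K^4\|f-f_h\|_{L^2(K)}^2$, $f_h$ denotes the piecewise average of $f$ (on each $K\in\mathcal T$), and, for $K\in\mathcal T$ and $E\in\mathcal E(\Omega)$, $$\eta_K^2:=h_K^4\big(\|f+[u_{dG},v_{dG}]\|_{L^2(K)}^2+\|[u_{dG},u_{dG}]\|_{L^2(K)}^2\big),$$ $$\eta_E^2:=h_E\big(\|[D^2u_{dG}\,\nu_E]_E\|_{L^2(E)}^2+\|[D^2v_{dG}\,\nu_E]_E\|_{L^2(E)}^2\big)+h_E^{-3}\big(\|[u_{dG}]_E\|_{L^2(E)}^2+\|[v_{dG}]_E\|_{L^2(E)}^2\big)+h_E^{-1}\big(\|[\nabla u_{dG}]_E\|_{L^2(E)}^2+\|[\nabla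 v_{dG}]_E\|_{L^2(E)}^2\big).$$
   Context: Continuous problem. $\Omega\subset\mathbb R^2$ is a bounded polygonal domain, $X:=H^2_0(\Omega)$, and bold letters denote products ($\boldsymbol X=X\times X$, $\boldsymbol H^s=H^s\times H^s$, etc.). $\alpha\in(1/2,1]$ is the index of elliptic regularity of $\Omega$: solutions $w\in H^2_0(\Omega)$ of $\Delta^2w=g$ with $g\in H^{-1}(\Omega)$ lie in $H^{2+\alpha}(\Omega)$ (with norm bound). The von Kármán bracket is $[\eta,\chi]=\eta_{xx}\chi_{yy}+\eta_{yy}\chi_{xx}-2\eta_{xy}\chi_{xy}$ (piecewise for piecewise polynomials). For $f\in L^2(\Omega)$ put $a(\eta,\chi)=\int_\Omega D^2\eta:D^2\chi\,dx$, $b(\eta,\chi,\varphi)=-\frac12\int_\Omega[\eta,\chi]\varphi\,dx$, $l(\varphi)=\int_\Omega f\varphi\,dx$, and for $\Xi=(\xi_1,\xi_2),\Theta=(\theta_1,\theta_2),\Phi=(\varphi_1,\varphi_2)\in\boldsymbol X$: $A(\Theta,\Phi)=a(\theta_1,\varphi_1)+a(\theta_2,\varphi_2)$, $B(\Xi,\Theta,\Phi)=b(\xi_1,\theta_2,\varphi_1)+b(\xi_2,\theta_1,\varphi_1)-b(\xi_1,\theta_1,\varphi_2)$, $L(\Phi)=l(\varphi_1)$, $|||\Phi|||_2=(|\varphi_1|_{H^2(\Omega)}^2+|\varphi_2|_{H^2(\Omega)}^2)^{1/2}$. A regular solution is $\Psi=(u,v)\in\boldsymbol X$ with $A(\Psi,\Phi)+B(\Psi,\Psi,\Phi)-L(\Phi)=0$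 for all $\Phi\in\boldsymbol X$ (weak form of $\Delta^2u=[u,v]+f$, $\Delta^2v=-\frac12[u,u]$) such that $$0<\beta:=\inf_{\Theta\in \boldsymbol X,\,|||\Theta|||_2=1}\ \sup_{\Phi\in \boldsymbol X,\,|||\Phi|||_2=1}\big(A(\Theta,\Phi)+2B(\Psi,\Theta,\Phi)\big).$$ Regular solutions belong to $\boldsymbol H^{2+\alpha}(\Omega)$. Discretization. $\mathcal T$ ranges over a shape-regular family of triangulations of $\Omega$ into closed triangles; $h_K=\mathrm{diam}\,K$, $h=\max_{K\in\mathcal T} h_K$; $\mathcal E$ is the set of all edges (interior and boundary), $\mathcal E(\Omega)$ the set of interior edges, $h_E$ the length and $\nu_E$ a unit normal of $E\in\mathcal E$. $P_r(\mathcal T)$ is the space of (discontinuous) piecewise polynomials of degree $\le r$, $\boldsymbol P_2(\mathcal T)=P_2(\mathcal T)^2$. $H^s(\mathcal T)$ is the broken Sobolev space with seminorm $|\cdot|_{H^s(\mathcal T)}$. For an interior edge $E=\partial K_+\cap\partial K_-$: $[\varphi]_E=\varphi|_{K_+}-\varphi|_{K_-}$, $\langle\varphi\rangle_E=\frac12(\varphi|_{K_+}+\varphi|_{K_-})$; for a boundary edge $[\varphi]_E=\langle\varphi\rangle_E=\varphi|_E$ (componentwise for vector functions). For stabilization parameters $\sigma_1,\sigma_2>0$: $$a_{dG}(\eta,\chi)=\sum_{K}\int_K D^2\eta:D^2\chi\,dx-J(\eta,\chi)-J(\chi,\eta)+J_{\sigma_1,\sigma_2}(\eta,\chi),\quad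 J(\eta,\chi)=\sum_{E\in\mathcal E}\int_E[\nabla\chi]_E\cdot\langle D^2\eta\,\nu_E\rangle_E\,ds,$$ $$J_{\sigma_1,\sigma_2}(\eta,\chi)=\sum_{E\in\mathcal E}\frac{\sigma_1}{h_E^3}\int_E[\eta]_E[\chi]_E\,ds+\sum_{E\in\mathcal E}\frac{\sigma_2}{h_E}\int_E[\nabla\eta\cdot\nu_E]_E[\nabla\chi\cdot\nu_E]_E\,ds,$$ $b_{dG}(\eta,\chi,\varphi)=-\frac12\sum_K\int_K[\eta,\chi]\varphi\,dx$; $A_{dG}(\Theta,\Phi)=a_{dG}(\theta_1,\varphi_1)+a_{dG}(\theta_2,\varphi_2)$; $B_{dG}(\Xi,\Theta,\Phi)=b_{dG}(\xi_1,\theta_2,\varphi_1)+b_{dG}(\xi_2,\theta_1,\varphi_1)-b_{dG}(\xi_1,\theta_1,\varphi_2)$; $L_{dG}(\Phi)=\sum_K\int_K f\varphi_1\,dx$. Norms: $\|\varphi\|_{dG}^2=|\varphi|_{H^2(\mathcal T)}^2+\sum_{E\in\mathcal E}\frac{\sigma_1}{h_E^3}\|[\varphi]_E\|_{L^2(E)}^2+\sum_{E\in\mathcal E}\frac{\sigma_2}{h_E}\|[\nabla\varphi\cdot\nu_E]_E\|_{L^2(E)}^2$, $|||\Phi|||_{dG}^2=\|\varphi_1\|_{dG}^2+\|\varphi_2\|_{dG}^2$. Interpolation. $\Pi_h:H^s(\mathcal T)\to P_2(\mathcal T)$ (applied componentwise) is a fixed linear operator with $\|\varphi-\Pi_h\varphi\|_{H^q(K)}\le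 C h_K^{\min(3,s)-q}\|\varphi\|_{H^s(K)}$ for $0\le q\le s$, $K\in\mathcal T$, and $\|\varphi-\Pi_h\varphi\|_{dG}\le C h^\alpha\|\varphi\|_{H^{2+\alpha}(\Omega)}$ for $\varphi\in H^{2+\alpha}(\Omega)$. Local discrete solution. $\mathbb B_R(\Pi_h\Psi)=\{\Phi_{dG}\in\boldsymbol P_2(\mathcal T):|||\Phi_{dG}-\Pi_h\Psi|||_{dG}\le R\}$. For sufficiently large $\sigma_2$ and sufficiently small $h$ the form $\tilde{\mathcal A}_{dG}(\Theta,\Phi)=A_{dG}(\Theta,\Phi)+2B_{dG}(\Pi_h\Psi,\Theta,\Phi)$ satisfies an $h$-uniform inf-sup condition on $\boldsymbol P_2(\mathcal T)$, so that $\mu:\boldsymbol P_2(\mathcal T)\to\boldsymbol P_2(\mathcal T)$ is well defined by $\tilde{\mathcal A}_{dG}(\mu(\Theta),\Phi)=L_{dG}(\Phi)+2B_{dG}(\Pi_h\Psi,\Theta,\Phi)-B_{dG}(\Theta,\Theta,\Phi)$ for all $\Phi\in\boldsymbol P_2(\mathcal T)$. $R(h):=2C_1h^\alpha$, where $C_1>0$ is an $h$-independent constant with $|||\mu(\Theta)-\Pi_h\Psi|||_{dG}\le C_1(h^\alpha+|||\Theta-\Pi_h\Psi|||_{dG}^2)$ for all $\Theta\in\boldsymbol P_2(\mathcal T)$. The local discrete solution $\Psi_{dG}$ is the unique solution of the discrete problem in $\mathbb B_{R(h)}(\Pi_h\Psi)$ (which exists for sufficiently large $\sigma_2$ and sufficiently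 small $h$). Convention. "For sufficiently large $\sigma_2$ and sufficiently small $h$ ..." means: there exists $\underline\sigma_2$ such that for all $\sigma_2\ge\underline\sigma_2$ (large enough that $a_{dG}$ is elliptic, i.e. $\beta_0\|\theta\|_{dG}^2\le a_{dG}(\theta,\theta)$ on $P_2(\mathcal T)$ with some $h$-independent $\beta_0>0$), there exists $h(\sigma_2)>0$ such that for all $\mathcal T$ with $h\le h(\sigma_2)$ the assertion holds. $\sigma_1>0$ is fixed. *)

theory Defs
  imports "HOL-Analysis.Analysis"
begin

type_synonym pt = "real^2"
type_synonym scalar_fn = "pt \<Rightarrow> real"
type_synonym pair_fn = "scalar_fn \<times> scalar_fn"
type_synonym mesh = "pt set set"

definition sub_fn :: "scalar_fn \<Rightarrow> scalar_fn \<Rightarrow> scalar_fn" where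
  "sub_fn \<phi> \<psi> = (\<lambda>x. \<phi> x - \<psi> x)"

definition sub_pair :: "pair_fn \<Rightarrow> pair_fn \<Rightarrow> pair_fn" where
  "sub_pair \<Phi> \<Theta> = (sub_fn (fst \<Phi>) (fst \<Theta>), sub_fn (snd \<Phi>) (snd \<Theta>))"


section \<open>Sobolev spaces\<close>

text \<open>Derivatives are indexed by lists of coordinate directions; the empty list is the function
  itself. All function spaces consist of representatives: only the values almost everywhere
  on the respective open set matter.\<close>

fun partial :: "2 list \<Rightarrow> scalar_fn \<Rightarrow> scalar_fn" where
  "partial [] f = f"
| "partial (i # js) f = (\<lambda>x. frechet_derivative (partial js f) (at x) (axis i 1))"

definition smooth :: "scalar_fn \<Rightarrow> bool" where
  "smooth f \<longleftrightarrow> (\<forall>js x. partial js f differentiable (at x))"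

definition test_functions :: "pt set \<Rightarrow> scalar_fn set" where
  "test_functions D =
     {\<phi>. smooth \<phi> \<and> compact (closure {x. \<phi> x \<noteq> 0}) \<and> closure {x. \<phi> x \<noteq> 0} \<subseteq> D}"

definition locally_integrable :: "pt set \<Rightarrow> scalar_fn \<Rightarrow> bool" where
  "locally_integrable D f \<longleftrightarrow> (\<forall>C. compact C \<and> C \<subseteq> D \<longrightarrow> set_integrable lebesgue C f)"

definition L2 :: "pt set \<Rightarrow> scalar_fn set" where
  "L2 D = {f. set_borel_measurable lebesgue D f \<and> set_integrable lebesgue D (\<lambda>x. (f x)\<^sup>2)}"

definition is_weak_deriv :: "pt set \<Rightarrow> 2 list \<Rightarrow> scalar_fn \<Rightarrow> scalar_fn \<Rightarrow> bool" where
  "is_weak_deriv D js f g \<longleftrightarrow> locally_integrable D f \<and> locally_integrable D g \<and>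
     (\<forall>\<phi>\<in>test_functions D.
        (LINT x:D|lebesgue. f x * partial js \<phi> x)
          = (-1) ^ length js * (LINT x:D|lebesgue. g x * \<phi> x))"

definition weak_deriv :: "pt set \<Rightarrow> 2 list \<Rightarrow> scalar_fn \<Rightarrow> scalar_fn" where
  "weak_deriv D js f = (SOME g. is_weak_deriv D js f g)"

text \<open>Squared integer-order seminorm \<open>\<parallel>D\<^sup>m f\<parallel>\<^sup>2\<close>. Summing over lists counts mixed derivatives with
  multiplicity, i.e. it uses the Frobenius norm, so that for \<open>m = 2\<close> this is \<open>\<integral> D\<^sup>2f : D\<^sup>2f\<close>.\<close>

definition seminorm_sq :: "nat \<Rightarrow> pt set \<Rightarrow> scalar_fn \<Rightarrow> real" where
  "seminorm_sq m D f = (\<Sum>js | length js = m. LINT x:D|lebesgue. (weak_deriv D js f x)\<^sup>2)"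

text \<open>Squared Sobolev-Slobodeckij seminorm of order \<open>\<theta> \<in> (0,1)\<close> in two space dimensions.\<close>

definition slobodeckij_sq :: "real \<Rightarrow> pt set \<Rightarrow> scalar_fn \<Rightarrow> ennreal" where
  "slobodeckij_sq \<theta> D g =
     (\<integral>\<^sup>+x\<in>D. (\<integral>\<^sup>+y\<in>D. ennreal ((g x - g y)\<^sup>2 / norm (x - y) powr (2 + 2 * \<theta>)) \<partial>lebesgue) \<partial>lebesgue)"

definition Hs :: "real \<Rightarrow> pt set \<Rightarrow> scalar_fn set" where
  "Hs s D = {f. (\<forall>js. length js \<le> nat \<lfloor>s\<rfloor> \<longrightarrow> (\<exists>g\<in>L2 D. is_weak_deriv D js f g)) \<and>
     (frac s > 0 \<longrightarrow> (\<forall>js. length js = nat \<lfloor>s\<rfloor> \<longrightarrow>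
        slobodeckij_sq (frac s) D (weak_deriv D js f) < \<infinity>))}"

definition Hs_norm :: "real \<Rightarrow> pt set \<Rightarrow> scalar_fn \<Rightarrow> real" where
  "Hs_norm s D f = sqrt ((\<Sum>m\<le>nat \<lfloor>s\<rfloor>. seminorm_sq m D f) +
     (if frac s > 0
      then \<Sum>js | length js = nat \<lfloor>s\<rfloor>. enn2real (slobodeckij_sq (frac s) D (weak_deriv D js f))
      else 0))"

definition Hk0 :: "nat \<Rightarrow> pt set \<Rightarrow> scalar_fn set" where
  "Hk0 k D = {f \<in> Hs (real k) D. \<exists>\<phi>. (\<forall>n. \<phi> n \<in> test_functions D) \<and>
     (\<lambda>n. Hs_norm (real k) D (sub_fn (\<phi> n) f)) \<longlonglongrightarrow> 0}"


section \<open>The continuous problem\<close>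

text \<open>Polygonal domains may be multiply connected; the condition \<open>interior (closure \<Omega>) = \<Omega>\<close>
  excludes slits and punctures.\<close>

definition polygonal_domain :: "pt set \<Rightarrow> bool" where
  "polygonal_domain \<Omega> \<longleftrightarrow> \<Omega> \<noteq> {} \<and> open \<Omega> \<and> connected \<Omega> \<and> bounded \<Omega> \<and>
     interior (closure \<Omega>) = \<Omega> \<and>
     (\<exists>S. finite S \<and> (\<forall>s\<in>S. \<exists>p q. s = closed_segment p q) \<and> frontier \<Omega> = \<Union>S)"

definition a_form :: "pt set \<Rightarrow> scalar_fn \<Rightarrow> scalar_fn \<Rightarrow> real" where
  "a_form D \<eta> \<zeta> =
     (LINT x:D|lebesgue. (\<Sum>i\<in>UNIV. \<Sum>j\<in>UNIV. weak_deriv D [i,j] \<eta> x * weak_deriv D [i,j] \<zeta> x))"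

text \<open>\<open>G\<close> ranges over the bounded linear functionals on \<open>H\<^sup>1\<^sub>0\<close>, \<open>c\<close> over the upper bounds of its
  \<open>H\<^sup>-\<^sup>1\<close> norm, and \<open>\<Delta>\<^sup>2 w = G\<close> is understood weakly.\<close>

definition elliptic_regularity :: "pt set \<Rightarrow> real \<Rightarrow> bool" where
  "elliptic_regularity \<Omega> \<alpha> \<longleftrightarrow> (\<exists>C. \<forall>G c. \<forall>w\<in>Hk0 2 \<Omega>.
     (\<forall>\<phi>\<in>Hk0 1 \<Omega>. \<forall>\<psi>\<in>Hk0 1 \<Omega>. \<forall>s t. G (\<lambda>x. s * \<phi> x + t * \<psi> x) = s * G \<phi> + t * G \<psi>) \<and>
     (\<forall>\<phi>\<in>Hk0 1 \<Omega>. \<bar>G \<phi>\<bar> \<le> c * Hs_norm 1 \<Omega> \<phi>) \<and>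
     (\<forall>\<phi>\<in>Hk0 2 \<Omega>. a_form \<Omega> w \<phi> = G \<phi>)
     \<longrightarrow> w \<in> Hs (2 + \<alpha>) \<Omega> \<and> Hs_norm (2 + \<alpha>) \<Omega> w \<le> C * c)"

text \<open>The von Karman bracket, relative to a (weak or broken) differentiation operator.\<close>

definition vk_bracket ::
  "(2 list \<Rightarrow> scalar_fn \<Rightarrow> scalar_fn) \<Rightarrow> scalar_fn \<Rightarrow> scalar_fn \<Rightarrow> scalar_fn" where
  "vk_bracket D \<eta> \<zeta> = (\<lambda>x. D [1,1] \<eta> x * D [2,2] \<zeta> x + D [2,2] \<eta> x * D [1,1] \<zeta> x
     - 2 * D [1,2] \<eta> x * D [1,2] \<zeta> x)"

definition b_form :: "pt set \<Rightarrow> scalar_fn \<Rightarrow> scalar_fn \<Rightarrow> scalar_fn \<Rightarrow> real" where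
  "b_form \<Omega> \<eta> \<zeta> \<phi> =
     - (1/2) * (LINT x:\<Omega>|lebesgue. vk_bracket (weak_deriv \<Omega>) \<eta> \<zeta> x * \<phi> x)"

definition vec_A :: "(scalar_fn \<Rightarrow> scalar_fn \<Rightarrow> real) \<Rightarrow> pair_fn \<Rightarrow> pair_fn \<Rightarrow> real" where
  "vec_A a \<Theta> \<Phi> = a (fst \<Theta>) (fst \<Phi>) + a (snd \<Theta>) (snd \<Phi>)"

definition vec_B ::
  "(scalar_fn \<Rightarrow> scalar_fn \<Rightarrow> scalar_fn \<Rightarrow> real) \<Rightarrow> pair_fn \<Rightarrow> pair_fn \<Rightarrow> pair_fn \<Rightarrow> real" where
  "vec_B b \<Xi> \<Theta> \<Phi> = b (fst \<Xi>) (snd \<Theta>) (fst \<Phi>) + b (snd \<Xi>) (fst \<Theta>) (fst \<Phi>)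
     - b (fst \<Xi>) (fst \<Theta>) (snd \<Phi>)"

definition L_form :: "pt set \<Rightarrow> scalar_fn \<Rightarrow> pair_fn \<Rightarrow> real" where
  "L_form \<Omega> f \<Phi> = (LINT x:\<Omega>|lebesgue. f x * fst \<Phi> x)"

definition X_space :: "pt set \<Rightarrow> pair_fn set" where
  "X_space \<Omega> = Hk0 2 \<Omega> \<times> Hk0 2 \<Omega>"

definition X_norm :: "pt set \<Rightarrow> pair_fn \<Rightarrow> real" where
  "X_norm \<Omega> \<Phi> = sqrt (seminorm_sq 2 \<Omega> (fst \<Phi>) + seminorm_sq 2 \<Omega> (snd \<Phi>))"

text \<open>Infimum and supremum are taken in the extended reals, so they carry no side conditions.\<close>

definition regular_solution :: "pt set \<Rightarrow> scalar_fn \<Rightarrow> pair_fn \<Rightarrow> bool" where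
  "regular_solution \<Omega> f \<Psi> \<longleftrightarrow> \<Psi> \<in> X_space \<Omega> \<and>
     (\<forall>\<Phi>\<in>X_space \<Omega>.
        vec_A (a_form \<Omega>) \<Psi> \<Phi> + vec_B (b_form \<Omega>) \<Psi> \<Psi> \<Phi> - L_form \<Omega> f \<Phi> = 0) \<and>
     0 < (INF \<Theta>\<in>{\<Theta>\<in>X_space \<Omega>. X_norm \<Omega> \<Theta> = 1}. SUP \<Phi>\<in>{\<Phi>\<in>X_space \<Omega>. X_norm \<Omega> \<Phi> = 1}.
            ereal (vec_A (a_form \<Omega>) \<Theta> \<Phi> + 2 * vec_B (b_form \<Omega>) \<Psi> \<Theta> \<Phi>))"


section \<open>Triangulations, traces and jumps\<close>

definition mesh_of :: "pt set \<Rightarrow> mesh \<Rightarrow> bool" where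
  "mesh_of \<Omega> \<T> \<longleftrightarrow> triangulation \<T> \<and> (\<forall>K\<in>\<T>. 2 simplex K) \<and> \<Union>\<T> = closure \<Omega>"

definition shape_regular_family :: "pt set \<Rightarrow> mesh set \<Rightarrow> bool" where
  "shape_regular_family \<Omega> \<TT> \<longleftrightarrow> (\<forall>\<T>\<in>\<TT>. mesh_of \<Omega> \<T>) \<and>
     (\<exists>\<kappa>>0. \<forall>\<T>\<in>\<TT>. \<forall>K\<in>\<T>. \<exists>z. cball z (\<kappa> * diameter K) \<subseteq> K)"

definition mesh_size :: "mesh \<Rightarrow> real" where
  "mesh_size \<T> = Max (diameter ` \<T>)"

definition edges :: "mesh \<Rightarrow> pt set set" where
  "edges \<T> = {E. \<exists>K\<in>\<T>. E edge_of K}"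

definition interior_edges :: "mesh \<Rightarrow> pt set set" where
  "interior_edges \<T> = {E. \<exists>K\<in>\<T>. \<exists>K'\<in>\<T>. K \<noteq> K' \<and> E edge_of K \<and> E edge_of K'}"

text \<open>The labelling of the two neighbours of an interior edge is arbitrary. The normal points
  out of \<open>K\<^sub>+\<close>, so swapping the labels changes the sign of the jump and of the normal
  simultaneously and no quantity below depends on the choice.\<close>

definition K_plus :: "mesh \<Rightarrow> pt set \<Rightarrow> pt set" where
  "K_plus \<T> E = (SOME K. K \<in> \<T> \<and> E edge_of K)"

definition K_minus :: "mesh \<Rightarrow> pt set \<Rightarrow> pt set" where
  "K_minus \<T> E = (SOME K. K \<in> \<T> \<and> E edge_of K \<and> K \<noteq> K_plus \<T> E)"

definition edge_normal :: "mesh \<Rightarrow> pt set \<Rightarrow> pt" where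
  "edge_normal \<T> E = (SOME \<nu>. norm \<nu> = 1 \<and> (\<forall>x\<in>E. \<forall>y\<in>E. \<nu> \<bullet> (y - x) = 0) \<and>
     (\<forall>x\<in>E. \<forall>y\<in>K_plus \<T> E. \<nu> \<bullet> (y - x) \<le> 0))"

text \<open>The arc length integral over a segment, by an affine parametrisation.\<close>

definition edge_path :: "pt set \<Rightarrow> real \<Rightarrow> pt" where
  "edge_path E = (let p = (SOME p. E = closed_segment (fst p) (snd p)) in linepath (fst p) (snd p))"

definition edge_int :: "pt set \<Rightarrow> scalar_fn \<Rightarrow> real" where
  "edge_int E g = diameter E * (LINT t:{0..1}|lebesgue. g (edge_path E t))"

definition edge_L2 :: "pt set \<Rightarrow> scalar_fn set" where
  "edge_L2 E = {g. set_borel_measurable lebesgue {0..1} (\<lambda>t. g (edge_path E t)) \<and>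
     set_integrable lebesgue {0..1} (\<lambda>t. (g (edge_path E t))\<^sup>2)}"

text \<open>Trace of an \<open>H\<^sup>1(K)\<close> function: the continuous extension of the restriction of smooth functions.\<close>

definition is_trace :: "pt set \<Rightarrow> pt set \<Rightarrow> scalar_fn \<Rightarrow> scalar_fn \<Rightarrow> bool" where
  "is_trace K E w g \<longleftrightarrow> w \<in> Hs 1 (interior K) \<and> g \<in> edge_L2 E \<and>
     (\<exists>\<phi>. (\<forall>n. smooth (\<phi> n)) \<and>
        (\<lambda>n. Hs_norm 1 (interior K) (sub_fn (\<phi> n) w)) \<longlonglongrightarrow> 0 \<and>
        (\<lambda>n. edge_int E (\<lambda>x. (\<phi> n x - g x)\<^sup>2)) \<longlonglongrightarrow> 0)"

definition edge_trace :: "pt set \<Rightarrow> pt set \<Rightarrow> scalar_fn \<Rightarrow> scalar_fn" where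
  "edge_trace K E w = (SOME g. is_trace K E w g)"

definition jump :: "mesh \<Rightarrow> pt set \<Rightarrow> scalar_fn \<Rightarrow> scalar_fn" where
  "jump \<T> E w = (\<lambda>x. if E \<in> interior_edges \<T>
     then edge_trace (K_plus \<T> E) E w x - edge_trace (K_minus \<T> E) E w x
     else edge_trace (K_plus \<T> E) E w x)"

definition average :: "mesh \<Rightarrow> pt set \<Rightarrow> scalar_fn \<Rightarrow> scalar_fn" where
  "average \<T> E w = (\<lambda>x. if E \<in> interior_edges \<T>
     then (edge_trace (K_plus \<T> E) E w x + edge_trace (K_minus \<T> E) E w x) / 2
     else edge_trace (K_plus \<T> E) E w x)"

text \<open>Piecewise weak derivative (set to 0 on the skeleton).\<close>

definition pw_deriv :: "mesh \<Rightarrow> 2 list \<Rightarrow> scalar_fn \<Rightarrow> scalar_fn" where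
  "pw_deriv \<T> js \<phi> =
     (\<lambda>x. \<Sum>K\<in>\<T>. indicat_real (interior K) x * weak_deriv (interior K) js \<phi> x)"

definition normal_deriv :: "mesh \<Rightarrow> pt set \<Rightarrow> scalar_fn \<Rightarrow> scalar_fn" where
  "normal_deriv \<T> E \<phi> = (\<lambda>x. \<Sum>i\<in>UNIV. pw_deriv \<T> [i] \<phi> x * edge_normal \<T> E $ i)"

text \<open>The \<open>i\<close>-th component of \<open>D\<^sup>2\<phi> \<nu>\<^sub>E\<close>.\<close>

definition hess_normal :: "mesh \<Rightarrow> pt set \<Rightarrow> 2 \<Rightarrow> scalar_fn \<Rightarrow> scalar_fn" where
  "hess_normal \<T> E i \<phi> = (\<lambda>x. \<Sum>j\<in>UNIV. pw_deriv \<T> [i,j] \<phi> x * edge_normal \<T> E $ j)"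


section \<open>The discrete problem\<close>

definition polys :: "nat \<Rightarrow> scalar_fn set" where
  "polys r = {p. \<exists>c::nat \<Rightarrow> nat \<Rightarrow> real.
     p = (\<lambda>x. \<Sum>(i,j)\<in>{(i,j). i + j \<le> r}. c i j * (x $ 1) ^ i * (x $ 2) ^ j)}"

definition pw_polys :: "nat \<Rightarrow> mesh \<Rightarrow> scalar_fn set" where
  "pw_polys r \<T> = {w. \<forall>K\<in>\<T>. \<exists>p\<in>polys r. \<forall>x\<in>interior K. w x = p x}"

definition P2 :: "mesh \<Rightarrow> pair_fn set" where
  "P2 \<T> = pw_polys 2 \<T> \<times> pw_polys 2 \<T>"

definition broken_Hs :: "real \<Rightarrow> mesh \<Rightarrow> scalar_fn set" where
  "broken_Hs s \<T> = {\<phi>. \<forall>K\<in>\<T>. \<phi> \<in> Hs s (interior K)}"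

definition J_pen :: "real \<Rightarrow> real \<Rightarrow> mesh \<Rightarrow> scalar_fn \<Rightarrow> scalar_fn \<Rightarrow> real" where
  "J_pen \<sigma>\<^sub>1 \<sigma>\<^sub>2 \<T> \<eta> \<zeta> =
     (\<Sum>E\<in>edges \<T>. \<sigma>\<^sub>1 / diameter E ^ 3 * edge_int E (\<lambda>x. jump \<T> E \<eta> x * jump \<T> E \<zeta> x)) +
     (\<Sum>E\<in>edges \<T>. \<sigma>\<^sub>2 / diameter E *
        edge_int E (\<lambda>x. jump \<T> E (normal_deriv \<T> E \<eta>) x * jump \<T> E (normal_deriv \<T> E \<zeta>) x))"

definition J_cons :: "mesh \<Rightarrow> scalar_fn \<Rightarrow> scalar_fn \<Rightarrow> real" where
  "J_cons \<T> \<eta> \<zeta> = (\<Sum>E\<in>edges \<T>. edge_int E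
     (\<lambda>x. \<Sum>i\<in>UNIV. jump \<T> E (pw_deriv \<T> [i] \<zeta>) x * average \<T> E (hess_normal \<T> E i \<eta>) x))"

definition a_dG :: "real \<Rightarrow> real \<Rightarrow> mesh \<Rightarrow> scalar_fn \<Rightarrow> scalar_fn \<Rightarrow> real" where
  "a_dG \<sigma>\<^sub>1 \<sigma>\<^sub>2 \<T> \<eta> \<zeta> = (\<Sum>K\<in>\<T>. a_form (interior K) \<eta> \<zeta>)
     - J_cons \<T> \<eta> \<zeta> - J_cons \<T> \<zeta> \<eta> + J_pen \<sigma>\<^sub>1 \<sigma>\<^sub>2 \<T> \<eta> \<zeta>"

definition b_dG :: "mesh \<Rightarrow> scalar_fn \<Rightarrow> scalar_fn \<Rightarrow> scalar_fn \<Rightarrow> real" where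
  "b_dG \<T> \<eta> \<zeta> \<phi> =
     - (1/2) * (\<Sum>K\<in>\<T>. LINT x:K|lebesgue. vk_bracket (pw_deriv \<T>) \<eta> \<zeta> x * \<phi> x)"

definition A_dG :: "real \<Rightarrow> real \<Rightarrow> mesh \<Rightarrow> pair_fn \<Rightarrow> pair_fn \<Rightarrow> real" where
  "A_dG \<sigma>\<^sub>1 \<sigma>\<^sub>2 \<T> = vec_A (a_dG \<sigma>\<^sub>1 \<sigma>\<^sub>2 \<T>)"

definition B_dG :: "mesh \<Rightarrow> pair_fn \<Rightarrow> pair_fn \<Rightarrow> pair_fn \<Rightarrow> real" where
  "B_dG \<T> = vec_B (b_dG \<T>)"

definition L_dG :: "mesh \<Rightarrow> scalar_fn \<Rightarrow> pair_fn \<Rightarrow> real" where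
  "L_dG \<T> f \<Phi> = (\<Sum>K\<in>\<T>. LINT x:K|lebesgue. f x * fst \<Phi> x)"

definition dG_norm :: "real \<Rightarrow> real \<Rightarrow> mesh \<Rightarrow> scalar_fn \<Rightarrow> real" where
  "dG_norm \<sigma>\<^sub>1 \<sigma>\<^sub>2 \<T> \<phi> = sqrt (
     (\<Sum>K\<in>\<T>. seminorm_sq 2 (interior K) \<phi>) +
     (\<Sum>E\<in>edges \<T>. \<sigma>\<^sub>1 / diameter E ^ 3 * edge_int E (\<lambda>x. (jump \<T> E \<phi> x)\<^sup>2)) +
     (\<Sum>E\<in>edges \<T>. \<sigma>\<^sub>2 / diameter E * edge_int E (\<lambda>x. (jump \<T> E (normal_deriv \<T> E \<phi>) x)\<^sup>2)))"

definition dG_norm_pair :: "real \<Rightarrow> real \<Rightarrow> mesh \<Rightarrow> pair_fn \<Rightarrow> real" where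
  "dG_norm_pair \<sigma>\<^sub>1 \<sigma>\<^sub>2 \<T> \<Phi> =
     sqrt ((dG_norm \<sigma>\<^sub>1 \<sigma>\<^sub>2 \<T> (fst \<Phi>))\<^sup>2 + (dG_norm \<sigma>\<^sub>1 \<sigma>\<^sub>2 \<T> (snd \<Phi>))\<^sup>2)"

text \<open>The interpolation operators \<open>P \<T>\<close>. Linearity is understood
  almost everywhere; that \<open>P \<T>\<close> respects almost everywhere equality follows from the first
  estimate with \<open>q = s = 0\<close>. Constants may depend on the exponents and on the penalty parameters.\<close>

definition interpolation_family ::
  "pt set \<Rightarrow> real \<Rightarrow> real \<Rightarrow> mesh set \<Rightarrow> (mesh \<Rightarrow> scalar_fn \<Rightarrow> scalar_fn) \<Rightarrow> bool" where
  "interpolation_family \<Omega> \<alpha> \<sigma>\<^sub>1 \<TT> P \<longleftrightarrow>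
     (\<forall>\<T>\<in>\<TT>. \<forall>s\<ge>0. \<forall>\<phi>\<in>broken_Hs s \<T>. P \<T> \<phi> \<in> pw_polys 2 \<T>) \<and>
     (\<forall>\<T>\<in>\<TT>. \<forall>s\<ge>0. \<forall>\<phi>\<in>broken_Hs s \<T>. \<forall>\<psi>\<in>broken_Hs s \<T>. \<forall>c d.
        AE x in lebesgue. x \<in> \<Omega> \<longrightarrow>
          P \<T> (\<lambda>y. c * \<phi> y + d * \<psi> y) x = c * P \<T> \<phi> x + d * P \<T> \<psi> x) \<and>
     (\<forall>q s. 0 \<le> q \<and> q \<le> s \<longrightarrow> (\<exists>C. \<forall>\<T>\<in>\<TT>. \<forall>\<phi>\<in>broken_Hs s \<T>. \<forall>K\<in>\<T>.
        Hs_norm q (interior K) (sub_fn \<phi> (P \<T> \<phi>))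
          \<le> C * diameter K powr (min 3 s - q) * Hs_norm s (interior K) \<phi>)) \<and>
     (\<forall>\<sigma>\<^sub>2>0. \<exists>C. \<forall>\<T>\<in>\<TT>. \<forall>\<phi>\<in>Hs (2 + \<alpha>) \<Omega>.
        dG_norm \<sigma>\<^sub>1 \<sigma>\<^sub>2 \<T> (sub_fn \<phi> (P \<T> \<phi>))
          \<le> C * mesh_size \<T> powr \<alpha> * Hs_norm (2 + \<alpha>) \<Omega> \<phi>)"

definition interp_pair ::
  "(mesh \<Rightarrow> scalar_fn \<Rightarrow> scalar_fn) \<Rightarrow> mesh \<Rightarrow> pair_fn \<Rightarrow> pair_fn" where
  "interp_pair P \<T> \<Phi> = (P \<T> (fst \<Phi>), P \<T> (snd \<Phi>))"

definition discrete_solution ::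
  "real \<Rightarrow> real \<Rightarrow> mesh \<Rightarrow> scalar_fn \<Rightarrow> pair_fn \<Rightarrow> bool" where
  "discrete_solution \<sigma>\<^sub>1 \<sigma>\<^sub>2 \<T> f \<Theta> \<longleftrightarrow> \<Theta> \<in> P2 \<T> \<and>
     (\<forall>\<Phi>\<in>P2 \<T>. A_dG \<sigma>\<^sub>1 \<sigma>\<^sub>2 \<T> \<Theta> \<Phi> + B_dG \<T> \<Theta> \<Theta> \<Phi> = L_dG \<T> f \<Phi>)"

definition dG_ball :: "real \<Rightarrow> real \<Rightarrow> mesh \<Rightarrow> pair_fn \<Rightarrow> real \<Rightarrow> pair_fn set" where
  "dG_ball \<sigma>\<^sub>1 \<sigma>\<^sub>2 \<T> Z R = {\<Phi>\<in>P2 \<T>. dG_norm_pair \<sigma>\<^sub>1 \<sigma>\<^sub>2 \<T> (sub_pair \<Phi> Z) \<le> R}"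

text \<open>\<open>M = \<mu>(\<Theta>)\<close>, where \<open>Z\<close> is the interpolant of the exact solution.\<close>

definition is_mu ::
  "real \<Rightarrow> real \<Rightarrow> mesh \<Rightarrow> scalar_fn \<Rightarrow> pair_fn \<Rightarrow> pair_fn \<Rightarrow> pair_fn \<Rightarrow> bool" where
  "is_mu \<sigma>\<^sub>1 \<sigma>\<^sub>2 \<T> f Z \<Theta> M \<longleftrightarrow> M \<in> P2 \<T> \<and>
     (\<forall>\<Phi>\<in>P2 \<T>. A_dG \<sigma>\<^sub>1 \<sigma>\<^sub>2 \<T> M \<Phi> + 2 * B_dG \<T> Z M \<Phi>
        = L_dG \<T> f \<Phi> + 2 * B_dG \<T> Z \<Theta> \<Phi> - B_dG \<T> \<Theta> \<Theta> \<Phi>)"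

text \<open>\<open>C\<^sub>1\<close> is an admissible, mesh-independent constant in the definition of the radius
  \<open>R(h) = 2 C\<^sub>1 h\<^sup>\<alpha>\<close>; the estimate is required on all sufficiently fine meshes, where \<open>\<mu>\<close> is
  well defined.\<close>

definition mu_constant ::
  "real \<Rightarrow> real \<Rightarrow> real \<Rightarrow> mesh set \<Rightarrow> (mesh \<Rightarrow> scalar_fn \<Rightarrow> scalar_fn) \<Rightarrow>
   scalar_fn \<Rightarrow> pair_fn \<Rightarrow> real \<Rightarrow> bool" where
  "mu_constant \<alpha> \<sigma>\<^sub>1 \<sigma>\<^sub>2 \<TT> P f \<Psi> C\<^sub>1 \<longleftrightarrow> C\<^sub>1 > 0 \<and>
     (\<exists>h\<^sub>1>0. \<forall>\<T>\<in>\<TT>. mesh_size \<T> \<le> h\<^sub>1 \<longrightarrow> (\<forall>\<Theta>\<in>P2 \<T>. \<forall>M.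
        is_mu \<sigma>\<^sub>1 \<sigma>\<^sub>2 \<T> f (interp_pair P \<T> \<Psi>) \<Theta> M \<longrightarrow>
        dG_norm_pair \<sigma>\<^sub>1 \<sigma>\<^sub>2 \<T> (sub_pair M (interp_pair P \<T> \<Psi>))
          \<le> C\<^sub>1 * (mesh_size \<T> powr \<alpha> +
               (dG_norm_pair \<sigma>\<^sub>1 \<sigma>\<^sub>2 \<T> (sub_pair \<Theta> (interp_pair P \<T> \<Psi>)))\<^sup>2)))"

text \<open>The unique solution (up to null sets) of the discrete problem in the ball around \<open>Z\<close>.\<close>

definition local_solution ::
  "pt set \<Rightarrow> real \<Rightarrow> real \<Rightarrow> mesh \<Rightarrow> scalar_fn \<Rightarrow> pair_fn \<Rightarrow> real \<Rightarrow> pair_fn \<Rightarrow> bool" where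
  "local_solution \<Omega> \<sigma>\<^sub>1 \<sigma>\<^sub>2 \<T> f Z R \<Psi>dG \<longleftrightarrow>
     \<Psi>dG \<in> dG_ball \<sigma>\<^sub>1 \<sigma>\<^sub>2 \<T> Z R \<and> discrete_solution \<sigma>\<^sub>1 \<sigma>\<^sub>2 \<T> f \<Psi>dG \<and>
     (\<forall>\<Theta>\<in>dG_ball \<sigma>\<^sub>1 \<sigma>\<^sub>2 \<T> Z R. discrete_solution \<sigma>\<^sub>1 \<sigma>\<^sub>2 \<T> f \<Theta> \<longrightarrow>
        (AE x in lebesgue. x \<in> \<Omega> \<longrightarrow> fst \<Theta> x = fst \<Psi>dG x \<and> snd \<Theta> x = snd \<Psi>dG x))"


section \<open>Error estimator and data oscillation\<close>

definition eta_K_sq :: "mesh \<Rightarrow> scalar_fn \<Rightarrow> pair_fn \<Rightarrow> pt set \<Rightarrow> real" where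
  "eta_K_sq \<T> f U K = diameter K ^ 4 *
     ((LINT x:K|lebesgue. (f x + vk_bracket (pw_deriv \<T>) (fst U) (snd U) x)\<^sup>2) +
      (LINT x:K|lebesgue. (vk_bracket (pw_deriv \<T>) (fst U) (fst U) x)\<^sup>2))"

definition eta_E_sq :: "mesh \<Rightarrow> pair_fn \<Rightarrow> pt set \<Rightarrow> real" where
  "eta_E_sq \<T> U E =
     diameter E *
       ((\<Sum>i\<in>UNIV. edge_int E (\<lambda>x. (jump \<T> E (hess_normal \<T> E i (fst U)) x)\<^sup>2)) +
        (\<Sum>i\<in>UNIV. edge_int E (\<lambda>x. (jump \<T> E (hess_normal \<T> E i (snd U)) x)\<^sup>2))) +
     1 / diameter E ^ 3 *
       (edge_int E (\<lambda>x. (jump \<T> E (fst U) x)\<^sup>2) + edge_int E (\<lambda>x. (jump \<T> E (snd U) x)\<^sup>2)) +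
     1 / diameter E *
       ((\<Sum>i\<in>UNIV. edge_int E (\<lambda>x. (jump \<T> E (pw_deriv \<T> [i] (fst U)) x)\<^sup>2)) +
        (\<Sum>i\<in>UNIV. edge_int E (\<lambda>x. (jump \<T> E (pw_deriv \<T> [i] (snd U)) x)\<^sup>2)))"

definition mean_on :: "pt set \<Rightarrow> scalar_fn \<Rightarrow> real" where
  "mean_on K f = (LINT x:K|lebesgue. f x) / measure lebesgue K"

definition osc_sq :: "mesh \<Rightarrow> scalar_fn \<Rightarrow> real" where
  "osc_sq \<T> f = (\<Sum>K\<in>\<T>. diameter K ^ 4 * (LINT x:K|lebesgue. (f x - mean_on K f)\<^sup>2))"

end

theory Submission
  imports Defs
begin

text \<open>
  Verfuerth's bubble function technique. On a triangle, and on a disc around the midpoint of an interior edge,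
  the weak equations of the exact solution are tested with a smooth function of compact support.
  The piecewise Hessians of the discrete solution are constant, so each element and edge residual is, up to
  data oscillation, a constant multiple of an integral of that test function, and the remainder
  is bounded by the local Hessian error and the difference of the brackets. The latter is bilinear,
  and the discrete Hessians are bounded uniformly in the mesh because the discrete solution lies in
  the prescribed ball around the interpolant. The jump of the Hessian has a normal-normal part,
  which is detected by the bubble times the signed distance from the edge, and a tangential
  part, which together with the jump of the gradient is controlled by inverse inequalities for the
  jump of the function and of its normal derivative along the edge. These two jumps coincide with those
  of the error, as functions in \<open>H\<^sup>2\<^sub>0\<close> have no jumps, and hence are part of the dG norm.
\<close>

subsection \<open>Smooth functions\<close>

text \<open>Polynomial bubbles are only finitely smooth: their membership in H^2_0 and their weak
  derivatives would need arguments of their own. A smooth function of compact support is a test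
  function of \<open>is_weak_deriv\<close>, so both come for free. The price is that its support has
  to fit into an explicit disc, whose radius is supplied by the inscribed balls of shape regularity.
  All test functions are rescaled copies of two fixed profiles in an orthonormal frame, so their
  integrals and derivative bounds are explicit in the radius. The distance factor at an edge is
  forced: the Hessian jump is paired with second derivatives, and over one side of the edge these
  integrate to the normal derivative on the edge, which vanishes for an even bubble.
  \<open>weak_deriv\<close>, \<open>edge_trace\<close>, \<open>edge_normal\<close> and
  \<open>edge_path\<close> are arbitrary choices. Almost everywhere uniqueness of weak derivatives
  (fundamental lemma) and of traces (trace inequality) therefore has to be settled before any jump
  can be computed.\<close>

lemma partial_append: "partial (js @ ks) f = partial js (partial ks f)"
  by (induction js) auto

text \<open>Since \<open>smooth\<close> asks for differentiability of all iterated partial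
  derivatives, a class of differentiable functions that is closed under \<open>partial\<close>
  replaces an induction on directions for each single function.\<close>

lemma smooth_coinduct:
  assumes "f \<in> S"
    and "\<And>g x. g \<in> S \<Longrightarrow> g differentiable (at x)"
    and "\<And>g i. g \<in> S \<Longrightarrow> partial [i] g \<in> S"
  shows "smooth f"
proof -
  have "partial js f \<in> S" for js
    by (induction js) (use assms in auto)
  then show ?thesis
    using assms(2) by (auto simp: smooth_def)
qed

lemma smooth_differentiable: "smooth f \<Longrightarrow> f differentiable (at x)"
  unfolding smooth_def by (metis partial.simps(1))

lemma smooth_partial: "smooth f \<Longrightarrow> smooth (partial js f)"
  unfolding smooth_def by (metis partial_append)

lemma smooth_continuous_on: "smooth f \<Longrightarrow> continuous_on S f"
  by (simp add: continuous_at_imp_continuous_on differentiable_imp_continuous_within smooth_differentiable)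

lemma has_derivative_partial:
  assumes "(f has_derivative f') (at x)"
  shows "partial [i] f x = f' (axis i 1)"
  using frechet_derivative_at[OF assms] by simp

lemma partial_lincomb:
  assumes "f differentiable (at x)" "g differentiable (at x)"
  shows "partial [i] (\<lambda>x. a * f x + b * g x) x = a * partial [i] f x + b * partial [i] g x"
proof -
  have "((\<lambda>x. a * f x + b * g x) has_derivative
      (\<lambda>h. a * frechet_derivative f (at x) h + b * frechet_derivative g (at x) h)) (at x)"
    using assms unfolding frechet_derivative_works
    by (auto intro!: derivative_eq_intros)
  from has_derivative_partial[OF this] show ?thesis by simp
qed

lemma partial_mult:
  assumes "f differentiable (at x)" "g differentiable (at x)"
  shows "partial [i] (\<lambda>x. f x * g x) x = f x * partial [i] g x + partial [i] f x * g x"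
proof -
  have "((\<lambda>x. f x * g x) has_derivative
      (\<lambda>h. f x * frechet_derivative g (at x) h + frechet_derivative f (at x) h * g x)) (at x)"
    using assms unfolding frechet_derivative_works by (rule has_derivative_mult)
  from has_derivative_partial[OF this] show ?thesis by simp
qed

text \<open>Products alone are not stable under \<open>partial\<close>, because the product rule
  yields sums of products. The generated algebra is stable, so \<open>smooth_coinduct\<close>
  applies to it.\<close>

inductive_set smooth_algebra :: "scalar_fn set" where
  base: "smooth f \<Longrightarrow> f \<in> smooth_algebra"
| lincomb: "f \<in> smooth_algebra \<Longrightarrow> g \<in> smooth_algebra \<Longrightarrow> (\<lambda>x. a * f x + b * g x) \<in> smooth_algebra"
| mult: "f \<in> smooth_algebra \<Longrightarrow> g \<in> smooth_algebra \<Longrightarrow> (\<lambda>x. f x * g x) \<in> smooth_algebra"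

lemma smooth_algebra_smooth:
  assumes "f \<in> smooth_algebra"
  shows "smooth f"
proof -
  have diff: "g differentiable (at x)" if "g \<in> smooth_algebra" for g x
    using that by induction (auto simp: smooth_differentiable)
  have part: "partial [i] g \<in> smooth_algebra" if "g \<in> smooth_algebra" for g i
    using that
  proof induction
    case (base f)
    then show ?case by (intro smooth_algebra.base smooth_partial)
  next
    case (lincomb f g a b)
    have "partial [i] (\<lambda>x. a * f x + b * g x) = (\<lambda>x. a * partial [i] f x + b * partial [i] g x)"
      using lincomb.hyps diff by (intro ext partial_lincomb) auto
    then show ?case
      using smooth_algebra.lincomb[OF lincomb.IH] by simp
  next
    case (mult f g)
    have eq: "partial [i] (\<lambda>x. f x * g x) = (\<lambda>x. 1 * (f x * partial [i] g x) + 1 * (partial [i] f x * g x))"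
      using mult.hyps diff partial_mult[of f _ g] by (intro ext) auto
    show ?case
      unfolding eq by (intro smooth_algebra.lincomb smooth_algebra.mult mult)
  qed
  show ?thesis
    using smooth_coinduct[OF assms] diff part by blast
qed

lemma smooth_lincomb: "smooth f \<Longrightarrow> smooth g \<Longrightarrow> smooth (\<lambda>x. a * f x + b * g x)"
  by (rule smooth_algebra_smooth, rule smooth_algebra.lincomb) (rule smooth_algebra.base, assumption)+

lemma smooth_mult: "smooth f \<Longrightarrow> smooth g \<Longrightarrow> smooth (\<lambda>x. f x * g x)"
  by (rule smooth_algebra_smooth, rule smooth_algebra.mult) (rule smooth_algebra.base, assumption)+

lemma smooth_affine: "smooth (\<lambda>x. c + d \<bullet> x)"
proof (rule smooth_coinduct)
  show "(\<lambda>x. c + d \<bullet> x) \<in> {\<lambda>x. c + d \<bullet> x | c d. True}" by blast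
next
  fix g :: scalar_fn and x assume "g \<in> {\<lambda>x. c + d \<bullet> x | c d. True}"
  then show "g differentiable (at x)" by auto
next
  fix g :: scalar_fn and i assume "g \<in> {\<lambda>x. c + d \<bullet> x | c d. True}"
  then obtain c d where g: "g = (\<lambda>x. c + d \<bullet> x)" by blast
  have "partial [i] g = (\<lambda>x. d \<bullet> axis i 1 + 0 \<bullet> x)"
  proof
    fix x
    have "(g has_derivative (\<lambda>h. d \<bullet> h)) (at x)"
      unfolding g by (auto intro!: derivative_eq_intros)
    from has_derivative_partial[OF this] show "partial [i] g x = d \<bullet> axis i 1 + 0 \<bullet> x" by simp
  qed
  then show "partial [i] g \<in> {\<lambda>x. c + d \<bullet> x | c d. True}" by blast
qed

lemma smooth_const: "smooth (\<lambda>x. c)"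
  using smooth_affine[of c 0] by simp

lemma smooth_diff: "smooth f \<Longrightarrow> smooth g \<Longrightarrow> smooth (\<lambda>x. f x - g x)"
  using smooth_lincomb[of f g 1 "-1"] by simp

lemma smooth_component: "smooth (\<lambda>x. x $ i)"
  using smooth_affine[of 0 "axis i 1"] by (simp add: inner_axis')

subsection \<open>Bump functions\<close>

text \<open>The function exp (-1/t) t^(-k), continued by 0 to t <= 0. The exponent is carried along
  because differentiation raises it by one and by two.\<close>

definition flat :: "nat \<Rightarrow> real \<Rightarrow> real" where
  "flat k t = (if t > 0 then exp (- inverse t) * inverse t ^ k else 0)"

lemma flat_nonneg: "flat k t \<ge> 0"
  by (simp add: flat_def)

lemma flat_0_le_1: "flat 0 t \<le> 1"
  by (simp add: flat_def)

lemma flat_0_mono: "s \<le> t \<Longrightarrow> flat 0 s \<le> flat 0 t"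
  by (auto simp: flat_def le_imp_inverse_le)

lemma flat_tendsto_0: "(flat k \<longlongrightarrow> 0) (at 0)"
proof -
  have "((\<lambda>t. exp (- inverse t) * inverse t ^ k) \<longlongrightarrow> 0) (at_right (0::real))"
    using filterlim_compose[OF tendsto_power_div_exp_0[of k] filterlim_inverse_at_top_right]
    by (simp add: exp_minus field_simps)
  then have R: "(flat k \<longlongrightarrow> 0) (at_right 0)"
    by (rule Lim_transform_eventually) (auto simp: eventually_at_filter flat_def)
  have L: "(flat k \<longlongrightarrow> 0) (at_left 0)"
    by (rule tendsto_eventually) (auto simp: eventually_at_filter flat_def)
  show ?thesis
    using filterlim_at_split L R by blast
qed

lemma flat_has_derivative:
  "(flat k has_real_derivative flat (k + 2) t - real k * flat (k + 1) t) (at t)"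
proof -
  consider "t > 0" | "t < 0" | "t = 0" by linarith
  then show ?thesis
  proof cases
    case 1
    have "((\<lambda>t. exp (- inverse t) * inverse t ^ k) has_real_derivative
        flat (k + 2) t - real k * flat (k + 1) t) (at t)"
      using 1 by (auto intro!: derivative_eq_intros simp: flat_def field_simps power2_eq_square)
        (cases k; simp add: field_simps)
    then show ?thesis
      by (rule has_field_derivative_transform_within_open[of _ _ _ "{0<..}"])
        (use 1 in \<open>auto simp: flat_def\<close>)
  next
    case 2
    have "((\<lambda>t. 0) has_real_derivative flat (k + 2) t - real k * flat (k + 1) t) (at t)"
      using 2 by (simp add: flat_def)
    then show ?thesis
      by (rule has_field_derivative_transform_within_open[of _ _ _ "{..<0}"])
        (use 2 in \<open>auto simp: flat_def\<close>)
  next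
    case 3
    \<comment> \<open>The difference quotient of \<open>flat k\<close> at 0 is
      \<open>flat (Suc k)\<close>, which tends to 0.\<close>
    have "((\<lambda>y. (flat k y - flat k 0) / (y - 0)) \<longlongrightarrow> 0) (at 0)"
      by (rule Lim_transform_eventually[OF flat_tendsto_0[of "Suc k"]])
        (auto simp: eventually_at_filter flat_def field_simps)
    then show ?thesis
      unfolding 3 has_field_derivative_iff by (simp add: flat_def)
  qed
qed

lemma flat_continuous: "continuous_on S (flat k)"
  by (meson DERIV_isCont continuous_at_imp_continuous_on flat_has_derivative)

inductive_set flat_span :: "scalar_fn set" where
  base: "(\<lambda>x. flat k (c + d \<bullet> x)) \<in> flat_span"
| lincomb: "f \<in> flat_span \<Longrightarrow> g \<in> flat_span \<Longrightarrow> (\<lambda>x. a * f x + b * g x) \<in> flat_span"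

lemma smooth_flat: "smooth (\<lambda>x. flat k (c + d \<bullet> x))"
proof -
  have der: "((\<lambda>x. flat k (c + d \<bullet> x)) has_derivative
      (\<lambda>h. (flat (k + 2) (c + d \<bullet> x) - real k * flat (k + 1) (c + d \<bullet> x)) * (d \<bullet> h))) (at x)"
    for k c d and x :: pt
    by (rule has_derivative_compose[of "\<lambda>x. c + d \<bullet> x" "\<lambda>h. d \<bullet> h",
          OF _ flat_has_derivative[unfolded has_field_derivative_def]])
      (auto intro!: derivative_eq_intros)
  have diff: "g differentiable (at x)" if "g \<in> flat_span" for g x
    using that
  proof induction
    case (base k c d)
    then show ?case using der differentiable_def by blast
  qed auto
  have part: "partial [i] g \<in> flat_span" if "g \<in> flat_span" for g i
    using that
  proof induction
    case (base k c d)
    have "partial [i] (\<lambda>x. flat k (c + d \<bullet> x)) =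
       (\<lambda>x. (d \<bullet> axis i 1) * flat (k + 2) (c + d \<bullet> x) + (- real k * (d \<bullet> axis i 1)) * flat (k + 1) (c + d \<bullet> x))"
      by (rule ext) (subst has_derivative_partial[OF der], simp add: algebra_simps)
    then show ?case
      by (simp only:) (intro flat_span.intros)
  next
    case (lincomb f g a b)
    have "partial [i] (\<lambda>x. a * f x + b * g x) = (\<lambda>x. a * partial [i] f x + b * partial [i] g x)"
      using lincomb.hyps diff by (intro ext partial_lincomb) auto
    then show ?case
      using flat_span.lincomb[OF lincomb.IH] by simp
  qed
  show ?thesis
    by (rule smooth_coinduct[OF flat_span.base diff part])
qed

subsection \<open>Square integrable functions\<close>

text \<open>Kept general in the measure space, for it serves both as \<open>L2\<close> on open sets
  and, through the parametrisation by the unit interval, as \<open>edge_L2\<close>.\<close>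

definition sq_integrable :: "'a measure \<Rightarrow> 'a set \<Rightarrow> ('a \<Rightarrow> real) \<Rightarrow> bool" where
  "sq_integrable M A f \<longleftrightarrow> set_borel_measurable M A f \<and> set_integrable M A (\<lambda>x. (f x)\<^sup>2)"

lemma L2_iff: "f \<in> L2 D \<longleftrightarrow> sq_integrable lebesgue D f"
  by (simp add: L2_def sq_integrable_def)

lemma sq_integrable_alt:
  "sq_integrable M A f \<longleftrightarrow> (\<lambda>x. indicator A x * f x) \<in> borel_measurable M \<and>
     integrable M (\<lambda>x. (indicator A x * f x)\<^sup>2)"
proof -
  have "(\<lambda>x. indicator A x * (f x)\<^sup>2) = (\<lambda>x. (indicator A x * f x)\<^sup>2)"
    by (auto simp: indicator_def)
  then show ?thesis
    by (simp add: sq_integrable_def set_borel_measurable_def set_integrable_def)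
qed

lemma integrable_square_mult:
  fixes F G :: "'a \<Rightarrow> real"
  assumes "F \<in> borel_measurable M" "G \<in> borel_measurable M"
    and "integrable M (\<lambda>x. (F x)\<^sup>2)" "integrable M (\<lambda>x. (G x)\<^sup>2)"
  shows "integrable M (\<lambda>x. F x * G x)"
proof (rule Bochner_Integration.integrable_bound)
  show "integrable M (\<lambda>x. (F x)\<^sup>2 + (G x)\<^sup>2)" using assms by simp
  have "\<bar>u * v\<bar> \<le> u\<^sup>2 + v\<^sup>2" for u v :: real
    using sum_squares_bound[of "\<bar>u\<bar>" "\<bar>v\<bar>"] mult_nonneg_nonneg[OF abs_ge_zero abs_ge_zero, of u v]
    by (simp only: abs_mult power2_abs)
  then show "AE x in M. norm (F x * G x) \<le> norm ((F x)\<^sup>2 + (G x)\<^sup>2)" by auto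
qed (use assms in measurable)

lemma sq_integrable_mult:
  assumes "sq_integrable M A f" "sq_integrable M A g"
  shows "set_integrable M A (\<lambda>x. f x * g x)"
proof -
  have "integrable M (\<lambda>x. (indicator A x * f x) * (indicator A x * g x))"
    using assms by (intro integrable_square_mult) (auto simp: sq_integrable_alt)
  also have "(\<lambda>x. (indicator A x * f x) * (indicator A x * g x)) = (\<lambda>x. indicator A x *\<^sub>R (f x * g x))"
    by (auto simp: indicator_def)
  finally show ?thesis by (simp add: set_integrable_def)
qed

lemma sq_integrable_lincomb:
  assumes "sq_integrable M A f" "sq_integrable M A g"
  shows "sq_integrable M A (\<lambda>x. a * f x + b * g x)"
proof -
  let ?F = "\<lambda>x. indicator A x * f x" and ?G = "\<lambda>x. indicator A x * g x"
  have FG: "?F \<in> borel_measurable M" "?G \<in> borel_measurable M"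
    "integrable M (\<lambda>x. (?F x)\<^sup>2)" "integrable M (\<lambda>x. (?G x)\<^sup>2)"
    using assms by (auto simp: sq_integrable_alt)
  have eq: "indicator A x * (a * f x + b * g x) = a * ?F x + b * ?G x" for x
    by (auto simp: algebra_simps)
  have sq: "(\<lambda>x. (a * ?F x + b * ?G x)\<^sup>2) = (\<lambda>x. a\<^sup>2 * (?F x)\<^sup>2 + 2 * a * b * (?F x * ?G x) + b\<^sup>2 * (?G x)\<^sup>2)"
    by (auto simp: power2_eq_square algebra_simps)
  have "(\<lambda>x. a * ?F x + b * ?G x) \<in> borel_measurable M"
    using FG(1,2) by measurable
  moreover have "integrable M (\<lambda>x. (a * ?F x + b * ?G x)\<^sup>2)"
    unfolding sq using FG integrable_square_mult[OF FG]
    by (intro Bochner_Integration.integrable_add integrable_mult_right) auto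
  ultimately show ?thesis
    unfolding sq_integrable_alt eq by (rule conjI)
qed

lemma sq_integrable_diff:
  "sq_integrable M A f \<Longrightarrow> sq_integrable M A g \<Longrightarrow> sq_integrable M A (\<lambda>x. f x - g x)"
  using sq_integrable_lincomb[of M A f g 1 "-1"] by simp

lemma sq_integrable_abs: "sq_integrable M A f \<Longrightarrow> sq_integrable M A (\<lambda>x. \<bar>f x\<bar>)"
proof -
  assume *: "sq_integrable M A f"
  have eq: "indicator A x * \<bar>f x\<bar> = \<bar>indicator A x * f x\<bar>" for x
    by (auto simp: indicator_def)
  from * show ?thesis
    unfolding sq_integrable_alt eq power2_abs by auto
qed

lemma sq_integrable_subset:
  assumes "sq_integrable M A f" "B \<in> sets M" "B \<subseteq> A"
  shows "sq_integrable M B f"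
  using assms set_integrable_subset[of M A _ B] set_borel_measurable_subset[of M A f B]
  by (auto simp: sq_integrable_def)

lemma sq_integrable_bounded:
  assumes "set_borel_measurable M A f" "A \<in> sets M" "emeasure M A < \<infinity>" "\<And>x. x \<in> A \<Longrightarrow> \<bar>f x\<bar> \<le> B"
  shows "sq_integrable M A f"
proof -
  have m: "(\<lambda>x. indicator A x * f x) \<in> borel_measurable M"
    using assms(1) by (simp add: set_borel_measurable_def)
  have "integrable M (\<lambda>x. (indicator A x * f x)\<^sup>2)"
  proof (rule Bochner_Integration.integrable_bound)
    show "integrable M (\<lambda>x. indicator A x * B\<^sup>2)"
      using assms(2,3) by (auto simp: integrable_indicator_iff)
    show "AE x in M. norm ((indicator A x * f x)\<^sup>2) \<le> norm (indicator A x * B\<^sup>2)"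
      using assms(4) by (intro AE_I2) (auto simp: indicator_def abs_le_square_iff[symmetric] dest: order_trans[OF _ abs_ge_self])
  qed (use m in measurable)
  with m show ?thesis by (simp add: sq_integrable_alt)
qed

lemma set_integral_square_nonneg: "(LINT x:A|M. (f x :: real)\<^sup>2) \<ge> 0"
  by (simp add: set_lebesgue_integral_def)

text \<open>The integral of (f - t g)^2 is a nonnegative quadratic polynomial in t, so its
  discriminant cannot be positive.\<close>

lemma set_integral_Cauchy_Schwarz:
  assumes "sq_integrable M A f" "sq_integrable M A g"
  shows "\<bar>LINT x:A|M. f x * g x\<bar> \<le> sqrt (LINT x:A|M. (f x)\<^sup>2) * sqrt (LINT x:A|M. (g x)\<^sup>2)"
proof -
  define a b c where "a = (LINT x:A|M. (f x)\<^sup>2)" and "b = (LINT x:A|M. (g x)\<^sup>2)"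
    and "c = (LINT x:A|M. f x * g x)"
  have int: "set_integrable M A (\<lambda>x. (f x)\<^sup>2)" "set_integrable M A (\<lambda>x. (g x)\<^sup>2)"
    "set_integrable M A (\<lambda>x. f x * g x)"
    using assms sq_integrable_mult by (auto simp: sq_integrable_def)
  have quad: "0 \<le> a - 2 * t * c + t\<^sup>2 * b" for t
  proof -
    have "0 \<le> (LINT x:A|M. (f x - t * g x)\<^sup>2)"
      by (rule set_integral_square_nonneg)
    also have "\<dots> = (LINT x:A|M. ((f x)\<^sup>2 - (2 * t) * (f x * g x)) + t\<^sup>2 * (g x)\<^sup>2)"
      by (rule arg_cong[of _ _ "set_lebesgue_integral M A"]) (auto simp: power2_eq_square algebra_simps)
    also have "\<dots> = a - 2 * t * c + t\<^sup>2 * b"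
      using int by (simp add: a_def b_def c_def)
    finally show ?thesis .
  qed
  have a: "a \<ge> 0" and b: "b \<ge> 0"
    by (simp_all add: a_def b_def set_integral_square_nonneg)
  have "c\<^sup>2 \<le> a * b"
  proof (cases "b = 0")
    case True
    have "c = 0"
    proof (rule ccontr)
      assume "c \<noteq> 0"
      \<comment> \<open>For b = 0 the polynomial is affine, and at this t it would take the value
        -1.\<close>
      have "0 \<le> a - 2 * ((a + 1) / (2 * c)) * c"
        using quad[of "(a + 1) / (2 * c)"] True by simp
      then show False using \<open>c \<noteq> 0\<close> by (simp add: field_simps)
    qed
    then show ?thesis using True by simp
  next
    case False
    then have "b > 0" using b by simp
    \<comment> \<open>t = c / b minimises the polynomial.\<close>
    have "0 \<le> a - 2 * (c / b) * c + (c / b)\<^sup>2 * b" by (rule quad)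
    also have "\<dots> = a - c\<^sup>2 / b"
      using \<open>b > 0\<close> by (simp add: power2_eq_square)
    finally show ?thesis using \<open>b > 0\<close> by (simp add: field_simps)
  qed
  then have "\<bar>c\<bar> \<le> sqrt (a * b)"
    using real_le_rsqrt[of "\<bar>c\<bar>"] by simp
  then show ?thesis by (simp add: a_def b_def c_def real_sqrt_mult)
qed

text \<open>Lebesgue measure is complete, so measurability passes to \<open>g\<close> along with the
  values.\<close>

lemma set_integrable_lebesgue_cong_AE:
  fixes f g :: "'a::euclidean_space \<Rightarrow> real"
  assumes "AE x in lebesgue. x \<in> A \<longrightarrow> f x = g x" "set_integrable lebesgue A f"
  shows "set_integrable lebesgue A g"
proof -
  have ae: "AE x in lebesgue. indicat_real A x *\<^sub>R f x = indicat_real A x *\<^sub>R g x"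
    using assms(1) by eventually_elim (auto simp: indicator_def)
  have "(\<lambda>x. indicat_real A x *\<^sub>R g x) \<in> borel_measurable lebesgue"
    using borel_measurable_AE[OF _ ae] assms(2) by (auto simp: set_integrable_def)
  then show ?thesis
    unfolding set_integrable_def
    by (rule integrable_cong_AE_imp[OF assms(2)[unfolded set_integrable_def] _ ae])
qed

text \<open>If \<open>f\<close> is not integrable, neither is \<open>g\<close>, and both integrals
  have the default value 0.\<close>

lemma set_integral_lebesgue_cong_AE:
  fixes f g :: "'a::euclidean_space \<Rightarrow> real"
  assumes "AE x in lebesgue. x \<in> A \<longrightarrow> f x = g x"
  shows "(LINT x:A|lebesgue. f x) = (LINT x:A|lebesgue. g x)"
proof (cases "set_integrable lebesgue A f")
  case True
  have ae: "AE x in lebesgue. indicat_real A x *\<^sub>R f x = indicat_real A x *\<^sub>R g x"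
    using assms by eventually_elim (auto simp: indicator_def)
  show ?thesis
    unfolding set_lebesgue_integral_def
    using True set_integrable_lebesgue_cong_AE[OF assms True] ae
    by (intro integral_cong_AE) (auto simp: set_integrable_def)
next
  case False
  have "AE x in lebesgue. x \<in> A \<longrightarrow> g x = f x"
    using assms by eventually_elim auto
  then have "\<not> set_integrable lebesgue A g"
    using False set_integrable_lebesgue_cong_AE[of A g f] by auto
  then show ?thesis
    using False not_integrable_integral_eq
    by (metis set_integrable_def set_lebesgue_integral_def)
qed

lemma set_borel_measurable_lebesgue_cong_AE:
  fixes f g :: "'a::euclidean_space \<Rightarrow> real"
  assumes "AE x in lebesgue. x \<in> A \<longrightarrow> f x = g x" "set_borel_measurable lebesgue A f"
  shows "set_borel_measurable lebesgue A g"
proof -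
  have "AE x in lebesgue. indicat_real A x *\<^sub>R f x = indicat_real A x *\<^sub>R g x"
    using assms(1) by eventually_elim (auto simp: indicator_def)
  from borel_measurable_AE[OF _ this] show ?thesis
    using assms(2) by (simp add: set_borel_measurable_def)
qed

lemma sq_integrable_lebesgue_cong_AE:
  fixes f g :: "'a::euclidean_space \<Rightarrow> real"
  assumes "AE x in lebesgue. x \<in> A \<longrightarrow> f x = g x" "sq_integrable lebesgue A f"
  shows "sq_integrable lebesgue A g"
proof -
  have "AE x in lebesgue. x \<in> A \<longrightarrow> (f x)\<^sup>2 = (g x)\<^sup>2"
    using assms(1) by eventually_elim auto
  from set_integrable_lebesgue_cong_AE[OF this] show ?thesis
    using assms set_borel_measurable_lebesgue_cong_AE[OF assms(1)]
    by (simp add: sq_integrable_def)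
qed

lemma set_integrable_continuous_compact:
  fixes f :: "'a::euclidean_space \<Rightarrow> real"
  assumes "compact C" "continuous_on C f"
  shows "set_integrable lebesgue C f"
proof -
  have "integrable lborel (\<lambda>x. indicator C x *\<^sub>R f x)"
    by (rule borel_integrable_compact[OF assms])
  then show ?thesis
    unfolding set_integrable_def
    by (subst integrable_completion) (auto intro: borel_measurable_integrable)
qed

lemma sq_integrable_continuous:
  fixes f :: "'a::euclidean_space \<Rightarrow> real"
  assumes "bounded A" "A \<in> sets lebesgue" "continuous_on UNIV f"
  shows "sq_integrable lebesgue A f"
proof -
  have c: "compact (closure A)" "continuous_on (closure A) f"
    using assms(1) continuous_on_subset[OF assms(3)] by auto
  have "set_integrable lebesgue (closure A) (\<lambda>x. (f x)\<^sup>2)"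
    by (rule set_integrable_continuous_compact[OF c(1)]) (intro continuous_intros c)
  then have "sq_integrable lebesgue (closure A) f"
    using set_integrable_continuous_compact[OF c]
    unfolding sq_integrable_def set_integrable_def set_borel_measurable_def
    by (auto dest: borel_measurable_integrable)
  then show ?thesis
    using assms(2) closure_subset sq_integrable_subset by blast
qed

lemma sq_integrable_imp_set_integrable:
  fixes f :: "'a::euclidean_space \<Rightarrow> real"
  assumes "sq_integrable lebesgue A f" "A \<in> sets lebesgue" "bounded A"
  shows "set_integrable lebesgue A f"
  using sq_integrable_mult[OF assms(1) sq_integrable_continuous[of A "\<lambda>_. 1"]] assms by simp

subsection \<open>Test functions\<close>

text \<open>The complement of the support is open, so each further derivative there is a derivative
  of the zero function.\<close>

lemma partial_eq_0_outside:
  assumes "x \<notin> closure {x. \<phi> x \<noteq> 0}"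
  shows "partial js \<phi> x = 0"
  using assms
proof (induction js arbitrary: x)
  case Nil
  then show ?case using closure_subset[of "{x. \<phi> x \<noteq> 0}"] by auto
next
  case (Cons i js)
  let ?U = "- closure {x. \<phi> x \<noteq> 0}"
  have "(partial js \<phi> has_derivative (\<lambda>h. 0)) (at x)"
    by (rule has_derivative_transform_within_open[of "\<lambda>x. 0" _ x UNIV ?U]) (use Cons in auto)
  from frechet_derivative_at[OF this, symmetric] show ?case by simp
qed

text \<open>The support is a closed subset of \<open>C\<close>. Hence any compact set off which
  \<phi> vanishes will do, without knowing the support itself.\<close>

lemma test_functionI:
  assumes "smooth \<phi>" "compact C" "C \<subseteq> D" "\<And>x. x \<notin> C \<Longrightarrow> \<phi> x = 0"
  shows "\<phi> \<in> test_functions D"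
proof -
  have "closure {x. \<phi> x \<noteq> 0} \<subseteq> C"
    using assms(2,4) by (intro closure_minimal) (auto simp: compact_imp_closed)
  moreover from this have "compact (closure {x. \<phi> x \<noteq> 0})"
    using assms(2) by (metis closed_closure compact_Int_closed inf.absorb_iff2)
  ultimately show ?thesis
    using assms by (auto simp: test_functions_def)
qed

lemma test_functionE:
  assumes "\<phi> \<in> test_functions D"
  obtains C where "smooth \<phi>" "compact C" "C \<subseteq> D" "\<And>x js. x \<notin> C \<Longrightarrow> partial js \<phi> x = 0"
proof
  show "compact (closure {x. \<phi> x \<noteq> 0})" "closure {x. \<phi> x \<noteq> 0} \<subseteq> D" "smooth \<phi>"
    using assms by (simp_all add: test_functions_def del: compact_closure)
qed (rule partial_eq_0_outside)

lemma test_function_smooth: "\<phi> \<in> test_functions D \<Longrightarrow> smooth \<phi>"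
  by (simp add: test_functions_def)

lemma test_function_outside: "\<phi> \<in> test_functions D \<Longrightarrow> x \<notin> D \<Longrightarrow> partial js \<phi> x = 0"
  by (meson subsetD test_functionE)

lemma test_function_partial:
  assumes "\<phi> \<in> test_functions D"
  shows "partial js \<phi> \<in> test_functions D"
  using test_functionE[OF assms] by (metis smooth_partial test_functionI)

lemma test_functions_mono: "D \<subseteq> D' \<Longrightarrow> test_functions D \<subseteq> test_functions D'"
  by (auto simp: test_functions_def)

lemma test_function_mult_smooth:
  assumes "\<phi> \<in> test_functions D" "smooth g"
  shows "(\<lambda>x. g x * \<phi> x) \<in> test_functions D"
proof -
  obtain C where C: "smooth \<phi>" "compact C" "C \<subseteq> D" "\<And>x js. x \<notin> C \<Longrightarrow> partial js \<phi> x = 0"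
    using test_functionE[OF assms(1)] by metis
  show ?thesis
    by (rule test_functionI[OF smooth_mult C(2,3)]) (use assms C C(4)[of _ "[]"] in auto)
qed

text \<open>Only a compact set carrying \<phi> matters; on it \<open>f\<close> is integrable and
  \<phi> is bounded.\<close>

lemma test_function_integrable:
  assumes "\<phi> \<in> test_functions D" "locally_integrable D f"
  shows "set_integrable lebesgue D (\<lambda>x. f x * \<phi> x)"
proof -
  obtain C where C: "smooth \<phi>" "compact C" "C \<subseteq> D" "\<And>x. x \<notin> C \<Longrightarrow> \<phi> x = 0"
    using test_functionE[OF assms(1)] by (metis partial.simps(1))
  have "compact (\<phi> ` C)"
    using C smooth_continuous_on compact_continuous_image by blast
  then obtain B where B: "\<And>x. x \<in> C \<Longrightarrow> \<bar>\<phi> x\<bar> \<le> B"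
    by (metis bounded_iff compact_imp_bounded image_eqI real_norm_def)
  have f: "integrable lebesgue (\<lambda>x. indicat_real C x * f x)"
    using assms(2) C(2,3) by (auto simp: locally_integrable_def set_integrable_def)
  have "\<phi> \<in> borel_measurable lebesgue"
    using borel_measurable_continuous_onI[OF smooth_continuous_on[OF C(1)]]
    by (intro measurable_completion) simp
  then have "integrable lebesgue (\<lambda>x. (indicat_real C x * f x) * \<phi> x)"
    using B f
    by (intro Bochner_Integration.integrable_bound[OF integrable_mult_right[of B, OF f]])
      (auto simp: indicator_def abs_mult mult.commute intro!: AE_I2 mult_right_mono dest: order_trans[OF _ abs_ge_self])
  also have "(\<lambda>x. (indicat_real C x * f x) * \<phi> x) = (\<lambda>x. indicat_real D x *\<^sub>R (f x * \<phi> x))"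
    using C by (auto simp: indicator_def fun_eq_iff)
  finally show ?thesis by (simp add: set_integrable_def)
qed

lemma set_integral_supported:
  fixes f :: "'a \<Rightarrow> real"
  assumes "\<And>x. x \<notin> D \<Longrightarrow> f x = 0"
  shows "(LINT x:D|M. f x) = (LINT x|M. f x)"
  using assms unfolding set_lebesgue_integral_def
  by (intro arg_cong[of _ _ "integral\<^sup>L M"]) (auto simp: indicator_def fun_eq_iff)

lemma smooth_locally_integrable: "smooth f \<Longrightarrow> locally_integrable D f"
  by (auto simp: locally_integrable_def smooth_continuous_on intro: set_integrable_continuous_compact)

text \<open>Difference quotients integrate to 0 by translation invariance, are bounded through the
  mean value theorem and converge to the derivative. Dominated convergence then does without
  iterated integration.\<close>

lemma integral_partial_eq_0:
  assumes "\<phi> \<in> test_functions UNIV"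
  shows "(LINT x|lebesgue. partial [i] \<phi> x) = 0"
proof -
  let ?e = "axis i 1 :: pt" and ?d = "partial [i] \<phi>"
  obtain C where C: "smooth \<phi>" "compact C" "\<And>x js. x \<notin> C \<Longrightarrow> partial js \<phi> x = 0"
    using test_functionE[OF assms] by metis
  have cont: "continuous_on S \<phi>" "continuous_on S ?d" for S
    using C(1) smooth_partial[of \<phi> "[i]"] by (auto simp: smooth_continuous_on simp del: partial.simps)
  have meas: "\<phi> \<in> borel_measurable borel" "?d \<in> borel_measurable borel"
    using cont by (auto intro!: borel_measurable_continuous_onI simp del: partial.simps)
  have "compact (?d ` C)"
    using C cont compact_continuous_image by blast
  then obtain B0 where B0: "\<And>x. x \<in> C \<Longrightarrow> \<bar>?d x\<bar> \<le> B0"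
    by (metis bounded_iff compact_imp_bounded image_eqI real_norm_def)
  define B where "B = max B0 0"
  have B: "\<bar>?d x\<bar> \<le> B" for x
    using B0[of x] C(3)[of x "[i]"] by (cases "x \<in> C") (auto simp: B_def)
  obtain R where R: "\<And>x. x \<in> C \<Longrightarrow> norm x \<le> R"
    using compact_imp_bounded[OF C(2)] unfolding bounded_iff by blast
  have line: "((\<lambda>t. \<phi> (x + t *\<^sub>R ?e)) has_real_derivative ?d (x + t *\<^sub>R ?e)) (at t)" for x t
  proof -
    have f: "(\<phi> has_derivative frechet_derivative \<phi> (at (x + t *\<^sub>R ?e))) (at (x + t *\<^sub>R ?e))"
      using C(1) smooth_differentiable frechet_derivative_works by blast
    have "((\<lambda>t. x + t *\<^sub>R ?e) has_derivative (\<lambda>h. h *\<^sub>R ?e)) (at t)"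
      by (auto intro!: derivative_eq_intros)
    from has_derivative_compose[of "\<lambda>t. x + t *\<^sub>R ?e", OF this f]
    have "((\<lambda>t. \<phi> (x + t *\<^sub>R ?e)) has_derivative (\<lambda>h. frechet_derivative \<phi> (at (x + t *\<^sub>R ?e)) (h *\<^sub>R ?e))) (at t)" .
    moreover have "frechet_derivative \<phi> (at (x + t *\<^sub>R ?e)) (h *\<^sub>R ?e) = h * ?d (x + t *\<^sub>R ?e)" for h
      using linear_frechet_derivative[OF smooth_differentiable[OF C(1)]]
      by (simp add: linear_cmul)
    ultimately show ?thesis
      unfolding has_field_derivative_def
      by (elim has_derivative_eq_rhs) (simp add: fun_eq_iff mult.commute del: partial.simps)
  qed
  define q where "q n x = (\<phi> (x + inverse (real (Suc n)) *\<^sub>R ?e) - \<phi> x) * real (Suc n)" for n x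
  have q_bound: "\<bar>q n x\<bar> \<le> B" for n x
  proof -
    obtain t where "\<phi> (x + inverse (real (Suc n)) *\<^sub>R ?e) - \<phi> (x + 0 *\<^sub>R ?e) =
        (inverse (real (Suc n)) - 0) * ?d (x + t *\<^sub>R ?e)"
      using MVT2[of 0 "inverse (real (Suc n))" "\<lambda>t. \<phi> (x + t *\<^sub>R ?e)" "\<lambda>t. ?d (x + t *\<^sub>R ?e)"] line
      by (auto simp del: partial.simps)
    then have "q n x = ?d (x + t *\<^sub>R ?e)"
      by (simp add: q_def field_simps del: partial.simps)
    then show ?thesis using B by simp
  qed
  \<comment> \<open>The steps have length at most 1, so the ball of radius \<open>R + 1\<close>
    contains all supports, and \<open>B\<close> on this ball dominates the whole sequence.\<close>
  have q_supp: "q n x = 0" if "norm x > R + 1" for n x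
  proof -
    have "norm (inverse (real (Suc n)) *\<^sub>R ?e) \<le> 1" by (simp add: field_simps)
    then have "norm (x + inverse (real (Suc n)) *\<^sub>R ?e) > R"
      using that norm_diff_ineq[of x "inverse (real (Suc n)) *\<^sub>R ?e"] by linarith
    then have "x + inverse (real (Suc n)) *\<^sub>R ?e \<notin> C" "x \<notin> C"
      using R that by fastforce+
    then show ?thesis
      using C(3)[of _ "[]"] by (simp add: q_def)
  qed
  have q_lim: "(\<lambda>n. q n x) \<longlonglongrightarrow> ?d x" for x
  proof -
    have "((\<lambda>h. (\<phi> (x + h *\<^sub>R ?e) - \<phi> (x + 0 *\<^sub>R ?e)) / (h - 0)) \<longlongrightarrow> ?d (x + 0 *\<^sub>R ?e)) (at 0)"
      using line[of x 0] unfolding has_field_derivative_iff .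
    moreover have "filterlim (\<lambda>n. inverse (real (Suc n))) (at 0) sequentially"
      unfolding filterlim_at using LIMSEQ_inverse_real_of_nat by auto
    ultimately have "(\<lambda>n. (\<phi> (x + inverse (real (Suc n)) *\<^sub>R ?e) - \<phi> (x + 0 *\<^sub>R ?e)) / (inverse (real (Suc n)) - 0))
        \<longlonglongrightarrow> ?d (x + 0 *\<^sub>R ?e)"
      by (rule filterlim_compose)
    then show ?thesis
      by (simp add: q_def[abs_def] field_simps del: partial.simps)
  qed
  have int_phi: "integrable lborel \<phi>"
  proof -
    have "integrable lborel (\<lambda>x. indicator C x *\<^sub>R \<phi> x)"
      by (rule borel_integrable_compact[OF C(2) cont(1)])
    also have "(\<lambda>x. indicator C x *\<^sub>R \<phi> x) = \<phi>"
      using C(3)[of _ "[]"] by (auto simp: indicator_def fun_eq_iff)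
    finally show ?thesis .
  qed
  have q_int: "integral\<^sup>L lborel (q n) = 0" for n
  proof -
    let ?v = "inverse (real (Suc n)) *\<^sub>R ?e"
    have d: "distr lborel borel ((+) ?v) = lborel" by (rule lborel_distr_plus)
    have "integral\<^sup>L lborel (\<lambda>x. \<phi> (?v + x)) = integral\<^sup>L (distr lborel borel ((+) ?v)) \<phi>"
      using meas by (subst integral_distr) auto
    also have "\<dots> = integral\<^sup>L lborel \<phi>" by (simp only: d)
    finally have 1: "integral\<^sup>L lborel (\<lambda>x. \<phi> (x + ?v)) = integral\<^sup>L lborel \<phi>"
      by (simp only: add.commute)
    have "integrable (distr lborel borel ((+) ?v)) \<phi>" using int_phi by (simp only: d)
    then have 2: "integrable lborel (\<lambda>x. \<phi> (x + ?v))"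
      using meas by (subst (asm) integrable_distr_eq) (auto simp: add.commute)
    show ?thesis
      unfolding q_def using 1 2 int_phi by simp
  qed
  have "(\<lambda>n. integral\<^sup>L lborel (q n)) \<longlonglongrightarrow> integral\<^sup>L lborel ?d"
  proof (rule integral_dominated_convergence)
    show "integrable lborel (\<lambda>x. indicat_real (cball 0 (R + 1)) x *\<^sub>R B)"
      by (rule borel_integrable_compact) auto
    show "AE x in lborel. norm (q n x) \<le> indicat_real (cball 0 (R + 1)) x *\<^sub>R B" for n
      using q_bound q_supp by (auto simp: indicator_def not_le)
    show "q n \<in> borel_measurable lborel" for n
      unfolding q_def using meas by measurable
  qed (use q_lim meas in \<open>auto simp del: partial.simps\<close>)
  then have "integral\<^sup>L lborel ?d = 0"
    using q_int LIMSEQ_unique[OF tendsto_const] by fastforce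
  then show ?thesis
    using integral_completion[of ?d lborel] meas by (simp del: partial.simps)
qed

text \<open>The product of \<open>f\<close> and \<phi> is again a test function, so its derivative
  integrates to 0; the product rule does the rest.\<close>

lemma partial_integration:
  assumes "smooth f" "\<phi> \<in> test_functions D"
  shows "(LINT x:D|lebesgue. f x * partial [i] \<phi> x) = - (LINT x:D|lebesgue. partial [i] f x * \<phi> x)"
proof -
  note [simp del] = partial.simps
  have t: "(\<lambda>x. f x * \<phi> x) \<in> test_functions UNIV"
    using test_function_mult_smooth[OF assms(2,1)] test_functions_mono by blast
  have int: "set_integrable lebesgue D (\<lambda>x. f x * partial [i] \<phi> x)"
    "set_integrable lebesgue D (\<lambda>x. partial [i] f x * \<phi> x)"
    using assms by (auto intro!: test_function_integrable smooth_locally_integrable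
      test_function_partial smooth_partial)
  have "0 = (LINT x|lebesgue. partial [i] (\<lambda>x. f x * \<phi> x) x)"
    using integral_partial_eq_0[OF t] by simp
  also have "\<dots> = (LINT x|lebesgue. f x * partial [i] \<phi> x + partial [i] f x * \<phi> x)"
    using assms test_function_smooth smooth_differentiable by (subst partial_mult) auto
  also have "\<dots> = (LINT x:D|lebesgue. f x * partial [i] \<phi> x + partial [i] f x * \<phi> x)"
    using test_function_outside[OF assms(2)] test_function_outside[OF assms(2), of _ "[]"]
    by (intro set_integral_supported[symmetric]) (auto simp: partial.simps(1))
  also have "\<dots> = (LINT x:D|lebesgue. f x * partial [i] \<phi> x) + (LINT x:D|lebesgue. partial [i] f x * \<phi> x)"
    using int by simp
  finally show ?thesis by simp
qed

subsection \<open>Weak derivatives\<close>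

text \<open>Derivatives are transferred one at a time, which reverses their order.\<close>

lemma is_weak_deriv_smooth:
  assumes "smooth f"
  shows "is_weak_deriv D js f (partial (rev js) f)"
proof -
  have "(LINT x:D|lebesgue. f x * partial js \<phi> x)
      = (-1) ^ length js * (LINT x:D|lebesgue. partial (rev js) f x * \<phi> x)"
    if "\<phi> \<in> test_functions D" "smooth f" for \<phi> f
    using that(2)
  proof (induction js arbitrary: f)
    case (Cons i js)
    have "(LINT x:D|lebesgue. f x * partial (i # js) \<phi> x)
        = (LINT x:D|lebesgue. f x * partial [i] (partial js \<phi>) x)"
      by simp
    also have "\<dots> = - (LINT x:D|lebesgue. partial [i] f x * partial js \<phi> x)"
      using Cons.prems that(1) by (intro partial_integration test_function_partial)
    also have "\<dots> = - ((-1) ^ length js * (LINT x:D|lebesgue. partial (rev js) (partial [i] f) x * \<phi> x))"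
      using Cons.prems by (subst Cons.IH) (auto intro: smooth_partial simp del: partial.simps)
    finally show ?case
      by (simp add: partial_append del: partial.simps)
  qed simp
  then show ?thesis
    using assms smooth_partial smooth_locally_integrable by (auto simp: is_weak_deriv_def)
qed

section \<open>The fundamental lemma of the calculus of variations\<close>

definition box_bump :: "pt \<Rightarrow> pt \<Rightarrow> nat \<Rightarrow> scalar_fn" where
  "box_bump a b n = (\<lambda>x. flat 0 (real n * (x $ 1 - a $ 1)) * flat 0 (real n * (b $ 1 - x $ 1)) *
     (flat 0 (real n * (x $ 2 - a $ 2)) * flat 0 (real n * (b $ 2 - x $ 2))))"

lemma mem_box_2:
  "x \<in> box a b \<longleftrightarrow> a $ 1 < x $ 1 \<and> x $ 1 < b $ 1 \<and> a $ 2 < x $ 2 \<and> x $ 2 < (b :: pt) $ 2"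
  "x \<in> cbox a b \<longleftrightarrow> a $ 1 \<le> x $ 1 \<and> x $ 1 \<le> b $ 1 \<and> a $ 2 \<le> x $ 2 \<and> x $ 2 \<le> (b :: pt) $ 2"
  by (auto simp: mem_box_cart forall_2)

lemma flat_0_eq_0: "t \<le> 0 \<Longrightarrow> flat 0 t = 0"
  by (simp add: flat_def)

lemma flat_0_tendsto_1:
  assumes "t > 0"
  shows "(\<lambda>n. flat 0 (real n * t)) \<longlonglongrightarrow> 1"
proof -
  have "(\<lambda>n. exp (- (inverse (real (Suc n)) * inverse t))) \<longlonglongrightarrow> exp (- (0 * inverse t))"
    by (intro tendsto_intros LIMSEQ_inverse_real_of_nat)
  then have "(\<lambda>n. flat 0 (real (Suc n) * t)) \<longlonglongrightarrow> 1"
    using assms by (simp add: flat_def del: of_nat_Suc)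
  then show ?thesis
    by (rule LIMSEQ_imp_Suc)
qed

lemma box_bump_nonneg: "box_bump a b n x \<ge> 0"
  by (simp add: box_bump_def flat_nonneg)

lemma box_bump_le_1: "box_bump a b n x \<le> 1"
  unfolding box_bump_def by (intro mult_le_one mult_nonneg_nonneg flat_nonneg flat_0_le_1)

lemma box_bump_outside:
  assumes "x \<notin> box a b"
  shows "box_bump a b n x = 0"
proof -
  have "x $ 1 - a $ 1 \<le> 0 \<or> b $ 1 - x $ 1 \<le> 0 \<or> x $ 2 - a $ 2 \<le> 0 \<or> b $ 2 - x $ 2 \<le> 0"
    using assms by (auto simp: mem_box_2)
  then show ?thesis
    unfolding box_bump_def
    by (elim disjE) (simp_all add: flat_0_eq_0 mult_nonneg_nonpos)
qed

text \<open>Each of the four factors tends to 1 on the inner side of its face and is 0 on the other.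
  As all values lie in [0, 1], dominated convergence can replace a test function by the indicator of
  a box.\<close>

lemma box_bump_tendsto: "(\<lambda>n. box_bump a b n x) \<longlonglongrightarrow> indicat_real (box a b) x"
proof (cases "x \<in> box a b")
  case True
  then have "(\<lambda>n. box_bump a b n x) \<longlonglongrightarrow> 1 * 1 * (1 * 1)"
    unfolding box_bump_def by (intro tendsto_mult flat_0_tendsto_1) (auto simp: mem_box_2)
  then show ?thesis using True by simp
next
  case False
  then show ?thesis by (simp add: box_bump_outside)
qed

lemma smooth_box_bump: "smooth (box_bump a b n)"
proof -
  have "smooth (\<lambda>x. flat 0 (real n * (x $ i - a $ i)))" for i
    using smooth_flat[of 0 "- real n * a $ i" "real n *\<^sub>R axis i 1"]
    by (simp add: inner_axis' algebra_simps)
  moreover have "smooth (\<lambda>x. flat 0 (real n * (b $ i - x $ i)))" for i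
    using smooth_flat[of 0 "real n * b $ i" "- real n *\<^sub>R axis i 1"]
    by (simp add: inner_axis' algebra_simps)
  ultimately show ?thesis
    unfolding box_bump_def by (intro smooth_mult)
qed

lemma box_bump_test_function:
  assumes "cbox a b \<subseteq> D"
  shows "box_bump a b n \<in> test_functions D"
  by (rule test_functionI[OF smooth_box_bump compact_cbox assms])
    (use box_bump_outside box_subset_cbox in blast)

text \<open>Open boxes are an intersection-stable generator of the Borel sets, so a Dynkin argument
  extends the vanishing of the integral to every Borel set.\<close>

lemma integral_boxes_0_imp_AE_0:
  fixes h :: "'a::euclidean_space \<Rightarrow> real"
  assumes h: "integrable lborel h" and box: "\<And>a b. (LINT x:box a b|lborel. h x) = 0"
  shows "AE x in lborel. h x = 0"
proof (rule sigma_finite_measure.density_zero[OF lborel.sigma_finite_measure_axioms h])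
  have set_h: "set_integrable lborel A h" if "A \<in> sets borel" for A
    using h that integrable_mult_indicator[of A lborel h] by (simp add: set_integrable_def)
  \<comment> \<open>Complements in the Dynkin argument require the integral over the whole space,
    obtained by exhausting it with boxes.\<close>
  have total: "integral\<^sup>L lborel h = 0"
  proof -
    define B :: "nat \<Rightarrow> 'a set" where "B n = box (- real n *\<^sub>R One) (real n *\<^sub>R One)" for n
    have lim: "(\<lambda>n. indicat_real (B n) x * h x) \<longlonglongrightarrow> h x" for x
    proof -
      obtain N :: nat where N: "norm x < real N" using reals_Archimedean2 by blast
      have "x \<in> B n" if "n \<ge> N" for n
        using that N by (auto simp: B_def mem_box) (smt (verit) Basis_le_norm of_nat_mono)+
      then have "eventually (\<lambda>n. indicat_real (B n) x * h x = h x) sequentially"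
        by (auto simp: eventually_sequentially intro!: exI[of _ N])
      then show ?thesis by (rule tendsto_eventually)
    qed
    have "(\<lambda>n. LINT x|lborel. indicat_real (B n) x * h x) \<longlonglongrightarrow> integral\<^sup>L lborel h"
    proof (rule integral_dominated_convergence[where w = "\<lambda>x. \<bar>h x\<bar>"])
      show "AE x in lborel. norm (indicat_real (B n) x * h x) \<le> \<bar>h x\<bar>" for n
        by (auto simp: indicator_def)
      show "(\<lambda>x. indicat_real (B n) x * h x) \<in> borel_measurable lborel" for n
        using h by (auto simp: B_def)
    qed (use h lim in auto)
    moreover have "(LINT x|lborel. indicat_real (B n) x * h x) = 0" for n
      using box by (simp add: B_def set_lebesgue_integral_def)
    ultimately show ?thesis
      using LIMSEQ_unique[OF tendsto_const] by fastforce
  qed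
  fix A assume "A \<in> sets (lborel :: 'a measure)"
  then have A: "A \<in> sigma_sets UNIV (range (\<lambda>(a, b). box a b :: 'a set))"
    by (simp add: borel_eq_box)
  have "Int_stable (range (\<lambda>(a, b). box a b :: 'a set))"
    by (auto simp: Int_stable_def box_Int_box)
  moreover have "range (\<lambda>(a, b). box a b :: 'a set) \<subseteq> Pow UNIV" by simp
  ultimately show "(LINT x:A|lborel. h x) = 0"
    using A
  proof (induction rule: sigma_sets_induct_disjoint)
    case (compl A)
    then have A: "A \<in> sets borel" by (simp add: borel_eq_box)
    have "(LINT x:UNIV - A|lborel. h x) = (LINT x|lborel. h x - indicat_real A x * h x)"
      unfolding set_lebesgue_integral_def
      by (rule arg_cong[of _ _ "integral\<^sup>L lborel"]) (auto simp: indicator_def)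
    also have "\<dots> = 0"
      using h total compl.IH set_h[OF A]
      by (subst Bochner_Integration.integral_diff) (auto simp: set_lebesgue_integral_def set_integrable_def)
    finally show ?case .
  next
    case (union A)
    then have A: "A i \<in> sets borel" for i by (auto simp: borel_eq_box)
    have "(LINT x:(\<Union>i. A i)|lborel. h x) = (\<Sum>i. LINT x:A i|lborel. h x)"
      by (rule lebesgue_integral_countable_add) (use union A set_h in \<open>auto simp: disjoint_family_on_def\<close>)
    then show ?case using union by simp
  qed (use box in \<open>auto simp: set_lebesgue_integral_def\<close>)
qed

text \<open>On a closed box inside \<open>D\<close> the function is integrable, and testing with box
  bumps annihilates its integral over all smaller boxes. Countably many closed boxes cover
  \<open>D\<close>.\<close>

lemma fundamental_lemma_variations:
  assumes "open D" "locally_integrable D g"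
    and zero: "\<And>\<phi>. \<phi> \<in> test_functions D \<Longrightarrow> (LINT x:D|lebesgue. g x * \<phi> x) = 0"
  shows "AE x in lebesgue. x \<in> D \<longrightarrow> g x = 0"
proof -
  have cb: "AE x in lebesgue. x \<in> cbox a b \<longrightarrow> g x = 0" if ab: "cbox a b \<subseteq> D" for a b
  proof -
    define h where "h x = indicat_real (cbox a b) x * g x" for x
    have h: "integrable lebesgue h"
      using assms(2) ab unfolding locally_integrable_def set_integrable_def h_def by simp
    have sub: "(LINT x|lebesgue. indicat_real (box c d) x * h x) = 0" for c d
    proof -
      obtain u v where uv: "box c d \<inter> box a b = box u v" by (auto simp: box_Int_box)
      \<comment> \<open>\<open>h\<close> is cut off to a closed box whereas intersections are formed
        with open ones; the two differ by a null set.\<close>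
      have hb: "AE x in lebesgue. h x = indicat_real (box a b) x * g x"
      proof (rule AE_I')
        show "cbox a b - box a b \<in> null_sets lebesgue"
          using negligible_frontier_interval negligible_iff_null_sets by blast
      qed (use box_subset_cbox[of a b] in \<open>auto simp: h_def indicator_def\<close>)
      have "(LINT x|lebesgue. indicat_real (box c d) x * h x) = (LINT x|lebesgue. indicat_real (box u v) x * g x)"
        (is "?L = ?R")
      proof -
        have eq: "AE x in lebesgue. indicat_real (box c d) x * h x = indicat_real (box u v) x * g x"
          using hb unfolding uv[symmetric] by eventually_elim (auto simp: indicator_def)
        have "(\<lambda>x. indicat_real (box c d) x * h x) \<in> borel_measurable lebesgue"
          using borel_measurable_integrable[OF h]
          by (intro borel_measurable_times borel_measurable_indicator) auto
        then show ?thesis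
          using borel_measurable_AE[OF _ eq] eq by (intro integral_cong_AE)
      qed
      also have "?R = 0"
      proof (cases "box u v = {}")
        case False
        have "box u v \<subseteq> cbox a b" using uv box_subset_cbox by blast
        then have "closure (box u v) \<subseteq> cbox a b" by (intro closure_minimal) auto
        then have cuv: "cbox u v \<subseteq> cbox a b" using False by simp
        then have uvD: "cbox u v \<subseteq> D" using ab by blast
        have "(\<lambda>n. LINT x|lebesgue. box_bump u v n x * g x) \<longlonglongrightarrow> ?R"
        proof (rule integral_dominated_convergence[where w = "\<lambda>x. \<bar>h x\<bar>"])
          show "(\<lambda>x. indicat_real (box u v) x * g x) \<in> borel_measurable lebesgue"
          proof -
            have "(\<lambda>x. indicat_real (box u v) x * g x) = (\<lambda>x. indicat_real (box u v) x * h x)"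
              using cuv box_subset_cbox[of u v] by (auto simp: h_def indicator_def fun_eq_iff)
            then show ?thesis
              using borel_measurable_integrable[OF h]
              by (simp only:) (intro borel_measurable_times borel_measurable_indicator, auto)
          qed
          show "(\<lambda>x. box_bump u v n x * g x) \<in> borel_measurable lebesgue" for n
          proof -
            have "(\<lambda>x. box_bump u v n x * g x) = (\<lambda>x. box_bump u v n x * h x)"
              using cuv box_subset_cbox[of u v] box_bump_outside[of _ u v n]
              by (auto simp: h_def indicator_def fun_eq_iff)
            moreover have "box_bump u v n \<in> borel_measurable lebesgue"
              using borel_measurable_continuous_onI[OF smooth_continuous_on[OF smooth_box_bump]]
              by (intro measurable_completion) simp
            ultimately show ?thesis using h by auto
          qed
          show "integrable lebesgue (\<lambda>x. \<bar>h x\<bar>)" using h by simp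
          show "AE x in lebesgue. (\<lambda>n. box_bump u v n x * g x) \<longlonglongrightarrow> indicat_real (box u v) x * g x"
            by (intro AE_I2 tendsto_mult box_bump_tendsto tendsto_const)
          show "AE x in lebesgue. norm (box_bump u v n x * g x) \<le> \<bar>h x\<bar>" for n
          proof (rule AE_I2)
            fix x show "norm (box_bump u v n x * g x) \<le> \<bar>h x\<bar>"
            proof (cases "x \<in> box u v")
              case True
              then have "x \<in> cbox a b" using cuv box_subset_cbox by blast
              then show ?thesis
                using box_bump_nonneg[of u v n x] box_bump_le_1[of u v n x]
                by (simp add: h_def abs_mult mult_left_le_one_le)
            qed (simp add: box_bump_outside)
          qed
        qed
        moreover have "(LINT x|lebesgue. box_bump u v n x * g x) = 0" for n
        proof -
          have "(LINT x|lebesgue. box_bump u v n x * g x) = (LINT x:D|lebesgue. g x * box_bump u v n x)"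
            using uvD box_bump_outside[of _ u v n] box_subset_cbox[of u v]
            by (subst set_integral_supported) (auto simp: mult.commute)
          then show ?thesis using zero[OF box_bump_test_function[OF uvD]] by simp
        qed
        ultimately show ?thesis
          using LIMSEQ_unique[OF tendsto_const] by fastforce
      qed simp
      finally show ?thesis .
    qed
    \<comment> \<open>\<open>integral_boxes_0_imp_AE_0\<close> speaks of \<open>lborel\<close>,
      hence the passage to a Borel representative of \<open>h\<close>.\<close>
    obtain k where k: "k \<in> borel_measurable lborel" "AE x in lborel. h x = k x"
      using completion_ex_borel_measurable_real[of h lborel] h by blast
    have hk: "AE x in lebesgue. h x = k x"
      using k(2) by (rule AE_completion)
    have km: "k \<in> borel_measurable lebesgue" using k(1) by (rule measurable_completion)
    have "integrable lebesgue k"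
      using integrable_cong_AE_imp[OF h km hk] .
    then have ki: "integrable lborel k"
      using k(1) by (subst (asm) integrable_completion) auto
    have "(LINT x:box c d|lborel. k x) = 0" for c d
    proof -
      have "(LINT x:box c d|lborel. k x) = (LINT x|lebesgue. indicat_real (box c d) x * k x)"
        unfolding set_lebesgue_integral_def using k(1) by (subst integral_completion) auto
      also have "\<dots> = (LINT x|lebesgue. indicat_real (box c d) x * h x)"
        using km hk borel_measurable_integrable[OF h]
        by (intro integral_cong_AE borel_measurable_times borel_measurable_indicator) auto
      finally show ?thesis using sub by simp
    qed
    then have "AE x in lborel. k x = 0"
      by (rule integral_boxes_0_imp_AE_0[OF ki])
    then have "AE x in lebesgue. k x = 0" by (rule AE_completion)
    with hk show ?thesis by eventually_elim (auto simp: h_def)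
  qed
  obtain \<D> where \<D>: "countable \<D>" "\<D> \<subseteq> Pow D" "\<And>X. X \<in> \<D> \<Longrightarrow> \<exists>a b. X = cbox a b" "\<Union>\<D> = D"
    using open_countable_Union_open_cbox[OF assms(1)] by metis
  have "AE x in lebesgue. \<forall>X\<in>\<D>. x \<in> X \<longrightarrow> g x = 0"
  proof (subst AE_ball_countable[OF \<D>(1)], rule ballI)
    fix X assume X: "X \<in> \<D>"
    obtain a b where "X = cbox a b" using \<D>(3)[OF X] by auto
    then show "AE x in lebesgue. x \<in> X \<longrightarrow> g x = 0"
      using cb[of a b] \<D>(2) X by auto
  qed
  then show ?thesis
    by eventually_elim (use \<D>(4) in blast)
qed

text \<open>Makes the choice inside \<open>weak_deriv\<close> harmless: any weak derivative at hand
  may replace the chosen one almost everywhere.\<close>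

lemma is_weak_deriv_unique:
  assumes "open D" "is_weak_deriv D js f g" "is_weak_deriv D js f' g'"
    and "AE x in lebesgue. x \<in> D \<longrightarrow> f x = f' x"
  shows "AE x in lebesgue. x \<in> D \<longrightarrow> g x = g' x"
proof -
  have "AE x in lebesgue. x \<in> D \<longrightarrow> g x - g' x = 0"
  proof (rule fundamental_lemma_variations[OF assms(1)])
    show "locally_integrable D (\<lambda>x. g x - g' x)"
      using assms(2,3) by (auto simp: is_weak_deriv_def locally_integrable_def)
    fix \<phi> assume \<phi>: "\<phi> \<in> test_functions D"
    have "(LINT x:D|lebesgue. f x * partial js \<phi> x) = (LINT x:D|lebesgue. f' x * partial js \<phi> x)"
      using assms(4) by (intro set_integral_lebesgue_cong_AE) (auto elim!: eventually_mono)
    then have eq: "(LINT x:D|lebesgue. g x * \<phi> x) = (LINT x:D|lebesgue. g' x * \<phi> x)"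
      using assms(2,3) \<phi> by (auto simp: is_weak_deriv_def)
    have "set_integrable lebesgue D (\<lambda>x. g x * \<phi> x)" "set_integrable lebesgue D (\<lambda>x. g' x * \<phi> x)"
      using assms(2,3) \<phi> by (auto simp: is_weak_deriv_def intro!: test_function_integrable)
    then show "(LINT x:D|lebesgue. (g x - g' x) * \<phi> x) = 0"
      using eq by (simp add: left_diff_distrib)
  qed
  then show ?thesis by eventually_elim auto
qed

lemma weak_deriv_works: "is_weak_deriv D js f g \<Longrightarrow> is_weak_deriv D js f (weak_deriv D js f)"
  unfolding weak_deriv_def by (rule someI[of "is_weak_deriv D js f"])

lemma weak_deriv_AE_eq:
  assumes "open D" "is_weak_deriv D js f g"
  shows "AE x in lebesgue. x \<in> D \<longrightarrow> weak_deriv D js f x = g x"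
  using is_weak_deriv_unique[OF assms(1) weak_deriv_works[OF assms(2)] assms(2)] by simp

lemma is_weak_deriv_cong_AE:
  assumes "is_weak_deriv D js f g"
    and f: "AE x in lebesgue. x \<in> D \<longrightarrow> f x = f' x" and g: "AE x in lebesgue. x \<in> D \<longrightarrow> g x = g' x"
  shows "is_weak_deriv D js f' g'"
proof -
  have loc: "locally_integrable D u'"
    if "locally_integrable D u" "AE x in lebesgue. x \<in> D \<longrightarrow> u x = u' x" for u u'
    unfolding locally_integrable_def
  proof safe
    fix C assume C: "compact C" "C \<subseteq> D"
    have "AE x in lebesgue. x \<in> C \<longrightarrow> u x = u' x"
      using that(2) by eventually_elim (use C in auto)
    then show "set_integrable lebesgue C u'"
      using that(1) C set_integrable_lebesgue_cong_AE[of C u u'] by (auto simp: locally_integrable_def)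
  qed
  have int: "(LINT x:D|lebesgue. u x * \<phi> x) = (LINT x:D|lebesgue. u' x * \<phi> x)"
    if "AE x in lebesgue. x \<in> D \<longrightarrow> u x = u' x" for u u' \<phi> :: scalar_fn
    using that by (intro set_integral_lebesgue_cong_AE) (auto elim!: eventually_mono)
  show ?thesis
    using assms(1) loc[OF _ f] loc[OF _ g] unfolding is_weak_deriv_def int[OF f] int[OF g] by blast
qed

lemma is_weak_deriv_lincomb:
  assumes "is_weak_deriv D js f g" "is_weak_deriv D js f' g'"
  shows "is_weak_deriv D js (\<lambda>x. a * f x + b * f' x) (\<lambda>x. a * g x + b * g' x)"
  unfolding is_weak_deriv_def
proof (intro conjI ballI)
  show "locally_integrable D (\<lambda>x. a * f x + b * f' x)" "locally_integrable D (\<lambda>x. a * g x + b * g' x)"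
    using assms by (auto simp: is_weak_deriv_def locally_integrable_def intro!: set_integral_add)
  fix \<phi> assume \<phi>: "\<phi> \<in> test_functions D"
  have int: "set_integrable lebesgue D (\<lambda>x. f x * partial js \<phi> x)" "set_integrable lebesgue D (\<lambda>x. f' x * partial js \<phi> x)"
    "set_integrable lebesgue D (\<lambda>x. g x * \<phi> x)" "set_integrable lebesgue D (\<lambda>x. g' x * \<phi> x)"
    using assms \<phi> test_function_partial
    by (auto simp: is_weak_deriv_def intro!: test_function_integrable)
  have lin: "(LINT x:D|lebesgue. (a * u x + b * u' x) * \<psi> x)
      = a * (LINT x:D|lebesgue. u x * \<psi> x) + b * (LINT x:D|lebesgue. u' x * \<psi> x)"
    if "set_integrable lebesgue D (\<lambda>x. u x * \<psi> x)" "set_integrable lebesgue D (\<lambda>x. u' x * \<psi> x)"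
    for u u' \<psi> :: scalar_fn
  proof -
    have "(LINT x:D|lebesgue. (a * u x + b * u' x) * \<psi> x)
        = (LINT x:D|lebesgue. a * (u x * \<psi> x) + b * (u' x * \<psi> x))"
      by (simp add: algebra_simps)
    also have "\<dots> = a * (LINT x:D|lebesgue. u x * \<psi> x) + b * (LINT x:D|lebesgue. u' x * \<psi> x)"
      using that by simp
    finally show ?thesis .
  qed
  show "(LINT x:D|lebesgue. (a * f x + b * f' x) * partial js \<phi> x)
      = (-1) ^ length js * (LINT x:D|lebesgue. (a * g x + b * g' x) * \<phi> x)"
    using assms \<phi> unfolding lin[OF int(1,2)] lin[OF int(3,4)] is_weak_deriv_def
    by (simp add: algebra_simps)
qed

lemma is_weak_deriv_diff:
  "is_weak_deriv D js f g \<Longrightarrow> is_weak_deriv D js f' g' \<Longrightarrow>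
     is_weak_deriv D js (sub_fn f f') (\<lambda>x. g x - g' x)"
  using is_weak_deriv_lincomb[of D js f g f' g' 1 "-1"] by (simp add: sub_fn_def)

lemma is_weak_deriv_subset:
  assumes "is_weak_deriv D js f g" "D' \<subseteq> D"
  shows "is_weak_deriv D' js f g"
  unfolding is_weak_deriv_def
proof (intro conjI ballI)
  show "locally_integrable D' f" "locally_integrable D' g"
    using assms by (auto simp: is_weak_deriv_def locally_integrable_def)
  fix \<phi> assume \<phi>: "\<phi> \<in> test_functions D'"
  have \<phi>': "\<phi> \<in> test_functions D"
    using \<phi> test_functions_mono[OF assms(2)] by blast
  have eq: "(LINT x:D'|lebesgue. u x * partial ks \<phi> x) = (LINT x:D|lebesgue. u x * partial ks \<phi> x)" for u ks
    using test_function_outside[OF \<phi>] test_function_outside[OF \<phi>']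
    by (subst (1 2) set_integral_supported) auto
  show "(LINT x:D'|lebesgue. f x * partial js \<phi> x) = (-1) ^ length js * (LINT x:D'|lebesgue. g x * \<phi> x)"
    using eq[of f js] eq[of g "[]"] assms(1) \<phi>' by (simp add: is_weak_deriv_def)
qed

text \<open>Testing the derivative of order \<open>ks\<close> with \<open>partial js \<phi>\<close>
  yields two expressions for one integral, in which the sign of \<open>ks\<close> cancels. This
  makes weak derivatives of Sobolev functions Sobolev functions of lower order.\<close>

lemma is_weak_deriv_append:
  assumes "is_weak_deriv D ks f g" "is_weak_deriv D (ks @ js) f g'"
  shows "is_weak_deriv D js g g'"
  unfolding is_weak_deriv_def
proof (intro conjI ballI)
  show "locally_integrable D g" "locally_integrable D g'"
    using assms by (auto simp: is_weak_deriv_def)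
  fix \<phi> assume \<phi>: "\<phi> \<in> test_functions D"
  have s: "(-1::real) ^ length ks * (-1) ^ length ks = 1"
    by (simp flip: power_add power_mult_distrib)
  have 1: "(LINT x:D|lebesgue. f x * partial ks (partial js \<phi>) x)
      = (-1) ^ length ks * (LINT x:D|lebesgue. g x * partial js \<phi> x)"
    using assms(1) test_function_partial[OF \<phi>] by (auto simp: is_weak_deriv_def)
  have 2: "(LINT x:D|lebesgue. f x * partial ks (partial js \<phi>) x)
      = (-1) ^ length ks * (-1) ^ length js * (LINT x:D|lebesgue. g' x * \<phi> x)"
    using assms(2) \<phi> by (auto simp: is_weak_deriv_def partial_append power_add)
  have "(LINT x:D|lebesgue. g x * partial js \<phi> x)
      = (-1) ^ length ks * ((-1) ^ length ks * (LINT x:D|lebesgue. g x * partial js \<phi> x))"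
    by (simp only: mult.assoc[symmetric] s mult_1_left)
  also have "\<dots> = (-1) ^ length ks * ((-1) ^ length ks * (-1) ^ length js * (LINT x:D|lebesgue. g' x * \<phi> x))"
    by (simp only: 1[symmetric] 2)
  also have "\<dots> = (-1) ^ length js * (LINT x:D|lebesgue. g' x * \<phi> x)"
    by (simp only: mult.assoc[symmetric] s mult_1_left)
  finally show "(LINT x:D|lebesgue. g x * partial js \<phi> x) = (-1) ^ length js * (LINT x:D|lebesgue. g' x * \<phi> x)" .
qed

subsection \<open>Sobolev functions of integer order\<close>

lemma Hs_nat_iff: "f \<in> Hs (real k) D \<longleftrightarrow> (\<forall>js. length js \<le> k \<longrightarrow> (\<exists>g\<in>L2 D. is_weak_deriv D js f g))"
  by (simp add: Hs_def)

lemma Hs_norm_nat: "Hs_norm (real k) D f = sqrt (\<Sum>m\<le>k. seminorm_sq m D f)"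
  by (simp add: Hs_norm_def)

lemma seminorm_sq_nonneg: "seminorm_sq m D f \<ge> 0"
  unfolding seminorm_sq_def by (intro sum_nonneg set_integral_square_nonneg)

lemma Hs_norm_sq: "(Hs_norm (real k) D f)\<^sup>2 = (\<Sum>m\<le>k. seminorm_sq m D f)"
  unfolding Hs_norm_nat by (intro real_sqrt_pow2 sum_nonneg seminorm_sq_nonneg)

lemma Hs_norm_nonneg: "Hs_norm (real k) D f \<ge> 0"
  unfolding Hs_norm_nat by (intro real_sqrt_ge_zero sum_nonneg seminorm_sq_nonneg)

text \<open>Membership in \<open>Hs\<close> only provides some square integrable derivative;
  uniqueness transfers this to the chosen one.\<close>

lemma Hs_weak_deriv:
  assumes "open D" "f \<in> Hs (real k) D" "length js \<le> k"
  shows "weak_deriv D js f \<in> L2 D" "is_weak_deriv D js f (weak_deriv D js f)"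
proof -
  obtain g where g: "g \<in> L2 D" "is_weak_deriv D js f g"
    using assms by (auto simp: Hs_nat_iff)
  have "AE x in lebesgue. x \<in> D \<longrightarrow> g x = weak_deriv D js f x"
    using weak_deriv_AE_eq[OF assms(1) g(2)] by eventually_elim auto
  then show "weak_deriv D js f \<in> L2 D"
    using sq_integrable_lebesgue_cong_AE g(1) by (auto simp: L2_iff)
  show "is_weak_deriv D js f (weak_deriv D js f)"
    by (rule weak_deriv_works[OF g(2)])
qed

lemma Hs_subset:
  assumes "f \<in> Hs (real k) D" "D' \<subseteq> D" "D' \<in> sets lebesgue"
  shows "f \<in> Hs (real k) D'"
  unfolding Hs_nat_iff
proof safe
  fix js :: "2 list" assume "length js \<le> k"
  then obtain g where g: "g \<in> L2 D" "is_weak_deriv D js f g"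
    using assms(1) by (auto simp: Hs_nat_iff)
  have "g \<in> L2 D'"
    using g(1) assms(2,3) sq_integrable_subset[of lebesgue D g D'] by (simp add: L2_iff)
  with is_weak_deriv_subset[OF g(2) assms(2)] show "\<exists>g\<in>L2 D'. is_weak_deriv D' js f g" by auto
qed

lemma Hs_diff:
  assumes "f \<in> Hs (real k) D" "g \<in> Hs (real k) D"
  shows "sub_fn f g \<in> Hs (real k) D"
  unfolding Hs_nat_iff
proof safe
  fix js :: "2 list" assume js: "length js \<le> k"
  obtain f' where f': "sq_integrable lebesgue D f'" "is_weak_deriv D js f f'"
    using assms(1) js by (auto simp: Hs_nat_iff L2_iff)
  obtain g' where g': "sq_integrable lebesgue D g'" "is_weak_deriv D js g g'"
    using assms(2) js by (auto simp: Hs_nat_iff L2_iff)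
  show "\<exists>h\<in>L2 D. is_weak_deriv D js (sub_fn f g) h"
    by (rule bexI[where P = "is_weak_deriv D js (sub_fn f g)", OF is_weak_deriv_diff[OF f'(2) g'(2)]])
      (use sq_integrable_diff[OF f'(1) g'(1)] in \<open>simp add: L2_iff\<close>)
qed

lemma weak_deriv_diff:
  assumes "open D" "is_weak_deriv D js f f'" "is_weak_deriv D js g g'"
  shows "AE x in lebesgue. x \<in> D \<longrightarrow> weak_deriv D js (sub_fn f g) x = f' x - g' x"
  by (rule weak_deriv_AE_eq[OF assms(1) is_weak_deriv_diff[OF assms(2,3)]])

lemma seminorm_sq_eq:
  assumes "open D" "\<And>js. length js = m \<Longrightarrow> is_weak_deriv D js f (g js)"
  shows "seminorm_sq m D f = (\<Sum>js | length js = m. LINT x:D|lebesgue. (g js x)\<^sup>2)"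
  unfolding seminorm_sq_def
proof (rule sum.cong[OF refl])
  fix js :: "2 list" assume "js \<in> {js. length js = m}"
  then have "AE x in lebesgue. x \<in> D \<longrightarrow> weak_deriv D js f x = g js x"
    using weak_deriv_AE_eq assms by auto
  then show "(LINT x:D|lebesgue. (weak_deriv D js f x)\<^sup>2) = (LINT x:D|lebesgue. (g js x)\<^sup>2)"
    by (intro set_integral_lebesgue_cong_AE) (auto elim!: eventually_mono)
qed

lemma finite_lists_2: "finite {js :: 2 list. length js = m}"
  using finite_lists_length_eq[of "UNIV :: 2 set" m] by simp

lemma sum_lists_1: "(\<Sum>js :: 2 list | length js = 1. F js) = (\<Sum>i\<in>UNIV. F [i])"
  by (rule sum.reindex_bij_witness[of _ "\<lambda>i. [i]" hd]) (auto simp: length_Suc_conv)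

lemma sum_lists_2: "(\<Sum>js :: 2 list | length js = 2. F js) = (\<Sum>i\<in>UNIV. \<Sum>j\<in>UNIV. F [i, j])"
  unfolding sum.cartesian_product
  by (rule sum.reindex_bij_witness[of _ "\<lambda>(i, j). [i, j]" "\<lambda>js. (hd js, hd (tl js))"])
    (auto simp: length_Suc_conv numeral_2_eq_2)

lemma seminorm_sq_cong_AE:
  assumes "open D" "f \<in> Hs (real k) D" "AE x in lebesgue. x \<in> D \<longrightarrow> f x = f' x" "m \<le> k"
  shows "seminorm_sq m D f' = seminorm_sq m D f"
  unfolding seminorm_sq_def[of m D f]
proof (rule seminorm_sq_eq[OF assms(1)])
  fix js :: "2 list" assume "length js = m"
  then have "is_weak_deriv D js f (weak_deriv D js f)"
    using assms by (intro Hs_weak_deriv) auto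
  then show "is_weak_deriv D js f' (weak_deriv D js f)"
    using assms(3) by (rule is_weak_deriv_cong_AE) simp
qed

lemma Hs_cong_AE:
  assumes "f \<in> Hs (real k) D" "AE x in lebesgue. x \<in> D \<longrightarrow> f x = f' x"
  shows "f' \<in> Hs (real k) D"
  unfolding Hs_nat_iff
proof safe
  fix js :: "2 list" assume "length js \<le> k"
  then obtain g where g: "g \<in> L2 D" "is_weak_deriv D js f g"
    using assms(1) by (auto simp: Hs_nat_iff)
  have "is_weak_deriv D js f' g"
    by (rule is_weak_deriv_cong_AE[OF g(2) assms(2)]) simp
  with g(1) show "\<exists>g\<in>L2 D. is_weak_deriv D js f' g" by auto
qed

lemma smooth_sq_integrable:
  assumes "bounded D" "D \<in> sets lebesgue" "smooth f"
  shows "sq_integrable lebesgue D f"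
  using assms smooth_continuous_on by (intro sq_integrable_continuous)

lemma smooth_Hs:
  assumes "bounded D" "D \<in> sets lebesgue" "smooth f"
  shows "f \<in> Hs (real k) D"
  unfolding Hs_nat_iff
proof (intro allI impI)
  fix js
  show "\<exists>g\<in>L2 D. is_weak_deriv D js f g"
    by (rule bexI[where P = "is_weak_deriv D js f", OF is_weak_deriv_smooth[OF assms(3)]])
      (use smooth_sq_integrable[OF assms(1,2) smooth_partial[OF assms(3)]] in \<open>simp add: L2_iff\<close>)
qed

lemma Hs_mono: "f \<in> Hs (real k) D \<Longrightarrow> m \<le> k \<Longrightarrow> f \<in> Hs (real m) D"
  by (auto simp: Hs_nat_iff)

lemma weak_deriv_Hs:
  assumes "open D" "f \<in> Hs (real (length ks + k)) D"
  shows "weak_deriv D ks f \<in> Hs (real k) D"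
  unfolding Hs_nat_iff
proof safe
  fix js :: "2 list" assume js: "length js \<le> k"
  have "is_weak_deriv D js (weak_deriv D ks f) (weak_deriv D (ks @ js) f)"
    by (rule is_weak_deriv_append[OF Hs_weak_deriv(2)[OF assms] Hs_weak_deriv(2)[OF assms]])
      (use js in auto)
  then show "\<exists>g\<in>L2 D. is_weak_deriv D js (weak_deriv D ks f) g"
    using Hs_weak_deriv(1)[OF assms, of "ks @ js"] js by auto
qed

subsection \<open>Integration in affine coordinates\<close>

lemma measurable_vector_pair:
  "(\<lambda>(s, t). vector [s, t] :: pt) \<in> (lborel \<Otimes>\<^sub>M lborel) \<rightarrow>\<^sub>M borel"
proof -
  have "(\<lambda>(s, t). vector [s, t] :: pt) = (\<lambda>z. fst z *\<^sub>R axis 1 1 + snd z *\<^sub>R axis 2 1)"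
    by (auto simp: fun_eq_iff vec_eq_iff forall_2 axis_def)
  then show ?thesis by simp
qed

text \<open>Prepares Fubini's theorem in the plane: two measures that agree on boxes
  coincide.\<close>

lemma distr_lborel_pair_vector:
  "distr (lborel \<Otimes>\<^sub>M lborel) borel (\<lambda>(s, t). vector [s, t] :: pt) = lborel"
proof (rule lborel_eqI[symmetric])
  note m = measurable_vector_pair
  fix l u :: pt assume lu: "\<And>b. b \<in> Basis \<Longrightarrow> l \<bullet> b \<le> u \<bullet> b"
  have le: "l $ i \<le> u $ i" for i
    using lu[of "axis i 1"] by (simp add: inner_axis axis_in_Basis_iff)
  have "(\<lambda>(s, t). vector [s, t] :: pt) -` box l u = {l $ 1<..<u $ 1} \<times> {l $ 2<..<u $ 2}"
    by (auto simp: mem_box_2)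
  then have "emeasure (distr (lborel \<Otimes>\<^sub>M lborel) borel (\<lambda>(s, t). vector [s, t] :: pt)) (box l u)
      = emeasure (lborel \<Otimes>\<^sub>M lborel) ({l $ 1<..<u $ 1} \<times> {l $ 2<..<u $ 2})"
    using m by (subst emeasure_distr) (auto simp: space_pair_measure)
  also have "\<dots> = ennreal ((u $ 1 - l $ 1) * (u $ 2 - l $ 2))"
    using le by (subst lborel.emeasure_pair_measure_Times) (auto simp: ennreal_mult)
  also have "(u $ 1 - l $ 1) * (u $ 2 - l $ 2) = (\<Prod>b\<in>Basis. (u - l) \<bullet> b)"
  proof -
    have B: "(Basis :: pt set) = (\<lambda>i. axis i 1) ` UNIV"
      by (auto simp: Basis_vec_def)
    have "inj (\<lambda>i :: 2. axis i (1::real))" by (auto simp: inj_on_def axis_eq_axis)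
    then show ?thesis
      unfolding B by (subst prod.reindex) (auto simp: inner_axis UNIV_2 o_def)
  qed
  finally show "emeasure (distr (lborel \<Otimes>\<^sub>M lborel) borel (\<lambda>(s, t). vector [s, t] :: pt)) (box l u)
      = ennreal (\<Prod>b\<in>Basis. (u - l) \<bullet> b)" .
qed simp

text \<open>The determinant with columns \<open>a\<close> and \<open>b\<close>. It is the Jacobian
  of coordinates in this frame, and its quotients are the barycentric coordinates of a
  triangle.\<close>

definition cross2 :: "pt \<Rightarrow> pt \<Rightarrow> real" where
  "cross2 a b = a $ 1 * b $ 2 - a $ 2 * b $ 1"

text \<open>The preimage of a box under \<open>T\<close> has the area of the box divided by the
  determinant, and boxes determine the measure.\<close>

lemma distr_lborel_linear:
  fixes T :: "pt \<Rightarrow> pt"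
  assumes T: "linear T" and d: "det (matrix T) \<noteq> 0"
  shows "distr lborel borel T = density lborel (\<lambda>_. ennreal (1 / \<bar>det (matrix T)\<bar>))"
proof (rule measure_eqI_generator_eq[where A = "\<lambda>n::nat. box (- real n *\<^sub>R One) (real n *\<^sub>R One)"
      and \<Omega> = UNIV and E = "range (\<lambda>(a, b). box a b :: pt set)"])
  have cont: "continuous_on UNIV T" by (rule linear_continuous_on) (rule T[unfolded linear_conv_bounded_linear])
  then have Tm: "T \<in> borel_measurable borel" by (rule borel_measurable_continuous_onI)
  have bij: "bij T"
    using T d det_nz_iff_inj inj_linear_imp_inv_linear
    by (metis bij_def linear_injective_imp_surjective)
  have key: "emeasure (distr lborel borel T) (box a b) = ennreal (1 / \<bar>det (matrix T)\<bar>) * emeasure lborel (box a b)" for a b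
  proof -
    define B where "B = T -` box a b"
    have lin: "linear (inv T)" using T bij by (metis bij_def inj_linear_imp_inv_linear)
    have B: "B = inv T ` box a b" unfolding B_def using bij by (simp add: bij_vimage_eq_inv_image)
    have "bounded B" unfolding B by (intro bounded_linear_image bounded_box) (use lin linear_conv_bounded_linear in blast)
    moreover have Bb: "B \<in> sets borel" unfolding B_def using Tm by (auto dest: measurable_sets[of _ borel borel "box a b"])
    ultimately have Bl: "B \<in> lmeasurable"
      by (intro bounded_set_imp_lmeasurable) auto
    have TB: "T ` B = box a b" unfolding B_def using bij by (simp add: bij_is_surj)
    have "measure lebesgue (T ` B) = \<bar>det (matrix T)\<bar> * measure lebesgue B"
      using measure_linear_image[OF T Bl] .
    then have m: "measure lborel B = (1 / \<bar>det (matrix T)\<bar>) * measure lborel (box a b)"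
      unfolding TB using d Bb by (simp add: field_simps measure_completion)
    have "emeasure (distr lborel borel T) (box a b) = emeasure lborel B"
      using Tm by (subst emeasure_distr) (auto simp: B_def)
    also have "\<dots> = ennreal (measure lborel B)"
      using \<open>bounded B\<close> emeasure_bounded_finite[of B] by (intro emeasure_eq_ennreal_measure) auto
    also have "\<dots> = ennreal (1 / \<bar>det (matrix T)\<bar>) * ennreal (measure lborel (box a b))"
      unfolding m by (rule ennreal_mult) auto
    also have "ennreal (measure lborel (box a b)) = emeasure lborel (box a b)"
      using emeasure_bounded_finite[of "box a b"] by (intro emeasure_eq_ennreal_measure[symmetric]) auto
    finally show ?thesis .
  qed
  show "Int_stable (range (\<lambda>(a, b). box a b :: pt set))"
    by (auto simp: Int_stable_def box_Int_box)
  show "X \<in> range (\<lambda>(a, b). box a b :: pt set) \<Longrightarrow>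
      emeasure (distr lborel borel T) X = emeasure (density lborel (\<lambda>_. ennreal (1 / \<bar>det (matrix T)\<bar>))) X" for X
    using key by (auto simp: emeasure_density_const)
  show "sets (distr lborel borel T) = sigma_sets UNIV (range (\<lambda>(a, b). box a b :: pt set))"
    by (simp add: borel_eq_box)
  show "sets (density lborel (\<lambda>_. ennreal (1 / \<bar>det (matrix T)\<bar>))) = sigma_sets UNIV (range (\<lambda>(a, b). box a b :: pt set))"
    by (simp add: borel_eq_box)
  show "(\<Union>n::nat. box (- real n *\<^sub>R One) (real n *\<^sub>R One)) = (UNIV :: pt set)"
    by (simp add: UN_box_eq_UNIV)
  show "emeasure (distr lborel borel T) (box (- real n *\<^sub>R One) (real n *\<^sub>R One)) \<noteq> \<infinity>" for n
    unfolding key using emeasure_bounded_finite[of "box (- real n *\<^sub>R One) (real n *\<^sub>R One) :: pt set"]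
    by (simp add: ennreal_mult_eq_top_iff)
qed auto

lemma distr_affine_frame:
  assumes d: "cross2 a b \<noteq> 0"
  shows "distr (lborel \<Otimes>\<^sub>M lborel) borel (\<lambda>(s, t). p + s *\<^sub>R a + t *\<^sub>R b)
    = density lborel (\<lambda>_. ennreal (1 / \<bar>cross2 a b\<bar>))"
proof -
  define T :: "pt \<Rightarrow> pt" where "T x = x $ 1 *\<^sub>R a + x $ 2 *\<^sub>R b" for x
  have T: "linear T"
    unfolding T_def by (intro linearI) (auto simp: algebra_simps)
  have det: "det (matrix T) = cross2 a b"
    unfolding det_2 matrix_def T_def cross2_def by (simp add: axis_def)
  have Tm: "T \<in> borel_measurable borel"
    by (rule borel_measurable_continuous_onI, rule linear_continuous_on) (rule T[unfolded linear_conv_bounded_linear])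
  note V = measurable_vector_pair
  have "distr (lborel \<Otimes>\<^sub>M lborel) borel (\<lambda>(s, t). p + s *\<^sub>R a + t *\<^sub>R b)
      = distr (distr (distr (lborel \<Otimes>\<^sub>M lborel) borel (\<lambda>(s, t). vector [s, t])) borel T) borel ((+) p)"
    using Tm V by (subst distr_distr, measurable)+ (auto intro!: distr_cong simp: T_def add.assoc)
  also have "\<dots> = distr (density lborel (\<lambda>_. ennreal (1 / \<bar>cross2 a b\<bar>))) borel ((+) p)"
    unfolding distr_lborel_pair_vector distr_lborel_linear[OF T, unfolded det, OF d] ..
  also have "\<dots> = density (distr lborel borel ((+) p)) (\<lambda>_. ennreal (1 / \<bar>cross2 a b\<bar>))"
    by (subst density_distr) auto
  finally show ?thesis by (simp add: lborel_distr_plus)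
qed

text \<open>Needed for two kinds of frames: orthonormal ones for the bumps, and the skew frame of an
  edge and another side of the triangle for the trace inequality.\<close>

lemma integral_affine_frame:
  fixes F :: scalar_fn
  assumes d: "cross2 a b \<noteq> 0" and F: "integrable lborel F"
  shows "(LINT x|lborel. F x) = \<bar>cross2 a b\<bar> * (LINT s|lborel. LINT t|lborel. F (p + s *\<^sub>R a + t *\<^sub>R b))"
    and "integrable lborel (\<lambda>s. LINT t|lborel. F (p + s *\<^sub>R a + t *\<^sub>R b))"
proof -
  let ?L = "\<lambda>(s, t). p + s *\<^sub>R a + t *\<^sub>R b"
  have L: "?L \<in> (lborel \<Otimes>\<^sub>M lborel) \<rightarrow>\<^sub>M borel"
    by measurable
  have Fm: "F \<in> borel_measurable borel" using F by auto
  have di: "distr (lborel \<Otimes>\<^sub>M lborel) borel ?L = density lborel (\<lambda>_. ennreal (1 / \<bar>cross2 a b\<bar>))"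
    by (rule distr_affine_frame[OF d])
  have "integrable (density lborel (\<lambda>_. ennreal (1 / \<bar>cross2 a b\<bar>))) F"
    using F by (subst integrable_density) auto
  then have int: "integrable (lborel \<Otimes>\<^sub>M lborel) (\<lambda>z. F (?L z))"
    unfolding di[symmetric] using L Fm by (subst (asm) integrable_distr_eq) auto
  show "integrable lborel (\<lambda>s. LINT t|lborel. F (p + s *\<^sub>R a + t *\<^sub>R b))"
    using lborel_pair.integrable_fst'[OF int] by simp
  have "(LINT s|lborel. LINT t|lborel. F (p + s *\<^sub>R a + t *\<^sub>R b)) = integral\<^sup>L (lborel \<Otimes>\<^sub>M lborel) (\<lambda>z. F (?L z))"
    using lborel_pair.integral_fst'[OF int] by simp
  also have "\<dots> = integral\<^sup>L (density lborel (\<lambda>_. ennreal (1 / \<bar>cross2 a b\<bar>))) F"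
    unfolding di[symmetric] using L Fm by (subst integral_distr) auto
  also have "\<dots> = (1 / \<bar>cross2 a b\<bar>) * (LINT x|lborel. F x)"
    using Fm by (subst integral_density) auto
  finally show "(LINT x|lborel. F x) = \<bar>cross2 a b\<bar> * (LINT s|lborel. LINT t|lborel. F (p + s *\<^sub>R a + t *\<^sub>R b))"
    using d by simp
qed

subsection \<open>Localised test functions\<close>

text \<open>One factor of a bump, bundled with its first two derivatives. The bound 1 on
  \<open>g\<close> keeps test functions below 1 in modulus; \<open>B\<close> enters through their
  second derivatives.\<close>

definition profile :: "real \<Rightarrow> (real \<Rightarrow> real) \<Rightarrow> (real \<Rightarrow> real) \<Rightarrow> (real \<Rightarrow> real) \<Rightarrow> bool" where
  "profile B g g1 g2 \<longleftrightarrow>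
     (\<forall>t. (g has_real_derivative g1 t) (at t)) \<and> (\<forall>t. (g1 has_real_derivative g2 t) (at t)) \<and>
     continuous_on UNIV g2 \<and> (\<forall>t. \<bar>t\<bar> \<ge> 1 \<longrightarrow> g t = 0 \<and> g1 t = 0 \<and> g2 t = 0) \<and>
     (\<forall>t. \<bar>g t\<bar> \<le> 1 \<and> \<bar>g1 t\<bar> \<le> B \<and> \<bar>g2 t\<bar> \<le> B)"

text \<open>Equals exp (-2 / (1 - t^2)) on (-1, 1).\<close>

definition bump :: "real \<Rightarrow> real" where
  "bump t = flat 0 (1 - t) * flat 0 (1 + t)"

text \<open>By \<open>flat_has_derivative\<close>, \<open>flat 0\<close> differentiates to
  \<open>flat 2\<close>, and \<open>flat 2\<close> to \<open>flat 4\<close> minus twice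
  \<open>flat 3\<close>.\<close>

definition bump' :: "real \<Rightarrow> real" where
  "bump' t = flat 0 (1 - t) * flat 2 (1 + t) - flat 2 (1 - t) * flat 0 (1 + t)"

definition bump'' :: "real \<Rightarrow> real" where
  "bump'' t = flat 0 (1 - t) * (flat 4 (1 + t) - 2 * flat 3 (1 + t)) - 2 * flat 2 (1 - t) * flat 2 (1 + t)
     + (flat 4 (1 - t) - 2 * flat 3 (1 - t)) * flat 0 (1 + t)"

lemma flat_affine_has_derivative:
  "((\<lambda>t. flat k (1 + t)) has_real_derivative flat (k + 2) (1 + t) - real k * flat (k + 1) (1 + t)) (at t)"
  "((\<lambda>t. flat k (1 - t)) has_real_derivative - (flat (k + 2) (1 - t) - real k * flat (k + 1) (1 - t))) (at t)"
proof -
  have "((\<lambda>t. 1 + t) has_real_derivative 1) (at t)" by (auto intro!: derivative_eq_intros)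
  from DERIV_chain2[where g = "\<lambda>t. 1 + t", OF flat_has_derivative this]
  show "((\<lambda>t. flat k (1 + t)) has_real_derivative flat (k + 2) (1 + t) - real k * flat (k + 1) (1 + t)) (at t)"
    by simp
  have "((\<lambda>t. 1 - t) has_real_derivative -1) (at t)" by (auto intro!: derivative_eq_intros)
  from DERIV_chain2[where g = "\<lambda>t. 1 - t", OF flat_has_derivative this]
  show "((\<lambda>t. flat k (1 - t)) has_real_derivative - (flat (k + 2) (1 - t) - real k * flat (k + 1) (1 - t))) (at t)"
    by simp
qed

lemma bump_has_derivative: "(bump has_real_derivative bump' t) (at t)"
proof -
  note f = flat_affine_has_derivative[of 0 t]
  show ?thesis
    unfolding bump_def[abs_def] bump'_def
    by (rule DERIV_cong[OF DERIV_mult[OF f(2) f(1)]]) (simp add: eval_nat_numeral algebra_simps)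
qed

lemma bump'_has_derivative: "(bump' has_real_derivative bump'' t) (at t)"
proof -
  note f = flat_affine_has_derivative[of 0 t] and g = flat_affine_has_derivative[of 2 t]
  show ?thesis
    unfolding bump'_def[abs_def] bump''_def
    by (rule DERIV_cong[OF DERIV_diff[OF DERIV_mult[OF f(2) g(1)] DERIV_mult[OF g(2) f(1)]]])
      (simp add: eval_nat_numeral algebra_simps)
qed

lemma flat_eq_0: "t \<le> 0 \<Longrightarrow> flat k t = 0"
  by (simp add: flat_def)

lemma bump_outside:
  assumes "\<bar>t\<bar> \<ge> 1"
  shows "bump t = 0" "bump' t = 0" "bump'' t = 0"
proof -
  have "1 - t \<le> 0 \<or> 1 + t \<le> 0" using assms by linarith
  then show "bump t = 0" "bump' t = 0" "bump'' t = 0"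
    by (auto simp: bump_def bump'_def bump''_def flat_eq_0)
qed

lemma continuous_on_flat_compose: "continuous_on S f \<Longrightarrow> continuous_on S (\<lambda>x. flat k (f x))"
  by (rule continuous_on_compose2[OF flat_continuous[of UNIV]]) auto

lemma bump''_continuous: "continuous_on S bump''"
  unfolding bump''_def[abs_def] by (intro continuous_intros continuous_on_flat_compose)

lemma bump'_continuous: "continuous_on S bump'"
  unfolding bump'_def[abs_def] by (intro continuous_intros continuous_on_flat_compose)

lemma bump_bounds: "0 \<le> bump t" "bump t \<le> 1"
  unfolding bump_def by (auto intro!: mult_le_one mult_nonneg_nonneg flat_nonneg flat_0_le_1)

lemma bounded_if_compactly_supported:
  fixes f :: "real \<Rightarrow> real"
  assumes "continuous_on UNIV f" "\<And>t. \<bar>t\<bar> \<ge> 1 \<Longrightarrow> f t = 0"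
  obtains B where "\<And>t. \<bar>f t\<bar> \<le> B"
proof -
  have "compact (f ` {-1..1})"
    using assms(1) by (intro compact_continuous_image) (auto intro: continuous_on_subset)
  then have "bounded (f ` {-1..1})" by (rule compact_imp_bounded)
  then obtain B where B: "\<forall>t\<in>{-1..1}. \<bar>f t\<bar> \<le> B"
    unfolding bounded_iff by auto
  have "\<bar>f t\<bar> \<le> max B 0" for t
    using B assms(2)[of t] by (cases "\<bar>t\<bar> \<ge> 1") (auto simp: abs_less_iff not_le intro: max.coboundedI1)
  then show ?thesis using that by blast
qed

text \<open>The even profile serves the triangles. The odd one vanishes at 0 with slope
  \<open>bump 0\<close> and is the factor across an edge. A single \<open>B\<close> covers
  both.\<close>

lemma bump_profiles:
  obtains B where "B \<ge> 1" "profile B bump bump' bump''"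
    "profile B (\<lambda>t. t * bump t) (\<lambda>t. bump t + t * bump' t) (\<lambda>t. 2 * bump' t + t * bump'' t)"
proof -
  obtain B1 where B1: "\<And>t. \<bar>bump' t\<bar> \<le> B1"
    using bounded_if_compactly_supported[OF bump'_continuous bump_outside(2)] by blast
  obtain B2 where B2: "\<And>t. \<bar>bump'' t\<bar> \<le> B2"
    using bounded_if_compactly_supported[OF bump''_continuous bump_outside(3)] by blast
  \<comment> \<open>Large enough for 1 + B1 and 2 B1 + B2, the bounds for the two derivatives of t
    bump t.\<close>
  define B where "B = 1 + 2 * B1 + B2"
  have nn: "0 \<le> B1" "0 \<le> B2" using B1[of 0] B2[of 0] by linarith+
  have le: "\<bar>t * f t\<bar> \<le> \<bar>f t\<bar>" if "\<And>t. \<bar>t\<bar> \<ge> 1 \<Longrightarrow> f t = 0" for t and f :: "real \<Rightarrow> real"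
    using that[of t] by (cases "\<bar>t\<bar> \<ge> 1") (auto simp: abs_mult intro: mult_left_le_one_le)
  show ?thesis
  proof
    show "B \<ge> 1" using nn by (simp add: B_def)
    show "profile B bump bump' bump''"
      unfolding profile_def
    proof (intro conjI allI impI bump_has_derivative bump'_has_derivative bump''_continuous bump_outside)
      fix t
      show "\<bar>bump t\<bar> \<le> 1" using bump_bounds[of t] by simp
      show "\<bar>bump' t\<bar> \<le> B" "\<bar>bump'' t\<bar> \<le> B" using B1[of t] B2[of t] nn by (auto simp: B_def)
    qed
    show "profile B (\<lambda>t. t * bump t) (\<lambda>t. bump t + t * bump' t) (\<lambda>t. 2 * bump' t + t * bump'' t)"
      unfolding profile_def
    proof (intro conjI allI impI)
      fix t
      show "((\<lambda>t. t * bump t) has_real_derivative bump t + t * bump' t) (at t)"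
        by (rule DERIV_cong[OF DERIV_mult[OF DERIV_ident bump_has_derivative]]) simp
      show "((\<lambda>t. bump t + t * bump' t) has_real_derivative 2 * bump' t + t * bump'' t) (at t)"
        by (rule DERIV_cong[OF DERIV_add[OF bump_has_derivative DERIV_mult[OF DERIV_ident bump'_has_derivative]]]) simp
      show "continuous_on UNIV (\<lambda>t. 2 * bump' t + t * bump'' t)"
        by (intro continuous_intros bump'_continuous bump''_continuous)
      show "\<bar>t * bump t\<bar> \<le> 1"
        using le[where f = bump, OF bump_outside(1), of t] bump_bounds[of t] by simp
      show "\<bar>bump t + t * bump' t\<bar> \<le> B"
        using le[where f = bump', OF bump_outside(2), of t] bump_bounds[of t] B1[of t] nn unfolding B_def by linarith
      show "\<bar>2 * bump' t + t * bump'' t\<bar> \<le> B"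
        using le[where f = bump'', OF bump_outside(3), of t] B1[of t] B2[of t] nn unfolding B_def by linarith
    qed (auto simp: bump_outside)
  qed
qed

definition tensor :: "pt \<Rightarrow> pt \<Rightarrow> pt \<Rightarrow> real \<Rightarrow> (real \<Rightarrow> real) \<Rightarrow> (real \<Rightarrow> real) \<Rightarrow> scalar_fn" where
  "tensor m \<nu> \<tau> \<rho> g k x = g (\<nu> \<bullet> (x - m) / \<rho>) * k (\<tau> \<bullet> (x - m) / \<rho>)"

lemma tensor_has_derivative:
  assumes "\<And>t. (g has_real_derivative g1 t) (at t)" "\<And>t. (k has_real_derivative k1 t) (at t)"
  shows "(tensor m \<nu> \<tau> \<rho> g k has_derivative
     (\<lambda>h. (\<nu> \<bullet> h / \<rho>) * tensor m \<nu> \<tau> \<rho> g1 k x + (\<tau> \<bullet> h / \<rho>) * tensor m \<nu> \<tau> \<rho> g k1 x)) (at x)"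
proof -
  have lin: "((\<lambda>x. v \<bullet> (x - m) / \<rho>) has_derivative (\<lambda>h. v \<bullet> h / \<rho>)) (at x)" for v x
    unfolding divide_inverse by (auto intro!: derivative_eq_intros)
  have 1: "((\<lambda>x. g (\<nu> \<bullet> (x - m) / \<rho>)) has_derivative (\<lambda>h. g1 (\<nu> \<bullet> (x - m) / \<rho>) * (\<nu> \<bullet> h / \<rho>))) (at x)"
    by (rule has_derivative_compose[of "\<lambda>x. \<nu> \<bullet> (x - m) / \<rho>" "\<lambda>h. \<nu> \<bullet> h / \<rho>",
          OF lin assms(1)[unfolded has_field_derivative_def]])
  have 2: "((\<lambda>x. k (\<tau> \<bullet> (x - m) / \<rho>)) has_derivative (\<lambda>h. k1 (\<tau> \<bullet> (x - m) / \<rho>) * (\<tau> \<bullet> h / \<rho>))) (at x)"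
    by (rule has_derivative_compose[of "\<lambda>x. \<tau> \<bullet> (x - m) / \<rho>" "\<lambda>h. \<tau> \<bullet> h / \<rho>",
          OF lin assms(2)[unfolded has_field_derivative_def]])
  show ?thesis
    unfolding tensor_def[abs_def]
    by (rule has_derivative_eq_rhs[OF has_derivative_mult[OF 1 2]]) (auto simp: algebra_simps)
qed

lemma partial_tensor:
  assumes "\<And>t. (g has_real_derivative g1 t) (at t)" "\<And>t. (k has_real_derivative k1 t) (at t)"
  shows "partial [i] (tensor m \<nu> \<tau> \<rho> g k) =
     (\<lambda>x. (\<nu> $ i / \<rho>) * tensor m \<nu> \<tau> \<rho> g1 k x + (\<tau> $ i / \<rho>) * tensor m \<nu> \<tau> \<rho> g k1 x)"
  by (rule ext, subst has_derivative_partial[OF tensor_has_derivative[OF assms]])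
    (simp add: inner_axis)

lemma partial2_tensor:
  assumes "profile B g g1 g2" "profile B' k k1 k2"
  shows "partial [i, j] (tensor m \<nu> \<tau> \<rho> g k) =
     (\<lambda>x. (\<nu> $ i * \<nu> $ j * tensor m \<nu> \<tau> \<rho> g2 k x + (\<nu> $ i * \<tau> $ j + \<tau> $ i * \<nu> $ j) * tensor m \<nu> \<tau> \<rho> g1 k1 x
        + \<tau> $ i * \<tau> $ j * tensor m \<nu> \<tau> \<rho> g k2 x) / \<rho>\<^sup>2)"
proof -
  have d: "\<And>t. (g has_real_derivative g1 t) (at t)" "\<And>t. (g1 has_real_derivative g2 t) (at t)"
    "\<And>t. (k has_real_derivative k1 t) (at t)" "\<And>t. (k1 has_real_derivative k2 t) (at t)"
    using assms by (auto simp: profile_def)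
  have diff: "tensor m \<nu> \<tau> \<rho> g1 k differentiable (at x)" "tensor m \<nu> \<tau> \<rho> g k1 differentiable (at x)" for x
    using tensor_has_derivative[OF d(2,3), of m \<nu> \<tau> \<rho> x] tensor_has_derivative[OF d(1,4), of m \<nu> \<tau> \<rho> x]
    unfolding differentiable_def by blast+
  have "partial [i, j] (tensor m \<nu> \<tau> \<rho> g k) = partial [i] (partial [j] (tensor m \<nu> \<tau> \<rho> g k))"
    by simp
  also have "\<dots> = (\<lambda>x. (\<nu> $ j / \<rho>) * partial [i] (tensor m \<nu> \<tau> \<rho> g1 k) x
      + (\<tau> $ j / \<rho>) * partial [i] (tensor m \<nu> \<tau> \<rho> g k1) x)"
    unfolding partial_tensor[OF d(1,3), of j] using diff by (intro ext partial_lincomb)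
  also have "\<dots> = (\<lambda>x. (\<nu> $ i * \<nu> $ j * tensor m \<nu> \<tau> \<rho> g2 k x + (\<nu> $ i * \<tau> $ j + \<tau> $ i * \<nu> $ j) * tensor m \<nu> \<tau> \<rho> g1 k1 x
        + \<tau> $ i * \<tau> $ j * tensor m \<nu> \<tau> \<rho> g k2 x) / \<rho>\<^sup>2)"
    unfolding partial_tensor[OF d(2,3)] partial_tensor[OF d(1,4)]
    by (auto simp: fun_eq_iff field_simps power2_eq_square add_divide_distrib)
  finally show ?thesis .
qed

lemma smooth_tensor_bump:
  "smooth (tensor m \<nu> \<tau> \<rho> bump bump)" "smooth (tensor m \<nu> \<tau> \<rho> (\<lambda>t. t * bump t) bump)"
proof -
  have fl: "smooth (\<lambda>x. flat 0 (1 + v \<bullet> (x - m) / \<rho>))" "smooth (\<lambda>x. flat 0 (1 - v \<bullet> (x - m) / \<rho>))" for v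
    using smooth_flat[of 0 "1 - v \<bullet> m / \<rho>" "v /\<^sub>R \<rho>"] smooth_flat[of 0 "1 + v \<bullet> m / \<rho>" "- v /\<^sub>R \<rho>"]
    by (simp_all add: inner_diff_right diff_divide_distrib algebra_simps divide_inverse)
  have b: "smooth (\<lambda>x. bump (v \<bullet> (x - m) / \<rho>))" for v
    unfolding bump_def by (intro smooth_mult fl)
  show "smooth (tensor m \<nu> \<tau> \<rho> bump bump)"
    unfolding tensor_def[abs_def] by (intro smooth_mult b)
  have "smooth (\<lambda>x. \<nu> \<bullet> (x - m) / \<rho>)"
    using smooth_affine[of "- \<nu> \<bullet> m / \<rho>" "\<nu> /\<^sub>R \<rho>"]
    by (simp add: inner_diff_right divide_inverse algebra_simps)
  then show "smooth (tensor m \<nu> \<tau> \<rho> (\<lambda>t. t * bump t) bump)"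
    unfolding tensor_def[abs_def] by (intro smooth_mult b)
qed

text \<open>A square matrix with orthonormal columns also has orthonormal rows; the expansion of the
  norm follows from the rows.\<close>

lemma norm_orthonormal_2:
  fixes \<nu> \<tau> :: pt
  assumes "norm \<nu> = 1" "norm \<tau> = 1" "\<nu> \<bullet> \<tau> = 0"
  shows "(norm x)\<^sup>2 = (\<nu> \<bullet> x)\<^sup>2 + (\<tau> \<bullet> x)\<^sup>2" "(cross2 \<nu> \<tau>)\<^sup>2 = 1"
    "\<nu> $ i * \<nu> $ j + \<tau> $ i * \<tau> $ j = (if i = j then 1 else 0)"
proof -
  have n: "\<nu> $ 1 * \<nu> $ 1 + \<nu> $ 2 * \<nu> $ 2 = 1" "\<tau> $ 1 * \<tau> $ 1 + \<tau> $ 2 * \<tau> $ 2 = 1"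
    "\<nu> $ 1 * \<tau> $ 1 + \<nu> $ 2 * \<tau> $ 2 = 0"
    using assms by (simp_all add: norm_eq_1 inner_vec_def sum_2)
  show c: "(cross2 \<nu> \<tau>)\<^sup>2 = 1"
    using n unfolding cross2_def by algebra
  have e: "\<nu> $ 1 * \<nu> $ 1 + \<tau> $ 1 * \<tau> $ 1 = 1" "\<nu> $ 2 * \<nu> $ 2 + \<tau> $ 2 * \<tau> $ 2 = 1"
    "\<nu> $ 1 * \<nu> $ 2 + \<tau> $ 1 * \<tau> $ 2 = 0"
    using n by algebra+
  show "\<nu> $ i * \<nu> $ j + \<tau> $ i * \<tau> $ j = (if i = j then 1 else 0)"
    using e exhaust_2[of i] exhaust_2[of j] by (auto simp: mult.commute)
  have "(norm x)\<^sup>2 = x $ 1 * x $ 1 + x $ 2 * x $ 2"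
    by (simp add: power2_norm_eq_inner inner_vec_def sum_2)
  also have "\<dots> = (\<nu> \<bullet> x)\<^sup>2 + (\<tau> \<bullet> x)\<^sup>2"
    using e by (simp add: inner_vec_def sum_2) algebra
  finally show "(norm x)\<^sup>2 = (\<nu> \<bullet> x)\<^sup>2 + (\<tau> \<bullet> x)\<^sup>2" .
qed

lemma component_le_1: "norm (\<nu> :: pt) = 1 \<Longrightarrow> \<bar>\<nu> $ i\<bar> \<le> 1"
  using component_le_norm_cart[of \<nu> i] by simp

text \<open>The normal, mixed and tangential terms of \<open>partial2_tensor\<close> contribute B^2,
  2 B^2 and B^2, each divided by \<rho>^2.\<close>

lemma partial2_tensor_bound:
  assumes g: "profile B g g1 g2" and k: "profile B k k1 k2" and B: "B \<ge> 1"
    and \<nu>\<tau>: "norm \<nu> = 1" "norm \<tau> = 1" and \<rho>: "\<rho> > 0"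
  shows "\<bar>partial [i, j] (tensor m \<nu> \<tau> \<rho> g k) x\<bar> \<le> 4 * B\<^sup>2 / \<rho>\<^sup>2"
proof -
  have BB: "B \<le> B\<^sup>2" using B by (simp add: power2_eq_square)
  let ?s = "\<nu> \<bullet> (x - m) / \<rho>" and ?t = "\<tau> \<bullet> (x - m) / \<rho>"
  have gb: "\<bar>g ?s\<bar> \<le> 1" "\<bar>g1 ?s\<bar> \<le> B" "\<bar>g2 ?s\<bar> \<le> B" and kb: "\<bar>k ?t\<bar> \<le> 1" "\<bar>k1 ?t\<bar> \<le> B" "\<bar>k2 ?t\<bar> \<le> B"
    using g k by (auto simp: profile_def)
  have t: "\<bar>tensor m \<nu> \<tau> \<rho> g2 k x\<bar> \<le> B\<^sup>2" "\<bar>tensor m \<nu> \<tau> \<rho> g1 k1 x\<bar> \<le> B\<^sup>2" "\<bar>tensor m \<nu> \<tau> \<rho> g k2 x\<bar> \<le> B\<^sup>2"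
    unfolding tensor_def abs_mult power2_eq_square
    using mult_mono[OF gb(3) kb(1)] mult_mono[OF gb(2) kb(2)] mult_mono[OF gb(1) kb(3)] order_trans[OF _ BB] B
    by (auto simp: power2_eq_square)
  have n: "\<bar>\<nu> $ i * \<nu> $ j\<bar> \<le> 1" "\<bar>\<tau> $ i * \<tau> $ j\<bar> \<le> 1" "\<bar>\<nu> $ i * \<tau> $ j + \<tau> $ i * \<nu> $ j\<bar> \<le> 2"
    using mult_le_one[OF component_le_1[OF \<nu>\<tau>(1), of i] _ component_le_1[OF \<nu>\<tau>(1), of j]]
      mult_le_one[OF component_le_1[OF \<nu>\<tau>(2), of i] _ component_le_1[OF \<nu>\<tau>(2), of j]]
      mult_le_one[OF component_le_1[OF \<nu>\<tau>(1), of i] _ component_le_1[OF \<nu>\<tau>(2), of j]]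
      mult_le_one[OF component_le_1[OF \<nu>\<tau>(2), of i] _ component_le_1[OF \<nu>\<tau>(1), of j]]
    by (auto simp: abs_mult intro: order_trans[OF abs_triangle_ineq])
  have "\<bar>\<nu> $ i * \<nu> $ j * tensor m \<nu> \<tau> \<rho> g2 k x\<bar> \<le> 1 * B\<^sup>2"
    "\<bar>(\<nu> $ i * \<tau> $ j + \<tau> $ i * \<nu> $ j) * tensor m \<nu> \<tau> \<rho> g1 k1 x\<bar> \<le> 2 * B\<^sup>2"
    "\<bar>\<tau> $ i * \<tau> $ j * tensor m \<nu> \<tau> \<rho> g k2 x\<bar> \<le> 1 * B\<^sup>2"
    using mult_mono[OF n(1) t(1)] mult_mono[OF n(3) t(2)] mult_mono[OF n(2) t(3)]
    by (simp_all only: abs_mult[of _ "tensor _ _ _ _ _ _ _"])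
  then show ?thesis
    unfolding partial2_tensor[OF g k] using \<rho>
    by (simp add: abs_divide divide_right_mono)
qed

text \<open>The support lies in a square of half side \<rho>, hence in the disc of radius sqrt 2
  \<rho>; 2 \<rho> is a convenient upper bound for it.\<close>

lemma tensor_outside:
  assumes "profile B g g1 g2" "profile B k k1 k2" "\<rho> > 0" "norm \<nu> = 1" "norm \<tau> = 1" "\<nu> \<bullet> \<tau> = 0"
    and "x \<notin> cball m (2 * \<rho>)"
  shows "tensor m \<nu> \<tau> \<rho> g k x = 0"
proof -
  have "\<bar>\<nu> \<bullet> (x - m)\<bar> \<ge> \<rho> \<or> \<bar>\<tau> \<bullet> (x - m)\<bar> \<ge> \<rho>"
  proof (rule ccontr)
    assume "\<not> ?thesis"
    then have "\<bar>\<nu> \<bullet> (x - m)\<bar> \<le> \<rho>" "\<bar>\<tau> \<bullet> (x - m)\<bar> \<le> \<rho>" by auto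
    then have "(\<nu> \<bullet> (x - m))\<^sup>2 \<le> \<rho>\<^sup>2" "(\<tau> \<bullet> (x - m))\<^sup>2 \<le> \<rho>\<^sup>2"
      using assms(3) by (auto simp: abs_le_square_iff[symmetric])
    then have "(norm (x - m))\<^sup>2 \<le> \<rho>\<^sup>2 + \<rho>\<^sup>2"
      unfolding norm_orthonormal_2(1)[OF assms(4-6)] by linarith
    also have "\<dots> \<le> (2 * \<rho>)\<^sup>2" by (simp add: power_mult_distrib)
    finally have "(norm (x - m))\<^sup>2 \<le> (2 * \<rho>)\<^sup>2" .
    then have "norm (x - m) \<le> 2 * \<rho>"
      using assms(3) by (rule_tac power2_le_imp_le) auto
    then show False using assms(7) by (simp add: dist_norm norm_minus_commute)
  qed
  then have "\<bar>\<nu> \<bullet> (x - m) / \<rho>\<bar> \<ge> 1 \<or> \<bar>\<tau> \<bullet> (x - m) / \<rho>\<bar> \<ge> 1"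
    using assms(3) by (simp add: abs_divide)
  then show ?thesis
    using assms(1,2) by (auto simp: profile_def tensor_def)
qed

text \<open>The fundamental theorem of calculus, with boundary values 0 at -1 and 1. Integration
  over the half line leaves the slope at 0 as the only boundary term.\<close>

lemma profile_integrals:
  assumes g: "profile B g g1 g2"
  shows "(LINT s|lborel. g1 s) = 0" "(LINT s|lborel. g2 s) = 0"
    "(LINT s|lborel. indicat_real {..0} s * g2 s) = g1 0"
proof -
  have d: "\<And>t. (g has_real_derivative g1 t) (at t)" "\<And>t. (g1 has_real_derivative g2 t) (at t)"
    and c: "continuous_on UNIV g2" and z: "\<And>t. \<bar>t\<bar> \<ge> 1 \<Longrightarrow> g t = 0 \<and> g1 t = 0 \<and> g2 t = 0"
    using g by (auto simp: profile_def)
  have c1: "isCont g1 t" for t using d(2) DERIV_isCont by blast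
  have c2: "isCont g2 t" for t using c by (simp add: continuous_on_eq_continuous_at)
  have ind: "g1 s = g1 s * indicator {-1..1} s" "g2 s = g2 s * indicator {-1..1} s"
    "indicat_real {..0} s * g2 s = g2 s * indicator {-1..0} s" for s
    using z[of s] by (cases "1 \<le> \<bar>s\<bar>"; auto simp: indicator_def abs_less_iff not_le)+
  have "(LINT s|lborel. g1 s * indicator {-1..1} s) = g 1 - g (-1)"
    by (rule integral_FTC_Icc_real) (use d c1 in auto)
  then show "(LINT s|lborel. g1 s) = 0" using z ind(1) by simp
  have "(LINT s|lborel. g2 s * indicator {-1..1} s) = g1 1 - g1 (-1)"
    by (rule integral_FTC_Icc_real) (use d c2 in auto)
  then show "(LINT s|lborel. g2 s) = 0" using z ind(2) by simp
  have "(LINT s|lborel. g2 s * indicator {-1..0} s) = g1 0 - g1 (-1)"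
    by (rule integral_FTC_Icc_real) (use d c2 in auto)
  then show "(LINT s|lborel. indicat_real {..0} s * g2 s) = g1 0" using z unfolding ind(3) by simp
qed

lemma profile_integrable:
  assumes g: "profile B g g1 g2"
  shows "integrable lborel g" "integrable lborel g1" "integrable lborel g2"
proof -
  have d: "\<And>t. (g has_real_derivative g1 t) (at t)" "\<And>t. (g1 has_real_derivative g2 t) (at t)"
    and c: "continuous_on UNIV g2" and z: "\<And>t. \<bar>t\<bar> \<ge> 1 \<Longrightarrow> g t = 0 \<and> g1 t = 0 \<and> g2 t = 0"
    using g by (auto simp: profile_def)
  have cc: "continuous_on {-1..1} g" "continuous_on {-1..1} g1" "continuous_on {-1..1} g2"
    using d c by (auto intro: DERIV_isCont continuous_at_imp_continuous_on continuous_on_subset)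
  have *: "integrable lborel f" if "continuous_on {-1..1} f" "\<And>t. \<bar>t\<bar> \<ge> 1 \<Longrightarrow> f t = 0" for f :: "real \<Rightarrow> real"
  proof -
    have "integrable lborel (\<lambda>x. indicator {-1..1} x *\<^sub>R f x)"
      by (rule borel_integrable_compact[OF compact_Icc that(1)])
    also have "(\<lambda>x. indicator {-1..1} x *\<^sub>R f x) = f"
    proof
      fix x show "indicator {-1..1} x *\<^sub>R f x = f x"
        using that(2)[of x] by (cases "1 \<le> \<bar>x\<bar>") (auto simp: indicator_def abs_less_iff not_le)
    qed
    finally show ?thesis .
  qed
  show "integrable lborel g" "integrable lborel g1" "integrable lborel g2"
    using * cc z by auto
qed

lemma tensor_frame:
  assumes "norm \<nu> = 1" "norm \<tau> = 1" "\<nu> \<bullet> \<tau> = 0" "\<rho> > 0"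
  shows "tensor m \<nu> \<tau> \<rho> g k (m + s *\<^sub>R (\<rho> *\<^sub>R \<nu>) + t *\<^sub>R (\<rho> *\<^sub>R \<tau>)) = g s * k t"
  using assms by (simp add: tensor_def inner_add_right norm_eq_1 inner_commute)

lemma integral_orthonormal_frame:
  fixes \<nu> \<tau> :: pt and F :: scalar_fn
  assumes "norm \<nu> = 1" "norm \<tau> = 1" "\<nu> \<bullet> \<tau> = 0" "\<rho> > 0" "integrable lborel F"
  shows "(LINT x|lborel. F x) = \<rho>\<^sup>2 * (LINT s|lborel. LINT t|lborel. F (m + s *\<^sub>R (\<rho> *\<^sub>R \<nu>) + t *\<^sub>R (\<rho> *\<^sub>R \<tau>)))"
proof -
  have "cross2 (\<rho> *\<^sub>R \<nu>) (\<rho> *\<^sub>R \<tau>) = \<rho>\<^sup>2 * cross2 \<nu> \<tau>"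
    by (simp add: cross2_def algebra_simps power2_eq_square)
  moreover have "\<bar>cross2 \<nu> \<tau>\<bar> = 1"
    using norm_orthonormal_2(2)[OF assms(1-3)] by (auto simp: power2_eq_1_iff)
  ultimately have c: "\<bar>cross2 (\<rho> *\<^sub>R \<nu>) (\<rho> *\<^sub>R \<tau>)\<bar> = \<rho>\<^sup>2" by (simp add: abs_mult)
  then have "cross2 (\<rho> *\<^sub>R \<nu>) (\<rho> *\<^sub>R \<tau>) \<noteq> 0" using assms(4) by auto
  from integral_affine_frame(1)[OF this assms(5), of m] show ?thesis by (simp only: c)
qed

lemma test_function_integrable_lborel:
  assumes "\<phi> \<in> test_functions D"
  shows "integrable lborel \<phi>"
proof -
  obtain C where C: "smooth \<phi>" "compact C" "C \<subseteq> D" "\<And>x js. x \<notin> C \<Longrightarrow> partial js \<phi> x = 0"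
    using test_functionE[OF assms] by metis
  have "integrable lborel (\<lambda>x. indicator C x *\<^sub>R \<phi> x)"
    by (rule borel_integrable_compact[OF C(2) smooth_continuous_on[OF C(1)]])
  also have "(\<lambda>x. indicator C x *\<^sub>R \<phi> x) = \<phi>"
    using C(4)[of _ "[]"] by (auto simp: indicator_def fun_eq_iff)
  finally show ?thesis .
qed

lemma integral_tensor:
  assumes "norm \<nu> = 1" "norm \<tau> = 1" "\<nu> \<bullet> \<tau> = 0" "\<rho> > 0"
    and t: "tensor m \<nu> \<tau> \<rho> g k \<in> test_functions D"
  shows "(LINT x|lebesgue. tensor m \<nu> \<tau> \<rho> g k x) = \<rho>\<^sup>2 * ((LINT s|lborel. g s) * (LINT t|lborel. k t))"
proof -
  have i: "integrable lborel (tensor m \<nu> \<tau> \<rho> g k)" by (rule test_function_integrable_lborel[OF t])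
  have "(LINT x|lebesgue. tensor m \<nu> \<tau> \<rho> g k x) = (LINT x|lborel. tensor m \<nu> \<tau> \<rho> g k x)"
    using i by (intro integral_completion) auto
  also have "\<dots> = \<rho>\<^sup>2 * (LINT s|lborel. LINT t|lborel. g s * k t)"
    by (subst integral_orthonormal_frame[OF assms(1-4) i, of m]) (simp only: tensor_frame[OF assms(1-4)])
  finally show ?thesis by simp
qed

text \<open>The terms with \<open>k1\<close> and \<open>k2\<close> integrate to 0 along the edge,
  which leaves the rank-one matrix of \<nu> with itself; across the edge the half line integral of
  \<open>g2\<close> is \<open>g1 0\<close>. The Jacobian \<rho>^2 cancels the scaling of second
  derivatives, so the value does not depend on \<rho>.\<close>

lemma half_plane_integral_partial2_tensor:
  assumes \<nu>\<tau>: "norm \<nu> = 1" "norm \<tau> = 1" "\<nu> \<bullet> \<tau> = 0" and \<rho>: "\<rho> > 0"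
    and g: "profile B g g1 g2" and k: "profile B k k1 k2"
    and t: "tensor m \<nu> \<tau> \<rho> g k \<in> test_functions D"
  shows "(LINT x|lebesgue. indicat_real {x. \<nu> \<bullet> (x - m) \<le> 0} x * partial [i, j] (tensor m \<nu> \<tau> \<rho> g k) x)
    = g1 0 * (LINT t|lborel. k t) * \<nu> $ i * \<nu> $ j"
proof -
  define F where "F x = indicat_real {x. \<nu> \<bullet> (x - m) \<le> 0} x * partial [i, j] (tensor m \<nu> \<tau> \<rho> g k) x" for x
  have "{x. \<nu> \<bullet> (x - m) \<le> 0} \<in> sets borel"
    by (intro borel_closed closed_Collect_le continuous_intros)
  then have F: "integrable lborel F"
    unfolding F_def using test_function_integrable_lborel[OF test_function_partial[OF t]]
    integrable_mult_indicator[of "{x. \<nu> \<bullet> (x - m) \<le> 0}" lborel "partial [i, j] (tensor m \<nu> \<tau> \<rho> g k)"]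
    by (simp del: partial.simps)
  have pos: "\<nu> \<bullet> (m + s *\<^sub>R (\<rho> *\<^sub>R \<nu>) + t *\<^sub>R (\<rho> *\<^sub>R \<tau>) - m) \<le> 0 \<longleftrightarrow> s \<le> 0" for s t
    using \<nu>\<tau> \<rho> by (simp add: inner_add_right norm_eq_1 mult_le_0_iff)
  have Fst: "F (m + s *\<^sub>R (\<rho> *\<^sub>R \<nu>) + t *\<^sub>R (\<rho> *\<^sub>R \<tau>)) = indicat_real {..0} s *
      ((\<nu> $ i * \<nu> $ j * g2 s) * k t + ((\<nu> $ i * \<tau> $ j + \<tau> $ i * \<nu> $ j) * g1 s) * k1 t + (\<tau> $ i * \<tau> $ j * g s) * k2 t) / \<rho>\<^sup>2" for s t
    unfolding F_def partial2_tensor[OF g k] tensor_frame[OF \<nu>\<tau> \<rho>] indicator_def mem_Collect_eq pos atMost_iff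
    by (simp add: algebra_simps)
  have inner: "(LINT t|lborel. F (m + s *\<^sub>R (\<rho> *\<^sub>R \<nu>) + t *\<^sub>R (\<rho> *\<^sub>R \<tau>)))
      = (\<nu> $ i * \<nu> $ j * (LINT t|lborel. k t) / \<rho>\<^sup>2) * (indicat_real {..0} s * g2 s)" for s
    unfolding Fst using profile_integrable[OF k] profile_integrals[OF k] by simp
  have "(LINT x|lebesgue. F x) = (LINT x|lborel. F x)"
    using F by (intro integral_completion) auto
  also have "\<dots> = \<rho>\<^sup>2 * (LINT s|lborel. (\<nu> $ i * \<nu> $ j * (LINT t|lborel. k t) / \<rho>\<^sup>2) * (indicat_real {..0} s * g2 s))"
    by (subst integral_orthonormal_frame[OF \<nu>\<tau> \<rho> F, of m]) (simp only: inner)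
  also have "\<dots> = g1 0 * (LINT t|lborel. k t) * \<nu> $ i * \<nu> $ j"
    using \<rho> by (simp only: integral_mult_right_zero profile_integrals(3)[OF g]) simp
  finally show ?thesis unfolding F_def .
qed

text \<open>On [-1/2, 1/2] both factors of the bump are at least flat 0 (1/2) = exp (-2).\<close>

lemma bump_integral_pos: "(LINT t|lborel. bump t) > 0"
proof -
  obtain B where B: "profile B bump bump' bump''" using bump_profiles by blast
  have i: "integrable lborel bump" by (rule profile_integrable(1)[OF B])
  have "0 < (LINT t|lborel. indicat_real {-1/2..1/2::real} t * exp (-4))" by simp
  also have "\<dots> \<le> (LINT t|lborel. bump t)"
  proof (rule integral_mono[OF _ i])
    show "integrable lborel (\<lambda>t. indicat_real {-1/2..1/2::real} t * exp (-4))" by simp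
    fix t :: real
    have "exp (-2) * exp (-2) \<le> bump t" if "t \<in> {-1/2..1/2}"
      unfolding bump_def using that flat_0_mono[of "1/2" "1 - t"] flat_0_mono[of "1/2" "1 + t"]
      by (intro mult_mono) (auto simp: flat_def split: if_splits)
    then show "indicat_real {-1/2..1/2} t * exp (-4) \<le> bump t"
      using bump_bounds[of t] by (auto simp: indicator_def simp flip: exp_add)
  qed
  finally show ?thesis .
qed

lemma bump_0_pos: "bump 0 > 0"
  by (simp add: bump_def flat_def)

subsection \<open>Triangles and edges\<close>

lemma cross2_parallel_eq_0:
  assumes "\<nu> \<noteq> 0" "\<nu> \<bullet> a = 0" "\<nu> \<bullet> b = 0"
  shows "cross2 a b = 0"
proof -
  have e: "\<nu> $ 1 * a $ 1 + \<nu> $ 2 * a $ 2 = 0" "\<nu> $ 1 * b $ 1 + \<nu> $ 2 * b $ 2 = 0"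
    using assms by (simp_all add: inner_vec_def sum_2)
  have "\<nu> $ 1 * cross2 a b = 0" "\<nu> $ 2 * cross2 a b = 0"
    using e unfolding cross2_def by algebra+
  moreover have "\<nu> $ 1 \<noteq> 0 \<or> \<nu> $ 2 \<noteq> 0"
    using assms(1) by (auto simp: vec_eq_iff forall_2)
  ultimately show ?thesis by auto
qed

text \<open>Cramer's rule for the coordinates of \<open>x\<close> in the basis \<open>a\<close>,
  \<open>b\<close>.\<close>

lemma cross2_expand:
  assumes "cross2 a b \<noteq> 0"
  shows "x = (cross2 x b / cross2 a b) *\<^sub>R a + (cross2 a x / cross2 a b) *\<^sub>R b"
proof -
  have "cross2 a b *\<^sub>R x = cross2 x b *\<^sub>R a + cross2 a x *\<^sub>R b"
    by (simp add: vec_eq_iff forall_2 cross2_def algebra_simps)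
  then have "x = (1 / cross2 a b) *\<^sub>R (cross2 x b *\<^sub>R a + cross2 a x *\<^sub>R b)"
    using assms by (metis divide_inverse mult_1 scaleR_left_imp_eq scaleR_scaleR real_vector.scale_one right_inverse mult.commute)
  then show ?thesis by (simp add: scaleR_add_right)
qed

lemma parallel_2:
  fixes v w :: pt
  assumes "v $ 1 * w $ 2 = v $ 2 * w $ 1" "v \<noteq> 0"
  shows "\<exists>k. w = k *\<^sub>R v"
proof (cases "v $ 1 = 0")
  case True
  then have "v $ 2 \<noteq> 0" using assms(2) by (auto simp: vec_eq_iff forall_2)
  then have "w = (w $ 2 / v $ 2) *\<^sub>R v"
    using assms(1) True by (auto simp: vec_eq_iff forall_2)
  then show ?thesis by blast
next
  case False
  then have "w = (w $ 1 / v $ 1) *\<^sub>R v"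
    using assms(1) by (auto simp: vec_eq_iff forall_2 field_simps)
  then show ?thesis by blast
qed

lemma cross2_nonzero_if_affine_independent:
  assumes "\<not> affine_dependent {p, q, c}" "p \<noteq> q" "p \<noteq> c" "q \<noteq> c"
  shows "cross2 (q - p) (c - p) \<noteq> 0"
proof
  assume "cross2 (q - p) (c - p) = 0"
  then have eq: "(q - p) $ 1 * (c - p) $ 2 = (q - p) $ 2 * (c - p) $ 1"
    by (simp add: cross2_def)
  have "collinear {0, q - p, c - p}"
    unfolding collinear_lemma using parallel_2[OF eq] assms(2) by auto
  then have "collinear {q, p, c}"
    by (subst collinear_3) (auto simp: NO_MATCH_def)
  then have "collinear {p, q, c}" by (simp add: insert_commute)
  then show False
    using assms collinear_3_eq_affine_dependent by blast
qed

lemma simplex_2E: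
  assumes "2 simplex K"
  obtains p q c where "K = convex hull {p, q, c}" "\<not> affine_dependent {p, q, c}" "p \<noteq> q" "p \<noteq> c" "q \<noteq> c"
proof -
  obtain C where C: "\<not> affine_dependent C" "int (card C) = 2 + 1" "K = convex hull C"
    using assms unfolding simplex_def by blast
  then have "card C = 3" by linarith
  then obtain p q c where "C = {p, q, c}" "p \<noteq> q" "p \<noteq> c" "q \<noteq> c"
    by (auto simp: card_3_iff)
  with C that show ?thesis by auto
qed

text \<open>Faces of a simplex are hulls of sets of its vertices, and affine dimension 1 means two
  of them; \<open>c\<close> is the remaining vertex.\<close>

lemma triangle_edge:
  assumes "2 simplex K" "E edge_of K"
  obtains p q c where "E = closed_segment p q" "K = convex hull {p, q, c}" "cross2 (q - p) (c - p) \<noteq> 0"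
proof -
  obtain C where C: "\<not> affine_dependent C" "int (card C) = 2 + 1" "K = convex hull C"
    using assms unfolding simplex_def by blast
  have finC: "finite C" by (rule aff_independent_finite[OF C(1)])
  obtain S where S: "S \<subseteq> C" "E = convex hull S"
    using assms(2) C face_of_convex_hull_affine_independent[OF C(1)] by (auto simp: edge_of_def)
  have "\<not> affine_dependent S"
    using C(1) S(1) affine_independent_subset by blast
  then have "int (card S) - 1 = aff_dim E"
    unfolding S(2) aff_dim_convex_hull by (simp add: aff_dim_affine_independent)
  then have "int (card S) - 1 = 1" using assms(2) by (simp add: edge_of_def)
  then have "card S = 2" by linarith
  then obtain p q where pq: "S = {p, q}" "p \<noteq> q" by (auto simp: card_2_iff)
  have "card (C - S) = 1"
    using C(2) \<open>card S = 2\<close> S(1) finC by (simp add: card_Diff_subset finite_subset)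
  then obtain c where c: "C - S = {c}" by (auto simp: card_1_singleton_iff)
  then have Ceq: "C = {p, q, c}" "c \<noteq> p" "c \<noteq> q" using S(1) pq by auto
  show ?thesis
  proof
    show "E = closed_segment p q" using S(2) pq by (simp add: segment_convex_hull)
    show "K = convex hull {p, q, c}" using C(3) Ceq by simp
    show "cross2 (q - p) (c - p) \<noteq> 0"
      using cross2_nonzero_if_affine_independent[of p q c] C(1) Ceq pq by auto
  qed
qed

text \<open>Two triangles sharing an edge have to be described with the same endpoints. A segment
  determines its endpoints up to order, and swapping them only changes the sign of
  \<open>cross2\<close>.\<close>

lemma triangle_edge_endpoints:
  assumes "2 simplex K" "closed_segment p q edge_of K"
  obtains c where "K = convex hull {p, q, c}" "cross2 (q - p) (c - p) \<noteq> 0"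
proof -
  obtain p' q' c where *: "closed_segment p q = closed_segment p' q'" "K = convex hull {p', q', c}"
    "cross2 (q' - p') (c - p') \<noteq> 0"
    using triangle_edge[OF assms] by metis
  have "{p, q} = {p', q'}" using *(1) by (simp add: closed_segment_eq)
  then consider "p = p'" "q = q'" | "p = q'" "q = p'" by (auto simp: doubleton_eq_iff)
  then show ?thesis
  proof cases
    case 2
    have "cross2 (q - p) (c - p) = - cross2 (q' - p') (c - p')"
      unfolding 2 by (simp add: cross2_def algebra_simps)
    then show ?thesis using that[of c] *(2,3) 2 by (simp add: insert_commute)
  qed (use that * in auto)
qed

text \<open>The endpoints chosen inside \<open>edge_path\<close> are out of control, so later
  arguments take them as they are and adapt the description of the triangles.\<close>

lemma edge_path_endpoints:
  assumes "E = closed_segment p q"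
  obtains p' q' where "E = closed_segment p' q'" "edge_path E = linepath p' q'"
proof -
  let ?z = "SOME z. E = closed_segment (fst z) (snd z)"
  have "E = closed_segment (fst ?z) (snd ?z)"
    by (rule someI[of "\<lambda>z. E = closed_segment (fst z) (snd z)" "(p, q)"]) (simp add: assms)
  then show ?thesis
    by (rule that) (simp only: edge_path_def Let_def)
qed

text \<open>The quotients are the barycentric coordinates belonging to \<open>q\<close> and
  \<open>c\<close>; that of \<open>p\<close> is the complement of their sum to 1.\<close>

lemma triangle_mem_iff:
  assumes "cross2 (q - p) (c - p) \<noteq> 0"
  shows "x \<in> convex hull {p, q, c} \<longleftrightarrow> 0 \<le> cross2 (x - p) (c - p) / cross2 (q - p) (c - p) \<and>
     0 \<le> cross2 (q - p) (x - p) / cross2 (q - p) (c - p) \<and>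
     cross2 (x - p) (c - p) / cross2 (q - p) (c - p) + cross2 (q - p) (x - p) / cross2 (q - p) (c - p) \<le> 1"
proof
  assume "x \<in> convex hull {p, q, c}"
  then obtain u v where uv: "x = p + u *\<^sub>R (q - p) + v *\<^sub>R (c - p)" "0 \<le> u" "0 \<le> v" "u + v \<le> 1"
    unfolding convex_hull_3_alt by blast
  have "cross2 (x - p) (c - p) = u * cross2 (q - p) (c - p)" "cross2 (q - p) (x - p) = v * cross2 (q - p) (c - p)"
    unfolding uv(1) by (simp_all add: cross2_def algebra_simps)
  then show "0 \<le> cross2 (x - p) (c - p) / cross2 (q - p) (c - p) \<and>
     0 \<le> cross2 (q - p) (x - p) / cross2 (q - p) (c - p) \<and>
     cross2 (x - p) (c - p) / cross2 (q - p) (c - p) + cross2 (q - p) (x - p) / cross2 (q - p) (c - p) \<le> 1"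
    using assms uv by simp
next
  assume *: "0 \<le> cross2 (x - p) (c - p) / cross2 (q - p) (c - p) \<and>
     0 \<le> cross2 (q - p) (x - p) / cross2 (q - p) (c - p) \<and>
     cross2 (x - p) (c - p) / cross2 (q - p) (c - p) + cross2 (q - p) (x - p) / cross2 (q - p) (c - p) \<le> 1"
  have "x = p + (cross2 (x - p) (c - p) / cross2 (q - p) (c - p)) *\<^sub>R (q - p)
      + (cross2 (q - p) (x - p) / cross2 (q - p) (c - p)) *\<^sub>R (c - p)"
    using cross2_expand[OF assms, of "x - p"] by (simp add: algebra_simps)
  then show "x \<in> convex hull {p, q, c}"
    unfolding convex_hull_3_alt using * by blast
qed

text \<open>The gradient of a barycentric coordinate is controlled by the inradius, because the
  coordinate varies by at most one across the inscribed ball.\<close>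

lemma affine_gradient_bound:
  fixes g :: pt
  assumes ball: "cball z r \<subseteq> K" and r: "r > 0"
    and K: "\<And>x. x \<in> K \<Longrightarrow> 0 \<le> a + g \<bullet> x \<and> a + g \<bullet> x \<le> 1"
  shows "2 * r * norm g \<le> 1"
proof (cases "g = 0")
  case False
  let ?u = "(r / norm g) *\<^sub>R g"
  have "norm ?u = r" using False r by simp
  then have "z + ?u \<in> K" "z - ?u \<in> K" using ball by (auto simp: subset_iff dist_norm)
  then have "a + g \<bullet> (z + ?u) \<le> 1" "0 \<le> a + g \<bullet> (z - ?u)" using K by auto
  then have "2 * (g \<bullet> ?u) \<le> 1" by (simp add: inner_add_right inner_diff_right)
  moreover have "g \<bullet> ?u = r * norm g"
    using False by (simp add: dot_square_norm power2_eq_square)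
  ultimately show ?thesis by simp
qed simp

text \<open>With a gradient of norm at most 1 / (2 r), a value 1/2 cannot drop below 0 within
  distance \<open>r\<close>.\<close>

lemma affine_nonneg_near:
  fixes g :: pt
  assumes ball: "cball z r \<subseteq> K" and r: "r > 0"
    and K: "\<And>x. x \<in> K \<Longrightarrow> 0 \<le> a + g \<bullet> x \<and> a + g \<bullet> x \<le> 1"
    and m: "a + g \<bullet> m = 1/2" and x: "norm (x - m) \<le> r"
  shows "0 \<le> a + g \<bullet> x"
proof -
  have "2 * r * norm g \<le> 1" by (rule affine_gradient_bound[OF ball r K])
  moreover have "\<bar>g \<bullet> (x - m)\<bar> \<le> norm g * r"
    using Cauchy_Schwarz_ineq2[of g "x - m"] x mult_left_mono[OF x, of "norm g"] by auto
  ultimately have "- (1/2) \<le> g \<bullet> (x - m)" by (simp only: abs_le_iff mult.commute[of r] mult.assoc mult.left_commute[of 2]) linarith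
  then show ?thesis using m by (simp add: inner_diff_right)
qed

text \<open>At the midpoint of the edge the barycentric coordinates of \<open>p\<close> and
  \<open>q\<close> are 1/2 and survive a move of length \<open>r\<close>. That of \<open>c\<close>
  is 0 there, and its sign is decided by the side of the edge. So half a disc of the size of an
  inscribed ball fits into the triangle at the edge.\<close>

lemma half_disc_in_triangle:
  assumes d: "cross2 (q - p) (c - p) \<noteq> 0"
    and ball: "cball z r \<subseteq> convex hull {p, q, c}" and r: "r > 0"
    and \<nu>: "\<nu> \<bullet> (q - p) = 0" "\<nu> \<bullet> (c - p) < 0"
    and x: "norm (x - midpoint p q) \<le> r" "\<nu> \<bullet> (x - midpoint p q) \<le> 0"
  shows "x \<in> convex hull {p, q, c}"
proof -
  let ?D = "cross2 (q - p) (c - p)" and ?m = "midpoint p q"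
  define lq where "lq y = cross2 (y - p) (c - p) / ?D" for y
  define lc where "lc y = cross2 (q - p) (y - p) / ?D" for y
  define gq where "gq = (vector [(c - p) $ 2, - (c - p) $ 1] :: pt) /\<^sub>R ?D"
  define gc where "gc = (vector [- (q - p) $ 2, (q - p) $ 1] :: pt) /\<^sub>R ?D"
  have lq: "lq y = - (gq \<bullet> p) + gq \<bullet> y" for y
    by (simp add: lq_def gq_def cross2_def inner_vec_def sum_2 divide_inverse algebra_simps)
  have lc: "lc y = - (gc \<bullet> p) + gc \<bullet> y" for y
    by (simp add: lc_def gc_def cross2_def inner_vec_def sum_2 divide_inverse algebra_simps)
  have mem: "y \<in> convex hull {p, q, c} \<longleftrightarrow> 0 \<le> lq y \<and> 0 \<le> lc y \<and> lq y + lc y \<le> 1" for y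
    unfolding triangle_mem_iff[OF d] lq_def lc_def ..
  have mp: "?m - p = (1/2) *\<^sub>R (q - p)" by (simp add: midpoint_def algebra_simps scaleR_2)
       (simp add: vec_eq_iff)
  have lqm: "lq ?m = 1/2" "lc ?m = 0"
    unfolding lq_def lc_def mp using d by (simp_all add: cross2_def field_simps)
  have 1: "0 \<le> lq x"
    unfolding lq
  proof (rule affine_nonneg_near[OF ball r _ _ x(1)])
    show "y \<in> convex hull {p, q, c} \<Longrightarrow> 0 \<le> - (gq \<bullet> p) + gq \<bullet> y \<and> - (gq \<bullet> p) + gq \<bullet> y \<le> 1" for y
      using mem[of y] by (auto simp: lq)
    show "- (gq \<bullet> p) + gq \<bullet> ?m = 1/2" using lqm by (simp only: lq)
  qed
  \<comment> \<open>This affine function is the barycentric coordinate of \<open>p\<close>, that is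
    1 - lq - lc.\<close>
  have "0 \<le> (1 + gq \<bullet> p + gc \<bullet> p) + (- gq - gc) \<bullet> x"
  proof (rule affine_nonneg_near[OF ball r _ _ x(1)])
    show "y \<in> convex hull {p, q, c} \<Longrightarrow> 0 \<le> (1 + gq \<bullet> p + gc \<bullet> p) + (- gq - gc) \<bullet> y \<and>
        (1 + gq \<bullet> p + gc \<bullet> p) + (- gq - gc) \<bullet> y \<le> 1" for y
      using mem[of y] by (auto simp: lq lc inner_diff_left)
    show "(1 + gq \<bullet> p + gc \<bullet> p) + (- gq - gc) \<bullet> ?m = 1/2"
      using lqm unfolding lq lc by (simp add: inner_diff_left)
  qed
  then have 2: "lq x + lc x \<le> 1" by (simp add: lq lc inner_diff_left)
  have "x - p = lq x *\<^sub>R (q - p) + lc x *\<^sub>R (c - p)"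
    using cross2_expand[OF d, of "x - p"] by (simp add: lq_def lc_def)
  then have "\<nu> \<bullet> (x - p) = lc x * (\<nu> \<bullet> (c - p))" using \<nu>(1) by (simp add: inner_add_right)
  moreover have "\<nu> \<bullet> (x - p) = \<nu> \<bullet> (x - ?m) + \<nu> \<bullet> (?m - p)" by (simp add: inner_diff_right)
  moreover have "\<nu> \<bullet> (?m - p) = 0" unfolding mp using \<nu>(1) by simp
  ultimately have "lc x * (\<nu> \<bullet> (c - p)) \<le> 0" using x(2) by simp
  then have "0 \<le> lc x" using \<nu>(2) by (simp add: mult_le_0_iff)
  with 1 2 show ?thesis using mem by blast
qed

text \<open>The barycentric coordinate of \<open>q\<close> rises from 0 to 1 along the edge although
  its gradient is at most 1 / (2 r).\<close>

lemma inradius_le_edge: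
  assumes d: "cross2 (q - p) (c - p) \<noteq> 0"
    and ball: "cball z r \<subseteq> convex hull {p, q, c}" and r: "r > 0"
  shows "2 * r \<le> dist p q"
proof -
  let ?D = "cross2 (q - p) (c - p)"
  define g where "g = (vector [(c - p) $ 2, - (c - p) $ 1] :: pt) /\<^sub>R ?D"
  have g: "cross2 (y - p) (c - p) / ?D = - (g \<bullet> p) + g \<bullet> y" for y
    by (simp add: g_def cross2_def inner_vec_def sum_2 divide_inverse algebra_simps)
  have bound: "2 * r * norm g \<le> 1"
  proof (rule affine_gradient_bound[OF ball r])
    show "0 \<le> - (g \<bullet> p) + g \<bullet> y \<and> - (g \<bullet> p) + g \<bullet> y \<le> 1" if "y \<in> convex hull {p, q, c}" for y
      using that unfolding triangle_mem_iff[OF d] g[symmetric] by linarith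
  qed
  have "1 = g \<bullet> (q - p)" using g[of q] d by (simp add: inner_diff_right)
  also have "\<dots> \<le> norm g * norm (q - p)" by (rule norm_cauchy_schwarz)
  finally have "2 * r * 1 \<le> 2 * r * (norm g * dist p q)"
    using r by (intro mult_left_mono) (auto simp: dist_norm norm_minus_commute)
  also have "\<dots> = (2 * r * norm g) * dist p q" by simp
  also have "\<dots> \<le> 1 * dist p q" by (rule mult_right_mono[OF bound]) simp
  finally show ?thesis by simp
qed

lemma half_disc_in_interior:
  assumes d: "cross2 (q - p) (c - p) \<noteq> 0"
    and ball: "cball z r \<subseteq> convex hull {p, q, c}" and r: "r > 0"
    and \<nu>: "\<nu> \<bullet> (q - p) = 0" "\<nu> \<bullet> (c - p) < 0"
    and x: "norm (x - midpoint p q) < r" "\<nu> \<bullet> (x - midpoint p q) < 0"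
  shows "x \<in> interior (convex hull {p, q, c})"
proof (rule interiorI)
  let ?H = "{x. norm (x - midpoint p q) < r} \<inter> {x. \<nu> \<bullet> (x - midpoint p q) < 0}"
  show "open ?H" by (intro open_Int open_Collect_less continuous_intros)
  show "x \<in> ?H" using x by simp
  show "?H \<subseteq> convex hull {p, q, c}"
    using half_disc_in_triangle[OF d ball r \<nu>] by auto
qed

text \<open>The intersection of two cells is a face of both, and a face that meets the interior is
  the whole cell.\<close>

lemma mesh_interiors_disjoint:
  assumes "triangulation \<T>" "K \<in> \<T>" "K' \<in> \<T>" "interior K \<inter> interior K' \<noteq> {}"
  shows "K = K'"
proof -
  have f: "(K \<inter> K') face_of K" "(K' \<inter> K) face_of K'"
    using assms unfolding triangulation_def by blast+
  have "K \<inter> K' = K"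
    using face_of_disjoint_interior[OF f(1)] assms(4) interior_subset by blast
  moreover have "K' \<inter> K = K'"
    using face_of_disjoint_interior[OF f(2)] assms(4) interior_subset by blast
  ultimately show ?thesis by blast
qed

lemma simplex_compact_convex:
  assumes "2 simplex K"
  shows "compact (K :: pt set)" "convex K" "K \<noteq> {}"
  using simplex_2E[OF assms] by (metis finite.emptyI finite_imp_compact_convex_hull finite_insert,
    metis convex_convex_hull, metis convex_hull_eq_empty insert_not_empty)

lemma null_sets_Diff_interior:
  assumes "convex (K :: pt set)" "closed K"
  shows "K - interior K \<in> null_sets lebesgue"
  using negligible_convex_frontier[OF assms(1)] assms(2)
  by (simp add: frontier_def negligible_iff_null_sets)

lemma triangle_diameter_pos:
  assumes "2 simplex (K :: pt set)"
  shows "diameter K > 0"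
proof -
  obtain p q c where K: "K = convex hull {p, q, c}" "p \<noteq> q"
    using simplex_2E[OF assms] by metis
  have "p \<in> K" "q \<in> K" unfolding K by (auto intro: hull_inc)
  then have "dist p q \<le> diameter K"
    using diameter_bounded_bound simplex_compact_convex(1)[OF assms] compact_imp_bounded by blast
  then show ?thesis using K(2) by (meson dist_pos_lt less_le_trans)
qed

text \<open>The set fits into the square of side twice its diameter, centred at one of its
  points.\<close>

lemma measure_le_diameter_sq:
  assumes "bounded (S :: pt set)" "S \<in> sets lebesgue"
  shows "measure lebesgue S \<le> 4 * (diameter S)\<^sup>2"
proof (cases "S = {}")
  case False
  then obtain x where x: "x \<in> S" by auto
  let ?d = "diameter S"
  have d: "?d \<ge> 0" using assms(1) by (rule diameter_ge_0)
  let ?B = "cbox (\<chi> i. x $ i - ?d) (\<chi> i. x $ i + ?d) :: pt set"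
  have sub: "S \<subseteq> ?B"
  proof
    fix y assume "y \<in> S"
    then have "norm (y - x) \<le> ?d"
      using diameter_bounded_bound[OF assms(1), of y x] x by (simp add: dist_norm)
    then have "\<bar>(y - x) $ i\<bar> \<le> ?d" for i
      using component_le_norm_cart[of "y - x" i] by linarith
    then have "x $ i - ?d \<le> y $ i \<and> y $ i \<le> x $ i + ?d" for i
      by (simp add: abs_le_iff algebra_simps)
    then show "y \<in> ?B" by (simp add: mem_box_cart)
  qed
  then have "measure lebesgue S \<le> measure lebesgue ?B"
    by (intro measure_mono_fmeasurable) (use assms in auto)
  also have "\<dots> = measure lborel ?B" by (rule measure_completion) simp
  also have "\<dots> = (\<Prod>i\<in>UNIV. ((\<chi> i. x $ i + ?d) :: pt) $ i - ((\<chi> i. x $ i - ?d) :: pt) $ i)"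
    using sub x by (intro content_cbox_cart) auto
  also have "\<dots> = 4 * ?d\<^sup>2" by (simp add: UNIV_2 power2_eq_square)
  finally show ?thesis .
qed simp

text \<open>Edges are hulls of subsets of the three vertices, of which there are 8. The crude bound
  suffices to count overlaps independently of the mesh.\<close>

lemma card_edges_of_triangle:
  assumes "2 simplex K"
  shows "finite {E. E edge_of K}" "card {E. E edge_of K} \<le> 8"
proof -
  obtain C where C: "\<not> affine_dependent C" "int (card C) = 2 + 1" "K = convex hull C"
    using assms unfolding simplex_def by blast
  have finC: "finite C" by (rule aff_independent_finite[OF C(1)])
  have sub: "{E. E edge_of K} \<subseteq> (\<lambda>S. convex hull S) ` Pow C"
    using face_of_convex_hull_affine_independent[OF C(1)] C(3) by (auto simp: edge_of_def)
  show "finite {E. E edge_of K}"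
    using finite_subset[OF sub] finC by simp
  have "card {E. E edge_of K} \<le> card ((\<lambda>S. convex hull S) ` Pow C)"
    using sub finC by (intro card_mono) auto
  also have "\<dots> \<le> card (Pow C)" using finC by (intro card_image_le) simp
  also have "\<dots> = 2 ^ 3" using finC C(2) by (simp add: card_Pow)
  finally show "card {E. E edge_of K} \<le> 8" by simp
qed

subsection \<open>Traces on edges\<close>

text \<open>The density of the squared H^1 norm in classical derivatives, so that it is continuous
  for smooth functions.\<close>

definition gradient_energy :: "scalar_fn \<Rightarrow> scalar_fn" where
  "gradient_energy \<phi> x = (\<phi> x)\<^sup>2 + (\<Sum>i\<in>UNIV. (partial [i] \<phi> x)\<^sup>2)"

lemma smooth_line_derivative:
  assumes "smooth \<phi>"
  shows "((\<lambda>t. \<phi> (a + t *\<^sub>R d)) has_real_derivative (\<Sum>i\<in>UNIV. d $ i * partial [i] \<phi> (a + t *\<^sub>R d))) (at t)"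
proof -
  let ?D = "frechet_derivative \<phi> (at (a + t *\<^sub>R d))"
  have f: "(\<phi> has_derivative ?D) (at (a + t *\<^sub>R d))"
    using smooth_differentiable[OF assms] frechet_derivative_works by blast
  have lin: "linear ?D" using smooth_differentiable[OF assms] by (rule linear_frechet_derivative)
  have "((\<lambda>t. a + t *\<^sub>R d) has_derivative (\<lambda>h. h *\<^sub>R d)) (at t)"
    by (auto intro!: derivative_eq_intros)
  from has_derivative_compose[of "\<lambda>t. a + t *\<^sub>R d", OF this f]
  have *: "((\<lambda>t. \<phi> (a + t *\<^sub>R d)) has_derivative (\<lambda>h. ?D (h *\<^sub>R d))) (at t)" .
  have "d = d $ 1 *\<^sub>R axis 1 1 + d $ 2 *\<^sub>R axis 2 1"
    by (simp add: vec_eq_iff forall_2 axis_def)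
  then have "?D d = ?D (d $ 1 *\<^sub>R axis 1 1 + d $ 2 *\<^sub>R axis 2 1)" by simp
  also have "\<dots> = d $ 1 * ?D (axis 1 1) + d $ 2 * ?D (axis 2 1)"
    using lin by (simp add: linear_add linear_cmul)
  finally have "?D (h *\<^sub>R d) = (\<Sum>i\<in>UNIV. d $ i * partial [i] \<phi> (a + t *\<^sub>R d)) * h" for h
    using lin by (simp add: linear_cmul sum_2)
  then show ?thesis
    unfolding has_field_derivative_def using * by (simp del: partial.simps)
qed

text \<open>For each \<open>s\<close> the value on the edge is recovered by integrating the
  derivative of (t - 1/2) \<phi>^2 in the direction \<open>d\<close>, where the weight removes the
  far end t = 1/2. Integration in \<open>s\<close> then sweeps a parallelogram with Jacobian
  \<open>cross2 e d\<close>. Only half an edge is treated, because a parallelogram over the whole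
  edge would leave the triangle.\<close>

lemma half_edge_trace_inequality:
  fixes \<phi> :: scalar_fn
  assumes d: "cross2 e d \<noteq> 0" and K: "compact K"
    and sub: "\<And>s t. s \<in> {s0..s0 + 1/2} \<Longrightarrow> t \<in> {0..1/2} \<Longrightarrow> p + s *\<^sub>R e + t *\<^sub>R d \<in> K"
    and \<phi>: "smooth \<phi>"
  shows "(LINT s|lborel. indicat_real {s0..s0 + 1/2} s * (\<phi> (p + s *\<^sub>R e))\<^sup>2)
    \<le> 4 * (1 + (norm d)\<^sup>2) / \<bar>cross2 e d\<bar> * (LINT x:K|lebesgue. gradient_energy \<phi> x)"
proof -
  let ?G = "gradient_energy \<phi>" and ?S = "{s0..s0 + 1/2}" and ?c = "2 * (1 + (norm d)\<^sup>2)"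
  have contG: "continuous_on A ?G" for A
    unfolding gradient_energy_def[abs_def]
    by (intro continuous_intros smooth_continuous_on \<phi> smooth_partial)
  have G0: "?G x \<ge> 0" for x unfolding gradient_energy_def by (intro add_nonneg_nonneg sum_nonneg) auto
  define Q where "Q = {x. cross2 (x - p) d / cross2 e d \<in> ?S} \<inter> {x. cross2 e (x - p) / cross2 e d \<in> {0..1/2}}"
  have Qclosed: "closed Q"
    unfolding Q_def cross2_def atLeastAtMost_iff
    by (intro closed_Int closed_Collect_conj closed_Collect_le continuous_intros)
      (use d in \<open>simp_all add: cross2_def\<close>)
  have QK: "Q \<subseteq> K"
  proof
    fix x assume "x \<in> Q"
    then have "p + (cross2 (x - p) d / cross2 e d) *\<^sub>R e + (cross2 e (x - p) / cross2 e d) *\<^sub>R d \<in> K"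
      by (intro sub) (auto simp: Q_def)
    then show "x \<in> K" using cross2_expand[OF d, of "x - p"] by (simp add: add.assoc)
  qed
  have coord: "cross2 (p + s *\<^sub>R e + t *\<^sub>R d - p) d = s * cross2 e d" "cross2 e (p + s *\<^sub>R e + t *\<^sub>R d - p) = t * cross2 e d" for s t
    by (simp_all add: cross2_def algebra_simps)
  have Qmem: "p + s *\<^sub>R e + t *\<^sub>R d \<in> Q \<longleftrightarrow> s \<in> ?S \<and> t \<in> {0..1/2}" for s t
    unfolding Q_def Int_iff mem_Collect_eq coord using d by simp
  define F where "F x = indicat_real Q x * ?G x" for x
  have "compact Q" using compact_Int_closed[OF K Qclosed] QK by (simp add: Int_absorb1)
  then have Fint: "integrable lborel F"
    using borel_integrable_compact[of Q ?G] contG by (simp add: F_def[abs_def])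
  have Kint: "integrable lborel (\<lambda>x. indicat_real K x * ?G x)"
    using borel_integrable_compact[OF K contG] by simp
  have point: "indicat_real ?S s * (\<phi> (p + s *\<^sub>R e))\<^sup>2 \<le> (2 * ?c) * (LINT t|lborel. F (p + s *\<^sub>R e + t *\<^sub>R d))" for s
  proof (cases "s \<in> ?S")
    case True
    let ?x = "\<lambda>t. p + s *\<^sub>R e + t *\<^sub>R d"
    let ?dp = "\<lambda>t. \<Sum>i\<in>UNIV. d $ i * partial [i] \<phi> (?x t)"
    let ?U = "\<lambda>t. (t - 1/2) * (\<phi> (?x t))\<^sup>2"
    let ?u = "\<lambda>t. (\<phi> (?x t))\<^sup>2 + (t - 1/2) * (2 * \<phi> (?x t) * ?dp t)"
    have cont: "continuous_on UNIV (\<lambda>t. \<psi> (?x t))" if "smooth \<psi>" for \<psi>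
      by (rule continuous_on_compose2[OF smooth_continuous_on[OF that, of UNIV]]) (auto intro!: continuous_intros)
    have cu: "continuous_on UNIV ?u"
      by (intro continuous_intros cont \<phi> smooth_partial)
    have cG: "continuous_on {0..1/2} (\<lambda>t. ?G (?x t))"
      by (rule continuous_on_compose2[OF contG[of UNIV]]) (auto intro!: continuous_intros)
    have der: "DERIV ?U t :> ?u t" for t
      by (rule DERIV_cong[OF DERIV_mult[OF DERIV_diff[OF DERIV_ident DERIV_const]
            DERIV_power[OF smooth_line_derivative[OF \<phi>]]]]) (simp add: algebra_simps del: partial.simps)
    have "(LINT t|lborel. ?u t * indicator {0..1/2} t) = ?U (1/2) - ?U 0"
    proof (rule integral_FTC_Icc_real)
      show "isCont ?u t" for t using cu unfolding continuous_on_eq_continuous_at[OF open_UNIV] by (rule bspec) simp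
    qed (use der in \<open>auto simp del: partial.simps\<close>)
    \<comment> \<open>At t = 0 the weight is -1/2, whence the factor 2.\<close>
    then have "(\<phi> (p + s *\<^sub>R e))\<^sup>2 = 2 * (LINT t|lborel. indicator {0..1/2} t * ?u t)"
      by (simp add: mult.commute del: partial.simps)
    \<comment> \<open>The mixed term 2 \<phi> times the derivative along \<open>d\<close> is split
      into squares, with |t - 1/2| <= 1 and Cauchy-Schwarz for the directional derivative.\<close>
    also have "\<dots> \<le> 2 * (LINT t|lborel. indicator {0..1/2} t * (?c * ?G (?x t)))"
    proof (rule mult_left_mono, rule integral_mono)
      show "integrable lborel (\<lambda>t. indicator {0..1/2} t * ?u t)"
        using borel_integrable_compact[OF compact_Icc continuous_on_subset[OF cu subset_UNIV], of 0 "1/2"] by simp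
      show "integrable lborel (\<lambda>t. indicator {0..1/2} t * (?c * ?G (?x t)))"
        using borel_integrable_compact[OF compact_Icc continuous_on_mult[OF continuous_on_const[of _ ?c] cG]] by simp
      fix t :: real
      show "indicator {0..1/2} t * ?u t \<le> indicator {0..1/2} t * (?c * ?G (?x t))"
      proof (cases "t \<in> {0..1/2}")
        case True
        let ?f = "\<phi> (?x t)" and ?g = "(\<chi> i. partial [i] \<phi> (?x t)) :: pt"
        have dp: "?dp t = d \<bullet> ?g" by (simp add: inner_vec_def del: partial.simps)
        have gn: "(norm ?g)\<^sup>2 = (\<Sum>i\<in>UNIV. (partial [i] \<phi> (?x t))\<^sup>2)"
          unfolding power2_norm_eq_inner by (simp add: inner_vec_def power2_eq_square del: partial.simps)
        have "(?dp t)\<^sup>2 \<le> (norm d)\<^sup>2 * (norm ?g)\<^sup>2"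
          unfolding dp using Cauchy_Schwarz_ineq[of d ?g] by (simp only: power2_norm_eq_inner)
        moreover have "(t - 1/2) * (2 * ?f * ?dp t) \<le> ?f\<^sup>2 + (?dp t)\<^sup>2"
        proof -
          have "(t - 1/2) * (2 * ?f * ?dp t) \<le> \<bar>t - 1/2\<bar> * \<bar>2 * ?f * ?dp t\<bar>"
            unfolding abs_mult[symmetric, of "t - 1/2"] by (rule abs_ge_self)
          also have "\<dots> \<le> 1 * \<bar>2 * ?f * ?dp t\<bar>"
            using True by (intro mult_right_mono) auto
          also have "\<dots> \<le> ?f\<^sup>2 + (?dp t)\<^sup>2"
            using sum_squares_bound[of "\<bar>?f\<bar>" "\<bar>?dp t\<bar>"] by (simp only: abs_mult power2_abs abs_numeral mult_1_left)
          finally show ?thesis .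
        qed
        ultimately have "?u t \<le> 2 * ?f\<^sup>2 + (norm d)\<^sup>2 * (norm ?g)\<^sup>2" by linarith
        also have "\<dots> \<le> ?c * (?f\<^sup>2 + (norm ?g)\<^sup>2)"
          by (simp add: algebra_simps)
        also have "?f\<^sup>2 + (norm ?g)\<^sup>2 = ?G (?x t)" by (simp only: gradient_energy_def gn)
        finally show ?thesis using True by (simp del: partial.simps)
      qed simp
    qed simp
    also have "\<dots> = (2 * ?c) * (LINT t|lborel. F (?x t))"
    proof -
      have "indicator {0..1/2} t * (?c * ?G (?x t)) = ?c * F (?x t)" for t
        using True Qmem[of s t] by (auto simp: F_def indicator_def)
      then show ?thesis by (simp only: integral_mult_right_zero mult.assoc)
    qed
    finally show ?thesis using True by simp
  next
    case False
    have "(LINT t|lborel. F (p + s *\<^sub>R e + t *\<^sub>R d)) \<ge> 0"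
      by (intro integral_nonneg_AE AE_I2) (simp add: F_def G0)
    then show ?thesis using False by simp
  qed
  have "continuous_on ?S (\<lambda>s. (\<phi> (p + s *\<^sub>R e))\<^sup>2)"
    by (intro continuous_intros continuous_on_compose2[OF smooth_continuous_on[OF \<phi>, of UNIV]]) auto
  from borel_integrable_compact[OF compact_Icc this]
  have "integrable lborel (\<lambda>s. indicat_real ?S s * (\<phi> (p + s *\<^sub>R e))\<^sup>2)" by simp
  then have "(LINT s|lborel. indicat_real ?S s * (\<phi> (p + s *\<^sub>R e))\<^sup>2)
      \<le> (LINT s|lborel. (2 * ?c) * (LINT t|lborel. F (p + s *\<^sub>R e + t *\<^sub>R d)))"
    using integral_affine_frame(2)[OF d Fint, of p] by (intro integral_mono point) auto
  also have "\<dots> = (2 * ?c) * ((LINT x|lborel. F x) / \<bar>cross2 e d\<bar>)"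
    using integral_affine_frame(1)[OF d Fint, of p] d by simp
  also have "(LINT x|lborel. F x) \<le> (LINT x|lborel. indicat_real K x * ?G x)"
    by (rule integral_mono[OF Fint Kint]) (use QK G0 in \<open>auto simp: F_def indicator_def\<close>)
  then have "(2 * ?c) * ((LINT x|lborel. F x) / \<bar>cross2 e d\<bar>) \<le> (2 * ?c) * ((LINT x|lborel. indicat_real K x * ?G x) / \<bar>cross2 e d\<bar>)"
    by (intro mult_left_mono divide_right_mono) auto
  also have "(LINT x|lborel. indicat_real K x * ?G x) = (LINT x:K|lebesgue. ?G x)"
    unfolding set_lebesgue_integral_def using Kint by (subst integral_completion) auto
  finally show ?thesis by simp
qed

lemma set_integral_continuous_lborel:
  fixes f :: "real \<Rightarrow> real"
  assumes "continuous_on {a..b} f"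
  shows "(LINT t:{a..b}|lebesgue. f t) = (LINT t|lborel. indicat_real {a..b} t * f t)"
    "integrable lborel (\<lambda>t. indicat_real {a..b} t * f t)"
proof -
  show i: "integrable lborel (\<lambda>t. indicat_real {a..b} t * f t)"
    using borel_integrable_compact[OF compact_Icc assms] by simp
  show "(LINT t:{a..b}|lebesgue. f t) = (LINT t|lborel. indicat_real {a..b} t * f t)"
    unfolding set_lebesgue_integral_def using i by (subst integral_completion) auto
qed

lemma set_integral_triangle_interior:
  fixes f :: scalar_fn
  assumes "2 simplex K"
  shows "(LINT x:interior K|lebesgue. f x) = (LINT x:K|lebesgue. f x)"
proof -
  have "AE x in lebesgue. x \<notin> K - interior K"
    using simplex_compact_convex[OF assms] by (intro AE_not_in null_sets_Diff_interior compact_imp_closed)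
  then have "AE x in lebesgue. x \<in> UNIV \<longrightarrow> indicat_real (interior K) x * f x = indicat_real K x * f x"
    by eventually_elim (use interior_subset[of K] in \<open>auto simp: indicator_def\<close>)
  from set_integral_lebesgue_cong_AE[OF this] show ?thesis
    by (simp add: set_lebesgue_integral_def)
qed

lemma gradient_energy_integral:
  assumes K: "2 simplex K" and \<phi>: "smooth \<phi>"
  shows "(LINT x:K|lebesgue. gradient_energy \<phi> x) = seminorm_sq 0 (interior K) \<phi> + seminorm_sq 1 (interior K) \<phi>"
proof -
  note K' = simplex_compact_convex[OF K]
  have int: "set_integrable lebesgue K (\<lambda>x. (\<psi> x)\<^sup>2)" if "smooth \<psi>" for \<psi>
    by (intro set_integrable_continuous_compact K' continuous_intros smooth_continuous_on that)
  have eq: "(LINT x:interior K|lebesgue. f x) = (LINT x:K|lebesgue. f x)" for f :: scalar_fn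
    by (rule set_integral_triangle_interior[OF K])
  have 0: "seminorm_sq 0 (interior K) \<phi> = (LINT x:K|lebesgue. (\<phi> x)\<^sup>2)"
    using seminorm_sq_eq[OF open_interior, of 0 K \<phi> "\<lambda>js. partial (rev js) \<phi>"]
      is_weak_deriv_smooth[OF \<phi>, of "interior K" "[]"]
    by (simp add: eq)
  have 1: "seminorm_sq 1 (interior K) \<phi> = (\<Sum>i\<in>UNIV. LINT x:K|lebesgue. (partial [i] \<phi> x)\<^sup>2)"
    using seminorm_sq_eq[OF open_interior, of 1 K \<phi> "\<lambda>js. partial (rev js) \<phi>"] is_weak_deriv_smooth[OF \<phi>]
    by (simp only: sum_lists_1 eq rev.simps append_Nil)
  show ?thesis
    unfolding 0 1 gradient_energy_def sum_2
    using int[OF \<phi>] int[OF smooth_partial[OF \<phi>, of "[1]"]] int[OF smooth_partial[OF \<phi>, of "[2]"]]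
    by (simp del: partial.simps)
qed

text \<open>Near \<open>p\<close> the parallelogram leans along the side to \<open>c\<close>, near
  \<open>q\<close> along the other side. The constant depends on the triangle, which is harmless: it
  only serves existence and uniqueness of traces.\<close>

lemma trace_inequality:
  assumes K: "2 simplex K" and E: "E edge_of K"
  obtains C where "C \<ge> 0" "\<And>\<phi>. smooth \<phi> \<Longrightarrow>
     (LINT t:{0..1}|lebesgue. (\<phi> (edge_path E t))\<^sup>2)
       \<le> C * (seminorm_sq 0 (interior K) \<phi> + seminorm_sq 1 (interior K) \<phi>)"
proof -
  obtain p0 q0 where "E = closed_segment p0 q0" using triangle_edge[OF K E] by metis
  then obtain p q where pq: "E = closed_segment p q" "edge_path E = linepath p q"
    using edge_path_endpoints by metis
  obtain c where c: "K = convex hull {p, q, c}" "cross2 (q - p) (c - p) \<noteq> 0"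
    using triangle_edge_endpoints[OF K E[unfolded pq(1)]] by metis
  let ?e = "q - p" and ?d1 = "c - p" and ?d2 = "c - q"
  have d2: "cross2 ?e ?d2 = cross2 ?e ?d1" by (simp add: cross2_def algebra_simps)
  have in1: "p + s *\<^sub>R ?e + t *\<^sub>R ?d1 \<in> K" if "s \<in> {0..0 + 1/2}" "t \<in> {0..1/2}" for s t
    unfolding c(1) convex_hull_3_alt mem_Collect_eq
    by (intro exI[of _ s] exI[of _ t]) (use that in auto)
  have in2: "p + s *\<^sub>R ?e + t *\<^sub>R ?d2 \<in> K" if "s \<in> {1/2..1/2 + 1/2}" "t \<in> {0..1/2}" for s t
  proof -
    \<comment> \<open>Here \<open>s\<close> is at least 1/2 and \<open>t\<close> at most 1/2, so
      \<open>s - t\<close> is an admissible coordinate.\<close>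
    have "p + s *\<^sub>R ?e + t *\<^sub>R ?d2 = p + (s - t) *\<^sub>R ?e + t *\<^sub>R ?d1" by (simp add: algebra_simps)
    then show ?thesis
      unfolding c(1) convex_hull_3_alt mem_Collect_eq
      by (intro exI[of _ "s - t"] exI[of _ t]) (use that in auto)
  qed
  note Kc = simplex_compact_convex(1)[OF K]
  define C1 where "C1 = 4 * (1 + (norm ?d1)\<^sup>2) / \<bar>cross2 ?e ?d1\<bar>"
  define C2 where "C2 = 4 * (1 + (norm ?d2)\<^sup>2) / \<bar>cross2 ?e ?d2\<bar>"
  show ?thesis
  proof
    show "C1 + C2 \<ge> 0" by (simp add: C1_def C2_def)
    fix \<phi> assume \<phi>: "smooth \<phi>"
    let ?f = "\<lambda>s. (\<phi> (p + s *\<^sub>R ?e))\<^sup>2"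
    have cont: "continuous_on A ?f" for A
      by (intro continuous_intros continuous_on_compose2[OF smooth_continuous_on[OF \<phi>, of UNIV]]) auto
    have ep: "edge_path E t = p + t *\<^sub>R ?e" for t
      unfolding pq(2) linepath_def by (simp add: algebra_simps)
    have "(LINT t:{0..1}|lebesgue. (\<phi> (edge_path E t))\<^sup>2) = (LINT t|lborel. indicat_real {0..1} t * ?f t)"
      unfolding ep by (rule set_integral_continuous_lborel(1)[OF cont])
    also have "\<dots> \<le> (LINT t|lborel. indicat_real {0..0 + 1/2} t * ?f t + indicat_real {1/2..1/2 + 1/2} t * ?f t)"
      by (intro integral_mono set_integral_continuous_lborel(2)[OF cont] Bochner_Integration.integrable_add)
        (auto simp: indicator_def)
    also have "\<dots> = (LINT t|lborel. indicat_real {0..0 + 1/2} t * ?f t) + (LINT t|lborel. indicat_real {1/2..1/2 + 1/2} t * ?f t)"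
      by (rule Bochner_Integration.integral_add[OF set_integral_continuous_lborel(2)[OF cont] set_integral_continuous_lborel(2)[OF cont]])
    also have "\<dots> \<le> C1 * (LINT x:K|lebesgue. gradient_energy \<phi> x) + C2 * (LINT x:K|lebesgue. gradient_energy \<phi> x)"
      unfolding C1_def C2_def
      by (intro add_mono half_edge_trace_inequality \<phi> Kc in1 in2) (use c d2 in auto)
    finally show "(LINT t:{0..1}|lebesgue. (\<phi> (edge_path E t))\<^sup>2)
       \<le> (C1 + C2) * (seminorm_sq 0 (interior K) \<phi> + seminorm_sq 1 (interior K) \<phi>)"
      by (simp only: gradient_energy_integral[OF K \<phi>] distrib_right)
  qed
qed

section \<open>Completeness of the square integrable functions\<close>

lemma nn_integral_Fatou_square:
  fixes h :: "nat \<Rightarrow> 'a \<Rightarrow> real"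
  assumes h: "\<And>k. h k \<in> borel_measurable M" "\<And>k x. h k x \<ge> 0" and g: "g \<in> borel_measurable M"
    and lim: "AE x in M. (\<lambda>k. h k x) \<longlonglongrightarrow> g x"
    and bound: "\<And>k. k \<ge> N \<Longrightarrow> integrable M (h k) \<and> (LINT x|M. h k x) \<le> e"
  shows "integrable M g" "(LINT x|M. g x) \<le> e"
proof -
  have g0: "AE x in M. g x \<ge> 0"
    using lim by eventually_elim (rule LIMSEQ_le_const, auto simp: h)
  have e0: "e \<ge> 0"
  proof -
    have "0 \<le> (LINT x|M. h N x)" by (intro integral_nonneg_AE AE_I2 h(2))
    then show ?thesis using bound[of N] by simp
  qed
  have "(\<integral>\<^sup>+x. ennreal (g x) \<partial>M) = (\<integral>\<^sup>+x. liminf (\<lambda>k. ennreal (h k x)) \<partial>M)"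
  proof (rule nn_integral_cong_AE, use lim in eventually_elim)
    fix x assume "(\<lambda>k. h k x) \<longlonglongrightarrow> g x"
    then have "(\<lambda>k. ennreal (h k x)) \<longlonglongrightarrow> ennreal (g x)" by (rule tendsto_ennrealI)
    then show "ennreal (g x) = liminf (\<lambda>k. ennreal (h k x))"
      by (simp add: lim_imp_Liminf)
  qed
  also have "\<dots> \<le> liminf (\<lambda>k. \<integral>\<^sup>+x. ennreal (h k x) \<partial>M)"
    using h by (intro nn_integral_liminf) auto
  also have "\<dots> \<le> ennreal e"
  proof (rule Liminf_le)
    have "(\<integral>\<^sup>+x. ennreal (h k x) \<partial>M) \<le> ennreal e" if "k \<ge> N" for k
      using bound[OF that] h(2) by (subst nn_integral_eq_integral) (auto intro: ennreal_leI)
    then show "\<forall>\<^sub>F k in sequentially. (\<integral>\<^sup>+x. ennreal (h k x) \<partial>M) \<le> ennreal e"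
      unfolding eventually_sequentially by blast
  qed simp
  finally have le: "(\<integral>\<^sup>+x. ennreal (g x) \<partial>M) \<le> ennreal e" .
  then show int: "integrable M g"
    using g g0 by (intro integrableI_nonneg) (auto intro: le_less_trans)
  have "ennreal (LINT x|M. g x) \<le> ennreal e"
    using le nn_integral_eq_integral[OF int g0] by simp
  then show "(LINT x|M. g x) \<le> e" using e0 by (simp add: ennreal_le_iff)
qed

text \<open>On a set of finite measure the sequence is Cauchy in L^1, so a subsequence converges
  almost everywhere, and Fatou's lemma turns this into mean square convergence of the whole
  sequence. The limit is spelled out as a pointwise \<open>lim\<close>, so that on an edge it is the
  pullback of a function of the point and not merely of the parameter.\<close>

lemma sq_integrable_complete:
  fixes s :: "nat \<Rightarrow> 'a \<Rightarrow> real"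
  assumes A: "A \<in> sets M" "emeasure M A < \<infinity>" and s: "\<And>n. sq_integrable M A (s n)"
    and Cauchy: "\<And>e. e > 0 \<Longrightarrow> \<exists>N. \<forall>i\<ge>N. \<forall>j\<ge>N. (LINT x:A|M. (s i x - s j x)\<^sup>2) < e"
  obtains r where "sq_integrable M A (\<lambda>x. lim (\<lambda>k. s (r k) x))"
    "(\<lambda>n. LINT x:A|M. (s n x - lim (\<lambda>k. s (r k) x))\<^sup>2) \<longlonglongrightarrow> 0"
proof -
  define f where "f n x = indicat_real A x * s n x" for n x
  have fm: "f n \<in> borel_measurable M" and f2: "integrable M (\<lambda>x. (f n x)\<^sup>2)" for n
    using s[of n] unfolding sq_integrable_alt f_def by auto
  have one: "sq_integrable M A (\<lambda>x. 1)"
    using A by (intro sq_integrable_bounded[of M A _ 1]) (auto simp: set_borel_measurable_def)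
  have si: "set_integrable M A (s n)" for n
    using sq_integrable_mult[OF s one] by simp
  have fi: "integrable M (f n)" for n
    using si[of n] by (simp add: set_integrable_def f_def[abs_def])
  have sqd: "sq_integrable M A (\<lambda>x. s i x - s j x)" for i j by (rule sq_integrable_diff[OF s s])
  define \<mu> where "\<mu> = (LINT x:A|M. (1::real)\<^sup>2)"
  have \<mu>: "\<mu> \<ge> 0" unfolding \<mu>_def by (rule set_integral_square_nonneg)
  have L1: "(LINT x|M. norm (f i x - f j x)) \<le> sqrt (LINT x:A|M. (s i x - s j x)\<^sup>2) * sqrt \<mu>" for i j
  proof -
    have "(LINT x|M. norm (f i x - f j x)) = (LINT x:A|M. \<bar>s i x - s j x\<bar> * 1)"
      unfolding set_lebesgue_integral_def f_def
      by (rule arg_cong[of _ _ "integral\<^sup>L M"]) (auto simp: indicator_def fun_eq_iff)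
    also have "\<dots> \<le> sqrt (LINT x:A|M. \<bar>s i x - s j x\<bar>\<^sup>2) * sqrt \<mu>"
      unfolding \<mu>_def using set_integral_Cauchy_Schwarz[OF sq_integrable_abs[OF sqd] one, of i j] by linarith
    finally show ?thesis by simp
  qed
  have L1C: "\<exists>N. \<forall>i\<ge>N. \<forall>j\<ge>N. (LINT x|M. norm (f i x - f j x)) < e" if "e > 0" for e
  proof -
    have \<mu>1: "sqrt \<mu> + 1 > 0" using \<mu> by (simp add: add_nonneg_pos)
    then have "(e / (sqrt \<mu> + 1))\<^sup>2 > 0" using that by simp
    then obtain N where N: "\<And>i j. i \<ge> N \<Longrightarrow> j \<ge> N \<Longrightarrow> (LINT x:A|M. (s i x - s j x)\<^sup>2) < (e / (sqrt \<mu> + 1))\<^sup>2"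
      using Cauchy by meson
    have "(LINT x|M. norm (f i x - f j x)) < e" if ij: "i \<ge> N" "j \<ge> N" for i j
    proof -
      have "sqrt (LINT x:A|M. (s i x - s j x)\<^sup>2) < e / (sqrt \<mu> + 1)"
        using N[OF ij] \<open>e > 0\<close> \<mu>1 by (intro real_less_lsqrt) (auto simp: set_integral_square_nonneg)
      then have "sqrt (LINT x:A|M. (s i x - s j x)\<^sup>2) * sqrt \<mu> \<le> e / (sqrt \<mu> + 1) * sqrt \<mu>"
        using \<mu> by (intro mult_right_mono) auto
      also have "\<dots> < e" using \<open>e > 0\<close> \<mu>1 by (simp add: field_simps)
      finally show ?thesis using L1[of i j] by linarith
    qed
    then show ?thesis by blast
  qed
  obtain r where r: "strict_mono r" "AE x in M. Cauchy (\<lambda>i. f (r i) x)"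
    using cauchy_L1_AE_cauchy_subseq[OF fi L1C] by blast
  define g where "g x = lim (\<lambda>k. s (r k) x)" for x
  define G where "G x = lim (\<lambda>k. f (r k) x)" for x
  have gG: "indicat_real A x * g x = G x" for x
    by (cases "x \<in> A") (simp_all add: g_def G_def f_def)
  have Gm: "G \<in> borel_measurable M"
    unfolding G_def[abs_def] using fm by (intro borel_measurable_lim_metric)
  have lim: "AE x in M. (\<lambda>k. f (r k) x) \<longlonglongrightarrow> G x"
    using r(2) by eventually_elim (simp add: G_def Cauchy_convergent_iff convergent_LIMSEQ_iff)
  have dist: "(LINT x:A|M. (s n x - g x)\<^sup>2) = (LINT x|M. (f n x - G x)\<^sup>2)" for n
    unfolding set_lebesgue_integral_def gG[symmetric] f_def
    by (rule arg_cong[of _ _ "integral\<^sup>L M"]) (auto simp: indicator_def fun_eq_iff)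
  have ss: "(LINT x|M. (f n x - f (r k) x)\<^sup>2) = (LINT x:A|M. (s n x - s (r k) x)\<^sup>2)" for n k
    unfolding set_lebesgue_integral_def f_def
    by (rule arg_cong[of _ _ "integral\<^sup>L M"]) (auto simp: indicator_def fun_eq_iff)
  have ffi: "integrable M (\<lambda>x. (f n x - f (r k) x)\<^sup>2)" for n k
  proof -
    have "indicator A x * (s n x - s (r k) x) = f n x - f (r k) x" for x
      by (simp add: f_def right_diff_distrib)
    then show ?thesis using sqd[of n "r k"] by (simp only: sq_integrable_alt)
  qed
  have main: "integrable M (\<lambda>x. (f n x - G x)\<^sup>2) \<and> (LINT x|M. (f n x - G x)\<^sup>2) \<le> e"
    if N: "\<And>i j. i \<ge> N \<Longrightarrow> j \<ge> N \<Longrightarrow> (LINT x:A|M. (s i x - s j x)\<^sup>2) < e" "n \<ge> N" for n N e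
  proof -
    have l: "AE x in M. (\<lambda>k. (f n x - f (r k) x)\<^sup>2) \<longlonglongrightarrow> (f n x - G x)\<^sup>2"
      using lim by eventually_elim (intro tendsto_intros)
    have b: "integrable M (\<lambda>x. (f n x - f (r k) x)\<^sup>2) \<and> (LINT x|M. (f n x - f (r k) x)\<^sup>2) \<le> e" if "k \<ge> N" for k
    proof -
      have "r k \<ge> N" using that seq_suble[OF r(1), of k] by linarith
      from N(1)[OF N(2) this] show ?thesis using ffi by (simp add: ss)
    qed
    show ?thesis
      using nn_integral_Fatou_square[of "\<lambda>k x. (f n x - f (r k) x)\<^sup>2" M "\<lambda>x. (f n x - G x)\<^sup>2" N e] fm Gm l b
      by auto
  qed
  have conv: "(\<lambda>n. LINT x:A|M. (s n x - g x)\<^sup>2) \<longlonglongrightarrow> 0"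
  proof (rule LIMSEQ_I)
    fix e :: real assume "e > 0"
    then obtain N where N: "\<And>i j. i \<ge> N \<Longrightarrow> j \<ge> N \<Longrightarrow> (LINT x:A|M. (s i x - s j x)\<^sup>2) < e / 2"
      using Cauchy[of "e / 2"] by auto
    have "norm ((LINT x:A|M. (s n x - g x)\<^sup>2) - 0) < e" if "n \<ge> N" for n
      using main[OF N that] \<open>e > 0\<close> set_integral_square_nonneg[of M A "\<lambda>x. s n x - g x"] by (simp add: dist)
    then show "\<exists>N. \<forall>n\<ge>N. norm ((LINT x:A|M. (s n x - g x)\<^sup>2) - 0) < e" by blast
  qed
  have "sq_integrable M A g"
  proof -
    obtain N where N: "\<And>i j. i \<ge> N \<Longrightarrow> j \<ge> N \<Longrightarrow> (LINT x:A|M. (s i x - s j x)\<^sup>2) < 1"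
      using Cauchy[of 1] by auto
    have eq: "indicator A x * (s N x - g x) = f N x - G x" for x
      by (simp add: f_def gG[symmetric] right_diff_distrib)
    have "sq_integrable M A (\<lambda>x. s N x - g x)"
      unfolding sq_integrable_alt eq using main[OF N order_refl] fm Gm by auto
    from sq_integrable_diff[OF s[of N] this] show ?thesis by simp
  qed
  with conv that show ?thesis unfolding g_def by blast
qed

section \<open>Squared norms of linear combinations\<close>

lemma sq_integrable_set_integrable: "sq_integrable M A f \<Longrightarrow> set_integrable M A (\<lambda>x. (f x)\<^sup>2)"
  by (simp add: sq_integrable_def)

lemma set_integral_lincomb_square_le:
  assumes "sq_integrable M A f" "sq_integrable M A g"
  shows "(LINT x:A|M. (a * f x + b * g x)\<^sup>2) \<le> 2 * a\<^sup>2 * (LINT x:A|M. (f x)\<^sup>2) + 2 * b\<^sup>2 * (LINT x:A|M. (g x)\<^sup>2)"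
proof -
  have "(LINT x:A|M. (a * f x + b * g x)\<^sup>2) \<le> (LINT x:A|M. 2 * a\<^sup>2 * (f x)\<^sup>2 + 2 * b\<^sup>2 * (g x)\<^sup>2)"
  proof (rule set_integral_mono)
    show "set_integrable M A (\<lambda>x. (a * f x + b * g x)\<^sup>2)"
      using sq_integrable_lincomb[OF assms] by (rule sq_integrable_set_integrable)
    show "set_integrable M A (\<lambda>x. 2 * a\<^sup>2 * (f x)\<^sup>2 + 2 * b\<^sup>2 * (g x)\<^sup>2)"
      using sq_integrable_set_integrable[OF assms(1)] sq_integrable_set_integrable[OF assms(2)]
      by (intro set_integral_add(1) set_integrable_mult_right) simp_all
    show "(a * f x + b * g x)\<^sup>2 \<le> 2 * a\<^sup>2 * (f x)\<^sup>2 + 2 * b\<^sup>2 * (g x)\<^sup>2" for x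
      using sum_squares_bound[of "a * f x" "b * g x"] by (simp add: power2_sum power_mult_distrib)
  qed
  also have "\<dots> = 2 * a\<^sup>2 * (LINT x:A|M. (f x)\<^sup>2) + 2 * b\<^sup>2 * (LINT x:A|M. (g x)\<^sup>2)"
    using sq_integrable_set_integrable[OF assms(1)] sq_integrable_set_integrable[OF assms(2)]
    by (subst set_integral_add(2)) simp_all
  finally show ?thesis .
qed

lemma seminorm_sq_lincomb_le:
  assumes "open D" "f \<in> Hs (real k) D" "g \<in> Hs (real k) D" "m \<le> k"
  shows "seminorm_sq m D (\<lambda>x. a * f x + b * g x) \<le> 2 * a\<^sup>2 * seminorm_sq m D f + 2 * b\<^sup>2 * seminorm_sq m D g"
proof -
  have "seminorm_sq m D (\<lambda>x. a * f x + b * g x)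
      = (\<Sum>js | length js = m. LINT x:D|lebesgue. (a * weak_deriv D js f x + b * weak_deriv D js g x)\<^sup>2)"
    by (rule seminorm_sq_eq[OF assms(1)], intro is_weak_deriv_lincomb Hs_weak_deriv(2)[OF assms(1,2)]
        Hs_weak_deriv(2)[OF assms(1,3)]) (use assms(4) in auto)
  also have "\<dots> \<le> (\<Sum>js | length js = m. 2 * a\<^sup>2 * (LINT x:D|lebesgue. (weak_deriv D js f x)\<^sup>2)
      + 2 * b\<^sup>2 * (LINT x:D|lebesgue. (weak_deriv D js g x)\<^sup>2))"
    using Hs_weak_deriv(1)[OF assms(1,2)] Hs_weak_deriv(1)[OF assms(1,3)] assms(4)
    by (intro sum_mono set_integral_lincomb_square_le) (auto simp: L2_iff)
  also have "\<dots> = 2 * a\<^sup>2 * seminorm_sq m D f + 2 * b\<^sup>2 * seminorm_sq m D g"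
    by (simp add: seminorm_sq_def sum.distrib sum_distrib_left)
  finally show ?thesis .
qed

lemma Hs_lincomb:
  assumes "f \<in> Hs (real k) D" "g \<in> Hs (real k) D"
  shows "(\<lambda>x. a * f x + b * g x) \<in> Hs (real k) D"
  unfolding Hs_nat_iff
proof safe
  fix js :: "2 list" assume js: "length js \<le> k"
  obtain f' where f': "sq_integrable lebesgue D f'" "is_weak_deriv D js f f'"
    using assms(1) js by (auto simp: Hs_nat_iff L2_iff)
  obtain g' where g': "sq_integrable lebesgue D g'" "is_weak_deriv D js g g'"
    using assms(2) js by (auto simp: Hs_nat_iff L2_iff)
  show "\<exists>h\<in>L2 D. is_weak_deriv D js (\<lambda>x. a * f x + b * g x) h"
    by (rule bexI[where P = "is_weak_deriv D js (\<lambda>x. a * f x + b * g x)", OF is_weak_deriv_lincomb[OF f'(2) g'(2)]])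
      (use sq_integrable_lincomb[OF f'(1) g'(1)] in \<open>simp add: L2_iff\<close>)
qed

text \<open>Lets Sobolev convergence be handled seminorm by seminorm and without square
  roots.\<close>

lemma Hs_norm_tendsto_0_iff:
  "(\<lambda>n. Hs_norm (real k) D (f n)) \<longlonglongrightarrow> 0 \<longleftrightarrow> (\<forall>m\<le>k. (\<lambda>n. seminorm_sq m D (f n)) \<longlonglongrightarrow> 0)"
proof
  assume "(\<lambda>n. Hs_norm (real k) D (f n)) \<longlonglongrightarrow> 0"
  then have "(\<lambda>n. (Hs_norm (real k) D (f n))\<^sup>2) \<longlonglongrightarrow> 0\<^sup>2" by (rule tendsto_power)
  then have *: "(\<lambda>n. \<Sum>m\<le>k. seminorm_sq m D (f n)) \<longlonglongrightarrow> 0" by (simp add: Hs_norm_sq)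
  show "\<forall>m\<le>k. (\<lambda>n. seminorm_sq m D (f n)) \<longlonglongrightarrow> 0"
  proof safe
    fix m assume "m \<le> k"
    then have "seminorm_sq m D (f n) \<le> (\<Sum>m\<le>k. seminorm_sq m D (f n))" for n
      by (intro member_le_sum) (auto simp: seminorm_sq_nonneg)
    then show "(\<lambda>n. seminorm_sq m D (f n)) \<longlonglongrightarrow> 0"
      by (intro tendsto_sandwich[OF _ _ tendsto_const *] always_eventually allI seminorm_sq_nonneg)
  qed
next
  assume "\<forall>m\<le>k. (\<lambda>n. seminorm_sq m D (f n)) \<longlonglongrightarrow> 0"
  then have "(\<lambda>n. \<Sum>m\<le>k. seminorm_sq m D (f n)) \<longlonglongrightarrow> (\<Sum>m\<le>k. 0)"
    by (intro tendsto_sum) auto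
  from tendsto_real_sqrt[OF this] show "(\<lambda>n. Hs_norm (real k) D (f n)) \<longlonglongrightarrow> 0"
    by (simp add: Hs_norm_nat)
qed

section \<open>Traces: uniqueness, linearity and existence\<close>

lemma edge_L2_iff: "g \<in> edge_L2 E \<longleftrightarrow> sq_integrable lebesgue {0..1} (\<lambda>t. g (edge_path E t))"
  by (simp add: edge_L2_def sq_integrable_def)

lemma edge_endpoints:
  assumes "2 simplex K" "E edge_of K"
  obtains p q c where "E = closed_segment p q" "edge_path E = linepath p q" "K = convex hull {p, q, c}"
    "cross2 (q - p) (c - p) \<noteq> 0" "p \<noteq> q" "diameter E = dist p q"
proof -
  obtain p0 q0 where "E = closed_segment p0 q0" using triangle_edge[OF assms] by metis
  then obtain p q where pq: "E = closed_segment p q" "edge_path E = linepath p q"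
    using edge_path_endpoints by metis
  obtain c where c: "K = convex hull {p, q, c}" "cross2 (q - p) (c - p) \<noteq> 0"
    using triangle_edge_endpoints[OF assms(1) assms(2)[unfolded pq(1)]] by metis
  have ne: "p \<noteq> q" using c(2) by (auto simp: cross2_def)
  have "diameter E = dist p q"
  proof (rule antisym)
    show "dist p q \<le> diameter E"
      unfolding pq(1) by (intro diameter_bounded_bound bounded_closed_segment) auto
    show "diameter E \<le> dist p q"
    proof (rule diameter_le)
      fix x y assume "x \<in> E" "y \<in> E"
      then obtain u v where uv: "0 \<le> u" "u \<le> 1" "0 \<le> v" "v \<le> 1" "x = (1 - u) *\<^sub>R p + u *\<^sub>R q" "y = (1 - v) *\<^sub>R p + v *\<^sub>R q"
        unfolding pq(1) in_segment by blast
      have "x - y = (v - u) *\<^sub>R (p - q)" unfolding uv by (simp add: algebra_simps)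
      then have "norm (x - y) = \<bar>v - u\<bar> * dist p q" by (simp add: dist_norm)
      also have "\<dots> \<le> 1 * dist p q" by (rule mult_right_mono) (use uv in auto)
      finally show "norm (x - y) \<le> dist p q" by simp
    qed simp
  qed
  then show ?thesis using that pq c ne by blast
qed

lemma smooth_on_edge_sq_integrable:
  assumes "2 simplex K" "E edge_of K" "smooth \<phi>"
  shows "\<phi> \<in> edge_L2 E"
proof -
  obtain p q where pq: "edge_path E = linepath p q" using edge_endpoints[OF assms(1,2)] by metis
  have "continuous_on UNIV (\<lambda>t. \<phi> (linepath p q t))"
    by (rule continuous_on_compose2[OF smooth_continuous_on[OF assms(3), of UNIV] continuous_on_linepath]) auto
  then show ?thesis
    unfolding edge_L2_iff pq by (intro sq_integrable_continuous) auto
qed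

lemma triangle_interior_bounded:
 assumes "2 simplex (K :: pt set)"
  shows "bounded (interior K)" "interior K \<in> sets lebesgue"
  using bounded_subset[OF compact_imp_bounded[OF simplex_compact_convex(1)[OF assms]] interior_subset] by auto

text \<open>Two approximating sequences of \<open>w\<close> differ by a null sequence in H^1 of the
  triangle, which the trace inequality carries over to the edge. Only this makes the choice in
  \<open>edge_trace\<close> computable.\<close>

lemma is_trace_AE_unique:
  assumes K: "2 simplex K" and E: "E edge_of K" and tr: "is_trace K E w g" "is_trace K E w g'"
  shows "AE t in lebesgue. t \<in> {0..1} \<longrightarrow> g (edge_path E t) = g' (edge_path E t)"
proof -
  let ?D = "interior K" and ?I = "{0..1::real}"
  obtain C where C: "C \<ge> 0" "\<And>\<phi>. smooth \<phi> \<Longrightarrow> (LINT t:?I|lebesgue. (\<phi> (edge_path E t))\<^sup>2)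
       \<le> C * (seminorm_sq 0 ?D \<phi> + seminorm_sq 1 ?D \<phi>)"
    using trace_inequality[OF K E] by blast
  have dE: "diameter E > 0" using edge_endpoints[OF K E] by (metis dist_pos_lt)
  have ext: "\<exists>\<phi>. (\<forall>n. smooth (\<phi> n)) \<and> (\<forall>m\<le>1. (\<lambda>n. seminorm_sq m ?D (sub_fn (\<phi> n) w)) \<longlonglongrightarrow> 0) \<and>
      (\<lambda>n. LINT t:?I|lebesgue. (\<phi> n (edge_path E t) - h (edge_path E t))\<^sup>2) \<longlonglongrightarrow> 0"
    if tr: "is_trace K E w h" for h
  proof -
    obtain \<phi> where \<phi>: "\<And>n. smooth (\<phi> n)" "(\<lambda>n. Hs_norm (real 1) ?D (sub_fn (\<phi> n) w)) \<longlonglongrightarrow> 0"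
      "(\<lambda>n. edge_int E (\<lambda>x. (\<phi> n x - h x)\<^sup>2)) \<longlonglongrightarrow> 0"
      using tr by (auto simp: is_trace_def)
    have "(\<lambda>n. edge_int E (\<lambda>x. (\<phi> n x - h x)\<^sup>2) / diameter E) \<longlonglongrightarrow> 0 / diameter E"
      by (intro tendsto_divide \<phi>(3)) (use dE in auto)
    then have "(\<lambda>n. LINT t:?I|lebesgue. (\<phi> n (edge_path E t) - h (edge_path E t))\<^sup>2) \<longlonglongrightarrow> 0"
      using dE by (simp add: edge_int_def)
    with \<phi> show ?thesis unfolding Hs_norm_tendsto_0_iff by blast
  qed
  obtain \<phi> where \<phi>: "\<And>n. smooth (\<phi> n)" "\<And>m. m \<le> 1 \<Longrightarrow> (\<lambda>n. seminorm_sq m ?D (sub_fn (\<phi> n) w)) \<longlonglongrightarrow> 0"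
    "(\<lambda>n. LINT t:?I|lebesgue. (\<phi> n (edge_path E t) - g (edge_path E t))\<^sup>2) \<longlonglongrightarrow> 0"
    using ext[OF tr(1)] by auto
  obtain \<psi> where \<psi>: "\<And>n. smooth (\<psi> n)" "\<And>m. m \<le> 1 \<Longrightarrow> (\<lambda>n. seminorm_sq m ?D (sub_fn (\<psi> n) w)) \<longlonglongrightarrow> 0"
    "(\<lambda>n. LINT t:?I|lebesgue. (\<psi> n (edge_path E t) - g' (edge_path E t))\<^sup>2) \<longlonglongrightarrow> 0"
    using ext[OF tr(2)] by auto
  have D: "bounded ?D" "?D \<in> sets lebesgue"
    by (rule triangle_interior_bounded[OF K])+
  have w: "w \<in> Hs (real 1) ?D" using tr(1) by (simp add: is_trace_def)
  have sm: "sub_fn \<phi>' w \<in> Hs (real 1) ?D" if "smooth \<phi>'" for \<phi>'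
    by (intro Hs_diff w smooth_Hs D that)
  have gL: "sq_integrable lebesgue ?I (\<lambda>t. g (edge_path E t))" "sq_integrable lebesgue ?I (\<lambda>t. g' (edge_path E t))"
    using tr by (auto simp: is_trace_def edge_L2_iff)
  have sL: "sq_integrable lebesgue ?I (\<lambda>t. \<phi>' (edge_path E t))" if "smooth \<phi>'" for \<phi>'
    using smooth_on_edge_sq_integrable[OF K E that] by (simp add: edge_L2_iff)
  let ?S = "\<lambda>\<phi>. seminorm_sq 0 ?D \<phi> + seminorm_sq 1 ?D \<phi>"
  let ?a = "\<lambda>n. LINT t:?I|lebesgue. (\<phi> n (edge_path E t) - g (edge_path E t))\<^sup>2"
  let ?b = "\<lambda>n. LINT t:?I|lebesgue. (\<psi> n (edge_path E t) - g' (edge_path E t))\<^sup>2"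
  have le: "(LINT t:?I|lebesgue. (g (edge_path E t) - g' (edge_path E t))\<^sup>2)
      \<le> 4 * ?a n + 4 * ?b n + 2 * (C * (2 * ?S (sub_fn (\<phi> n) w) + 2 * ?S (sub_fn (\<psi> n) w)))" for n
  proof -
    let ?\<chi> = "\<lambda>x. \<phi> n x - \<psi> n x"
    have s: "smooth ?\<chi>" by (intro smooth_diff \<phi> \<psi>)
    \<comment> \<open>The difference g - g' is routed through \<phi> n and \<psi> n; each splitting
      of a square costs a factor 2.\<close>
    have "(LINT t:?I|lebesgue. (g (edge_path E t) - g' (edge_path E t))\<^sup>2)
      = (LINT t:?I|lebesgue. (1 * ((-1) * (\<phi> n (edge_path E t) - g (edge_path E t)) + 1 * (\<psi> n (edge_path E t) - g' (edge_path E t)))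
          + 1 * ?\<chi> (edge_path E t))\<^sup>2)"
      by simp
    also have "\<dots> \<le> 2 * 1\<^sup>2 * (LINT t:?I|lebesgue. ((-1) * (\<phi> n (edge_path E t) - g (edge_path E t)) + 1 * (\<psi> n (edge_path E t) - g' (edge_path E t)))\<^sup>2)
        + 2 * 1\<^sup>2 * (LINT t:?I|lebesgue. (?\<chi> (edge_path E t))\<^sup>2)"
      by (intro set_integral_lincomb_square_le sq_integrable_lincomb sq_integrable_diff gL sL \<phi> \<psi> s)
    also have "(LINT t:?I|lebesgue. ((-1) * (\<phi> n (edge_path E t) - g (edge_path E t)) + 1 * (\<psi> n (edge_path E t) - g' (edge_path E t)))\<^sup>2)
        \<le> 2 * (-1)\<^sup>2 * ?a n + 2 * 1\<^sup>2 * ?b n"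
      by (intro set_integral_lincomb_square_le sq_integrable_diff gL sL \<phi> \<psi>)
    also have "(LINT t:?I|lebesgue. (?\<chi> (edge_path E t))\<^sup>2) \<le> C * ?S ?\<chi>"
      by (rule C(2)[OF s])
    also have "?S ?\<chi> \<le> 2 * ?S (sub_fn (\<phi> n) w) + 2 * ?S (sub_fn (\<psi> n) w)"
    proof -
      have eq: "?\<chi> = (\<lambda>x. 1 * sub_fn (\<phi> n) w x + (-1) * sub_fn (\<psi> n) w x)" by (simp add: sub_fn_def)
      have "seminorm_sq m ?D ?\<chi> \<le> 2 * 1\<^sup>2 * seminorm_sq m ?D (sub_fn (\<phi> n) w) + 2 * (-1)\<^sup>2 * seminorm_sq m ?D (sub_fn (\<psi> n) w)"
        if "m \<le> 1" for m
        unfolding eq by (intro seminorm_sq_lincomb_le[OF open_interior sm[OF \<phi>(1)] sm[OF \<psi>(1)] that])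
      from this[of 0] this[of 1] show ?thesis by simp
    qed
    finally show ?thesis using C(1) by (simp add: mult_left_mono)
  qed
  have "(\<lambda>n. 4 * ?a n + 4 * ?b n + 2 * (C * (2 * ?S (sub_fn (\<phi> n) w) + 2 * ?S (sub_fn (\<psi> n) w))))
      \<longlonglongrightarrow> 4 * 0 + 4 * 0 + 2 * (C * (2 * (0 + 0) + 2 * (0 + 0)))"
    by (intro tendsto_intros \<phi> \<psi>) auto
  from LIMSEQ_le_const[OF this, of "LINT t:?I|lebesgue. (g (edge_path E t) - g' (edge_path E t))\<^sup>2"]
  have "(LINT t:?I|lebesgue. (g (edge_path E t) - g' (edge_path E t))\<^sup>2) \<le> 0"
    using le by simp
  then have "(LINT t:?I|lebesgue. (g (edge_path E t) - g' (edge_path E t))\<^sup>2) = 0"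
    by (rule antisym) (rule set_integral_square_nonneg)
  note z = this[unfolded set_lebesgue_integral_def real_scaleR_def]
  have "integrable lebesgue (\<lambda>t. indicat_real ?I t * (g (edge_path E t) - g' (edge_path E t))\<^sup>2)"
    using sq_integrable_set_integrable[OF sq_integrable_diff[OF gL]] by (simp add: set_integrable_def)
  from integral_nonneg_eq_0_iff_AE[OF this] z
  have "AE t in lebesgue. indicat_real ?I t * (g (edge_path E t) - g' (edge_path E t))\<^sup>2 = 0" by auto
  then show ?thesis by eventually_elim (auto simp: indicator_def split: if_splits)
qed

lemma edge_trace_AE:
  assumes "2 simplex K" "E edge_of K" "is_trace K E w g"
  shows "AE t in lebesgue. t \<in> {0..1} \<longrightarrow> edge_trace K E w (edge_path E t) = g (edge_path E t)"
proof -
  have "is_trace K E w (edge_trace K E w)"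
    unfolding edge_trace_def by (rule someI[of "is_trace K E w", OF assms(3)])
  from is_trace_AE_unique[OF assms(1,2) this assms(3)] show ?thesis .
qed

lemma is_trace_lincomb:
  assumes K: "2 simplex K" and E: "E edge_of K" and tr: "is_trace K E w g" "is_trace K E w' g'"
  shows "is_trace K E (\<lambda>x. a * w x + b * w' x) (\<lambda>x. a * g x + b * g' x)"
proof -
  let ?D = "interior K"
  obtain \<phi> where \<phi>: "\<And>n. smooth (\<phi> n)" "(\<lambda>n. Hs_norm (real 1) ?D (sub_fn (\<phi> n) w)) \<longlonglongrightarrow> 0"
    "(\<lambda>n. edge_int E (\<lambda>x. (\<phi> n x - g x)\<^sup>2)) \<longlonglongrightarrow> 0"
    using tr(1) by (auto simp: is_trace_def)
  obtain \<psi> where \<psi>: "\<And>n. smooth (\<psi> n)" "(\<lambda>n. Hs_norm (real 1) ?D (sub_fn (\<psi> n) w')) \<longlonglongrightarrow> 0"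
    "(\<lambda>n. edge_int E (\<lambda>x. (\<psi> n x - g' x)\<^sup>2)) \<longlonglongrightarrow> 0"
    using tr(2) by (auto simp: is_trace_def)
  have D: "bounded ?D" "?D \<in> sets lebesgue"
    by (rule triangle_interior_bounded[OF K])+
  have w: "w \<in> Hs (real 1) ?D" "w' \<in> Hs (real 1) ?D" using tr by (simp_all add: is_trace_def)
  have gL: "g \<in> edge_L2 E" "g' \<in> edge_L2 E" using tr by (auto simp: is_trace_def)
  let ?\<chi> = "\<lambda>n x. a * \<phi> n x + b * \<psi> n x"
  have H: "(\<lambda>n. Hs_norm (real 1) ?D (sub_fn (?\<chi> n) (\<lambda>x. a * w x + b * w' x))) \<longlonglongrightarrow> 0"
    unfolding Hs_norm_tendsto_0_iff
  proof safe
    fix m :: nat assume m: "m \<le> 1"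
    have eq: "sub_fn (?\<chi> n) (\<lambda>x. a * w x + b * w' x) = (\<lambda>x. a * sub_fn (\<phi> n) w x + b * sub_fn (\<psi> n) w' x)" for n
      by (simp add: sub_fn_def algebra_simps)
    have le: "seminorm_sq m ?D (sub_fn (?\<chi> n) (\<lambda>x. a * w x + b * w' x))
        \<le> 2 * a\<^sup>2 * seminorm_sq m ?D (sub_fn (\<phi> n) w) + 2 * b\<^sup>2 * seminorm_sq m ?D (sub_fn (\<psi> n) w')" for n
      unfolding eq by (intro seminorm_sq_lincomb_le[OF open_interior _ _ m] Hs_diff w smooth_Hs D \<phi> \<psi>)
    have "(\<lambda>n. 2 * a\<^sup>2 * seminorm_sq m ?D (sub_fn (\<phi> n) w) + 2 * b\<^sup>2 * seminorm_sq m ?D (sub_fn (\<psi> n) w'))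
        \<longlonglongrightarrow> 2 * a\<^sup>2 * 0 + 2 * b\<^sup>2 * 0"
      using \<phi>(2) \<psi>(2) m unfolding Hs_norm_tendsto_0_iff by (intro tendsto_intros) auto
    then have lim: "(\<lambda>n. 2 * a\<^sup>2 * seminorm_sq m ?D (sub_fn (\<phi> n) w) + 2 * b\<^sup>2 * seminorm_sq m ?D (sub_fn (\<psi> n) w'))
        \<longlonglongrightarrow> 0" by simp
    show "(\<lambda>n. seminorm_sq m ?D (sub_fn (?\<chi> n) (\<lambda>x. a * w x + b * w' x))) \<longlonglongrightarrow> 0"
      by (rule tendsto_sandwich[OF _ _ tendsto_const lim]) (intro always_eventually allI le seminorm_sq_nonneg)+
  qed
  have L: "(\<lambda>n. edge_int E (\<lambda>x. (?\<chi> n x - (a * g x + b * g' x))\<^sup>2)) \<longlonglongrightarrow> 0"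
  proof -
    have dE: "diameter E \<ge> 0" using edge_endpoints[OF K E] by (metis zero_le_dist)
    have le: "edge_int E (\<lambda>x. (?\<chi> n x - (a * g x + b * g' x))\<^sup>2)
        \<le> 2 * a\<^sup>2 * edge_int E (\<lambda>x. (\<phi> n x - g x)\<^sup>2) + 2 * b\<^sup>2 * edge_int E (\<lambda>x. (\<psi> n x - g' x)\<^sup>2)" for n
    proof -
      have "(LINT t:{0..1}|lebesgue. (?\<chi> n (edge_path E t) - (a * g (edge_path E t) + b * g' (edge_path E t)))\<^sup>2)
        = (LINT t:{0..1}|lebesgue. (a * (\<phi> n (edge_path E t) - g (edge_path E t)) + b * (\<psi> n (edge_path E t) - g' (edge_path E t)))\<^sup>2)"
        by (simp add: algebra_simps)
      also have "\<dots> \<le> 2 * a\<^sup>2 * (LINT t:{0..1}|lebesgue. (\<phi> n (edge_path E t) - g (edge_path E t))\<^sup>2)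
          + 2 * b\<^sup>2 * (LINT t:{0..1}|lebesgue. (\<psi> n (edge_path E t) - g' (edge_path E t))\<^sup>2)"
        using smooth_on_edge_sq_integrable[OF K E \<phi>(1)] smooth_on_edge_sq_integrable[OF K E \<psi>(1)] gL
        unfolding edge_L2_iff by (intro set_integral_lincomb_square_le sq_integrable_diff) auto
      finally have "(LINT t:{0..1}|lebesgue. (?\<chi> n (edge_path E t) - (a * g (edge_path E t) + b * g' (edge_path E t)))\<^sup>2)
          \<le> 2 * a\<^sup>2 * (LINT t:{0..1}|lebesgue. (\<phi> n (edge_path E t) - g (edge_path E t))\<^sup>2)
          + 2 * b\<^sup>2 * (LINT t:{0..1}|lebesgue. (\<psi> n (edge_path E t) - g' (edge_path E t))\<^sup>2)" .
      from mult_left_mono[OF this dE] show ?thesis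
        unfolding edge_int_def by (simp only: distrib_left mult.left_commute[of "diameter E"] mult.assoc)
    qed
    have "(\<lambda>n. 2 * a\<^sup>2 * edge_int E (\<lambda>x. (\<phi> n x - g x)\<^sup>2) + 2 * b\<^sup>2 * edge_int E (\<lambda>x. (\<psi> n x - g' x)\<^sup>2))
        \<longlonglongrightarrow> 2 * a\<^sup>2 * 0 + 2 * b\<^sup>2 * 0"
      by (intro tendsto_intros \<phi>(3) \<psi>(3))
    then have lim: "(\<lambda>n. 2 * a\<^sup>2 * edge_int E (\<lambda>x. (\<phi> n x - g x)\<^sup>2) + 2 * b\<^sup>2 * edge_int E (\<lambda>x. (\<psi> n x - g' x)\<^sup>2))
        \<longlonglongrightarrow> 0" by simp
    show ?thesis
    proof (rule tendsto_sandwich[OF _ _ tendsto_const lim])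
      show "\<forall>\<^sub>F n in sequentially. 0 \<le> edge_int E (\<lambda>x. (?\<chi> n x - (a * g x + b * g' x))\<^sup>2)"
        unfolding edge_int_def by (intro always_eventually allI mult_nonneg_nonneg set_integral_square_nonneg dE)
    qed (intro always_eventually allI le)
  qed
  show ?thesis
    unfolding is_trace_def
  proof (intro conjI exI[of _ ?\<chi>] allI)
    show "(\<lambda>x. a * w x + b * w' x) \<in> Hs 1 ?D" using Hs_lincomb[OF w] by simp
    show "(\<lambda>x. a * g x + b * g' x) \<in> edge_L2 E"
      using sq_integrable_lincomb gL by (simp add: edge_L2_iff)
    show "smooth (?\<chi> n)" for n by (rule smooth_lincomb[OF \<phi>(1) \<psi>(1)])
    show "(\<lambda>n. Hs_norm 1 ?D (sub_fn (?\<chi> n) (\<lambda>x. a * w x + b * w' x))) \<longlonglongrightarrow> 0"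
      using H by simp
  qed (rule L)
qed

text \<open>Piecewise derivatives are known only almost everywhere; this allows their traces to be
  taken from smooth representatives.\<close>

lemma is_trace_cong_AE:
  assumes K: "2 simplex K" and tr: "is_trace K E w g" and eq: "AE x in lebesgue. x \<in> interior K \<longrightarrow> w x = w' x"
  shows "is_trace K E w' g"
proof -
  let ?D = "interior K"
  have D: "bounded ?D" "?D \<in> sets lebesgue"
    by (rule triangle_interior_bounded[OF K])+
  have w: "w \<in> Hs (real 1) ?D" using tr by (simp add: is_trace_def)
  have "Hs_norm 1 ?D (sub_fn \<phi> w') = Hs_norm 1 ?D (sub_fn \<phi> w)" if "smooth \<phi>" for \<phi>
  proof -
    have "AE x in lebesgue. x \<in> ?D \<longrightarrow> sub_fn \<phi> w x = sub_fn \<phi> w' x"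
      using eq by eventually_elim (auto simp: sub_fn_def)
    then have "seminorm_sq m ?D (sub_fn \<phi> w') = seminorm_sq m ?D (sub_fn \<phi> w)" if "m \<le> 1" for m
      using that \<open>smooth \<phi>\<close> by (intro seminorm_sq_cong_AE[OF open_interior, of _ 1] Hs_diff smooth_Hs D w)
    then have "Hs_norm (real 1) ?D (sub_fn \<phi> w') = Hs_norm (real 1) ?D (sub_fn \<phi> w)"
      unfolding Hs_norm_nat by simp
    then show ?thesis by simp
  qed
  moreover obtain \<phi> where "\<And>n. smooth (\<phi> n)" "(\<lambda>n. Hs_norm 1 ?D (sub_fn (\<phi> n) w)) \<longlonglongrightarrow> 0"
    "(\<lambda>n. edge_int E (\<lambda>x. (\<phi> n x - g x)\<^sup>2)) \<longlonglongrightarrow> 0" "g \<in> edge_L2 E"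
    using tr by (auto simp: is_trace_def)
  ultimately show ?thesis
    unfolding is_trace_def using Hs_cong_AE[OF w eq] by (intro conjI exI[of _ \<phi>]) auto
qed

lemma is_trace_smooth:
  assumes K: "2 simplex K" and E: "E edge_of K" and \<phi>: "smooth \<phi>"
  shows "is_trace K E \<phi> \<phi>"
  unfolding is_trace_def
proof (intro conjI exI[of _ "\<lambda>n. \<phi>"] allI \<phi>)
  let ?D = "interior K"
  have D: "bounded ?D" "?D \<in> sets lebesgue"
    by (rule triangle_interior_bounded[OF K])+
  show "\<phi> \<in> Hs 1 ?D" using smooth_Hs[OF D \<phi>, of 1] by simp
  show "\<phi> \<in> edge_L2 E" by (rule smooth_on_edge_sq_integrable[OF K E \<phi>])
  have "seminorm_sq m ?D (\<lambda>x. 0 * \<phi> x + 0 * \<phi> x) \<le> 0" for m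
    using seminorm_sq_lincomb_le[OF open_interior smooth_Hs[OF D \<phi>, of m] smooth_Hs[OF D \<phi>, of m] order_refl, of 0 0] by simp
  then have "seminorm_sq m ?D (sub_fn \<phi> \<phi>) = 0" for m
    using seminorm_sq_nonneg[of m ?D "sub_fn \<phi> \<phi>"] by (simp add: sub_fn_def order_antisym)
  then have "Hs_norm (real 1) ?D (sub_fn \<phi> \<phi>) = 0" unfolding Hs_norm_nat by simp
  then show "(\<lambda>n. Hs_norm 1 ?D (sub_fn \<phi> \<phi>)) \<longlonglongrightarrow> 0" by simp
  show "(\<lambda>n. edge_int E (\<lambda>x. (\<phi> x - \<phi> x)\<^sup>2)) \<longlonglongrightarrow> 0" by (simp add: edge_int_def)
qed

text \<open>By the trace inequality the restrictions to the edge form a Cauchy sequence. Their limit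
  belongs to the sequence \<phi> and not to the triangle, which later makes the traces from both
  sides coincide.\<close>

lemma edge_limit:
  assumes K: "2 simplex K" and E: "E edge_of K" and w: "w \<in> Hs (real 1) (interior K)"
    and \<phi>: "\<And>n. smooth (\<phi> n)" "(\<lambda>n. Hs_norm (real 1) (interior K) (sub_fn (\<phi> n) w)) \<longlonglongrightarrow> 0"
  obtains g where "g \<in> edge_L2 E" "(\<lambda>n. edge_int E (\<lambda>x. (\<phi> n x - g x)\<^sup>2)) \<longlonglongrightarrow> 0"
proof -
  let ?D = "interior K" and ?I = "{0..1::real}"
  obtain C where C: "C \<ge> 0" "\<And>\<phi>. smooth \<phi> \<Longrightarrow> (LINT t:?I|lebesgue. (\<phi> (edge_path E t))\<^sup>2)
       \<le> C * (seminorm_sq 0 ?D \<phi> + seminorm_sq 1 ?D \<phi>)"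
    using trace_inequality[OF K E] by blast
  have D: "bounded ?D" "?D \<in> sets lebesgue"
    by (rule triangle_interior_bounded[OF K])+
  have sm: "sub_fn (\<phi> n) w \<in> Hs (real 1) ?D" for n
    by (intro Hs_diff w smooth_Hs D \<phi>)
  define S where "S n = seminorm_sq 0 ?D (sub_fn (\<phi> n) w) + seminorm_sq 1 ?D (sub_fn (\<phi> n) w)" for n
  have "(\<lambda>n. 2 * C * S n) \<longlonglongrightarrow> 2 * C * (0 + 0)"
    unfolding S_def using \<phi>(2) unfolding Hs_norm_tendsto_0_iff by (intro tendsto_intros) auto
  then have S: "(\<lambda>n. 2 * C * S n) \<longlonglongrightarrow> 0" by simp
  have le: "(LINT t:?I|lebesgue. (\<phi> i (edge_path E t) - \<phi> j (edge_path E t))\<^sup>2) \<le> 2 * C * S i + 2 * C * S j" for i j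
  proof -
    let ?\<chi> = "\<lambda>x. \<phi> i x - \<phi> j x"
    have s: "smooth ?\<chi>" by (intro smooth_diff \<phi>)
    have eq: "?\<chi> = (\<lambda>x. 1 * sub_fn (\<phi> i) w x + (-1) * sub_fn (\<phi> j) w x)" by (simp add: sub_fn_def)
    have "seminorm_sq m ?D ?\<chi> \<le> 2 * 1\<^sup>2 * seminorm_sq m ?D (sub_fn (\<phi> i) w) + 2 * (-1)\<^sup>2 * seminorm_sq m ?D (sub_fn (\<phi> j) w)"
      if "m \<le> 1" for m
      unfolding eq by (intro seminorm_sq_lincomb_le[OF open_interior sm sm that])
    from this[of 0] this[of 1]
    have "seminorm_sq 0 ?D ?\<chi> + seminorm_sq 1 ?D ?\<chi> \<le> 2 * S i + 2 * S j" by (simp add: S_def)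
    from mult_left_mono[OF this C(1)] C(2)[OF s] show ?thesis by (simp add: algebra_simps)
  qed
  have Cau: "\<exists>N. \<forall>i\<ge>N. \<forall>j\<ge>N. (LINT t:?I|lebesgue. (\<phi> i (edge_path E t) - \<phi> j (edge_path E t))\<^sup>2) < e"
    if e: "e > 0" for e
  proof -
    obtain N where N: "\<And>n. n \<ge> N \<Longrightarrow> norm (2 * C * S n - 0) < e / 2"
      using LIMSEQ_D[OF S, of "e / 2"] e by auto
    have "(LINT t:?I|lebesgue. (\<phi> i (edge_path E t) - \<phi> j (edge_path E t))\<^sup>2) < e" if "i \<ge> N" "j \<ge> N" for i j
      using le[of i j] N[OF that(1)] N[OF that(2)] unfolding real_norm_def by linarith
    then show ?thesis by blast
  qed
  have sq: "sq_integrable lebesgue ?I (\<lambda>t. \<phi> n (edge_path E t))" for n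
    using smooth_on_edge_sq_integrable[OF K E \<phi>(1)] by (simp add: edge_L2_iff)
  obtain r where r: "sq_integrable lebesgue ?I (\<lambda>t. lim (\<lambda>k. \<phi> (r k) (edge_path E t)))"
    "(\<lambda>n. LINT t:?I|lebesgue. (\<phi> n (edge_path E t) - lim (\<lambda>k. \<phi> (r k) (edge_path E t)))\<^sup>2) \<longlonglongrightarrow> 0"
    using sq_integrable_complete[of ?I lebesgue "\<lambda>n t. \<phi> n (edge_path E t)", OF _ _ sq Cau] by auto
  show ?thesis
  proof
    show "(\<lambda>x. lim (\<lambda>k. \<phi> (r k) x)) \<in> edge_L2 E" using r(1) by (simp add: edge_L2_iff)
    show "(\<lambda>n. edge_int E (\<lambda>x. (\<phi> n x - lim (\<lambda>k. \<phi> (r k) x))\<^sup>2)) \<longlonglongrightarrow> 0"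
      unfolding edge_int_def by (rule tendsto_mult_right_zero[OF r(2)])
  qed
qed

subsection \<open>Quadratic polynomials\<close>

text \<open>The division by 2 makes \<open>H\<close> the Hessian once \<open>H\<close> is
  symmetric.\<close>

definition quadratic :: "real \<Rightarrow> pt \<Rightarrow> (2 \<Rightarrow> 2 \<Rightarrow> real) \<Rightarrow> scalar_fn" where
  "quadratic c b H x = c + b \<bullet> x + (\<Sum>i\<in>UNIV. \<Sum>j\<in>UNIV. H i j * x $ i * x $ j) / 2"

lemma polys_2_quadratic:
  assumes "p \<in> polys 2"
  obtains c b H where "p = quadratic c b H" "H 1 2 = H 2 1"
proof -
  obtain a where p: "p = (\<lambda>x. \<Sum>(i,j)\<in>{(i,j). i + j \<le> 2}. a i j * (x $ 1) ^ i * (x $ 2) ^ j)"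
    using assms by (auto simp: polys_def)
  have S: "{(i,j). i + j \<le> (2::nat)} = {(0,0),(0,1),(0,2),(1,0),(1,1),(2,0)}"
    by auto
  define H :: "2 \<Rightarrow> 2 \<Rightarrow> real" where
    "H i j = (if i = 1 then if j = 1 then 2 * a 2 0 else a 1 1 else if j = 1 then a 1 1 else 2 * a 0 2)" for i j
  have "p = quadratic (a 0 0) (vector [a 1 0, a 0 1]) H"
    unfolding p S quadratic_def H_def
    by (auto simp: fun_eq_iff inner_vec_def sum_2 power2_eq_square algebra_simps)
  moreover have "H 1 2 = H 2 1" by (simp add: H_def)
  ultimately show ?thesis using that by blast
qed

lemma quadratic_has_derivative:
  "(quadratic c b H has_derivative (\<lambda>h. b \<bullet> h + (\<Sum>i\<in>UNIV. \<Sum>j\<in>UNIV. H i j * (h $ i * x $ j + x $ i * h $ j)) / 2)) (at x)"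
proof -
  have l: "((\<lambda>x. x $ i) has_derivative (\<lambda>h. h $ i)) (at x)" for i and x :: pt
    by (intro bounded_linear_imp_has_derivative bounded_linear_vec_nth)
  have m: "((\<lambda>x. H i j * x $ i * x $ j) has_derivative (\<lambda>h. H i j * (h $ i * x $ j + x $ i * h $ j))) (at x)" for i j
    by (rule has_derivative_eq_rhs[OF has_derivative_mult[OF has_derivative_mult[OF has_derivative_const l] l]])
      (auto simp: algebra_simps)
  have b: "((\<lambda>x. b \<bullet> x) has_derivative (\<lambda>h. b \<bullet> h)) (at x)"
    by (auto intro!: derivative_eq_intros)
  have "((\<lambda>x. c + b \<bullet> x + (1/2) * (\<Sum>i\<in>UNIV. \<Sum>j\<in>UNIV. H i j * x $ i * x $ j)) has_derivative
      (\<lambda>h. 0 + b \<bullet> h + (1/2) * (\<Sum>i\<in>UNIV. \<Sum>j\<in>UNIV. H i j * (h $ i * x $ j + x $ i * h $ j)))) (at x)"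
    by (intro has_derivative_add has_derivative_const b has_derivative_mult_right has_derivative_sum m)
  then show ?thesis by (simp add: quadratic_def[abs_def])
qed

lemma partial_quadratic:
  assumes "H 1 2 = H 2 1"
  shows "partial [i] (quadratic c b H) = (\<lambda>x. b $ i + (\<Sum>j\<in>UNIV. H i j * x $ j))"
proof
  fix x
  have "partial [i] (quadratic c b H) x = b \<bullet> axis i 1 + (\<Sum>k\<in>UNIV. \<Sum>j\<in>UNIV. H k j * (axis i 1 $ k * x $ j + x $ k * axis i 1 $ j)) / 2"
    by (rule has_derivative_partial[OF quadratic_has_derivative])
  also have "\<dots> = b $ i + (\<Sum>j\<in>UNIV. H i j * x $ j)"
    using exhaust_2[of i] assms by (auto simp: sum_2 axis_def inner_vec_def algebra_simps)
  finally show "partial [i] (quadratic c b H) x = b $ i + (\<Sum>j\<in>UNIV. H i j * x $ j)" .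
qed

lemma partial2_quadratic:
  assumes "H 1 2 = H 2 1"
  shows "partial [i, j] (quadratic c b H) = (\<lambda>x. H i j)"
proof
  fix x :: pt
  have "partial [i, j] (quadratic c b H) x = partial [i] (partial [j] (quadratic c b H)) x" by simp
  also have "\<dots> = partial [i] (\<lambda>x. b $ j + (\<Sum>k\<in>UNIV. H j k * x $ k)) x"
    by (simp only: partial_quadratic[of H, OF assms])
  also have "\<dots> = (\<Sum>k\<in>UNIV. H j k * axis i 1 $ k)"
  proof (rule has_derivative_partial)
    have l: "((\<lambda>x. x $ i) has_derivative (\<lambda>h. h $ i)) (at x)" for i
      by (intro bounded_linear_imp_has_derivative bounded_linear_vec_nth)
    have "((\<lambda>x. b $ j + (\<Sum>k\<in>UNIV. H j k * x $ k)) has_derivative (\<lambda>h. 0 + (\<Sum>k\<in>UNIV. H j k * h $ k))) (at x)"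
      by (intro has_derivative_add has_derivative_const has_derivative_sum has_derivative_mult_right l)
    then show "((\<lambda>x. b $ j + (\<Sum>k\<in>UNIV. H j k * x $ k)) has_derivative (\<lambda>h. \<Sum>k\<in>UNIV. H j k * h $ k)) (at x)"
      by simp
  qed
  also have "\<dots> = H i j"
    using exhaust_2[of i] exhaust_2[of j] assms by (auto simp: sum_2 axis_def)
  finally show "partial [i, j] (quadratic c b H) x = H i j" .
qed

lemma smooth_quadratic: "smooth (quadratic c b H)"
proof -
  have "smooth (\<lambda>x. 1 * (c + b \<bullet> x) + (1/2) * (1 * (1 * (H 1 1 * (x $ 1 * x $ 1)) + 1 * (H 1 2 * (x $ 1 * x $ 2)))
      + 1 * (1 * (H 2 1 * (x $ 2 * x $ 1)) + 1 * (H 2 2 * (x $ 2 * x $ 2)))))"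
    by (intro smooth_lincomb smooth_affine smooth_mult smooth_const smooth_component)
  then show ?thesis
    unfolding quadratic_def[abs_def] by (simp add: sum_2 algebra_simps add_divide_distrib)
qed

lemma quadratic_diff:
  "quadratic c b H x - quadratic c' b' H' x = quadratic (c - c') (b - b') (\<lambda>i j. H i j - H' i j) x"
  by (simp add: quadratic_def sum_2 inner_diff_left algebra_simps add_divide_distrib diff_divide_distrib)

section \<open>Inverse inequalities along an edge\<close>

lemma unit_integral_polynomial_squares:
  fixes \<alpha> \<beta> \<gamma> :: real
  shows
  "(LINT t:{0..1}|lebesgue. (\<alpha> + \<beta> * t)\<^sup>2) = \<alpha>\<^sup>2 + \<alpha> * \<beta> + \<beta>\<^sup>2 / 3"
  "(LINT t:{0..1}|lebesgue. (\<alpha> + \<beta> * t + \<gamma> * t\<^sup>2)\<^sup>2)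
     = \<alpha>\<^sup>2 + \<alpha> * \<beta> + (\<beta>\<^sup>2 + 2 * \<alpha> * \<gamma>) / 3 + \<beta> * \<gamma> / 2 + \<gamma>\<^sup>2 / 5"
proof -
  have ftc: "(LINT t:{0..1}|lebesgue. f t) = F 1 - F 0"
    if "\<And>t. (F has_real_derivative f t) (at t)" "continuous_on UNIV f" for f F :: "real \<Rightarrow> real"
  proof -
    have "(LINT t:{0..1}|lebesgue. f t) = (LINT t|lborel. indicat_real {0..1} t * f t)"
      by (rule set_integral_continuous_lborel(1)[OF continuous_on_subset[OF that(2) subset_UNIV]])
    also have "\<dots> = (LINT t|lborel. f t * indicat_real {0..1} t)" by (simp add: mult.commute)
    also have "\<dots> = F 1 - F 0"
    proof (rule integral_FTC_Icc_real)
      show "isCont f t" for t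
        using that(2) unfolding continuous_on_eq_continuous_at[OF open_UNIV] by (rule bspec) simp
    qed (use that in auto)
    finally show ?thesis .
  qed
  have "(LINT t:{0..1}|lebesgue. (\<alpha> + \<beta> * t)\<^sup>2) = (\<lambda>t. \<alpha>\<^sup>2 * t + \<alpha> * \<beta> * t\<^sup>2 + \<beta>\<^sup>2 * t ^ 3 / 3) 1
      - (\<lambda>t. \<alpha>\<^sup>2 * t + \<alpha> * \<beta> * t\<^sup>2 + \<beta>\<^sup>2 * t ^ 3 / 3) 0"
    by (rule ftc) (auto intro!: derivative_eq_intros continuous_intros simp: power2_eq_square algebra_simps)
  then show "(LINT t:{0..1}|lebesgue. (\<alpha> + \<beta> * t)\<^sup>2) = \<alpha>\<^sup>2 + \<alpha> * \<beta> + \<beta>\<^sup>2 / 3" by simp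
  let ?F = "\<lambda>t. \<alpha>\<^sup>2 * t + \<alpha> * \<beta> * t\<^sup>2 + (\<beta>\<^sup>2 + 2 * \<alpha> * \<gamma>) * t ^ 3 / 3 + \<beta> * \<gamma> * t ^ 4 / 2 + \<gamma>\<^sup>2 * t ^ 5 / 5"
  have "(LINT t:{0..1}|lebesgue. (\<alpha> + \<beta> * t + \<gamma> * t\<^sup>2)\<^sup>2) = ?F 1 - ?F 0"
    by (rule ftc) (auto intro!: derivative_eq_intros continuous_intros simp: power2_eq_square eval_nat_numeral algebra_simps)
  then show "(LINT t:{0..1}|lebesgue. (\<alpha> + \<beta> * t + \<gamma> * t\<^sup>2)\<^sup>2)
     = \<alpha>\<^sup>2 + \<alpha> * \<beta> + (\<beta>\<^sup>2 + 2 * \<alpha> * \<gamma>) / 3 + \<beta> * \<gamma> / 2 + \<gamma>\<^sup>2 / 5" by simp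
qed

lemma unit_inverse_inequalities:
  fixes \<alpha> \<beta> \<gamma> :: real
  shows
  "\<beta>\<^sup>2 \<le> 12 * (LINT t:{0..1}|lebesgue. (\<alpha> + \<beta> * t)\<^sup>2)"
  "(LINT t:{0..1}|lebesgue. (\<beta> + (2 * \<gamma>) * t)\<^sup>2) \<le> 60 * (LINT t:{0..1}|lebesgue. (\<alpha> + \<beta> * t + \<gamma> * t\<^sup>2)\<^sup>2)"
proof -
  \<comment> \<open>The minimum of the integral over \<alpha> is \<beta>^2 / 12, attained at
    \<alpha> = - \<beta> / 2.\<close>
  have "12 * (\<alpha>\<^sup>2 + \<alpha> * \<beta> + \<beta>\<^sup>2 / 3) - \<beta>\<^sup>2 = 12 * (\<alpha> + \<beta> / 2)\<^sup>2"
    by (simp add: power2_eq_square algebra_simps)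
  then show "\<beta>\<^sup>2 \<le> 12 * (LINT t:{0..1}|lebesgue. (\<alpha> + \<beta> * t)\<^sup>2)"
    unfolding unit_integral_polynomial_squares using zero_le_power2[of "\<alpha> + \<beta> / 2"] by linarith
  text \<open>Parseval in the Legendre basis of the unit interval, in which the derivative of the
    quadratic basis polynomial has squared norm 60.\<close>
  have "60 * (\<alpha>\<^sup>2 + \<alpha> * \<beta> + (\<beta>\<^sup>2 + 2 * \<alpha> * \<gamma>) / 3 + \<beta> * \<gamma> / 2 + \<gamma>\<^sup>2 / 5)
      - (\<beta>\<^sup>2 + \<beta> * (2 * \<gamma>) + (2 * \<gamma>)\<^sup>2 / 3)
      = 60 * (\<alpha> + \<beta> / 2 + \<gamma> / 3)\<^sup>2 + 4 * (\<beta> + \<gamma>)\<^sup>2"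
    by (simp add: power2_eq_square algebra_simps)
  then show "(LINT t:{0..1}|lebesgue. (\<beta> + (2 * \<gamma>) * t)\<^sup>2) \<le> 60 * (LINT t:{0..1}|lebesgue. (\<alpha> + \<beta> * t + \<gamma> * t\<^sup>2)\<^sup>2)"
    unfolding unit_integral_polynomial_squares
    using zero_le_power2[of "\<alpha> + \<beta> / 2 + \<gamma> / 3"] zero_le_power2[of "\<beta> + \<gamma>"] by linarith
qed

lemma orthonormal_coordinates:
  fixes \<nu> \<tau> :: pt
  assumes "norm \<nu> = 1" "norm \<tau> = 1" "\<nu> \<bullet> \<tau> = 0"
  shows "(\<Sum>i\<in>UNIV. (v i)\<^sup>2) = (\<Sum>i\<in>UNIV. v i * \<nu> $ i)\<^sup>2 + (\<Sum>i\<in>UNIV. v i * \<tau> $ i)\<^sup>2"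
  using norm_orthonormal_2(1)[OF assms, of "\<chi> i. v i"]
  unfolding power2_norm_eq_inner inner_vec_def sum_2 by (simp add: power2_eq_square mult.commute)

text \<open>Along the edge \<open>q\<close> is quadratic in \<open>t\<close>, and its
  \<open>t\<close>-derivative is h times the tangential derivative; with \<open>J1\<close> for the
  normal part this bounds the gradient. The normal derivative is affine in \<open>t\<close>, with
  slope h times the tangential component of H \<nu>, which is thus bounded by \<open>J1\<close>.
  Only the normal-normal entry of H remains, and it is left to the edge bubble.\<close>

lemma quadratic_edge_inequalities:
  fixes a e \<nu> b :: pt and c :: real and H :: "2 \<Rightarrow> 2 \<Rightarrow> real"
  assumes H: "H 1 2 = H 2 1" and e: "e \<noteq> 0" and \<nu>: "norm \<nu> = 1" "\<nu> \<bullet> e = 0"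
  defines "q \<equiv> quadratic c b H" and "h \<equiv> norm e"
  defines "J0 \<equiv> LINT t:{0..1}|lebesgue. (q (a + t *\<^sub>R e))\<^sup>2"
    and "J1 \<equiv> LINT t:{0..1}|lebesgue. (\<Sum>i\<in>UNIV. partial [i] q (a + t *\<^sub>R e) * \<nu> $ i)\<^sup>2"
  shows "(\<Sum>i\<in>UNIV. LINT t:{0..1}|lebesgue. (partial [i] q (a + t *\<^sub>R e))\<^sup>2) \<le> J1 + 60 / h\<^sup>2 * J0"
    and "h\<^sup>2 * (\<Sum>i\<in>UNIV. (\<Sum>j\<in>UNIV. H i j * \<nu> $ j)\<^sup>2)
      \<le> h\<^sup>2 * (\<Sum>i\<in>UNIV. \<Sum>j\<in>UNIV. H i j * \<nu> $ i * \<nu> $ j)\<^sup>2 + 12 * J1"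
proof -
  have h: "h > 0" using e by (simp add: h_def)
  define \<tau> where "\<tau> = e /\<^sub>R h"
  have e': "e = h *\<^sub>R \<tau>" using h by (simp add: \<tau>_def)
  have on: "norm \<nu> = 1" "norm \<tau> = 1" "\<nu> \<bullet> \<tau> = 0"
    using \<nu> h by (auto simp: \<tau>_def h_def)
  define d where "d i x = b $ i + (\<Sum>j\<in>UNIV. H i j * x $ j)" for i and x :: pt
  have pq: "partial [i] q = d i" for i
    unfolding q_def d_def partial_quadratic[of H, OF H] by simp
  define \<alpha> \<beta> \<gamma> where "\<alpha> = q a" and "\<beta> = (\<Sum>i\<in>UNIV. d i a * e $ i)" and "\<gamma> = (\<Sum>i\<in>UNIV. \<Sum>j\<in>UNIV. H i j * e $ i * e $ j) / 2"
  have q_line: "q (a + t *\<^sub>R e) = \<alpha> + \<beta> * t + \<gamma> * t\<^sup>2" for t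
    unfolding q_def \<alpha>_def \<beta>_def \<gamma>_def d_def quadratic_def
    using H by (simp add: sum_2 inner_vec_def power2_eq_square algebra_simps add_divide_distrib)
  have d_line: "(\<Sum>i\<in>UNIV. d i (a + t *\<^sub>R e) * e $ i) = \<beta> + (2 * \<gamma>) * t" for t
    unfolding \<beta>_def \<gamma>_def d_def using H by (simp add: sum_2 algebra_simps)
  define \<alpha>' \<beta>' where "\<alpha>' = (\<Sum>i\<in>UNIV. d i a * \<nu> $ i)" and "\<beta>' = h * (\<Sum>i\<in>UNIV. \<Sum>j\<in>UNIV. H i j * \<nu> $ j * \<tau> $ i)"
  have n_line: "(\<Sum>i\<in>UNIV. d i (a + t *\<^sub>R e) * \<nu> $ i) = \<alpha>' + \<beta>' * t" for t
    unfolding \<alpha>'_def \<beta>'_def d_def e' using H by (simp add: sum_2 algebra_simps)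
  have cont: "continuous_on UNIV (\<lambda>t. d i (a + t *\<^sub>R e))" for i
    unfolding d_def by (intro continuous_intros)
  have int: "set_integrable lebesgue {0..1} f" if "continuous_on UNIV f" for f :: "real \<Rightarrow> real"
    by (rule set_integrable_continuous_compact[OF compact_Icc continuous_on_subset[OF that subset_UNIV]])
  have "(\<Sum>i\<in>UNIV. LINT t:{0..1}|lebesgue. (d i (a + t *\<^sub>R e))\<^sup>2) = (LINT t:{0..1}|lebesgue. \<Sum>i\<in>UNIV. (d i (a + t *\<^sub>R e))\<^sup>2)"
    using int[of "\<lambda>t. (d 1 (a + t *\<^sub>R e))\<^sup>2"] int[of "\<lambda>t. (d 2 (a + t *\<^sub>R e))\<^sup>2"] cont
    by (simp add: sum_2 continuous_on_power)
  also have "\<dots> = (LINT t:{0..1}|lebesgue. (\<Sum>i\<in>UNIV. d i (a + t *\<^sub>R e) * \<nu> $ i)\<^sup>2 + (1 / h\<^sup>2) * (\<beta> + (2 * \<gamma>) * t)\<^sup>2)"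
  proof -
    have "(\<Sum>i\<in>UNIV. d i (a + t *\<^sub>R e) * \<tau> $ i) = (\<beta> + (2 * \<gamma>) * t) / h" for t
      unfolding d_line[symmetric] \<tau>_def by (simp add: sum_2 divide_inverse algebra_simps)
    then have "(\<Sum>i\<in>UNIV. (d i (a + t *\<^sub>R e))\<^sup>2) = (\<Sum>i\<in>UNIV. d i (a + t *\<^sub>R e) * \<nu> $ i)\<^sup>2 + (1 / h\<^sup>2) * (\<beta> + (2 * \<gamma>) * t)\<^sup>2" for t
      unfolding orthonormal_coordinates[OF on] by (simp add: power_divide)
    then show ?thesis by simp
  qed
  also have "\<dots> = J1 + (1 / h\<^sup>2) * (LINT t:{0..1}|lebesgue. (\<beta> + (2 * \<gamma>) * t)\<^sup>2)"
    unfolding J1_def pq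
    by (subst set_integral_add(2)) (use h in \<open>auto intro!: int continuous_intros cont\<close>)
  also have "\<dots> \<le> J1 + (1 / h\<^sup>2) * (60 * J0)"
    unfolding J0_def q_line by (intro add_left_mono mult_left_mono unit_inverse_inequalities) simp
  finally show "(\<Sum>i\<in>UNIV. LINT t:{0..1}|lebesgue. (partial [i] q (a + t *\<^sub>R e))\<^sup>2) \<le> J1 + 60 / h\<^sup>2 * J0"
    unfolding pq by simp
  have "(\<Sum>i\<in>UNIV. (\<Sum>j\<in>UNIV. H i j * \<nu> $ j)\<^sup>2) = (\<Sum>i\<in>UNIV. (\<Sum>j\<in>UNIV. H i j * \<nu> $ j) * \<nu> $ i)\<^sup>2 + (\<Sum>i\<in>UNIV. (\<Sum>j\<in>UNIV. H i j * \<nu> $ j) * \<tau> $ i)\<^sup>2"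
    by (rule orthonormal_coordinates[OF on])
  also have "(\<Sum>i\<in>UNIV. (\<Sum>j\<in>UNIV. H i j * \<nu> $ j) * \<nu> $ i) = (\<Sum>i\<in>UNIV. \<Sum>j\<in>UNIV. H i j * \<nu> $ i * \<nu> $ j)"
    by (simp add: sum_2 algebra_simps)
  finally have "h\<^sup>2 * (\<Sum>i\<in>UNIV. (\<Sum>j\<in>UNIV. H i j * \<nu> $ j)\<^sup>2)
      = h\<^sup>2 * (\<Sum>i\<in>UNIV. \<Sum>j\<in>UNIV. H i j * \<nu> $ i * \<nu> $ j)\<^sup>2 + \<beta>'\<^sup>2"
    by (simp add: \<beta>'_def power_mult_distrib sum_distrib_right distrib_left)
  moreover have "\<beta>'\<^sup>2 \<le> 12 * J1"
    unfolding J1_def pq n_line by (rule unit_inverse_inequalities)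
  ultimately show "h\<^sup>2 * (\<Sum>i\<in>UNIV. (\<Sum>j\<in>UNIV. H i j * \<nu> $ j)\<^sup>2)
      \<le> h\<^sup>2 * (\<Sum>i\<in>UNIV. \<Sum>j\<in>UNIV. H i j * \<nu> $ i * \<nu> $ j)\<^sup>2 + 12 * J1" by simp
qed

subsection \<open>Meshes\<close>

text \<open>The covering by triangles gives inclusions in the closure of \<Omega>;
  \<open>regular_open\<close> sharpens them, for open sets, to inclusions in \<Omega>.\<close>

locale meshed_domain =
  fixes \<Omega> :: "pt set" and \<T> :: mesh
  assumes open_domain: "open \<Omega>" and bounded_domain: "bounded \<Omega>"
    and regular_open: "interior (closure \<Omega>) = \<Omega>" and mesh: "mesh_of \<Omega> \<T>"
begin

lemma finite_mesh: "finite \<T>"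
  using mesh by (simp add: mesh_of_def triangulation_def)

lemma triangle: "K \<in> \<T> \<Longrightarrow> 2 simplex K"
  using mesh by (simp add: mesh_of_def)

lemma interiors_disjoint: "K \<in> \<T> \<Longrightarrow> K' \<in> \<T> \<Longrightarrow> interior K \<inter> interior K' \<noteq> {} \<Longrightarrow> K = K'"
  using mesh mesh_interiors_disjoint by (auto simp: mesh_of_def)

lemma triangle_subset_closure: "K \<in> \<T> \<Longrightarrow> K \<subseteq> closure \<Omega>"
  using mesh by (auto simp: mesh_of_def)

lemma interior_triangle_subset: "K \<in> \<T> \<Longrightarrow> interior K \<subseteq> \<Omega>"
  using interior_mono[OF triangle_subset_closure] regular_open by auto

lemma lebesgue_domain: "\<Omega> \<in> sets lebesgue"
  using open_domain by auto

lemma skeleton_null: "AE x in lebesgue. x \<in> \<Omega> \<longrightarrow> x \<in> (\<Union>K\<in>\<T>. interior K)"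
proof -
  have "K - interior K \<in> null_sets lebesgue" if "K \<in> \<T>" for K
    using simplex_compact_convex[OF triangle[OF that]] by (intro null_sets_Diff_interior compact_imp_closed)
  then have "(\<Union>K\<in>\<T>. K - interior K) \<in> null_sets lebesgue"
    using finite_mesh by (intro null_sets_UN' countable_finite)
  then have "AE x in lebesgue. x \<notin> (\<Union>K\<in>\<T>. K - interior K)" by (rule AE_not_in)
  then show ?thesis
  proof eventually_elim
    case (elim x)
    show ?case
    proof
      assume "x \<in> \<Omega>"
      then have "x \<in> \<Union>\<T>" using mesh closure_subset by (auto simp: mesh_of_def)
      then show "x \<in> (\<Union>K\<in>\<T>. interior K)" using elim by auto
    qed
  qed
qed

lemma set_integral_mesh:
  fixes f :: scalar_fn
  assumes "set_integrable lebesgue \<Omega> f"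
  shows "(LINT x:\<Omega>|lebesgue. f x) = (\<Sum>K\<in>\<T>. LINT x:interior K|lebesgue. f x)"
proof -
  have "AE x in lebesgue. indicat_real \<Omega> x * f x = (\<Sum>K\<in>\<T>. indicat_real (interior K) x * f x)"
    using skeleton_null
  proof eventually_elim
    case (elim x)
    show ?case
    proof (cases "x \<in> \<Omega>")
      case True
      then obtain K where K: "K \<in> \<T>" "x \<in> interior K" using elim by auto
      have "(\<Sum>K\<in>\<T>. indicat_real (interior K) x * f x) = (\<Sum>K'\<in>{K}. indicat_real (interior K') x * f x)"
        using finite_mesh K interiors_disjoint[OF K(1)]
        by (intro sum.mono_neutral_right) (auto simp: indicator_def)
      then show ?thesis using True K by simp
    next
      case False
      then have "\<forall>K\<in>\<T>. x \<notin> interior K" using interior_triangle_subset by auto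
      then show ?thesis using False by simp
    qed
  qed
  then have ae: "AE x in lebesgue. x \<in> UNIV \<longrightarrow> indicat_real \<Omega> x * f x = (\<Sum>K\<in>\<T>. indicat_real (interior K) x * f x)"
    by simp
  have "set_integrable lebesgue (interior K) f" if "K \<in> \<T>" for K
    using set_integrable_subset[OF assms _ interior_triangle_subset[OF that]] by simp
  then have "(LINT x|lebesgue. (\<Sum>K\<in>\<T>. indicat_real (interior K) x * f x)) = (\<Sum>K\<in>\<T>. LINT x:interior K|lebesgue. f x)"
    unfolding set_lebesgue_integral_def set_integrable_def
    by (subst Bochner_Integration.integral_sum) auto
  moreover have "(LINT x|lebesgue. indicat_real \<Omega> x * f x) = (LINT x|lebesgue. (\<Sum>K\<in>\<T>. indicat_real (interior K) x * f x))"
    using set_integral_lebesgue_cong_AE[OF ae] by (simp add: set_lebesgue_integral_def)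
  ultimately show ?thesis by (simp add: set_lebesgue_integral_def)
qed

lemma pw_deriv_interior:
  assumes "K \<in> \<T>" "x \<in> interior K"
  shows "pw_deriv \<T> js \<phi> x = weak_deriv (interior K) js \<phi> x"
proof -
  have "pw_deriv \<T> js \<phi> x = (\<Sum>K'\<in>{K}. indicat_real (interior K') x * weak_deriv (interior K') js \<phi> x)"
    unfolding pw_deriv_def using finite_mesh assms interiors_disjoint[OF assms(1)]
    by (intro sum.mono_neutral_right) (auto simp: indicator_def)
  then show ?thesis using assms by simp
qed

lemma Hs_on_triangle:
  assumes "w \<in> Hs (real k) \<Omega>" "K \<in> \<T>"
  shows "w \<in> Hs (real k) (interior K)"
  by (rule Hs_subset[OF assms(1) interior_triangle_subset[OF assms(2)]]) simp

lemma weak_deriv_on_triangle: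
  assumes "w \<in> Hs (real k) \<Omega>" "K \<in> \<T>" "length js \<le> k"
  shows "AE x in lebesgue. x \<in> interior K \<longrightarrow> weak_deriv (interior K) js w x = weak_deriv \<Omega> js w x"
  by (rule weak_deriv_AE_eq[OF open_interior is_weak_deriv_subset[OF Hs_weak_deriv(2)[OF open_domain assms(1,3)]
        interior_triangle_subset[OF assms(2)]]])

lemma seminorm_sq_mesh_sum:
  assumes "w \<in> Hs (real k) \<Omega>" "m \<le> k"
  shows "(\<Sum>K\<in>\<T>. seminorm_sq m (interior K) w) = seminorm_sq m \<Omega> w"
proof -
  have eq: "seminorm_sq m (interior K) w = (\<Sum>js | length js = m. LINT x:interior K|lebesgue. (weak_deriv \<Omega> js w x)\<^sup>2)"
    if "K \<in> \<T>" for K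
    by (rule seminorm_sq_eq[OF open_interior is_weak_deriv_subset[OF Hs_weak_deriv(2)[OF open_domain assms(1)]
          interior_triangle_subset[OF that]]]) (use assms(2) in auto)
  have "(\<Sum>K\<in>\<T>. seminorm_sq m (interior K) w)
      = (\<Sum>K\<in>\<T>. \<Sum>js | length js = m. LINT x:interior K|lebesgue. (weak_deriv \<Omega> js w x)\<^sup>2)"
    by (rule sum.cong) (auto simp: eq)
  also have "\<dots> = (\<Sum>js | length js = m. \<Sum>K\<in>\<T>. LINT x:interior K|lebesgue. (weak_deriv \<Omega> js w x)\<^sup>2)"
    by (rule sum.swap)
  also have "\<dots> = (\<Sum>js | length js = m. LINT x:\<Omega>|lebesgue. (weak_deriv \<Omega> js w x)\<^sup>2)"
  proof (rule sum.cong[OF refl])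
    fix js :: "2 list" assume "js \<in> {js. length js = m}"
    then have "sq_integrable lebesgue \<Omega> (weak_deriv \<Omega> js w)"
      using Hs_weak_deriv(1)[OF open_domain assms(1), of js] assms(2) by (auto simp: L2_iff)
    from set_integral_mesh[OF sq_integrable_set_integrable[OF this]]
    show "(\<Sum>K\<in>\<T>. LINT x:interior K|lebesgue. (weak_deriv \<Omega> js w x)\<^sup>2) = (LINT x:\<Omega>|lebesgue. (weak_deriv \<Omega> js w x)\<^sup>2)"
      by simp
  qed
  finally show ?thesis by (simp add: seminorm_sq_def)
qed

lemma seminorm_sq_triangle_le:
  assumes "w \<in> Hs (real k) \<Omega>" "m \<le> k" "K \<in> \<T>"
  shows "seminorm_sq m (interior K) w \<le> seminorm_sq m \<Omega> w"
  unfolding seminorm_sq_mesh_sum[OF assms(1,2), symmetric]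
  by (rule member_le_sum[OF assms(3)]) (auto simp: seminorm_sq_nonneg finite_mesh)

lemma finite_edges: "finite (edges \<T>)"
proof -
  have "edges \<T> = (\<Union>K\<in>\<T>. {E. E edge_of K})" by (auto simp: edges_def)
  then show ?thesis using finite_mesh card_edges_of_triangle(1)[OF triangle] by auto
qed

lemma interior_edges_subset: "interior_edges \<T> \<subseteq> edges \<T>"
  by (auto simp: interior_edges_def edges_def)

lemma K_plus_minus:
  assumes "E \<in> interior_edges \<T>"
  shows "K_plus \<T> E \<in> \<T>" "E edge_of K_plus \<T> E" "K_minus \<T> E \<in> \<T>" "E edge_of K_minus \<T> E"
    "K_minus \<T> E \<noteq> K_plus \<T> E"
proof -
  obtain K K' where K: "K \<in> \<T>" "K' \<in> \<T>" "K \<noteq> K'" "E edge_of K" "E edge_of K'"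
    using assms by (auto simp: interior_edges_def)
  have 1: "K_plus \<T> E \<in> \<T> \<and> E edge_of K_plus \<T> E"
    unfolding K_plus_def by (rule someI[of _ K]) (use K in auto)
  have "\<exists>K''. K'' \<in> \<T> \<and> E edge_of K'' \<and> K'' \<noteq> K_plus \<T> E" using K by metis
  then have 2: "K_minus \<T> E \<in> \<T> \<and> E edge_of K_minus \<T> E \<and> K_minus \<T> E \<noteq> K_plus \<T> E"
    unfolding K_minus_def by (rule someI_ex)
  from 1 2 show "K_plus \<T> E \<in> \<T>" "E edge_of K_plus \<T> E" "K_minus \<T> E \<in> \<T>" "E edge_of K_minus \<T> E"
    "K_minus \<T> E \<noteq> K_plus \<T> E" by auto
qed

text \<open>As \<open>edge_normal\<close> is a choice, a vector with the required properties has to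
  be exhibited first. The definition only gives a weak inequality towards \<open>c\<close>; equality
  would make two sides of the triangle parallel.\<close>

lemma edge_normal_works:
  assumes E: "E edge_of K_plus \<T> E" "K_plus \<T> E \<in> \<T>" and pq: "E = closed_segment p q"
    and c: "K_plus \<T> E = convex hull {p, q, c}" "cross2 (q - p) (c - p) \<noteq> 0"
  shows "norm (edge_normal \<T> E) = 1" "edge_normal \<T> E \<bullet> (q - p) = 0" "edge_normal \<T> E \<bullet> (c - p) < 0"
proof -
  let ?Q = "\<lambda>\<nu>. norm \<nu> = 1 \<and> (\<forall>x\<in>E. \<forall>y\<in>E. \<nu> \<bullet> (y - x) = 0) \<and> (\<forall>x\<in>E. \<forall>y\<in>K_plus \<T> E. \<nu> \<bullet> (y - x) \<le> 0)"
  define n where "n = (vector [(q - p) $ 2, - (q - p) $ 1] :: pt)"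
  have n_dot: "n \<bullet> y = - cross2 (q - p) y" for y
    by (simp add: n_def inner_vec_def sum_2 cross2_def algebra_simps)
  \<comment> \<open>The sign that makes the rotated edge vector point away from
    \<open>c\<close>.\<close>
  define s where "s = (if cross2 (q - p) (c - p) > 0 then 1 else -1 :: real)"
  have ne: "n \<noteq> 0" using c(2) n_dot[of "c - p"] by auto
  define \<nu> where "\<nu> = (s / norm n) *\<^sub>R n"
  have \<nu>1: "norm \<nu> = 1" using ne by (simp add: \<nu>_def s_def)
  have \<nu>q: "\<nu> \<bullet> (q - p) = 0" by (simp add: \<nu>_def n_dot cross2_def)
  have \<nu>c: "\<nu> \<bullet> (c - p) < 0"
    using ne c(2) by (auto simp: \<nu>_def n_dot s_def field_simps)
  have seg: "\<exists>u. 0 \<le> u \<and> u \<le> 1 \<and> x = p + u *\<^sub>R (q - p)" if "x \<in> E" for x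
    using that unfolding pq in_segment by (auto simp: algebra_simps intro!: exI)
  have tri: "\<exists>u v. 0 \<le> v \<and> x = p + u *\<^sub>R (q - p) + v *\<^sub>R (c - p)" if "x \<in> K_plus \<T> E" for x
    using that unfolding c(1) convex_hull_3_alt by blast
  have "?Q \<nu>"
  proof (intro conjI ballI \<nu>1)
    fix x y assume "x \<in> E" "y \<in> E"
    then obtain u v where xy: "x = p + u *\<^sub>R (q - p)" "y = p + v *\<^sub>R (q - p)" using seg by blast
    have "y - x = (v - u) *\<^sub>R (q - p)" unfolding xy by (simp add: algebra_simps)
    then show "\<nu> \<bullet> (y - x) = 0" using \<nu>q by simp
  next
    fix x y assume "x \<in> E" "y \<in> K_plus \<T> E"
    then obtain u v w where xy: "x = p + u *\<^sub>R (q - p)" "0 \<le> w" "y = p + v *\<^sub>R (q - p) + w *\<^sub>R (c - p)"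
      using seg tri by meson
    have "y - x = (v - u) *\<^sub>R (q - p) + w *\<^sub>R (c - p)" unfolding xy(1,3) by (simp add: algebra_simps)
    then show "\<nu> \<bullet> (y - x) \<le> 0" using xy(2) \<nu>q \<nu>c by (simp add: inner_add_right mult_nonneg_nonpos)
  qed
  then have Q: "?Q (edge_normal \<T> E)"
    unfolding edge_normal_def by (rule someI[of ?Q])
  then show 1: "norm (edge_normal \<T> E) = 1" by blast
  have cK: "c \<in> K_plus \<T> E" unfolding c(1) by (auto intro: hull_inc)
  have pE: "p \<in> E" "q \<in> E" unfolding pq by auto
  then show 2: "edge_normal \<T> E \<bullet> (q - p) = 0" using Q by blast
  have "edge_normal \<T> E \<bullet> (c - p) \<le> 0" using Q pE cK by blast
  moreover have "edge_normal \<T> E \<noteq> 0" using 1 by (metis norm_zero zero_neq_one)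
  then have "edge_normal \<T> E \<bullet> (c - p) \<noteq> 0"
    using cross2_parallel_eq_0[of "edge_normal \<T> E" "q - p" "c - p"] 2 c(2) by blast
  ultimately show "edge_normal \<T> E \<bullet> (c - p) < 0" by simp
qed

lemma jump_square_integral:
  assumes E: "E \<in> interior_edges \<T>"
    and tr: "is_trace (K_plus \<T> E) E w g" "is_trace (K_minus \<T> E) E w g'"
  shows "edge_int E (\<lambda>x. (jump \<T> E w x)\<^sup>2) = edge_int E (\<lambda>x. (g x - g' x)\<^sup>2)"
proof -
  note K = K_plus_minus[OF E]
  have "AE t in lebesgue. t \<in> {0..1} \<longrightarrow> (jump \<T> E w (edge_path E t))\<^sup>2 = (g (edge_path E t) - g' (edge_path E t))\<^sup>2"
    using edge_trace_AE[OF triangle[OF K(1)] K(2) tr(1)] edge_trace_AE[OF triangle[OF K(3)] K(4) tr(2)]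
    by eventually_elim (use E in \<open>simp add: jump_def\<close>)
  from set_integral_lebesgue_cong_AE[OF this] show ?thesis by (simp add: edge_int_def)
qed

lemma interior_edge_geometry:
  assumes E: "E \<in> interior_edges \<T>"
  obtains p q where "E = closed_segment p q" "edge_path E = linepath p q" "p \<noteq> q" "diameter E = dist p q"
    "norm (edge_normal \<T> E) = 1" "edge_normal \<T> E \<bullet> (q - p) = 0"
    "\<exists>c. K_plus \<T> E = convex hull {p, q, c} \<and> cross2 (q - p) (c - p) \<noteq> 0 \<and> edge_normal \<T> E \<bullet> (c - p) < 0"
proof -
  note K = K_plus_minus[OF E]
  obtain p q c where *: "E = closed_segment p q" "edge_path E = linepath p q" "K_plus \<T> E = convex hull {p, q, c}"
    "cross2 (q - p) (c - p) \<noteq> 0" "p \<noteq> q" "diameter E = dist p q"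
    using edge_endpoints[OF triangle[OF K(1)] K(2)] by metis
  note n = edge_normal_works[OF K(2,1) *(1,3,4)]
  show ?thesis by (rule that[OF *(1,2,5,6) n(1,2)]) (use * n in blast)
qed

end

subsection \<open>Jumps of the error\<close>

lemma weak_deriv_smooth_piece:
  assumes "smooth p" "\<And>x. x \<in> interior K \<Longrightarrow> w x = p x"
  shows "AE x in lebesgue. x \<in> interior K \<longrightarrow> weak_deriv (interior K) js w x = partial (rev js) p x"
proof -
  have "is_weak_deriv (interior K) js w (partial (rev js) p)"
    by (rule is_weak_deriv_cong_AE[OF is_weak_deriv_smooth[OF assms(1)]]) (use assms(2) in auto)
  then show ?thesis by (rule weak_deriv_AE_eq[OF open_interior])
qed

lemma Hs_smooth_piece:
  assumes "2 simplex K" "smooth p" "\<And>x. x \<in> interior K \<Longrightarrow> w x = p x"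
  shows "w \<in> Hs (real k) (interior K)"
  by (rule Hs_cong_AE[OF smooth_Hs[OF triangle_interior_bounded[OF assms(1)] assms(2)]]) (use assms(3) in auto)

text \<open>Prepending a direction injects the lists of length \<open>m\<close> into those of length
  \<open>Suc m\<close>, so the left side is a part of the sum on the right.\<close>

lemma seminorm_sq_weak_deriv_le:
  assumes "open D" "f \<in> Hs (real k) D" "Suc m \<le> k"
  shows "seminorm_sq m D (weak_deriv D [i] f) \<le> seminorm_sq (Suc m) D f"
proof -
  have "seminorm_sq m D (weak_deriv D [i] f) = (\<Sum>js | length js = m. LINT x:D|lebesgue. (weak_deriv D (i # js) f x)\<^sup>2)"
  proof (rule seminorm_sq_eq[OF assms(1)])
    fix js :: "2 list" assume "length js = m"
    then show "is_weak_deriv D js (weak_deriv D [i] f) (weak_deriv D (i # js) f)"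
      using is_weak_deriv_append[OF Hs_weak_deriv(2)[OF assms(1,2), of "[i]"] Hs_weak_deriv(2)[OF assms(1,2), of "[i] @ js"]] assms(3)
      by simp
  qed
  also have "\<dots> = (\<Sum>js\<in>(#) i ` {js. length js = m}. LINT x:D|lebesgue. (weak_deriv D js f x)\<^sup>2)"
    by (subst sum.reindex) (auto simp: inj_on_def)
  also have "\<dots> \<le> seminorm_sq (Suc m) D f"
    unfolding seminorm_sq_def
    by (rule sum_mono2[OF finite_lists_2]) (auto intro: set_integral_square_nonneg)
  finally show ?thesis .
qed

context meshed_domain
begin

text \<open>Skolemised form of \<open>pw_polys 2\<close>: coefficients are functions of the
  triangle, so the piecewise constant Hessian \<open>H\<close> can be named as a locale
  parameter.\<close>

definition pieces :: "scalar_fn \<Rightarrow> (pt set \<Rightarrow> real) \<Rightarrow> (pt set \<Rightarrow> pt) \<Rightarrow> (pt set \<Rightarrow> 2 \<Rightarrow> 2 \<Rightarrow> real) \<Rightarrow> bool" where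
  "pieces w c b H \<longleftrightarrow> (\<forall>K\<in>\<T>. H K 1 2 = H K 2 1 \<and> (\<forall>x\<in>interior K. w x = quadratic (c K) (b K) (H K) x))"

lemma pw_polys_pieces:
  assumes "w \<in> pw_polys 2 \<T>"
  obtains c b H where "pieces w c b H"
proof -
  have "\<forall>K\<in>\<T>. \<exists>z. snd (snd z) 1 2 = snd (snd z) 2 (1::2) \<and>
      (\<forall>x\<in>interior K. w x = quadratic (fst z) (fst (snd z)) (snd (snd z)) x)"
  proof
    fix K assume "K \<in> \<T>"
    then obtain p where p: "p \<in> polys 2" "\<forall>x\<in>interior K. w x = p x"
      using assms by (auto simp: pw_polys_def)
    obtain c b H where "p = quadratic c b H" "H 1 2 = H 2 1" using polys_2_quadratic[OF p(1)] .
    with p(2) show "\<exists>z. snd (snd z) 1 2 = snd (snd z) 2 (1::2) \<and>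
      (\<forall>x\<in>interior K. w x = quadratic (fst z) (fst (snd z)) (snd (snd z)) x)"
      by (intro exI[of _ "(c, b, H)"]) auto
  qed
  from bchoice[OF this] obtain z where "\<forall>K\<in>\<T>. snd (snd (z K)) 1 2 = snd (snd (z K)) 2 (1::2) \<and>
      (\<forall>x\<in>interior K. w x = quadratic (fst (z K)) (fst (snd (z K))) (snd (snd (z K))) x)" by blast
  then have "pieces w (\<lambda>K. fst (z K)) (\<lambda>K. fst (snd (z K))) (\<lambda>K. snd (snd (z K)))"
    by (simp add: pieces_def)
  then show ?thesis by (rule that)
qed

lemma pieces_weak_deriv:
  assumes "pieces w c b H" "K \<in> \<T>"
  shows "AE x in lebesgue. x \<in> interior K \<longrightarrow>
    weak_deriv (interior K) js w x = partial (rev js) (quadratic (c K) (b K) (H K)) x"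
  by (rule weak_deriv_smooth_piece[OF smooth_quadratic]) (use assms in \<open>auto simp: pieces_def\<close>)

lemma pieces_weak_deriv2:
  assumes "pieces w c b H" "K \<in> \<T>"
  shows "AE x in lebesgue. x \<in> interior K \<longrightarrow> weak_deriv (interior K) [i, j] w x = H K i j"
proof -
  have "H K 1 2 = H K 2 1" using assms by (auto simp: pieces_def)
  then have eq: "partial (rev [i, j]) (quadratic (c K) (b K) (H K)) = (\<lambda>x. H K i j)"
    using partial2_quadratic[of "H K" j i] exhaust_2[of i] exhaust_2[of j] by (auto simp del: partial.simps)
  show ?thesis using pieces_weak_deriv[OF assms, of "[i, j]"] unfolding eq .
qed

lemma pieces_Hs:
  assumes "pieces w c b H" "K \<in> \<T>"
  shows "w \<in> Hs (real k) (interior K)"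
  by (rule Hs_smooth_piece[OF triangle[OF assms(2)] smooth_quadratic]) (use assms in \<open>auto simp: pieces_def\<close>)

lemma pieces_trace:
  assumes "pieces w c b H" "K \<in> \<T>" "E edge_of K"
  shows "is_trace K E w (quadratic (c K) (b K) (H K))"
  by (rule is_trace_cong_AE[OF triangle[OF assms(2)] is_trace_smooth[OF triangle[OF assms(2)] assms(3) smooth_quadratic]])
    (use assms in \<open>auto simp: pieces_def\<close>)

lemma pieces_deriv_trace:
  assumes "pieces w c b H" "K \<in> \<T>" "E edge_of K"
  shows "is_trace K E (pw_deriv \<T> js w) (partial (rev js) (quadratic (c K) (b K) (H K)))"
proof (rule is_trace_cong_AE[OF triangle[OF assms(2)]
      is_trace_smooth[OF triangle[OF assms(2)] assms(3) smooth_partial[OF smooth_quadratic]]])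
  show "AE x in lebesgue. x \<in> interior K \<longrightarrow> partial (rev js) (quadratic (c K) (b K) (H K)) x = pw_deriv \<T> js w x"
    using pieces_weak_deriv[OF assms(1,2), of js]
    by eventually_elim (simp add: pw_deriv_interior[OF assms(2)])
qed

text \<open>Restriction to a triangle does not increase the seminorms, so one sequence of test
  functions approximates on all triangles at once.\<close>

lemma H20_approximation:
  assumes "u \<in> Hk0 2 \<Omega>"
  obtains \<phi> where "\<And>n. \<phi> n \<in> test_functions \<Omega>" "u \<in> Hs (real 2) \<Omega>"
    "\<And>m K. m \<le> 2 \<Longrightarrow> K \<in> \<T> \<Longrightarrow> (\<lambda>n. seminorm_sq m (interior K) (sub_fn (\<phi> n) u)) \<longlonglongrightarrow> 0"
proof -
  obtain \<phi> where \<phi>: "\<And>n. \<phi> n \<in> test_functions \<Omega>" "(\<lambda>n. Hs_norm (real 2) \<Omega> (sub_fn (\<phi> n) u)) \<longlonglongrightarrow> 0"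
    and u: "u \<in> Hs (real 2) \<Omega>"
    using assms by (auto simp: Hk0_def)
  have d: "sub_fn (\<phi> n) u \<in> Hs (real 2) \<Omega>" for n
    by (intro Hs_diff u smooth_Hs bounded_domain lebesgue_domain test_function_smooth[OF \<phi>(1)])
  have "(\<lambda>n. seminorm_sq m (interior K) (sub_fn (\<phi> n) u)) \<longlonglongrightarrow> 0" if "m \<le> 2" "K \<in> \<T>" for m K
  proof (rule tendsto_sandwich[OF _ _ tendsto_const])
    show "(\<lambda>n. seminorm_sq m \<Omega> (sub_fn (\<phi> n) u)) \<longlonglongrightarrow> 0"
      using \<phi>(2) that(1) unfolding Hs_norm_tendsto_0_iff by blast
  qed (intro always_eventually allI seminorm_sq_nonneg seminorm_sq_triangle_le[OF d that])+
  with \<phi>(1) u that show ?thesis by blast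
qed

text \<open>The approximating sequence is global, and its restriction to the edge does not depend on
  the side; hence all neighbours share the trace \<open>g\<close>.\<close>

lemma trace_H20:
  assumes u: "u \<in> Hk0 2 \<Omega>" and E: "E \<in> edges \<T>"
  obtains g where "\<And>K. K \<in> \<T> \<Longrightarrow> E edge_of K \<Longrightarrow> is_trace K E u g"
proof -
  obtain \<phi> where \<phi>: "\<And>n. \<phi> n \<in> test_functions \<Omega>" and u2: "u \<in> Hs (real 2) \<Omega>"
    and lim: "\<And>m K. m \<le> 2 \<Longrightarrow> K \<in> \<T> \<Longrightarrow> (\<lambda>n. seminorm_sq m (interior K) (sub_fn (\<phi> n) u)) \<longlonglongrightarrow> 0"
    using H20_approximation[OF u] by blast
  have u1: "u \<in> Hs (real 1) (interior K)" if "K \<in> \<T>" for K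
    by (rule Hs_on_triangle[OF Hs_mono[OF u2] that]) simp
  have conv: "(\<lambda>n. Hs_norm (real 1) (interior K) (sub_fn (\<phi> n) u)) \<longlonglongrightarrow> 0" if "K \<in> \<T>" for K
    unfolding Hs_norm_tendsto_0_iff using lim[OF _ that] by simp
  have sm: "smooth (\<phi> n)" for n by (rule test_function_smooth[OF \<phi>])
  obtain K0 where K0: "K0 \<in> \<T>" "E edge_of K0" using E by (auto simp: edges_def)
  obtain g where g: "g \<in> edge_L2 E" "(\<lambda>n. edge_int E (\<lambda>x. (\<phi> n x - g x)\<^sup>2)) \<longlonglongrightarrow> 0"
    using edge_limit[OF triangle[OF K0(1)] K0(2) u1[OF K0(1)] sm conv[OF K0(1)]] .
  have "is_trace K E u g" if "K \<in> \<T>" for K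
    unfolding is_trace_def using u1[OF that] conv[OF that] g sm by (intro conjI exI[of _ \<phi>]) auto
  then show ?thesis using that by blast
qed

text \<open>The same argument for the derivatives of the approximating sequence, whose H^1 distance
  is controlled by the H^2 distance of the functions.\<close>

lemma trace_deriv_H20:
  assumes u: "u \<in> Hk0 2 \<Omega>" and E: "E \<in> edges \<T>"
  obtains g where "\<And>K. K \<in> \<T> \<Longrightarrow> E edge_of K \<Longrightarrow> is_trace K E (pw_deriv \<T> [i] u) g"
proof -
  obtain \<phi> where \<phi>: "\<And>n. \<phi> n \<in> test_functions \<Omega>" and u2: "u \<in> Hs (real 2) \<Omega>"
    and lim: "\<And>m K. m \<le> 2 \<Longrightarrow> K \<in> \<T> \<Longrightarrow> (\<lambda>n. seminorm_sq m (interior K) (sub_fn (\<phi> n) u)) \<longlonglongrightarrow> 0"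
    using H20_approximation[OF u] by blast
  let ?w = "\<lambda>K. weak_deriv (interior K) [i] u" and ?\<psi> = "\<lambda>n. partial [i] (\<phi> n)"
  have uK: "u \<in> Hs (real 2) (interior K)" if "K \<in> \<T>" for K
    by (rule Hs_on_triangle[OF u2 that])
  have w1: "?w K \<in> Hs (real 1) (interior K)" if "K \<in> \<T>" for K
    by (rule weak_deriv_Hs[OF open_interior]) (use uK[OF that] in \<open>simp add: numeral_2_eq_2\<close>)
  have sm: "smooth (?\<psi> n)" for n by (rule smooth_partial[OF test_function_smooth[OF \<phi>]])
  have conv: "(\<lambda>n. Hs_norm (real 1) (interior K) (sub_fn (?\<psi> n) (?w K))) \<longlonglongrightarrow> 0" if K: "K \<in> \<T>" for K
    unfolding Hs_norm_tendsto_0_iff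
  proof safe
    fix m :: nat assume m: "m \<le> 1"
    have dK: "sub_fn (\<phi> n) u \<in> Hs (real 2) (interior K)" for n
      by (intro Hs_diff uK K smooth_Hs triangle_interior_bounded triangle test_function_smooth[OF \<phi>])
    have le: "seminorm_sq m (interior K) (sub_fn (?\<psi> n) (?w K)) \<le> seminorm_sq (Suc m) (interior K) (sub_fn (\<phi> n) u)" for n
    proof -
      have "AE x in lebesgue. x \<in> interior K \<longrightarrow> weak_deriv (interior K) [i] (sub_fn (\<phi> n) u) x = sub_fn (?\<psi> n) (?w K) x"
        using weak_deriv_diff[OF open_interior is_weak_deriv_smooth[OF test_function_smooth[OF \<phi>], of "interior K" "[i]" n]
          Hs_weak_deriv(2)[OF open_interior uK[OF K], of "[i]"]]
        by (simp add: sub_fn_def del: partial.simps)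
      then have "seminorm_sq m (interior K) (sub_fn (?\<psi> n) (?w K)) = seminorm_sq m (interior K) (weak_deriv (interior K) [i] (sub_fn (\<phi> n) u))"
        using dK m by (intro seminorm_sq_cong_AE[OF open_interior, of _ 1] weak_deriv_Hs[OF open_interior])
          (simp_all add: numeral_2_eq_2)
      also have "\<dots> \<le> seminorm_sq (Suc m) (interior K) (sub_fn (\<phi> n) u)"
        by (rule seminorm_sq_weak_deriv_le[OF open_interior dK]) (use m in simp)
      finally show ?thesis .
    qed
    have lim': "(\<lambda>n. seminorm_sq (Suc m) (interior K) (sub_fn (\<phi> n) u)) \<longlonglongrightarrow> 0"
      by (rule lim[OF _ K]) (use m in simp)
    show "(\<lambda>n. seminorm_sq m (interior K) (sub_fn (?\<psi> n) (?w K))) \<longlonglongrightarrow> 0"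
      by (rule tendsto_sandwich[OF _ _ tendsto_const lim']) (intro always_eventually allI le seminorm_sq_nonneg)+
  qed
  obtain K0 where K0: "K0 \<in> \<T>" "E edge_of K0" using E by (auto simp: edges_def)
  obtain g where g: "g \<in> edge_L2 E" "(\<lambda>n. edge_int E (\<lambda>x. (?\<psi> n x - g x)\<^sup>2)) \<longlonglongrightarrow> 0"
    using edge_limit[OF triangle[OF K0(1)] K0(2) w1[OF K0(1)] sm conv[OF K0(1)]] .
  have "is_trace K E (pw_deriv \<T> [i] u) g" if K: "K \<in> \<T>" for K
  proof (rule is_trace_cong_AE[OF triangle[OF K]])
    show "is_trace K E (?w K) g"
      unfolding is_trace_def using w1[OF K] conv[OF K] g sm
      by (intro conjI exI[of _ ?\<psi>]) (auto simp del: partial.simps)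
    show "AE x in lebesgue. x \<in> interior K \<longrightarrow> ?w K x = pw_deriv \<T> [i] u x"
      by (simp add: pw_deriv_interior[OF K])
  qed
  then show ?thesis using that by blast
qed

lemma pw_deriv_error_AE:
  assumes u: "u \<in> Hs (real k) \<Omega>" and w: "pieces w c b H" and K: "K \<in> \<T>" and js: "length js \<le> k"
  shows "AE x in lebesgue. x \<in> interior K \<longrightarrow>
    pw_deriv \<T> js (sub_fn u w) x = pw_deriv \<T> js u x - pw_deriv \<T> js w x"
  using weak_deriv_diff[OF open_interior Hs_weak_deriv(2)[OF open_interior Hs_on_triangle[OF u K] js]
    Hs_weak_deriv(2)[OF open_interior pieces_Hs[OF w K] js]]
  by eventually_elim (simp add: pw_deriv_interior[OF K])

lemma normal_trace:
  assumes "2 simplex K" "E edge_of K" "\<And>i. is_trace K E (W i) (G i)"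
  shows "is_trace K E (\<lambda>x. \<Sum>i\<in>UNIV. W i x * (\<nu> :: pt) $ i) (\<lambda>x. \<Sum>i\<in>UNIV. G i x * \<nu> $ i)"
  using is_trace_lincomb[OF assms(1,2) assms(3)[of 1] assms(3)[of 2], of "\<nu> $ 1" "\<nu> $ 2"]
  by (simp add: sum_2 mult.commute)

text \<open>The common traces of \<open>u\<close> and of its derivatives cancel, so the jump of the
  error is -q and that of the discrete function is q. Thus one quadratic polynomial expresses both
  the jump terms of the dG norm of the error and those of the estimator.\<close>

lemma jump_identities:
  assumes u: "u \<in> Hk0 2 \<Omega>" and w: "pieces w c b H" and E: "E \<in> interior_edges \<T>"
  defines "q \<equiv> quadratic (c (K_plus \<T> E) - c (K_minus \<T> E)) (b (K_plus \<T> E) - b (K_minus \<T> E))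
      (\<lambda>i j. H (K_plus \<T> E) i j - H (K_minus \<T> E) i j)"
    and "\<nu> \<equiv> edge_normal \<T> E"
  shows "edge_int E (\<lambda>x. (jump \<T> E (sub_fn u w) x)\<^sup>2) = edge_int E (\<lambda>x. (q x)\<^sup>2)"
    and "edge_int E (\<lambda>x. (jump \<T> E (normal_deriv \<T> E (sub_fn u w)) x)\<^sup>2)
      = edge_int E (\<lambda>x. (\<Sum>i\<in>UNIV. partial [i] q x * \<nu> $ i)\<^sup>2)"
    and "edge_int E (\<lambda>x. (jump \<T> E w x)\<^sup>2) = edge_int E (\<lambda>x. (q x)\<^sup>2)"
    and "edge_int E (\<lambda>x. (jump \<T> E (pw_deriv \<T> [i] w) x)\<^sup>2) = edge_int E (\<lambda>x. (partial [i] q x)\<^sup>2)"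
    and "edge_int E (\<lambda>x. (jump \<T> E (hess_normal \<T> E i w) x)\<^sup>2)
      = edge_int E (\<lambda>x. (\<Sum>j\<in>UNIV. (H (K_plus \<T> E) i j - H (K_minus \<T> E) i j) * \<nu> $ j)\<^sup>2)"
proof -
  note K = K_plus_minus[OF E]
  have Eed: "E \<in> edges \<T>" using E interior_edges_subset by blast
  have u2: "u \<in> Hs (real 2) \<Omega>" using u by (auto simp: Hk0_def)
  let ?p = "\<lambda>K. quadratic (c K) (b K) (H K)"
  have sym: "H K 1 2 = H K 2 1" if "K \<in> \<T>" for K using w that by (auto simp: pieces_def)
  have q: "?p (K_plus \<T> E) x - ?p (K_minus \<T> E) x = q x" for x
    unfolding q_def by (rule quadratic_diff)
  have dq: "partial [i] (?p (K_plus \<T> E)) x - partial [i] (?p (K_minus \<T> E)) x = partial [i] q x" for i x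
  proof -
    have "(\<lambda>i j. H (K_plus \<T> E) i j - H (K_minus \<T> E) i j) 1 2 = (\<lambda>i j. H (K_plus \<T> E) i j - H (K_minus \<T> E) i j) 2 1"
      using sym K by simp
    from partial_quadratic[of "\<lambda>i j. H (K_plus \<T> E) i j - H (K_minus \<T> E) i j", OF this]
    show ?thesis
      unfolding q_def partial_quadratic[of "H (K_plus \<T> E)", OF sym[OF K(1)]]
        partial_quadratic[of "H (K_minus \<T> E)", OF sym[OF K(3)]]
      by (simp add: sum_2 algebra_simps)
  qed
  obtain g where g: "\<And>K. K \<in> \<T> \<Longrightarrow> E edge_of K \<Longrightarrow> is_trace K E u g"
    using trace_H20[OF u Eed] by blast
  have "\<forall>i. \<exists>g. \<forall>K\<in>\<T>. E edge_of K \<longrightarrow> is_trace K E (pw_deriv \<T> [i] u) g"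
    using trace_deriv_H20[OF u Eed] by meson
  then obtain G where G: "\<And>i K. K \<in> \<T> \<Longrightarrow> E edge_of K \<Longrightarrow> is_trace K E (pw_deriv \<T> [i] u) (G i)"
    by metis
  have te: "is_trace K E (sub_fn u w) (\<lambda>x. g x - ?p K x)" if "K \<in> \<T>" "E edge_of K" for K
    using is_trace_lincomb[OF triangle[OF that(1)] that(2) g[OF that] pieces_trace[OF w that], of 1 "-1"]
    by (simp add: sub_fn_def)
  have td: "is_trace K E (pw_deriv \<T> [i] (sub_fn u w)) (\<lambda>x. G i x - partial [i] (?p K) x)" if K: "K \<in> \<T>" "E edge_of K" for K i
  proof (rule is_trace_cong_AE[OF triangle[OF K(1)]])
    show "is_trace K E (\<lambda>x. pw_deriv \<T> [i] u x - pw_deriv \<T> [i] w x) (\<lambda>x. G i x - partial [i] (?p K) x)"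
      using is_trace_lincomb[OF triangle[OF K(1)] K(2) G[OF K, of i] pieces_deriv_trace[OF w K, of "[i]"], of 1 "-1"]
      by (simp del: partial.simps)
    show "AE x in lebesgue. x \<in> interior K \<longrightarrow> pw_deriv \<T> [i] u x - pw_deriv \<T> [i] w x = pw_deriv \<T> [i] (sub_fn u w) x"
      using pw_deriv_error_AE[OF u2 w K(1), of "[i]"] by (auto elim!: eventually_mono)
  qed
  have tn: "is_trace K E (normal_deriv \<T> E (sub_fn u w)) (\<lambda>x. \<Sum>i\<in>UNIV. (G i x - partial [i] (?p K) x) * \<nu> $ i)"
    if K: "K \<in> \<T>" "E edge_of K" for K
    unfolding normal_deriv_def \<nu>_def[symmetric]
    by (rule normal_trace[OF triangle[OF K(1)] K(2) td[OF K]])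
  have th: "is_trace K E (hess_normal \<T> E i w) (\<lambda>x. \<Sum>j\<in>UNIV. H K i j * \<nu> $ j)" if K: "K \<in> \<T>" "E edge_of K" for K i
  proof -
    have "partial (rev [i, j]) (?p K) = (\<lambda>x. H K i j)" for j
      using partial2_quadratic[of "H K" j i, OF sym[OF K(1)]] sym[OF K(1)] exhaust_2[of i] exhaust_2[of j]
      by (auto simp del: partial.simps)
    then have "is_trace K E (pw_deriv \<T> [i, j] w) (\<lambda>x. H K i j)" for j
      using pieces_deriv_trace[OF w K, of "[i, j]"] by simp
    from normal_trace[OF triangle[OF K(1)] K(2) this]
    show ?thesis unfolding hess_normal_def \<nu>_def[symmetric] .
  qed
  show "edge_int E (\<lambda>x. (jump \<T> E (sub_fn u w) x)\<^sup>2) = edge_int E (\<lambda>x. (q x)\<^sup>2)"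
    unfolding jump_square_integral[OF E te[OF K(1,2)] te[OF K(3,4)]] q[symmetric]
    by (simp add: power2_commute)
  show "edge_int E (\<lambda>x. (jump \<T> E (normal_deriv \<T> E (sub_fn u w)) x)\<^sup>2)
      = edge_int E (\<lambda>x. (\<Sum>i\<in>UNIV. partial [i] q x * \<nu> $ i)\<^sup>2)"
  proof -
    have "(\<Sum>i\<in>UNIV. (G i x - partial [i] (?p (K_plus \<T> E)) x) * \<nu> $ i) - (\<Sum>i\<in>UNIV. (G i x - partial [i] (?p (K_minus \<T> E)) x) * \<nu> $ i)
        = - (\<Sum>i\<in>UNIV. partial [i] q x * \<nu> $ i)" for x
      unfolding dq[symmetric] by (simp add: sum_2 algebra_simps del: partial.simps)
    then show ?thesis
      unfolding jump_square_integral[OF E tn[OF K(1,2)] tn[OF K(3,4)]] by (simp del: partial.simps)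
  qed
  show "edge_int E (\<lambda>x. (jump \<T> E w x)\<^sup>2) = edge_int E (\<lambda>x. (q x)\<^sup>2)"
    unfolding jump_square_integral[OF E pieces_trace[OF w K(1,2)] pieces_trace[OF w K(3,4)]] q ..
  show "edge_int E (\<lambda>x. (jump \<T> E (pw_deriv \<T> [i] w) x)\<^sup>2) = edge_int E (\<lambda>x. (partial [i] q x)\<^sup>2)"
    using jump_square_integral[OF E pieces_deriv_trace[OF w K(1,2), of "[i]"] pieces_deriv_trace[OF w K(3,4), of "[i]"]]
    by (simp add: dq del: partial.simps)
  show "edge_int E (\<lambda>x. (jump \<T> E (hess_normal \<T> E i w) x)\<^sup>2)
      = edge_int E (\<lambda>x. (\<Sum>j\<in>UNIV. (H (K_plus \<T> E) i j - H (K_minus \<T> E) i j) * \<nu> $ j)\<^sup>2)"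
    unfolding jump_square_integral[OF E th[OF K(1,2)] th[OF K(3,4)]]
    by (simp add: sum_2 algebra_simps)
qed

end

subsection \<open>The residual\<close>

text \<open>The bounded weight is absorbed into the second factor.\<close>

lemma weighted_Cauchy_Schwarz:
  fixes f g \<phi> :: "'a \<Rightarrow> real"
  assumes f: "sq_integrable M A f" and g: "sq_integrable M A g" and A: "A \<in> sets M"
    and \<phi>: "\<phi> \<in> borel_measurable M" "\<And>x. x \<in> A \<Longrightarrow> \<bar>\<phi> x\<bar> \<le> C" and C: "C \<ge> 0"
  shows "set_integrable M A (\<lambda>x. f x * g x * \<phi> x)"
    and "\<bar>LINT x:A|M. f x * g x * \<phi> x\<bar> \<le> C * (sqrt (LINT x:A|M. (f x)\<^sup>2) * sqrt (LINT x:A|M. (g x)\<^sup>2))"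
proof -
  have gm: "(\<lambda>x. indicator A x * g x) \<in> borel_measurable M" "integrable M (\<lambda>x. (indicator A x * g x)\<^sup>2)"
    using g by (auto simp: sq_integrable_alt)
  have eq: "indicator A x * (g x * \<phi> x) = (indicator A x * g x) * \<phi> x" for x by simp
  have m: "(\<lambda>x. (indicator A x * g x) * \<phi> x) \<in> borel_measurable M"
    using gm(1) \<phi>(1) by (rule borel_measurable_times)
  have le: "((indicator A x * g x) * \<phi> x)\<^sup>2 \<le> C\<^sup>2 * (indicator A x * g x)\<^sup>2" for x
  proof (cases "x \<in> A")
    case True
    then have "(\<phi> x)\<^sup>2 \<le> C\<^sup>2" using \<phi>(2) C abs_le_square_iff[of "\<phi> x" C] by simp
    then show ?thesis using True by (simp add: power_mult_distrib mult.commute mult_right_mono)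
  qed simp
  have i: "integrable M (\<lambda>x. ((indicator A x * g x) * \<phi> x)\<^sup>2)"
    by (rule Bochner_Integration.integrable_bound[OF integrable_mult_right[OF gm(2), of "C\<^sup>2"]])
      (use m le in \<open>auto intro!: borel_measurable_power\<close>)
  have s: "sq_integrable M A (\<lambda>x. g x * \<phi> x)"
    unfolding sq_integrable_alt eq using m i by blast
  show "set_integrable M A (\<lambda>x. f x * g x * \<phi> x)"
    using sq_integrable_mult[OF f s] by (simp add: mult.assoc)
  have "(LINT x:A|M. (g x * \<phi> x)\<^sup>2) \<le> C\<^sup>2 * (LINT x:A|M. (g x)\<^sup>2)"
  proof -
    have ind: "indicat_real A x * (h x)\<^sup>2 = (indicat_real A x * h x)\<^sup>2" for x and h :: "'a \<Rightarrow> real"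
      by (simp add: indicator_def)
    have "(LINT x|M. ((indicator A x * g x) * \<phi> x)\<^sup>2) \<le> (LINT x|M. C\<^sup>2 * (indicator A x * g x)\<^sup>2)"
      by (rule integral_mono[OF i integrable_mult_right[OF gm(2), of "C\<^sup>2"] le])
    then show ?thesis
      unfolding set_lebesgue_integral_def real_scaleR_def ind[of _ g] ind[of _ "\<lambda>x. g x * \<phi> x"]
      by (simp only: mult.assoc integral_mult_right_zero)
  qed
  then have "sqrt (LINT x:A|M. (g x * \<phi> x)\<^sup>2) \<le> C * sqrt (LINT x:A|M. (g x)\<^sup>2)"
    using C by (metis real_sqrt_le_mono real_sqrt_mult real_sqrt_abs abs_of_nonneg)
  then have "sqrt (LINT x:A|M. (f x)\<^sup>2) * sqrt (LINT x:A|M. (g x * \<phi> x)\<^sup>2)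
      \<le> sqrt (LINT x:A|M. (f x)\<^sup>2) * (C * sqrt (LINT x:A|M. (g x)\<^sup>2))"
    by (intro mult_left_mono real_sqrt_ge_zero set_integral_square_nonneg)
  then show "\<bar>LINT x:A|M. f x * g x * \<phi> x\<bar> \<le> C * (sqrt (LINT x:A|M. (f x)\<^sup>2) * sqrt (LINT x:A|M. (g x)\<^sup>2))"
    using set_integral_Cauchy_Schwarz[OF f s] by (simp add: mult.assoc mult.left_commute[of C])
qed

text \<open>The bracket at the level of Hessians: for symmetric matrices it is the polarised
  determinant det (P + Q) - det P - det Q.\<close>

definition br :: "(2 \<Rightarrow> 2 \<Rightarrow> real) \<Rightarrow> (2 \<Rightarrow> 2 \<Rightarrow> real) \<Rightarrow> real" where
  "br P Q = P 1 1 * Q 2 2 + P 2 2 * Q 1 1 - 2 * P 1 2 * Q 1 2"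

lemma vk_bracket_br: "vk_bracket D \<eta> \<zeta> x = br (\<lambda>i j. D [i,j] \<eta> x) (\<lambda>i j. D [i,j] \<zeta> x)"
  by (simp add: vk_bracket_def br_def)

definition fro :: "pt set \<Rightarrow> (2 \<Rightarrow> 2 \<Rightarrow> scalar_fn) \<Rightarrow> real" where
  "fro D P = (\<Sum>i\<in>UNIV. \<Sum>j\<in>UNIV. LINT x:D|lebesgue. (P i j x)\<^sup>2)"

lemma fro_component: "sqrt (LINT x:D|lebesgue. (P i j x)\<^sup>2) \<le> sqrt (fro D P)"
proof -
  have "(LINT x:D|lebesgue. (P i j x)\<^sup>2) \<le> fro D P"
    unfolding fro_def sum_2
    using exhaust_2[of i] exhaust_2[of j] set_integral_square_nonneg[of lebesgue D "P 1 1"]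
      set_integral_square_nonneg[of lebesgue D "P 1 2"] set_integral_square_nonneg[of lebesgue D "P 2 1"]
      set_integral_square_nonneg[of lebesgue D "P 2 2"] by auto
  then show ?thesis by simp
qed

lemma fro_nonneg: "fro D P \<ge> 0"
  unfolding fro_def by (intro sum_nonneg set_integral_square_nonneg)

text \<open>The factor 4 is 1 + 1 + 2, the total weight of the three products of entries in
  \<open>br\<close>.\<close>

lemma br_integral_bound:
  assumes P: "\<And>i j. sq_integrable lebesgue D (P i j)" and Q: "\<And>i j. sq_integrable lebesgue D (Q i j)"
    and D: "D \<in> sets lebesgue" and \<phi>: "\<phi> \<in> borel_measurable lebesgue" "\<And>x. \<bar>\<phi> x\<bar> \<le> 1"
  shows "set_integrable lebesgue D (\<lambda>x. br (\<lambda>i j. P i j x) (\<lambda>i j. Q i j x) * \<phi> x)"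
    and "\<bar>LINT x:D|lebesgue. br (\<lambda>i j. P i j x) (\<lambda>i j. Q i j x) * \<phi> x\<bar> \<le> 4 * (sqrt (fro D P) * sqrt (fro D Q))"
proof -
  note cs = weighted_Cauchy_Schwarz[OF P Q D \<phi> zero_le_one]
  have eq: "br (\<lambda>i j. P i j x) (\<lambda>i j. Q i j x) * \<phi> x = P 1 1 x * Q 2 2 x * \<phi> x + P 2 2 x * Q 1 1 x * \<phi> x
      - 2 * (P 1 2 x * Q 1 2 x * \<phi> x)" for x
    by (simp add: br_def algebra_simps)
  have i: "set_integrable lebesgue D (\<lambda>x. P 1 1 x * Q 2 2 x * \<phi> x)" "set_integrable lebesgue D (\<lambda>x. P 2 2 x * Q 1 1 x * \<phi> x)"
    "set_integrable lebesgue D (\<lambda>x. 2 * (P 1 2 x * Q 1 2 x * \<phi> x))"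
    using cs(1) by auto
  show "set_integrable lebesgue D (\<lambda>x. br (\<lambda>i j. P i j x) (\<lambda>i j. Q i j x) * \<phi> x)"
    unfolding eq using i by (intro set_integral_diff(1) set_integral_add(1))
  have b: "\<bar>LINT x:D|lebesgue. P i j x * Q k l x * \<phi> x\<bar> \<le> sqrt (fro D P) * sqrt (fro D Q)" for i j k l
    using cs(2)[of i j k l] mult_mono[OF fro_component[of D P i j] fro_component[of D Q k l]]
    by (simp add: fro_nonneg set_integral_square_nonneg)
  have "(LINT x:D|lebesgue. br (\<lambda>i j. P i j x) (\<lambda>i j. Q i j x) * \<phi> x)
      = (LINT x:D|lebesgue. P 1 1 x * Q 2 2 x * \<phi> x) + (LINT x:D|lebesgue. P 2 2 x * Q 1 1 x * \<phi> x)
        - 2 * (LINT x:D|lebesgue. P 1 2 x * Q 1 2 x * \<phi> x)"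
    unfolding eq using i by (subst set_integral_diff(2)) (auto simp: set_integral_add(1))
  then show "\<bar>LINT x:D|lebesgue. br (\<lambda>i j. P i j x) (\<lambda>i j. Q i j x) * \<phi> x\<bar> \<le> 4 * (sqrt (fro D P) * sqrt (fro D Q))"
    using b[of 1 1 2 2] b[of 2 2 1 1] b[of 1 2 1 2] by linarith
qed

lemma sq_integrable_const:
  assumes "bounded D" "D \<in> sets lebesgue"
  shows "sq_integrable lebesgue (D :: 'a::euclidean_space set) (\<lambda>x. c)"
  using assms by (intro sq_integrable_continuous) auto

text \<open>Cauchy-Schwarz against the constant 1 for each of the four entries, which produces the
  root of the area.\<close>

lemma frobenius_integral_bound:
  assumes P: "\<And>i j. sq_integrable lebesgue D (P i j)" and D: "bounded D" "D \<in> sets lebesgue"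
    and \<phi>: "\<And>i j. \<phi> i j \<in> borel_measurable lebesgue" "\<And>i j x. \<bar>\<phi> i j x\<bar> \<le> C" and C: "C \<ge> 0"
  shows "set_integrable lebesgue D (\<lambda>x. \<Sum>i\<in>UNIV. \<Sum>j\<in>UNIV. P i j x * \<phi> i j x)"
    and "\<bar>LINT x:D|lebesgue. (\<Sum>i\<in>UNIV. \<Sum>j\<in>UNIV. P i j x * \<phi> i j x)\<bar> \<le> 4 * C * sqrt (measure lebesgue D) * sqrt (fro D P)"
proof -
  note cs = weighted_Cauchy_Schwarz[OF P sq_integrable_const[OF D, of 1] D(2) \<phi> C]
  have i: "set_integrable lebesgue D (\<lambda>x. P i j x * \<phi> i j x)" for i j
    using cs(1)[of i j i j] by simp
  show "set_integrable lebesgue D (\<lambda>x. \<Sum>i\<in>UNIV. \<Sum>j\<in>UNIV. P i j x * \<phi> i j x)"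
    unfolding sum_2 using i by (intro set_integral_add(1))
  have one: "(LINT x:D|lebesgue. (1::real)\<^sup>2) = measure lebesgue D"
    using D by (simp add: set_lebesgue_integral_def)
  have b: "\<bar>LINT x:D|lebesgue. P i j x * \<phi> i j x\<bar> \<le> C * sqrt (measure lebesgue D) * sqrt (fro D P)" for i j
  proof -
    have "\<bar>LINT x:D|lebesgue. P i j x * \<phi> i j x\<bar> \<le> C * (sqrt (LINT x:D|lebesgue. (P i j x)\<^sup>2) * sqrt (measure lebesgue D))"
      using cs(2)[of i j i j] unfolding one by simp
    also have "\<dots> \<le> C * (sqrt (fro D P) * sqrt (measure lebesgue D))"
      by (intro mult_left_mono mult_right_mono fro_component C) auto
    finally show ?thesis by (simp add: mult.assoc mult.commute[of "sqrt (fro D P)"])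
  qed
  have "(LINT x:D|lebesgue. (\<Sum>i\<in>UNIV. \<Sum>j\<in>UNIV. P i j x * \<phi> i j x))
      = (LINT x:D|lebesgue. P 1 1 x * \<phi> 1 1 x) + (LINT x:D|lebesgue. P 1 2 x * \<phi> 1 2 x)
        + ((LINT x:D|lebesgue. P 2 1 x * \<phi> 2 1 x) + (LINT x:D|lebesgue. P 2 2 x * \<phi> 2 2 x))"
    unfolding sum_2 using i by (simp add: set_integral_add(1))
  then show "\<bar>LINT x:D|lebesgue. (\<Sum>i\<in>UNIV. \<Sum>j\<in>UNIV. P i j x * \<phi> i j x)\<bar> \<le> 4 * C * sqrt (measure lebesgue D) * sqrt (fro D P)"
    using b[of 1 1] b[of 1 2] b[of 2 1] b[of 2 2] by linarith
qed

text \<open>Covers both equations: (w, y, z, g, r) is (u, u, v, f, 1) for the first and (v, u, u, 0,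
  -1/2) for the second. \<open>wh\<close>, \<open>yh\<close>, \<open>zh\<close> are the discrete
  counterparts.\<close>

locale residual = meshed_domain +
  fixes w y z g :: scalar_fn and r :: real and wh yh zh :: scalar_fn
    and cw cy cz :: "pt set \<Rightarrow> real" and bw by' bz :: "pt set \<Rightarrow> pt" and Hw Hy Hz :: "pt set \<Rightarrow> 2 \<Rightarrow> 2 \<Rightarrow> real"
  assumes w: "w \<in> Hk0 2 \<Omega>" and y: "y \<in> Hk0 2 \<Omega>" and z: "z \<in> Hk0 2 \<Omega>"
    and g: "g \<in> L2 \<Omega>" and r: "\<bar>r\<bar> \<le> 1"
    and weak_equation: "\<And>\<phi>. \<phi> \<in> test_functions \<Omega> \<Longrightarrow> a_form \<Omega> w \<phi>
      = (LINT x:\<Omega>|lebesgue. g x * \<phi> x) + r * (LINT x:\<Omega>|lebesgue. vk_bracket (weak_deriv \<Omega>) y z x * \<phi> x)"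
    and wh: "pieces wh cw bw Hw" and yh: "pieces yh cy by' Hy" and zh: "pieces zh cz bz Hz"
begin

lemma Hs2: "w \<in> Hs (real 2) \<Omega>" "y \<in> Hs (real 2) \<Omega>" "z \<in> Hs (real 2) \<Omega>"
  using w y z by (auto simp: Hk0_def)

lemma hess_sq_integrable:
  assumes "u \<in> Hs (real 2) \<Omega>"
  shows "sq_integrable lebesgue \<Omega> (weak_deriv \<Omega> [i, j] u)"
  using Hs_weak_deriv(1)[OF open_domain assms, of "[i, j]"] by (simp add: L2_iff)

lemma hess_sq_integrable_triangle:
  assumes "u \<in> Hs (real 2) \<Omega>" "K \<in> \<T>"
  shows "sq_integrable lebesgue (interior K) (weak_deriv \<Omega> [i, j] u)"
  by (rule sq_integrable_subset[OF hess_sq_integrable[OF assms(1)] _ interior_triangle_subset[OF assms(2)]]) simp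

lemma seminorm_fro:
  assumes "u \<in> Hs (real 2) \<Omega>" "K \<in> \<T>"
  shows "seminorm_sq 2 (interior K) u = fro (interior K) (\<lambda>i j. weak_deriv \<Omega> [i, j] u)"
proof -
  have "seminorm_sq 2 (interior K) u = (\<Sum>js | length js = 2. LINT x:interior K|lebesgue. (weak_deriv \<Omega> js u x)\<^sup>2)"
    by (rule seminorm_sq_eq[OF open_interior is_weak_deriv_subset[OF Hs_weak_deriv(2)[OF open_domain assms(1)]
          interior_triangle_subset[OF assms(2)]]]) simp
  then show ?thesis unfolding sum_lists_2 fro_def .
qed

lemma seminorm_fro_pieces:
  assumes "pieces uh c b H" "K \<in> \<T>"
  shows "seminorm_sq 2 (interior K) uh = fro (interior K) (\<lambda>i j x. H K i j)"
proof -
  have "(LINT x:interior K|lebesgue. (weak_deriv (interior K) [i,j] uh x)\<^sup>2) = (LINT x:interior K|lebesgue. (H K i j)\<^sup>2)" for i j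
    using pieces_weak_deriv2[OF assms, of i j] by (intro set_integral_lebesgue_cong_AE) (auto elim!: eventually_mono)
  then show ?thesis unfolding seminorm_sq_def sum_lists_2 fro_def by simp
qed

lemma seminorm_fro_error:
  assumes "u \<in> Hs (real 2) \<Omega>" "pieces uh c b H" "K \<in> \<T>"
  shows "seminorm_sq 2 (interior K) (sub_fn u uh) = fro (interior K) (\<lambda>i j x. weak_deriv \<Omega> [i, j] u x - H K i j)"
proof -
  have "(LINT x:interior K|lebesgue. (weak_deriv (interior K) [i,j] (sub_fn u uh) x)\<^sup>2)
      = (LINT x:interior K|lebesgue. (weak_deriv \<Omega> [i, j] u x - H K i j)\<^sup>2)" for i j
  proof (rule set_integral_lebesgue_cong_AE)
    have "AE x in lebesgue. x \<in> interior K \<longrightarrow> weak_deriv (interior K) [i,j] (sub_fn u uh) x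
        = weak_deriv (interior K) [i,j] u x - weak_deriv (interior K) [i,j] uh x"
      by (rule weak_deriv_diff[OF open_interior Hs_weak_deriv(2)[OF open_interior Hs_on_triangle[OF assms(1,3)]]
            Hs_weak_deriv(2)[OF open_interior pieces_Hs[OF assms(2,3), of 2]]]) auto
    moreover have "AE x in lebesgue. x \<in> interior K \<longrightarrow> weak_deriv (interior K) [i,j] u x = weak_deriv \<Omega> [i,j] u x"
      by (rule weak_deriv_on_triangle[OF assms(1,3)]) simp
    ultimately show "AE x in lebesgue. x \<in> interior K \<longrightarrow> (weak_deriv (interior K) [i,j] (sub_fn u uh) x)\<^sup>2
        = (weak_deriv \<Omega> [i, j] u x - H K i j)\<^sup>2"
      using pieces_weak_deriv2[OF assms(2,3), of i j] by eventually_elim auto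
  qed
  then show ?thesis unfolding seminorm_sq_def sum_lists_2 fro_def by simp
qed

text \<open>The Hessian error and the difference of the brackets, tested with \<phi> on one
  triangle. The reversed order \<open>[j, i]\<close> is that of
  \<open>is_weak_deriv_smooth\<close>.\<close>

definition res :: "pt set \<Rightarrow> scalar_fn \<Rightarrow> real" where
  "res K \<phi> = (LINT x:interior K|lebesgue. (\<Sum>i\<in>UNIV. \<Sum>j\<in>UNIV. (weak_deriv \<Omega> [i, j] w x - Hw K i j) * partial [j, i] \<phi> x))
     - r * (LINT x:interior K|lebesgue. (vk_bracket (weak_deriv \<Omega>) y z x - br (Hy K) (Hz K)) * \<phi> x)"

text \<open>The bracket difference is [y - yh, z] + [yh, z - zh], in which each term has one error
  as a factor. In the Hessian part the root of the area is bounded by twice the diameter, which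
  turns 4 into 8.\<close>

lemma res_bound:
  assumes K: "K \<in> \<T>" and \<phi>: "\<phi> \<in> test_functions \<Omega>" "\<And>x. \<bar>\<phi> x\<bar> \<le> 1" "\<And>i j x. \<bar>partial [i, j] \<phi> x\<bar> \<le> B" and B: "B \<ge> 0"
  shows "\<bar>res K \<phi>\<bar> \<le> 8 * B * diameter K * sqrt (seminorm_sq 2 (interior K) (sub_fn w wh))
    + 4 * (sqrt (seminorm_sq 2 (interior K) (sub_fn y yh)) * sqrt (seminorm_sq 2 (interior K) z)
      + sqrt (seminorm_sq 2 (interior K) yh) * sqrt (seminorm_sq 2 (interior K) (sub_fn z zh)))"
proof -
  let ?D = "interior K"
  note D = triangle_interior_bounded[OF triangle[OF K]]
  have sm: "smooth \<phi>" by (rule test_function_smooth[OF \<phi>(1)])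
  have meas: "\<psi> \<in> borel_measurable lebesgue" if "smooth \<psi>" for \<psi>
    using borel_measurable_continuous_onI[OF smooth_continuous_on[OF that]] by (intro measurable_completion) simp
  have sq: "sq_integrable lebesgue ?D (\<lambda>x. weak_deriv \<Omega> [i, j] u x - c)" if "u \<in> Hs (real 2) \<Omega>" for u i j c
    by (intro sq_integrable_diff hess_sq_integrable_triangle[OF that K] sq_integrable_const D)
  have 1: "\<bar>LINT x:?D|lebesgue. (\<Sum>i\<in>UNIV. \<Sum>j\<in>UNIV. (weak_deriv \<Omega> [i, j] w x - Hw K i j) * partial [j, i] \<phi> x)\<bar>
      \<le> 4 * B * sqrt (measure lebesgue ?D) * sqrt (seminorm_sq 2 ?D (sub_fn w wh))"
    unfolding seminorm_fro_error[OF Hs2(1) wh K]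
    by (rule frobenius_integral_bound(2)[OF sq[OF Hs2(1)] D meas[OF smooth_partial[OF sm]] \<phi>(3) B])
  have "measure lebesgue ?D \<le> measure lebesgue K"
    using simplex_compact_convex(1)[OF triangle[OF K]]
    by (intro measure_mono_fmeasurable interior_subset) (auto simp: lmeasurable_compact)
  also have "\<dots> \<le> 4 * (diameter K)\<^sup>2"
    using simplex_compact_convex(1)[OF triangle[OF K]]
    by (intro measure_le_diameter_sq) (auto simp: compact_imp_bounded lmeasurable_compact fmeasurableD)
  finally have "sqrt (measure lebesgue ?D) \<le> 2 * diameter K"
    using triangle_diameter_pos[OF triangle[OF K]] by (intro real_le_lsqrt) (auto simp: power_mult_distrib)
  then have "4 * B * sqrt (measure lebesgue ?D) * sqrt (seminorm_sq 2 ?D (sub_fn w wh))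
      \<le> 4 * B * (2 * diameter K) * sqrt (seminorm_sq 2 ?D (sub_fn w wh))"
    using B by (intro mult_right_mono mult_left_mono) (auto simp: seminorm_sq_nonneg)
  with 1 have 1: "\<bar>LINT x:?D|lebesgue. (\<Sum>i\<in>UNIV. \<Sum>j\<in>UNIV. (weak_deriv \<Omega> [i, j] w x - Hw K i j) * partial [j, i] \<phi> x)\<bar>
      \<le> 8 * B * diameter K * sqrt (seminorm_sq 2 ?D (sub_fn w wh))" by simp
  have split: "(vk_bracket (weak_deriv \<Omega>) y z x - br (Hy K) (Hz K)) * \<phi> x
      = br (\<lambda>i j. weak_deriv \<Omega> [i, j] y x - Hy K i j) (\<lambda>i j. weak_deriv \<Omega> [i, j] z x) * \<phi> x
        + br (Hy K) (\<lambda>i j. weak_deriv \<Omega> [i, j] z x - Hz K i j) * \<phi> x" for x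
    by (simp add: vk_bracket_br br_def algebra_simps)
  note b1 = br_integral_bound[where P = "\<lambda>i j x. weak_deriv \<Omega> [i, j] y x - Hy K i j" and Q = "\<lambda>i j. weak_deriv \<Omega> [i, j] z",
      OF sq[OF Hs2(2)] hess_sq_integrable_triangle[OF Hs2(3) K] D(2) meas[OF sm] \<phi>(2)]
  note b2 = br_integral_bound[where P = "\<lambda>i j x. Hy K i j" and Q = "\<lambda>i j x. weak_deriv \<Omega> [i, j] z x - Hz K i j",
      OF sq_integrable_const[OF D] sq[OF Hs2(3)] D(2) meas[OF sm] \<phi>(2)]
  have eq: "(LINT x:?D|lebesgue. (vk_bracket (weak_deriv \<Omega>) y z x - br (Hy K) (Hz K)) * \<phi> x)
      = (LINT x:?D|lebesgue. br (\<lambda>i j. weak_deriv \<Omega> [i, j] y x - Hy K i j) (\<lambda>i j. weak_deriv \<Omega> [i, j] z x) * \<phi> x)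
      + (LINT x:?D|lebesgue. br (Hy K) (\<lambda>i j. weak_deriv \<Omega> [i, j] z x - Hz K i j) * \<phi> x)" (is "?l = ?a + ?b")
    unfolding split by (rule set_integral_add(2)[OF b1(1) b2(1)])
  have "\<bar>?l\<bar> \<le> \<bar>?a\<bar> + \<bar>?b\<bar>" unfolding eq by (rule abs_triangle_ineq)
  moreover have "\<bar>LINT x:?D|lebesgue. br (\<lambda>i j. weak_deriv \<Omega> [i, j] y x - Hy K i j) (\<lambda>i j. weak_deriv \<Omega> [i, j] z x) * \<phi> x\<bar>
      \<le> 4 * (sqrt (seminorm_sq 2 ?D (sub_fn y yh)) * sqrt (seminorm_sq 2 ?D z))"
    unfolding seminorm_fro_error[OF Hs2(2) yh K] seminorm_fro[OF Hs2(3) K] by (rule b1(2))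
  moreover have "\<bar>LINT x:?D|lebesgue. br (Hy K) (\<lambda>i j. weak_deriv \<Omega> [i, j] z x - Hz K i j) * \<phi> x\<bar>
      \<le> 4 * (sqrt (seminorm_sq 2 ?D yh) * sqrt (seminorm_sq 2 ?D (sub_fn z zh)))"
    unfolding seminorm_fro_error[OF Hs2(3) zh K] seminorm_fro_pieces[OF yh K] by (rule b2(2))
  ultimately have 2: "\<bar>LINT x:?D|lebesgue. (vk_bracket (weak_deriv \<Omega>) y z x - br (Hy K) (Hz K)) * \<phi> x\<bar>
      \<le> 4 * (sqrt (seminorm_sq 2 ?D (sub_fn y yh)) * sqrt (seminorm_sq 2 ?D z)
      + sqrt (seminorm_sq 2 ?D yh) * sqrt (seminorm_sq 2 ?D (sub_fn z zh)))" (is "?X \<le> _")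
    unfolding distrib_left by linarith
  have "\<bar>r\<bar> * ?X \<le> 1 * ?X" using r by (rule mult_right_mono) simp
  then have "\<bar>r * (LINT x:?D|lebesgue. (vk_bracket (weak_deriv \<Omega>) y z x - br (Hy K) (Hz K)) * \<phi> x)\<bar> \<le> ?X"
    by (simp add: abs_mult)
  with 1 2 show ?thesis unfolding res_def by linarith
qed

text \<open>Summation over the mesh allows the weak equation to eliminate \<open>w\<close>,
  \<open>y\<close> and \<open>z\<close>, and the constant discrete Hessians leave the integrals. The
  left side is controlled by the error, while the right side contains only data and discrete
  quantities.\<close>

lemma res_identity:
  assumes \<phi>: "\<phi> \<in> test_functions \<Omega>"
  shows "(\<Sum>K\<in>\<T>. res K \<phi>) = (\<Sum>K\<in>\<T>. (LINT x:interior K|lebesgue. (g x + r * br (Hy K) (Hz K)) * \<phi> x)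
     - (\<Sum>i\<in>UNIV. \<Sum>j\<in>UNIV. Hw K i j * (LINT x:interior K|lebesgue. partial [j, i] \<phi> x)))"
proof -
  have sm: "smooth \<phi>" by (rule test_function_smooth[OF \<phi>])
  note D = bounded_domain lebesgue_domain
  have bm: "sq_integrable lebesgue \<Omega> \<psi>" if "smooth \<psi>" for \<psi>
    by (rule smooth_sq_integrable[OF D that])
  have gL: "sq_integrable lebesgue \<Omega> g" using g by (simp add: L2_iff)
  have iw: "set_integrable lebesgue \<Omega> (\<lambda>x. weak_deriv \<Omega> [i, j] w x * partial [j, i] \<phi> x)" for i j
    by (intro sq_integrable_mult hess_sq_integrable Hs2 bm smooth_partial sm)
  have ip: "set_integrable lebesgue \<Omega> (partial [j, i] \<phi>)" for i j
    by (intro sq_integrable_imp_set_integrable bm smooth_partial sm D)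
  have i\<phi>: "set_integrable lebesgue \<Omega> \<phi>" by (intro sq_integrable_imp_set_integrable bm sm D)
  have ig: "set_integrable lebesgue \<Omega> (\<lambda>x. g x * \<phi> x)" by (intro sq_integrable_mult gL bm sm)
  obtain C where C: "\<And>x. \<bar>\<phi> x\<bar> \<le> C" "C \<ge> 0"
  proof -
    obtain S where S: "compact S" "\<And>x. x \<notin> S \<Longrightarrow> \<phi> x = 0"
      using test_functionE[OF \<phi>] by (metis partial.simps(1))
    have "bounded (\<phi> ` S)" by (intro compact_imp_bounded compact_continuous_image smooth_continuous_on sm S)
    then obtain B where B: "\<forall>x\<in>S. \<bar>\<phi> x\<bar> \<le> B" unfolding bounded_iff by auto
    have "\<bar>\<phi> x\<bar> \<le> max B 0" for x using B S(2)[of x] by (cases "x \<in> S") (auto intro: max.coboundedI1)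
    then show ?thesis using that[of "max B 0"] by simp
  qed
  have ib: "set_integrable lebesgue \<Omega> (\<lambda>x. vk_bracket (weak_deriv \<Omega>) y z x * \<phi> x)"
  proof -
    have m: "\<phi> \<in> borel_measurable lebesgue"
      using borel_measurable_continuous_onI[OF smooth_continuous_on[OF sm]] by (intro measurable_completion) simp
    note t = weighted_Cauchy_Schwarz(1)[OF hess_sq_integrable[OF Hs2(2)] hess_sq_integrable[OF Hs2(3)] D(2) m C(1) C(2)]
    have "set_integrable lebesgue \<Omega> (\<lambda>x. weak_deriv \<Omega> [1, 1] y x * weak_deriv \<Omega> [2, 2] z x * \<phi> x
       + weak_deriv \<Omega> [2, 2] y x * weak_deriv \<Omega> [1, 1] z x * \<phi> x
       - 2 * (weak_deriv \<Omega> [1, 2] y x * weak_deriv \<Omega> [1, 2] z x * \<phi> x))"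
      by (intro set_integral_diff(1) set_integral_add(1) set_integrable_mult_right t)
    then show ?thesis by (simp add: vk_bracket_def algebra_simps)
  qed
  have sub: "set_integrable lebesgue (interior K) f" if "set_integrable lebesgue \<Omega> f" "K \<in> \<T>" for f :: scalar_fn and K
    by (rule set_integrable_subset[OF that(1) _ interior_triangle_subset[OF that(2)]]) simp
  have A: "a_form \<Omega> w \<phi> = (LINT x:\<Omega>|lebesgue. \<Sum>i\<in>UNIV. \<Sum>j\<in>UNIV. weak_deriv \<Omega> [i, j] w x * partial [j, i] \<phi> x)"
    unfolding a_form_def
  proof (rule set_integral_lebesgue_cong_AE)
    have "AE x in lebesgue. x \<in> \<Omega> \<longrightarrow> weak_deriv \<Omega> [i, j] \<phi> x = partial [j, i] \<phi> x" for i j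
      using weak_deriv_AE_eq[OF open_domain is_weak_deriv_smooth[OF sm], of "[i, j]"] by (simp del: partial.simps)
    from this[of 1 1] this[of 1 2] this[of 2 1] this[of 2 2]
    show "AE x in lebesgue. x \<in> \<Omega> \<longrightarrow> (\<Sum>i\<in>UNIV. \<Sum>j\<in>UNIV. weak_deriv \<Omega> [i, j] w x * weak_deriv \<Omega> [i, j] \<phi> x)
        = (\<Sum>i\<in>UNIV. \<Sum>j\<in>UNIV. weak_deriv \<Omega> [i, j] w x * partial [j, i] \<phi> x)"
      by eventually_elim (simp add: sum_2 del: partial.simps)
  qed
  define W where "W x = (\<Sum>i\<in>UNIV. \<Sum>j\<in>UNIV. weak_deriv \<Omega> [i, j] w x * partial [j, i] \<phi> x)" for x
  have iW: "set_integrable lebesgue \<Omega> W"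
    unfolding W_def sum_2 by (intro set_integral_add(1) iw)
  have global: "(\<Sum>K\<in>\<T>. LINT x:interior K|lebesgue. W x)
      = (\<Sum>K\<in>\<T>. LINT x:interior K|lebesgue. g x * \<phi> x)
        + r * (\<Sum>K\<in>\<T>. LINT x:interior K|lebesgue. vk_bracket (weak_deriv \<Omega>) y z x * \<phi> x)"
    using weak_equation[OF \<phi>] unfolding A W_def[symmetric]
      set_integral_mesh[OF iW] set_integral_mesh[OF ig] set_integral_mesh[OF ib] .
  have r1: "(LINT x:interior K|lebesgue. (\<Sum>i\<in>UNIV. \<Sum>j\<in>UNIV. (weak_deriv \<Omega> [i, j] w x - Hw K i j) * partial [j, i] \<phi> x))
      = (LINT x:interior K|lebesgue. W x) - (\<Sum>i\<in>UNIV. \<Sum>j\<in>UNIV. Hw K i j * (LINT x:interior K|lebesgue. partial [j, i] \<phi> x))"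
    if K: "K \<in> \<T>" for K
  proof -
    have "(LINT x:interior K|lebesgue. (\<Sum>i\<in>UNIV. \<Sum>j\<in>UNIV. (weak_deriv \<Omega> [i, j] w x - Hw K i j) * partial [j, i] \<phi> x))
        = (LINT x:interior K|lebesgue. W x - (\<Sum>i\<in>UNIV. \<Sum>j\<in>UNIV. Hw K i j * partial [j, i] \<phi> x))"
      unfolding W_def by (rule arg_cong[of _ _ "set_lebesgue_integral lebesgue (interior K)"])
        (simp add: sum_2 algebra_simps del: partial.simps)
    also have "\<dots> = (LINT x:interior K|lebesgue. W x) - (LINT x:interior K|lebesgue. \<Sum>i\<in>UNIV. \<Sum>j\<in>UNIV. Hw K i j * partial [j, i] \<phi> x)"
      unfolding sum_2 by (intro set_integral_diff(2) sub iW K set_integral_add(1) set_integrable_mult_right ip)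
    also have "(LINT x:interior K|lebesgue. \<Sum>i\<in>UNIV. \<Sum>j\<in>UNIV. Hw K i j * partial [j, i] \<phi> x)
        = (\<Sum>i\<in>UNIV. \<Sum>j\<in>UNIV. Hw K i j * (LINT x:interior K|lebesgue. partial [j, i] \<phi> x))"
      unfolding sum_2 using sub[OF ip K] by (simp add: set_integral_add(1) del: partial.simps)
    finally show ?thesis .
  qed
  have r2: "(LINT x:interior K|lebesgue. (vk_bracket (weak_deriv \<Omega>) y z x - br (Hy K) (Hz K)) * \<phi> x)
      = (LINT x:interior K|lebesgue. vk_bracket (weak_deriv \<Omega>) y z x * \<phi> x) - br (Hy K) (Hz K) * (LINT x:interior K|lebesgue. \<phi> x)"
    if K: "K \<in> \<T>" for K
    using sub[OF ib K] sub[OF i\<phi> K] by (simp add: left_diff_distrib)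
  have r3: "(LINT x:interior K|lebesgue. (g x + r * br (Hy K) (Hz K)) * \<phi> x)
      = (LINT x:interior K|lebesgue. g x * \<phi> x) + r * br (Hy K) (Hz K) * (LINT x:interior K|lebesgue. \<phi> x)"
    if K: "K \<in> \<T>" for K
    using sub[OF ig K] sub[OF i\<phi> K] by (simp add: distrib_right)
  have "(\<Sum>K\<in>\<T>. res K \<phi>) = (\<Sum>K\<in>\<T>. (LINT x:interior K|lebesgue. W x)
      - (\<Sum>i\<in>UNIV. \<Sum>j\<in>UNIV. Hw K i j * (LINT x:interior K|lebesgue. partial [j, i] \<phi> x))
      - r * (LINT x:interior K|lebesgue. vk_bracket (weak_deriv \<Omega>) y z x * \<phi> x)
      + r * br (Hy K) (Hz K) * (LINT x:interior K|lebesgue. \<phi> x))"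
  proof (rule sum.cong[OF refl])
    fix K assume K: "K \<in> \<T>"
    show "res K \<phi> = (LINT x:interior K|lebesgue. W x)
      - (\<Sum>i\<in>UNIV. \<Sum>j\<in>UNIV. Hw K i j * (LINT x:interior K|lebesgue. partial [j, i] \<phi> x))
      - r * (LINT x:interior K|lebesgue. vk_bracket (weak_deriv \<Omega>) y z x * \<phi> x)
      + r * br (Hy K) (Hz K) * (LINT x:interior K|lebesgue. \<phi> x)"
      unfolding res_def r1[OF K] r2[OF K] by (simp add: right_diff_distrib del: partial.simps)
  qed
  also have "\<dots> = (\<Sum>K\<in>\<T>. (LINT x:interior K|lebesgue. (g x + r * br (Hy K) (Hz K)) * \<phi> x)
     - (\<Sum>i\<in>UNIV. \<Sum>j\<in>UNIV. Hw K i j * (LINT x:interior K|lebesgue. partial [j, i] \<phi> x)))"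
    using global by (simp add: r3 sum.distrib sum_subtractf sum_distrib_left del: partial.simps)
  finally show ?thesis .
qed

end

subsection \<open>Local efficiency\<close>

text \<open>The squared factor is \<open>c1 * c2\<close> in the proof of
  \<open>volume_estimate\<close>; 2 and 16 come from splitting squares and from the area bound 4
  h^2.\<close>

definition vol_const :: "real \<Rightarrow> real \<Rightarrow> real" where
  "vol_const \<kappa> B = 2 + 16 * (16 / (\<kappa>\<^sup>2 * (LINT t|lborel. bump t)\<^sup>2) * (8 * (64 * B\<^sup>2 / \<kappa>\<^sup>2 + 1) + 2))\<^sup>2"

text \<open>The squared factor is \<open>c2 / a\<close> in the proof of
  \<open>edge_estimate\<close>; 4 comes from splitting the square of a sum of four terms.\<close>

definition edge_const :: "real \<Rightarrow> real \<Rightarrow> real" where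
  "edge_const \<kappa> B = 4 * ((8 * (32 * B\<^sup>2 / \<kappa> ^ 3 + 1)) / (bump 0 * (LINT t|lborel. bump t)))\<^sup>2"

text \<open>\<open>M\<close> bounds those factors in the split bracket that are not errors.
  \<open>small\<close> permits powers of the mesh size to be dropped where the bracket scales better
  than the Hessian.\<close>

locale shape_regular_residual = residual +
  fixes \<kappa> M B :: real
  assumes \<kappa>: "\<kappa> > 0" and inscribed: "\<And>K. K \<in> \<T> \<Longrightarrow> \<exists>x. cball x (\<kappa> * diameter K) \<subseteq> K"
    and small: "\<And>K. K \<in> \<T> \<Longrightarrow> diameter K \<le> 1"
    and M: "M \<ge> 0" "\<And>K. K \<in> \<T> \<Longrightarrow> sqrt (seminorm_sq 2 (interior K) z) \<le> M"
      "\<And>K. K \<in> \<T> \<Longrightarrow> sqrt (seminorm_sq 2 (interior K) yh) \<le> M"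
    and B: "B \<ge> 1" "profile B bump bump' bump''"
      "profile B (\<lambda>t. t * bump t) (\<lambda>t. bump t + t * bump' t) (\<lambda>t. 2 * bump' t + t * bump'' t)"
begin

definition err :: "pt set \<Rightarrow> real" where
  "err K = sqrt (seminorm_sq 2 (interior K) (sub_fn w wh))
     + M * (sqrt (seminorm_sq 2 (interior K) (sub_fn y yh)) + sqrt (seminorm_sq 2 (interior K) (sub_fn z zh)))"

definition vol :: "pt set \<Rightarrow> real" where
  "vol K = (LINT x:interior K|lebesgue. (g x + r * br (Hy K) (Hz K))\<^sup>2)"

definition osc :: "pt set \<Rightarrow> real" where
  "osc K = (LINT x:interior K|lebesgue. (g x - mean_on K g)\<^sup>2)"

lemma err_nonneg: "err K \<ge> 0"
  unfolding err_def using M(1) by (simp add: seminorm_sq_nonneg)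

lemma vol_nonneg: "vol K \<ge> 0" and osc_nonneg: "osc K \<ge> 0"
  unfolding vol_def osc_def by (rule set_integral_square_nonneg)+

text \<open>The Hessian part scales like b times the diameter and the bracket part like 1; the sum
  of both is a common factor.\<close>

lemma res_err_bound:
  assumes K: "K \<in> \<T>" and \<phi>: "\<phi> \<in> test_functions \<Omega>" "\<And>x. \<bar>\<phi> x\<bar> \<le> 1" "\<And>i j x. \<bar>partial [i, j] \<phi> x\<bar> \<le> b"
  shows "\<bar>res K \<phi>\<bar> \<le> 8 * (b * diameter K + 1) * err K"
proof -
  have b: "b \<ge> 0" using \<phi>(3)[of 1 1 0] by linarith
  let ?w = "sqrt (seminorm_sq 2 (interior K) (sub_fn w wh))"
  let ?y = "sqrt (seminorm_sq 2 (interior K) (sub_fn y yh))"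
  let ?z = "sqrt (seminorm_sq 2 (interior K) (sub_fn z zh))"
  have nn: "?w \<ge> 0" "?y \<ge> 0" "?z \<ge> 0" by (simp_all add: seminorm_sq_nonneg)
  have bh: "b * diameter K \<ge> 0" using b triangle_diameter_pos[OF triangle[OF K]] by simp
  have "\<bar>res K \<phi>\<bar> \<le> 8 * b * diameter K * ?w + 4 * (?y * sqrt (seminorm_sq 2 (interior K) z) + sqrt (seminorm_sq 2 (interior K) yh) * ?z)"
    by (rule res_bound[OF K \<phi> b])
  also have "\<dots> \<le> 8 * b * diameter K * ?w + 4 * (?y * M + M * ?z)"
    using M(2,3)[OF K] nn by (intro add_left_mono mult_left_mono add_mono mult_right_mono) auto
  also have "\<dots> = 8 * (b * diameter K) * ?w + 4 * (M * (?y + ?z))" by (simp add: algebra_simps)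
  also have "\<dots> \<le> 8 * (b * diameter K + 1) * ?w + 8 * (b * diameter K + 1) * (M * (?y + ?z))"
    using nn M(1) bh by (intro add_mono mult_right_mono mult_nonneg_nonneg add_nonneg_nonneg) auto
  also have "\<dots> = 8 * (b * diameter K + 1) * err K" by (simp add: err_def algebra_simps)
  finally show ?thesis .
qed

lemma res_identity_local:
  assumes \<phi>: "\<phi> \<in> test_functions \<Omega>" and S: "S \<subseteq> \<T>"
    and zero: "\<And>K x js. K \<in> \<T> - S \<Longrightarrow> x \<in> interior K \<Longrightarrow> partial js \<phi> x = 0"
  shows "(\<Sum>K\<in>S. res K \<phi>) = (\<Sum>K\<in>S. (LINT x:interior K|lebesgue. (g x + r * br (Hy K) (Hz K)) * \<phi> x)
     - (\<Sum>i\<in>UNIV. \<Sum>j\<in>UNIV. Hw K i j * (LINT x:interior K|lebesgue. partial [j, i] \<phi> x)))"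
proof -
  have z: "(LINT x:interior K|lebesgue. f x * partial js \<phi> x) = 0" if "K \<in> \<T> - S" for K js and f :: scalar_fn
  proof -
    have "(LINT x:interior K|lebesgue. f x * partial js \<phi> x) = (LINT x:interior K|lebesgue. 0)"
      by (rule set_lebesgue_integral_cong) (use zero[OF that] in auto)
    then show ?thesis by simp
  qed
  have zs: "(LINT x:interior K|lebesgue. (\<Sum>i\<in>UNIV. \<Sum>j\<in>UNIV. f i j x * partial [j, i] \<phi> x)) = 0"
    if "K \<in> \<T> - S" for K and f :: "2 \<Rightarrow> 2 \<Rightarrow> scalar_fn"
  proof -
    have "(LINT x:interior K|lebesgue. (\<Sum>i\<in>UNIV. \<Sum>j\<in>UNIV. f i j x * partial [j, i] \<phi> x)) = (LINT x:interior K|lebesgue. 0)"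
      by (rule set_lebesgue_integral_cong) (use zero[OF that] in \<open>auto simp del: partial.simps\<close>)
    then show ?thesis by simp
  qed
  have 1: "res K \<phi> = 0" if "K \<in> \<T> - S" for K
    unfolding res_def using zs[OF that, of "\<lambda>i j x. weak_deriv \<Omega> [i, j] w x - Hw K i j"]
      z[OF that, of "\<lambda>x. vk_bracket (weak_deriv \<Omega>) y z x - br (Hy K) (Hz K)" "[]"]
    by (simp del: partial.simps add: partial.simps(1))
  have 2: "(LINT x:interior K|lebesgue. (g x + r * br (Hy K) (Hz K)) * \<phi> x)
     - (\<Sum>i\<in>UNIV. \<Sum>j\<in>UNIV. Hw K i j * (LINT x:interior K|lebesgue. partial [j, i] \<phi> x)) = 0" if "K \<in> \<T> - S" for K
    using z[OF that, of "\<lambda>x. g x + r * br (Hy K) (Hz K)" "[]"] z[OF that, of "\<lambda>x. 1"]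
    by (simp del: partial.simps add: partial.simps(1))
  have "(\<Sum>K\<in>S. res K \<phi>) = (\<Sum>K\<in>\<T>. res K \<phi>)"
    by (rule sum.mono_neutral_left[OF finite_mesh S]) (use 1 in blast)
  also have "\<dots> = (\<Sum>K\<in>S. (LINT x:interior K|lebesgue. (g x + r * br (Hy K) (Hz K)) * \<phi> x)
     - (\<Sum>i\<in>UNIV. \<Sum>j\<in>UNIV. Hw K i j * (LINT x:interior K|lebesgue. partial [j, i] \<phi> x)))"
    unfolding res_identity[OF \<phi>] by (rule sum.mono_neutral_right[OF finite_mesh S]) (use 2 in blast)
  finally show ?thesis .
qed

lemma test_function_integral_bound:
  assumes K: "K \<in> \<T>" and f: "sq_integrable lebesgue (interior K) f" and \<phi>: "\<phi> \<in> test_functions \<Omega>" "\<And>x. \<bar>\<phi> x\<bar> \<le> 1"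
  shows "\<bar>LINT x:interior K|lebesgue. f x * \<phi> x\<bar> \<le> 2 * diameter K * sqrt (LINT x:interior K|lebesgue. (f x)\<^sup>2)"
    and "sqrt (measure lebesgue (interior K)) \<le> 2 * diameter K"
proof -
  let ?D = "interior K"
  note D = triangle_interior_bounded[OF triangle[OF K]]
  have m: "\<phi> \<in> borel_measurable lebesgue"
    using borel_measurable_continuous_onI[OF smooth_continuous_on[OF test_function_smooth[OF \<phi>(1)]]]
    by (intro measurable_completion) simp
  have "measure lebesgue ?D \<le> measure lebesgue K"
    using simplex_compact_convex(1)[OF triangle[OF K]]
    by (intro measure_mono_fmeasurable interior_subset) (auto simp: lmeasurable_compact)
  also have "\<dots> \<le> 4 * (diameter K)\<^sup>2"
    using simplex_compact_convex(1)[OF triangle[OF K]]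
    by (intro measure_le_diameter_sq) (auto simp: compact_imp_bounded lmeasurable_compact fmeasurableD)
  finally show d: "sqrt (measure lebesgue ?D) \<le> 2 * diameter K"
    using triangle_diameter_pos[OF triangle[OF K]] by (intro real_le_lsqrt) (auto simp: power_mult_distrib)
  have "\<bar>LINT x:?D|lebesgue. f x * 1 * \<phi> x\<bar> \<le> 1 * (sqrt (LINT x:?D|lebesgue. (f x)\<^sup>2) * sqrt (LINT x:?D|lebesgue. 1\<^sup>2))"
    by (rule weighted_Cauchy_Schwarz(2)[OF f sq_integrable_const[OF D] D(2) m \<phi>(2)]) auto
  also have "(LINT x:?D|lebesgue. (1::real)\<^sup>2) = measure lebesgue ?D"
    using D by (simp add: set_lebesgue_integral_def)
  also have "1 * (sqrt (LINT x:?D|lebesgue. (f x)\<^sup>2) * sqrt (measure lebesgue ?D)) \<le> 1 * (sqrt (LINT x:?D|lebesgue. (f x)\<^sup>2) * (2 * diameter K))"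
    using d by (intro mult_left_mono) (auto simp: set_integral_square_nonneg)
  finally show "\<bar>LINT x:?D|lebesgue. f x * \<phi> x\<bar> \<le> 2 * diameter K * sqrt (LINT x:?D|lebesgue. (f x)\<^sup>2)"
    by (simp add: mult.commute)
qed

lemma g_sq_integrable: "K \<in> \<T> \<Longrightarrow> sq_integrable lebesgue (interior K) (\<lambda>x. g x + c)"
proof -
  assume K: "K \<in> \<T>"
  have "sq_integrable lebesgue (interior K) g"
    using g sq_integrable_subset[OF _ _ interior_triangle_subset[OF K], of lebesgue g] by (simp add: L2_iff)
  from sq_integrable_lincomb[OF this sq_integrable_const[OF triangle_interior_bounded[OF triangle[OF K]], of c], of 1 1]
  show ?thesis by simp
qed

text \<open>With \<open>g\<close> replaced by its mean the element residual is a constant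
  \<open>A\<close>. Testing with a bump isolates \<open>A\<close> times the integral of the bump,
  which is comparable to h^2, up to error and oscillation. The power h^3 matches h^2 times the L^2
  norm of a constant on a set of area h^2.\<close>

lemma volume_estimate:
  assumes K: "K \<in> \<T>"
  shows "diameter K ^ 4 * vol K \<le> vol_const \<kappa> B * ((err K)\<^sup>2 + diameter K ^ 4 * osc K)"
proof -
  define h where "h = diameter K"
  have h: "0 < h" "h \<le> 1" using triangle_diameter_pos[OF triangle[OF K]] small[OF K] by (auto simp: h_def)
  define b0 where "b0 = (LINT t|lborel. bump t)"
  have b0: "b0 > 0" unfolding b0_def by (rule bump_integral_pos)
  obtain x0 where x0: "cball x0 (\<kappa> * h) \<subseteq> K" using inscribed[OF K] by (auto simp: h_def)
  \<comment> \<open>A quarter of the inscribed radius, so that the support radius 2 \<rho> stays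
    strictly inside the inscribed ball.\<close>
  define \<rho> where "\<rho> = \<kappa> * h / 4"
  have \<rho>: "\<rho> > 0" using \<kappa> h by (simp add: \<rho>_def)
  let ?e1 = "axis 1 1 :: pt" and ?e2 = "axis 2 1 :: pt"
  have on: "norm ?e1 = 1" "norm ?e2 = 1" "?e1 \<bullet> ?e2 = 0" by (simp_all add: inner_axis_axis)
  define \<phi> where "\<phi> = tensor x0 ?e1 ?e2 \<rho> bump bump"
  have sub: "cball x0 (2 * \<rho>) \<subseteq> interior K"
  proof -
    have "cball x0 (2 * \<rho>) \<subseteq> ball x0 (\<kappa> * h)" using mult_pos_pos[OF \<kappa> h(1)] by (auto simp: \<rho>_def)
    also have "\<dots> \<subseteq> interior K" using x0 ball_subset_cball by (intro interior_maximal) auto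
    finally show ?thesis .
  qed
  have tf: "\<phi> \<in> test_functions (interior K)"
    unfolding \<phi>_def
    by (rule test_functionI[OF smooth_tensor_bump(1) compact_cball sub tensor_outside[OF B(2) B(2) \<rho> on]])
  then have tf\<Omega>: "\<phi> \<in> test_functions \<Omega>" using test_functions_mono[OF interior_triangle_subset[OF K]] by blast
  have bd: "\<bar>\<phi> x\<bar> \<le> 1" for x
    unfolding \<phi>_def tensor_def abs_mult using bump_bounds by (intro mult_le_one) auto
  have bd2: "\<bar>partial [i, j] \<phi> x\<bar> \<le> 4 * B\<^sup>2 / \<rho>\<^sup>2" for i j x
    unfolding \<phi>_def by (rule partial2_tensor_bound[OF B(2) B(2) B(1) on(1,2) \<rho>])
  let ?c = "r * br (Hy K) (Hz K)"
  have "(\<Sum>K\<in>{K}. res K \<phi>) = (\<Sum>K\<in>{K}. (LINT x:interior K|lebesgue. (g x + r * br (Hy K) (Hz K)) * \<phi> x)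
     - (\<Sum>i\<in>UNIV. \<Sum>j\<in>UNIV. Hw K i j * (LINT x:interior K|lebesgue. partial [j, i] \<phi> x)))"
  proof (rule res_identity_local[OF tf\<Omega>])
    fix K' x js assume "K' \<in> \<T> - {K}" "x \<in> interior K'"
    then have "x \<notin> interior K" using interiors_disjoint[OF K, of K'] by auto
    then show "partial js \<phi> x = 0" by (rule test_function_outside[OF tf])
  qed (use K in auto)
  \<comment> \<open>The discrete Hessian is constant and the bump is supported in the triangle, so
    the Hessian drops out of the residual.\<close>
  moreover have "(LINT x:interior K|lebesgue. partial [j, i] \<phi> x) = 0" for i j
  proof -
    have "(LINT x:interior K|lebesgue. partial [j, i] \<phi> x) = (LINT x|lebesgue. partial [j] (partial [i] \<phi>) x)"
      using test_function_outside[OF tf, of _ "[j, i]"] by (subst set_integral_supported) auto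
    also have "\<dots> = 0"
      using test_functions_mono[OF subset_UNIV] test_function_partial[OF tf] by (intro integral_partial_eq_0) blast
    finally show ?thesis .
  qed
  ultimately have res: "res K \<phi> = (LINT x:interior K|lebesgue. (g x + ?c) * \<phi> x)" by (simp del: partial.simps)
  define m where "m = mean_on K g"
  define A where "A = m + ?c"
  have fsq: "sq_integrable lebesgue (interior K) (\<lambda>x. g x - m)" using g_sq_integrable[OF K, of "- m"] by simp
  have \<phi>int: "set_integrable lebesgue (interior K) \<phi>"
    using test_function_integrable[OF tf smooth_locally_integrable[OF smooth_const], of 1] by simp
  have gint: "set_integrable lebesgue (interior K) (\<lambda>x. (g x - m) * \<phi> x)"
    by (rule sq_integrable_mult[OF fsq smooth_sq_integrable[OF triangle_interior_bounded[OF triangle[OF K]] test_function_smooth[OF tf]]])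
  have "(LINT x:interior K|lebesgue. (g x + ?c) * \<phi> x) = (LINT x:interior K|lebesgue. A * \<phi> x + (g x - m) * \<phi> x)"
    by (simp add: A_def algebra_simps)
  also have "\<dots> = A * (LINT x:interior K|lebesgue. \<phi> x) + (LINT x:interior K|lebesgue. (g x - m) * \<phi> x)"
    using \<phi>int gint by simp
  also have "(LINT x:interior K|lebesgue. \<phi> x) = (LINT x|lebesgue. \<phi> x)"
    using test_function_outside[OF tf, of _ "[]"] by (intro set_integral_supported) simp
  also have "\<dots> = \<rho>\<^sup>2 * (b0 * b0)"
    unfolding \<phi>_def b0_def by (rule integral_tensor[OF on \<rho> tf[unfolded \<phi>_def]])
  finally have "A * (\<rho>\<^sup>2 * (b0 * b0)) = res K \<phi> - (LINT x:interior K|lebesgue. (g x - m) * \<phi> x)"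
    using res by simp
  then have "\<bar>A\<bar> * (\<rho>\<^sup>2 * (b0 * b0)) = \<bar>res K \<phi> - (LINT x:interior K|lebesgue. (g x - m) * \<phi> x)\<bar>"
    by (metis abs_mult abs_of_nonneg mult_nonneg_nonneg zero_le_power2 zero_le_square)
  also have "\<dots> \<le> 8 * (4 * B\<^sup>2 / \<rho>\<^sup>2 * h + 1) * err K + 2 * h * sqrt (osc K)"
    using res_err_bound[OF K tf\<Omega> bd bd2] test_function_integral_bound(1)[OF K fsq tf\<Omega> bd]
    unfolding osc_def m_def h_def by linarith
  finally have main: "\<bar>A\<bar> * (\<rho>\<^sup>2 * (b0 * b0)) \<le> 8 * (4 * B\<^sup>2 / \<rho>\<^sup>2 * h + 1) * err K + 2 * h * sqrt (osc K)" .
  let ?o = "sqrt (osc K)"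
  have o: "?o \<ge> 0" using osc_nonneg by simp
  \<comment> \<open>Chosen so that \<open>c1\<close> times \<rho>^2 b0^2 equals h^2.\<close>
  define c1 where "c1 = 16 / (\<kappa>\<^sup>2 * b0\<^sup>2)"
  have c1: "c1 > 0" unfolding c1_def using \<kappa> b0 by simp
  define c2 where "c2 = 8 * (64 * B\<^sup>2 / \<kappa>\<^sup>2 + 1) + 2"
  have "\<bar>A\<bar> * h ^ 3 = c1 * h * (\<bar>A\<bar> * (\<rho>\<^sup>2 * (b0 * b0)))"
    using \<kappa> b0 h by (simp add: c1_def \<rho>_def power2_eq_square power3_eq_cube field_simps)
  also have "\<dots> \<le> c1 * h * (8 * (4 * B\<^sup>2 / \<rho>\<^sup>2 * h + 1) * err K + 2 * h * ?o)"
    using main c1 h by (intro mult_left_mono) auto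
  also have "\<dots> = c1 * (8 * (64 * B\<^sup>2 / \<kappa>\<^sup>2 + h) * err K + 2 * (h\<^sup>2 * ?o))"
    using \<kappa> h by (simp add: \<rho>_def power2_eq_square field_simps)
  \<comment> \<open>Here h <= 1 is used; \<open>c2\<close> dominates the coefficients of both the
    error and the oscillation.\<close>
  also have "\<dots> \<le> c1 * (c2 * err K + c2 * (h\<^sup>2 * ?o))"
    using c1 h err_nonneg[of K] o zero_le_divide_iff[of "64 * B\<^sup>2" "\<kappa>\<^sup>2"]
    unfolding c2_def by (intro mult_left_mono add_mono mult_right_mono) auto
  finally have A3: "\<bar>A\<bar> * h ^ 3 \<le> (c1 * c2) * (err K + h\<^sup>2 * ?o)" by (simp add: algebra_simps)
  have "(\<bar>A\<bar> * h ^ 3)\<^sup>2 \<le> ((c1 * c2) * (err K + h\<^sup>2 * ?o))\<^sup>2"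
    using A3 h by (intro power_mono) auto
  also have "\<dots> \<le> (c1 * c2)\<^sup>2 * (2 * ((err K)\<^sup>2 + h ^ 4 * osc K))"
  proof -
    have "(err K + h\<^sup>2 * ?o)\<^sup>2 \<le> 2 * ((err K)\<^sup>2 + (h\<^sup>2 * ?o)\<^sup>2)"
      using sum_squares_bound[of "err K" "h\<^sup>2 * ?o"] by (simp add: power2_sum)
    also have "(h\<^sup>2 * ?o)\<^sup>2 = h ^ 4 * osc K" using osc_nonneg[of K] by (simp add: power_mult_distrib)
    finally show ?thesis unfolding power_mult_distrib[of "c1 * c2"] by (intro mult_left_mono) auto
  qed
  finally have A6: "A\<^sup>2 * h ^ 6 \<le> (c1 * c2)\<^sup>2 * (2 * ((err K)\<^sup>2 + h ^ 4 * osc K))"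
    by (simp add: power_mult_distrib)
  have "vol K = (LINT x:interior K|lebesgue. (1 * (g x - m) + A * 1)\<^sup>2)"
    unfolding vol_def A_def by (simp add: algebra_simps)
  also have "\<dots> \<le> 2 * 1\<^sup>2 * (LINT x:interior K|lebesgue. (g x - m)\<^sup>2) + 2 * A\<^sup>2 * (LINT x:interior K|lebesgue. 1\<^sup>2)"
    by (intro set_integral_lincomb_square_le fsq sq_integrable_const triangle_interior_bounded triangle K)
  also have "(LINT x:interior K|lebesgue. (1::real)\<^sup>2) = measure lebesgue (interior K)"
    using triangle_interior_bounded[OF triangle[OF K]] by (simp add: set_lebesgue_integral_def)
  also have "\<dots> \<le> 4 * h\<^sup>2"
    using test_function_integral_bound(2)[OF K fsq tf\<Omega> bd] h unfolding h_def[symmetric]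
    by (auto dest!: sqrt_le_D simp: power_mult_distrib)
  finally have "vol K \<le> 2 * osc K + 8 * A\<^sup>2 * h\<^sup>2"
    by (simp add: osc_def m_def mult_left_mono)
  then have "h ^ 4 * vol K \<le> h ^ 4 * (2 * osc K + 8 * A\<^sup>2 * h\<^sup>2)"
    using h by (intro mult_left_mono) auto
  also have "\<dots> = 2 * (h ^ 4 * osc K) + 8 * (A\<^sup>2 * h ^ 6)"
    by (simp add: algebra_simps eval_nat_numeral)
  also have "\<dots> \<le> 2 * ((err K)\<^sup>2 + h ^ 4 * osc K) + 8 * ((c1 * c2)\<^sup>2 * (2 * ((err K)\<^sup>2 + h ^ 4 * osc K)))"
    using A6 by (intro add_mono mult_left_mono) auto
  also have "\<dots> = vol_const \<kappa> B * ((err K)\<^sup>2 + h ^ 4 * osc K)"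
    unfolding vol_const_def c1_def c2_def b0_def by (simp add: algebra_simps)
  finally show ?thesis by (simp add: h_def)
qed

end

context shape_regular_residual
begin

lemma edge_diameter_bounds:
  assumes "K \<in> \<T>" "E edge_of K"
  shows "0 < diameter E" "diameter E \<le> diameter K" "2 * \<kappa> * diameter K \<le> diameter E"
proof -
  obtain p q c where *: "E = closed_segment p q" "K = convex hull {p, q, c}"
    "cross2 (q - p) (c - p) \<noteq> 0" "p \<noteq> q" "diameter E = dist p q"
    using edge_endpoints[OF triangle[OF assms(1)] assms(2)] by metis
  show "0 < diameter E" using * by simp
  show "diameter E \<le> diameter K"
    by (rule diameter_subset[OF edge_of_imp_subset[OF assms(2)] compact_imp_bounded[OF simplex_compact_convex(1)[OF triangle[OF assms(1)]]]])
  obtain x where "cball x (\<kappa> * diameter K) \<subseteq> K" using inscribed[OF assms(1)] by blast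
  from inradius_le_edge[OF *(3) this[unfolded *(2)]]
  show "2 * \<kappa> * diameter K \<le> diameter E"
    using \<kappa> triangle_diameter_pos[OF triangle[OF assms(1)]] * by simp
qed

text \<open>Both neighbours contain a ball of radius \<delta>, so each contains its half disc at the
  midpoint of the edge. The second triangle lies on the far side, since otherwise a point near the
  midpoint would be interior to both.\<close>

lemma edge_neighbourhood:
  assumes E: "E \<in> interior_edges \<T>" and pq: "E = closed_segment p q"
    and \<nu>: "\<nu> = edge_normal \<T> E" and \<delta>: "0 < \<delta>" "\<delta> \<le> \<kappa> * diameter E"
  shows "\<And>x. norm (x - midpoint p q) < \<delta> \<Longrightarrow> \<nu> \<bullet> (x - midpoint p q) < 0 \<Longrightarrow> x \<in> interior (K_plus \<T> E)"
    and "\<And>x. norm (x - midpoint p q) < \<delta> \<Longrightarrow> \<nu> \<bullet> (x - midpoint p q) > 0 \<Longrightarrow> x \<in> interior (K_minus \<T> E)"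
    and "ball (midpoint p q) \<delta> \<subseteq> \<Omega>"
proof -
  note K = K_plus_minus[OF E]
  let ?m = "midpoint p q"
  have inball: "\<exists>x0. cball x0 \<delta> \<subseteq> K'" if K': "K' \<in> \<T>" "E edge_of K'" for K'
  proof -
    obtain x0 where x0: "cball x0 (\<kappa> * diameter K') \<subseteq> K'" using inscribed[OF K'(1)] by blast
    have "\<delta> \<le> \<kappa> * diameter K'"
      using \<delta>(2) mult_left_mono[OF edge_diameter_bounds(2)[OF K'], of \<kappa>] \<kappa> by linarith
    then have "cball x0 \<delta> \<subseteq> K'" using x0 subset_cball by blast
    then show ?thesis by blast
  qed
  obtain c where c: "K_plus \<T> E = convex hull {p, q, c}" "cross2 (q - p) (c - p) \<noteq> 0"
    using triangle_edge_endpoints[OF triangle[OF K(1)], of p q] K(2) pq by metis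
  obtain c' where c': "K_minus \<T> E = convex hull {p, q, c'}" "cross2 (q - p) (c' - p) \<noteq> 0"
    using triangle_edge_endpoints[OF triangle[OF K(3)], of p q] K(4) pq by metis
  note n = edge_normal_works[OF K(2,1) pq c, folded \<nu>]
  obtain x1 where x1: "cball x1 \<delta> \<subseteq> convex hull {p, q, c}" using inball[OF K(1,2)] c(1) by auto
  obtain x2 where x2: "cball x2 \<delta> \<subseteq> convex hull {p, q, c'}" using inball[OF K(3,4)] c'(1) by auto
  show plus: "x \<in> interior (K_plus \<T> E)" if "norm (x - ?m) < \<delta>" "\<nu> \<bullet> (x - ?m) < 0" for x
    unfolding c(1) by (rule half_disc_in_interior[OF c(2) x1 \<delta>(1) n(2,3) that])
  have "\<nu> \<noteq> 0" using n(1) by (metis norm_zero zero_neq_one)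
  then have ne: "\<nu> \<bullet> (c' - p) \<noteq> 0" using cross2_parallel_eq_0[OF _ n(2)] c'(2) by blast
  have "\<not> \<nu> \<bullet> (c' - p) < 0"
  proof
    assume neg: "\<nu> \<bullet> (c' - p) < 0"
    let ?x = "?m - (\<delta> / 2) *\<^sub>R \<nu>"
    have "norm (?x - ?m) < \<delta>" using n(1) \<delta>(1) by simp
    moreover have "\<nu> \<bullet> (?x - ?m) < 0" using n(1) \<delta>(1) by (simp add: norm_eq_1)
    ultimately have x: "norm (?x - ?m) < \<delta>" "\<nu> \<bullet> (?x - ?m) < 0" .
    have "?x \<in> interior (K_minus \<T> E)"
      unfolding c'(1) by (rule half_disc_in_interior[OF c'(2) x2 \<delta>(1) n(2) neg x])
    then show False using plus[OF x] interiors_disjoint[OF K(1,3)] K(5) by blast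
  qed
  then have pos: "(- \<nu>) \<bullet> (c' - p) < 0" using ne by simp
  have n2: "(- \<nu>) \<bullet> (q - p) = 0" using n(2) by simp
  show "x \<in> interior (K_minus \<T> E)" if "norm (x - ?m) < \<delta>" "\<nu> \<bullet> (x - ?m) > 0" for x
    unfolding c'(1) by (rule half_disc_in_interior[OF c'(2) x2 \<delta>(1) n2 pos that(1)]) (use that(2) in simp)
  have "ball ?m \<delta> \<subseteq> closure \<Omega>"
  proof
    fix x assume "x \<in> ball ?m \<delta>"
    then have x: "norm (x - ?m) \<le> \<delta>" by (simp add: dist_norm norm_minus_commute)
    have "x \<in> K_plus \<T> E \<or> x \<in> K_minus \<T> E"
    proof (cases "\<nu> \<bullet> (x - ?m) \<le> 0")
      case True
      then show ?thesis unfolding c(1) using half_disc_in_triangle[OF c(2) x1 \<delta>(1) n(2,3) x] by blast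
    next
      case False
      then have "(- \<nu>) \<bullet> (x - ?m) \<le> 0" by simp
      then show ?thesis unfolding c'(1) using half_disc_in_triangle[OF c'(2) x2 \<delta>(1) n2 pos x] by blast
    qed
    then show "x \<in> closure \<Omega>" using triangle_subset_closure K by blast
  qed
  then show "ball ?m \<delta> \<subseteq> \<Omega>" using interior_maximal[OF _ open_ball] regular_open by blast
qed

text \<open>The test function is odd across the edge and even along it. The integrals of its second
  derivatives over the two triangles are opposite multiples of the matrix of \<nu> with itself, so
  the two constant Hessians enter through the normal-normal entry of their jump, with a factor
  \<open>a\<close> independent of the edge.\<close>

lemma edge_estimate:
  assumes E: "E \<in> interior_edges \<T>"
  shows "(diameter E)\<^sup>2 * (\<Sum>i\<in>UNIV. \<Sum>j\<in>UNIV. (Hw (K_plus \<T> E) i j - Hw (K_minus \<T> E) i j)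
       * edge_normal \<T> E $ i * edge_normal \<T> E $ j)\<^sup>2
    \<le> edge_const \<kappa> B * (\<Sum>K\<in>{K_plus \<T> E, K_minus \<T> E}. (err K)\<^sup>2 + diameter K ^ 4 * vol K)"
proof -
  note K = K_plus_minus[OF E]
  let ?K1 = "K_plus \<T> E" and ?K2 = "K_minus \<T> E"
  define h where "h = diameter E"
  define \<nu> where "\<nu> = edge_normal \<T> E"
  obtain p q where pq: "E = closed_segment p q" "p \<noteq> q" "diameter E = dist p q" "norm \<nu> = 1" "\<nu> \<bullet> (q - p) = 0"
    using interior_edge_geometry[OF E] unfolding \<nu>_def by metis
  define m where "m = midpoint p q"
  define \<tau> where "\<tau> = (q - p) /\<^sub>R h"
  have h: "0 < h" "h \<le> 1"
    using edge_diameter_bounds[OF K(1,2)] small[OF K(1)] by (auto simp: h_def)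
  have hn: "h = norm (q - p)" using pq(3) by (simp add: h_def dist_norm norm_minus_commute)
  have on: "norm \<nu> = 1" "norm \<tau> = 1" "\<nu> \<bullet> \<tau> = 0"
    using pq(4,5) h(1) by (auto simp: \<tau>_def hn)
  \<comment> \<open>The support radius 2 \<rho> is half of the radius \<open>R\<close> of the disc
    covered by the two triangles.\<close>
  define \<rho> where "\<rho> = \<kappa> * h / 4"
  have \<rho>: "\<rho> > 0" using \<kappa> h by (simp add: \<rho>_def)
  define R where "R = \<kappa> * h"
  have R: "0 < R" "R \<le> \<kappa> * diameter E" using \<kappa> h by (simp_all add: R_def h_def[symmetric])
  note nb = edge_neighbourhood[OF E pq(1) \<nu>_def R, folded m_def]
  define \<phi> where "\<phi> = tensor m \<nu> \<tau> \<rho> (\<lambda>t. t * bump t) bump"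
  have supp: "cball m (2 * \<rho>) \<subseteq> ball m R"
    using R(1) by (auto simp: \<rho>_def R_def)
  have sub: "cball m (2 * \<rho>) \<subseteq> \<Omega>" using supp nb(3) by blast
  have tfB: "\<phi> \<in> test_functions (ball m R)"
    unfolding \<phi>_def
    by (rule test_functionI[OF smooth_tensor_bump(2) compact_cball supp tensor_outside[OF B(3) B(2) \<rho> on]])
  have tf: "\<phi> \<in> test_functions \<Omega>" using test_functions_mono[OF nb(3)] tfB by blast
  have bd: "\<bar>\<phi> x\<bar> \<le> 1" for x
  proof -
    have "\<bar>t * bump t\<bar> \<le> 1" "\<bar>bump t\<bar> \<le> 1" for t using B(2,3) by (simp_all add: profile_def)
    from mult_le_one[OF this(1) abs_ge_zero this(2), of "\<nu> \<bullet> (x - m) / \<rho>" "\<tau> \<bullet> (x - m) / \<rho>"]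
    show ?thesis unfolding \<phi>_def tensor_def abs_mult .
  qed
  define b where "b = 4 * B\<^sup>2 / \<rho>\<^sup>2"
  have bd2: "\<bar>partial [i, j] \<phi> x\<bar> \<le> b" for i j x
    unfolding \<phi>_def b_def by (rule partial2_tensor_bound[OF B(3) B(2) B(1) on(1,2) \<rho>])
  define a where "a = bump 0 * (LINT t|lborel. bump t)"
  have a: "a > 0" unfolding a_def using bump_0_pos bump_integral_pos by simp
  have ball_norm: "x \<in> ball m R \<longleftrightarrow> norm (x - m) < R" for x by (simp add: dist_norm norm_minus_commute)
  have sides: "x \<notin> interior ?K2" if "norm (x - m) < R" "\<nu> \<bullet> (x - m) < 0" for x
    using nb(1)[OF that] interiors_disjoint[OF K(1,3)] K(5) by blast
  have sides': "x \<notin> interior ?K1" if "norm (x - m) < R" "\<nu> \<bullet> (x - m) > 0" for x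
    using nb(2)[OF that] interiors_disjoint[OF K(1,3)] K(5) by blast
  have zero: "partial js \<phi> x = 0" if K': "K' \<in> \<T> - {?K1, ?K2}" "x \<in> interior K'" for K' x js
  proof (rule ccontr)
    assume "partial js \<phi> x \<noteq> 0"
    then have "x \<in> ball m R" using test_function_outside[OF tfB] by blast
    then have "x \<in> interior K' \<inter> ball m R" using K'(2) by blast
    moreover have "open (interior K' \<inter> ball m R)" by auto
    ultimately obtain e where e: "e > 0" "ball x e \<subseteq> interior K' \<inter> ball m R"
      using open_contains_ball by blast
    \<comment> \<open>On the line of the edge neither half disc statement applies. A shift along
      \<nu> within the open set leads off the line and into one of the two interiors.\<close>
    define x' where "x' = (if \<nu> \<bullet> (x - m) = 0 then x + (e / 2) *\<^sub>R \<nu> else x)"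
    have "x' \<in> ball x e" using e(1) on(1) by (simp add: x'_def dist_norm)
    then have x': "x' \<in> interior K'" "norm (x' - m) < R" using e(2) ball_norm by auto
    have "\<nu> \<bullet> (x' - m) \<noteq> 0"
    proof (cases "\<nu> \<bullet> (x - m) = 0")
      case True
      then have "\<nu> \<bullet> (x' - m) = e / 2"
        using on(1) by (simp add: x'_def inner_diff_right inner_add_right norm_eq_1)
      then show ?thesis using e(1) by simp
    qed (simp add: x'_def)
    then have "x' \<in> interior ?K1 \<or> x' \<in> interior ?K2"
      using nb(1,2)[OF x'(2)] by linarith
    then show False using interiors_disjoint[of K'] x'(1) K' K(1,3) by blast
  qed
  have offline: "AE x in lebesgue. \<nu> \<bullet> x \<noteq> \<nu> \<bullet> m"
  proof -
    have "\<nu> \<noteq> 0" using on(1) by (metis norm_zero zero_neq_one)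
    then have "{x. \<nu> \<bullet> x = \<nu> \<bullet> m} \<in> null_sets lebesgue"
      using negligible_hyperplane[of \<nu> "\<nu> \<bullet> m"] by (simp add: negligible_iff_null_sets)
    from AE_not_in[OF this] show ?thesis by simp
  qed
  let ?H = "{x. \<nu> \<bullet> (x - m) \<le> 0}"
  have half: "(LINT x|lebesgue. indicat_real ?H x * partial [j, i] \<phi> x) = a * \<nu> $ j * \<nu> $ i" for i j
    using half_plane_integral_partial2_tensor[OF on \<rho> B(3) B(2) tf[unfolded \<phi>_def], of j i]
    by (simp add: \<phi>_def a_def del: partial.simps)
  have ind: "AE x in lebesgue. indicat_real (interior ?K1) x * partial js \<phi> x = indicat_real ?H x * partial js \<phi> x"
    "AE x in lebesgue. indicat_real (interior ?K2) x * partial js \<phi> x = partial js \<phi> x - indicat_real ?H x * partial js \<phi> x" for js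
  proof -
    have *: "indicat_real (interior ?K1) x * partial js \<phi> x = indicat_real ?H x * partial js \<phi> x \<and>
      indicat_real (interior ?K2) x * partial js \<phi> x = partial js \<phi> x - indicat_real ?H x * partial js \<phi> x"
      if "\<nu> \<bullet> x \<noteq> \<nu> \<bullet> m" for x
    proof (cases "x \<in> ball m R")
      case True
      then have n: "norm (x - m) < R" using ball_norm by blast
      have "\<nu> \<bullet> (x - m) \<noteq> 0" using that by (simp add: inner_diff_right)
      then consider "\<nu> \<bullet> (x - m) < 0" | "\<nu> \<bullet> (x - m) > 0" by linarith
      then show ?thesis
      proof cases
        case 1
        then show ?thesis using nb(1)[OF n 1] sides[OF n 1] by simp
      next
        case 2
        then show ?thesis using nb(2)[OF n 2] sides'[OF n 2] by simp
      qed
    next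
      case False
      then show ?thesis using test_function_outside[OF tfB False] by simp
    qed
    show "AE x in lebesgue. indicat_real (interior ?K1) x * partial js \<phi> x = indicat_real ?H x * partial js \<phi> x"
      "AE x in lebesgue. indicat_real (interior ?K2) x * partial js \<phi> x = partial js \<phi> x - indicat_real ?H x * partial js \<phi> x"
      using offline by (eventually_elim, use * in blast)+
  qed
  have lint: "(LINT x|lebesgue. f x) = (LINT x|lebesgue. f' x)" if "AE x in lebesgue. f x = f' x" for f f' :: scalar_fn
    using set_integral_lebesgue_cong_AE[of UNIV f f'] that by (simp add: set_lebesgue_integral_def)
  have plus: "(LINT x:interior ?K1|lebesgue. partial [j, i] \<phi> x) = a * \<nu> $ j * \<nu> $ i" for i j
    using lint[OF ind(1)[of "[j, i]"]] half[of j i] by (simp add: set_lebesgue_integral_def del: partial.simps)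
  \<comment> \<open>Over the whole plane a second derivative of \<phi> integrates to 0, so the
    second triangle receives the negative of the share of the first.\<close>
  have minus: "(LINT x:interior ?K2|lebesgue. partial [j, i] \<phi> x) = - (a * \<nu> $ j * \<nu> $ i)" for i j
  proof -
    have "partial [j] (partial [i] \<phi>) = partial [j, i] \<phi>" by simp
    moreover have "partial [i] \<phi> \<in> test_functions UNIV"
      using test_functions_mono[OF subset_UNIV] test_function_partial[OF tf] by blast
    ultimately have tot: "(LINT x|lebesgue. partial [j, i] \<phi> x) = 0"
      using integral_partial_eq_0[of "partial [i] \<phi>" j] by metis
    have i1: "integrable lborel (partial [j, i] \<phi>)"
      by (rule test_function_integrable_lborel[OF test_function_partial[OF tf]])
    have Hm: "?H \<in> sets borel" by (intro borel_closed closed_Collect_le continuous_intros)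
    have i2: "integrable lborel (\<lambda>x. indicat_real ?H x * partial [j, i] \<phi> x)"
      using integrable_mult_indicator[of ?H lborel "partial [j, i] \<phi>"] i1 Hm by simp
    have i1': "integrable lebesgue (partial [j, i] \<phi>)"
      using i1 by (subst integrable_completion) (auto intro: borel_measurable_integrable simp del: partial.simps)
    have i2': "integrable lebesgue (\<lambda>x. indicat_real ?H x * partial [j, i] \<phi> x)"
      using i2 by (subst integrable_completion) (auto intro: borel_measurable_integrable simp del: partial.simps)
    have "(LINT x:interior ?K2|lebesgue. partial [j, i] \<phi> x)
        = (LINT x|lebesgue. partial [j, i] \<phi> x - indicat_real ?H x * partial [j, i] \<phi> x)"
      using lint[OF ind(2)[of "[j, i]"]] by (simp add: set_lebesgue_integral_def del: partial.simps)
    also have "\<dots> = (LINT x|lebesgue. partial [j, i] \<phi> x) - (LINT x|lebesgue. indicat_real ?H x * partial [j, i] \<phi> x)"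
      by (rule Bochner_Integration.integral_diff[OF i1' i2'])
    finally show ?thesis by (simp only: tot half)
  qed
  define s where "s = (\<Sum>i\<in>UNIV. \<Sum>j\<in>UNIV. (Hw ?K1 i j - Hw ?K2 i j) * \<nu> $ i * \<nu> $ j)"
  let ?f = "\<lambda>K. LINT x:interior K|lebesgue. (g x + r * br (Hy K) (Hz K)) * \<phi> x"
  have "(\<Sum>K\<in>{?K1, ?K2}. res K \<phi>) = (\<Sum>K\<in>{?K1, ?K2}. ?f K
     - (\<Sum>i\<in>UNIV. \<Sum>j\<in>UNIV. Hw K i j * (LINT x:interior K|lebesgue. partial [j, i] \<phi> x)))"
    by (rule res_identity_local[OF tf _ zero]) (use K in auto)
  moreover have "(\<Sum>i\<in>UNIV. \<Sum>j\<in>UNIV. Hw ?K1 i j * (LINT x:interior ?K1|lebesgue. partial [j, i] \<phi> x))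
      + (\<Sum>i\<in>UNIV. \<Sum>j\<in>UNIV. Hw ?K2 i j * (LINT x:interior ?K2|lebesgue. partial [j, i] \<phi> x)) = a * s"
    unfolding plus minus s_def by (simp add: sum_2 algebra_simps)
  ultimately have "a * s = ?f ?K1 + ?f ?K2 - (res ?K1 \<phi> + res ?K2 \<phi>)"
    using K(5) by (simp del: partial.simps)
  then have tri: "a * \<bar>s\<bar> \<le> (\<bar>?f ?K1\<bar> + \<bar>res ?K1 \<phi>\<bar>) + (\<bar>?f ?K2\<bar> + \<bar>res ?K2 \<phi>\<bar>)"
    using a abs_mult[of a s] by (simp add: abs_of_pos)
  \<comment> \<open>8 is the factor of \<open>res_err_bound\<close>. The product of h, b and the
    diameter d of a neighbour is 64 B^2 / \<kappa>^2 times d / h, and d / h is at most 1 / (2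
    \<kappa>).\<close>
  define c2 where "c2 = 8 * (32 * B\<^sup>2 / \<kappa> ^ 3 + 1)"
  have c2: "c2 \<ge> 2" unfolding c2_def using \<kappa> by simp
  have each: "h * (\<bar>?f K'\<bar> + \<bar>res K' \<phi>\<bar>) \<le> c2 * (err K' + (diameter K')\<^sup>2 * sqrt (vol K'))"
    if K': "K' \<in> \<T>" "E edge_of K'" for K'
  proof -
    let ?d = "diameter K'" and ?v = "sqrt (vol K')"
    have d: "0 < ?d" "h \<le> ?d" "2 * \<kappa> * ?d \<le> h"
      using edge_diameter_bounds[OF K'] triangle_diameter_pos[OF triangle[OF K'(1)]] by (auto simp: h_def)
    have v: "?v \<ge> 0" using vol_nonneg by simp
    have 1: "\<bar>?f K'\<bar> \<le> 2 * ?d * ?v"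
      unfolding vol_def by (rule test_function_integral_bound(1)[OF K'(1) g_sq_integrable[OF K'(1)] tf bd])
    have 2: "\<bar>res K' \<phi>\<bar> \<le> 8 * (b * ?d + 1) * err K'"
      by (rule res_err_bound[OF K'(1) tf bd bd2])
    have "h * \<bar>?f K'\<bar> \<le> ?d * (2 * ?d * ?v)"
      using 1 d h by (intro mult_mono) auto
    also have "\<dots> = 2 * (?d\<^sup>2 * ?v)" by (simp add: power2_eq_square)
    also have "\<dots> \<le> c2 * (?d\<^sup>2 * ?v)" using c2 v by (intro mult_right_mono) auto
    finally have 3: "h * \<bar>?f K'\<bar> \<le> c2 * (?d\<^sup>2 * ?v)" .
    have hb: "h * (b * ?d) = 64 * B\<^sup>2 / \<kappa>\<^sup>2 * (?d / h)"
      using h \<kappa> by (simp add: b_def \<rho>_def power2_eq_square field_simps)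
    have "?d / h \<le> 1 / (2 * \<kappa>)" using d(3) h \<kappa> by (simp add: field_simps)
    then have "64 * B\<^sup>2 / \<kappa>\<^sup>2 * (?d / h) \<le> 64 * B\<^sup>2 / \<kappa>\<^sup>2 * (1 / (2 * \<kappa>))"
      by (intro mult_left_mono) auto
    also have "\<dots> = 32 * B\<^sup>2 / \<kappa> ^ 3" using \<kappa> by (simp add: power2_eq_square power3_eq_cube)
    finally have hbd: "h * (b * ?d) \<le> 32 * B\<^sup>2 / \<kappa> ^ 3" using hb by simp
    have "h * (8 * (b * ?d + 1)) = 8 * (h * (b * ?d)) + 8 * h" by (simp add: algebra_simps)
    also have "\<dots> \<le> 8 * (32 * B\<^sup>2 / \<kappa> ^ 3) + 8 * 1"
      using hbd h(2) by (intro add_mono mult_left_mono) simp_all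
    also have "\<dots> = c2" unfolding c2_def by (simp only: distrib_left)
    finally have "h * (8 * (b * ?d + 1)) \<le> c2" .
    then have "(h * (8 * (b * ?d + 1))) * err K' \<le> c2 * err K'" by (rule mult_right_mono[OF _ err_nonneg])
    moreover have "h * \<bar>res K' \<phi>\<bar> \<le> h * (8 * (b * ?d + 1) * err K')" using 2 h by (intro mult_left_mono) auto
    ultimately have "h * \<bar>res K' \<phi>\<bar> \<le> c2 * err K'" by (simp add: mult.assoc)
    with 3 show ?thesis by (simp add: distrib_left)
  qed
  let ?t = "\<lambda>K. err K + (diameter K)\<^sup>2 * sqrt (vol K)"
  have "a * (h * \<bar>s\<bar>) \<le> h * ((\<bar>?f ?K1\<bar> + \<bar>res ?K1 \<phi>\<bar>) + (\<bar>?f ?K2\<bar> + \<bar>res ?K2 \<phi>\<bar>))"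
    using mult_left_mono[OF tri, of h] h by (simp add: mult.left_commute)
  also have "\<dots> \<le> c2 * (?t ?K1 + ?t ?K2)"
    using each[OF K(1,2)] each[OF K(3,4)] by (simp add: distrib_left)
  finally have "h * \<bar>s\<bar> \<le> (c2 / a) * (?t ?K1 + ?t ?K2)" using a by (simp add: field_simps)
  then have "(h * \<bar>s\<bar>)\<^sup>2 \<le> ((c2 / a) * (?t ?K1 + ?t ?K2))\<^sup>2" using h by (intro power_mono) auto
  also have "\<dots> = (c2 / a)\<^sup>2 * (?t ?K1 + ?t ?K2)\<^sup>2" by (rule power_mult_distrib)
  also have "\<dots> \<le> (c2 / a)\<^sup>2 * (4 * (((err ?K1)\<^sup>2 + diameter ?K1 ^ 4 * vol ?K1) + ((err ?K2)\<^sup>2 + diameter ?K2 ^ 4 * vol ?K2)))"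
  proof (rule mult_left_mono)
    have two: "(p + q)\<^sup>2 \<le> 2 * p\<^sup>2 + 2 * q\<^sup>2" for p q :: real
      using sum_squares_bound[of p q] by (simp add: power2_sum)
    have sq: "(?t K)\<^sup>2 \<le> 2 * ((err K)\<^sup>2 + diameter K ^ 4 * vol K)" for K
      using two[of "err K" "(diameter K)\<^sup>2 * sqrt (vol K)"] vol_nonneg[of K]
      by (simp add: power_mult_distrib)
    have "(?t ?K1 + ?t ?K2)\<^sup>2 \<le> 2 * (?t ?K1)\<^sup>2 + 2 * (?t ?K2)\<^sup>2"
      by (rule two)
    also have "\<dots> \<le> 2 * (2 * ((err ?K1)\<^sup>2 + diameter ?K1 ^ 4 * vol ?K1)) + 2 * (2 * ((err ?K2)\<^sup>2 + diameter ?K2 ^ 4 * vol ?K2))"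
      by (intro add_mono mult_left_mono sq) simp_all
    finally show "(?t ?K1 + ?t ?K2)\<^sup>2 \<le> 4 * (((err ?K1)\<^sup>2 + diameter ?K1 ^ 4 * vol ?K1) + ((err ?K2)\<^sup>2 + diameter ?K2 ^ 4 * vol ?K2))"
      by (simp add: distrib_left)
  qed simp
  also have "\<dots> = edge_const \<kappa> B * (\<Sum>K\<in>{?K1, ?K2}. (err K)\<^sup>2 + diameter K ^ 4 * vol K)"
    using K(5) by (simp add: edge_const_def c2_def a_def)
  finally show ?thesis
    by (simp add: power_mult_distrib h_def s_def \<nu>_def)
qed

end

subsection \<open>Global efficiency\<close>

text \<open>The share of one component in \<open>eta_E_sq\<close>, so that each of the two equations
  can account for its own.\<close>

definition edge_terms :: "mesh \<Rightarrow> scalar_fn \<Rightarrow> pt set \<Rightarrow> real" where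
  "edge_terms \<T> u E = diameter E * (\<Sum>i\<in>UNIV. edge_int E (\<lambda>x. (jump \<T> E (hess_normal \<T> E i u) x)\<^sup>2))
     + 1 / diameter E ^ 3 * edge_int E (\<lambda>x. (jump \<T> E u x)\<^sup>2)
     + 1 / diameter E * (\<Sum>i\<in>UNIV. edge_int E (\<lambda>x. (jump \<T> E (pw_deriv \<T> [i] u) x)\<^sup>2))"

lemma eta_E_sq_edge_terms: "eta_E_sq \<T> U E = edge_terms \<T> (fst U) E + edge_terms \<T> (snd U) E"
  by (simp add: eta_E_sq_def edge_terms_def algebra_simps)

lemma edge_int_square_nonneg: "diameter E \<ge> 0 \<Longrightarrow> edge_int E (\<lambda>x. (f x)\<^sup>2) \<ge> 0"
  unfolding edge_int_def by (intro mult_nonneg_nonneg set_integral_square_nonneg)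

context meshed_domain
begin

lemma edge_diameter_pos: "E \<in> edges \<T> \<Longrightarrow> diameter E > 0"
  by (auto simp: edges_def elim!: edge_endpoints[OF triangle])

text \<open>All summands of the squared dG norm are nonnegative, so each group may be kept alone and
  the sums over edges restricted to the interior ones.\<close>

lemma dG_norm_sq:
  assumes "\<sigma>\<^sub>1 > 0" "\<sigma>\<^sub>2 > 0"
  shows "(\<Sum>K\<in>\<T>. seminorm_sq 2 (interior K) \<phi>) \<le> (dG_norm \<sigma>\<^sub>1 \<sigma>\<^sub>2 \<T> \<phi>)\<^sup>2"
    and "\<sigma>\<^sub>1 * (\<Sum>E\<in>interior_edges \<T>. 1 / diameter E ^ 3 * edge_int E (\<lambda>x. (jump \<T> E \<phi> x)\<^sup>2)) \<le> (dG_norm \<sigma>\<^sub>1 \<sigma>\<^sub>2 \<T> \<phi>)\<^sup>2"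
    and "\<sigma>\<^sub>2 * (\<Sum>E\<in>interior_edges \<T>. 1 / diameter E * edge_int E (\<lambda>x. (jump \<T> E (normal_deriv \<T> E \<phi>) x)\<^sup>2)) \<le> (dG_norm \<sigma>\<^sub>1 \<sigma>\<^sub>2 \<T> \<phi>)\<^sup>2"
proof -
  let ?S = "\<Sum>K\<in>\<T>. seminorm_sq 2 (interior K) \<phi>"
  let ?j = "\<lambda>E. \<sigma>\<^sub>1 / diameter E ^ 3 * edge_int E (\<lambda>x. (jump \<T> E \<phi> x)\<^sup>2)"
  let ?n = "\<lambda>E. \<sigma>\<^sub>2 / diameter E * edge_int E (\<lambda>x. (jump \<T> E (normal_deriv \<T> E \<phi>) x)\<^sup>2)"
  have S: "?S \<ge> 0" by (intro sum_nonneg seminorm_sq_nonneg)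
  have j: "?j E \<ge> 0" and n: "?n E \<ge> 0" if "E \<in> edges \<T>" for E
    using assms edge_diameter_pos[OF that]
    by (intro mult_nonneg_nonneg divide_nonneg_nonneg edge_int_square_nonneg; simp)+
  have J: "(\<Sum>E\<in>edges \<T>. ?j E) \<ge> 0" "(\<Sum>E\<in>edges \<T>. ?n E) \<ge> 0"
    using j n by (auto intro!: sum_nonneg)
  have eq: "(dG_norm \<sigma>\<^sub>1 \<sigma>\<^sub>2 \<T> \<phi>)\<^sup>2 = ?S + (\<Sum>E\<in>edges \<T>. ?j E) + (\<Sum>E\<in>edges \<T>. ?n E)"
    unfolding dG_norm_def by (rule real_sqrt_pow2) (use S J in linarith)
  show "?S \<le> (dG_norm \<sigma>\<^sub>1 \<sigma>\<^sub>2 \<T> \<phi>)\<^sup>2" using eq J by linarith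
  have "\<sigma>\<^sub>1 * (\<Sum>E\<in>interior_edges \<T>. 1 / diameter E ^ 3 * edge_int E (\<lambda>x. (jump \<T> E \<phi> x)\<^sup>2)) = (\<Sum>E\<in>interior_edges \<T>. ?j E)"
    by (simp add: sum_distrib_left)
  also have "\<dots> \<le> (\<Sum>E\<in>edges \<T>. ?j E)"
    by (rule sum_mono2[OF finite_edges interior_edges_subset]) (use j in auto)
  finally show "\<sigma>\<^sub>1 * (\<Sum>E\<in>interior_edges \<T>. 1 / diameter E ^ 3 * edge_int E (\<lambda>x. (jump \<T> E \<phi> x)\<^sup>2)) \<le> (dG_norm \<sigma>\<^sub>1 \<sigma>\<^sub>2 \<T> \<phi>)\<^sup>2"
    using eq S J by linarith
  have "\<sigma>\<^sub>2 * (\<Sum>E\<in>interior_edges \<T>. 1 / diameter E * edge_int E (\<lambda>x. (jump \<T> E (normal_deriv \<T> E \<phi>) x)\<^sup>2)) = (\<Sum>E\<in>interior_edges \<T>. ?n E)"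
    by (simp add: sum_distrib_left)
  also have "\<dots> \<le> (\<Sum>E\<in>edges \<T>. ?n E)"
    by (rule sum_mono2[OF finite_edges interior_edges_subset]) (use n in auto)
  finally show "\<sigma>\<^sub>2 * (\<Sum>E\<in>interior_edges \<T>. 1 / diameter E * edge_int E (\<lambda>x. (jump \<T> E (normal_deriv \<T> E \<phi>) x)\<^sup>2)) \<le> (dG_norm \<sigma>\<^sub>1 \<sigma>\<^sub>2 \<T> \<phi>)\<^sup>2"
    using eq S J by linarith
qed

text \<open>Finite overlap: after interchanging the sums, a triangle is counted at most once for
  each of its edges.\<close>

lemma edge_patch_sum_le:
  assumes "\<And>K. K \<in> \<T> \<Longrightarrow> (Y K :: real) \<ge> 0"
  shows "(\<Sum>E\<in>interior_edges \<T>. \<Sum>K\<in>{K_plus \<T> E, K_minus \<T> E}. Y K) \<le> 8 * (\<Sum>K\<in>\<T>. Y K)"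
proof -
  have fin: "finite (interior_edges \<T>)" using finite_subset[OF interior_edges_subset finite_edges] .
  have "(\<Sum>E\<in>interior_edges \<T>. \<Sum>K\<in>{K_plus \<T> E, K_minus \<T> E}. Y K)
      \<le> (\<Sum>E\<in>interior_edges \<T>. \<Sum>K\<in>{K\<in>\<T>. E edge_of K}. Y K)"
    by (intro sum_mono sum_mono2) (use finite_mesh K_plus_minus assms in auto)
  also have "\<dots> = (\<Sum>K\<in>\<T>. \<Sum>E\<in>{E\<in>interior_edges \<T>. E edge_of K}. Y K)"
    by (rule sum.swap_restrict[OF fin finite_mesh])
  also have "\<dots> = (\<Sum>K\<in>\<T>. real (card {E\<in>interior_edges \<T>. E edge_of K}) * Y K)" by simp
  also have "\<dots> \<le> (\<Sum>K\<in>\<T>. 8 * Y K)"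
  proof (rule sum_mono)
    fix K assume K: "K \<in> \<T>"
    have "card {E\<in>interior_edges \<T>. E edge_of K} \<le> card {E. E edge_of K}"
      by (rule card_mono[OF card_edges_of_triangle(1)[OF triangle[OF K]]]) auto
    also have "\<dots> \<le> 8" by (rule card_edges_of_triangle(2)[OF triangle[OF K]])
    finally show "real (card {E\<in>interior_edges \<T>. E edge_of K}) * Y K \<le> 8 * Y K"
      using assms[OF K] by (intro mult_right_mono) auto
  qed
  finally show ?thesis by (simp add: sum_distrib_left)
qed

end

text \<open>The summands stand for the volume terms, the edge bubbles summed over patches (factor
  8), and the jump terms with the factors 13 and 61 of \<open>edge_terms_le\<close>.\<close>

definition total_const :: "real \<Rightarrow> real \<Rightarrow> real \<Rightarrow> real \<Rightarrow> real \<Rightarrow> real" where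
  "total_const \<kappa> M B \<sigma>\<^sub>1 \<sigma>\<^sub>2 = vol_const \<kappa> B * (3 * (1 + M\<^sup>2) + 1)
     + edge_const \<kappa> B * (8 * (3 * (1 + M\<^sup>2) + vol_const \<kappa> B * (3 * (1 + M\<^sup>2) + 1)))
     + 13 / \<sigma>\<^sub>2 + 61 / \<sigma>\<^sub>1"

lemma vol_const_nonneg: "vol_const \<kappa> B \<ge> 0" and edge_const_nonneg: "edge_const \<kappa> B \<ge> 0"
  by (simp_all add: vol_const_def edge_const_def)

context shape_regular_residual
begin

text \<open>The normal jump pays 12 for the tangential part of the Hessian jump and 1 for the
  gradient, together 13. The jump of the function pays 60 for the gradient and 1 for itself,
  together 61.\<close>

lemma edge_terms_le:
  assumes E: "E \<in> interior_edges \<T>"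
  shows "edge_terms \<T> wh E \<le> edge_const \<kappa> B * (\<Sum>K\<in>{K_plus \<T> E, K_minus \<T> E}. (err K)\<^sup>2 + diameter K ^ 4 * vol K)
    + 13 * (1 / diameter E * edge_int E (\<lambda>x. (jump \<T> E (normal_deriv \<T> E (sub_fn w wh)) x)\<^sup>2))
    + 61 * (1 / diameter E ^ 3 * edge_int E (\<lambda>x. (jump \<T> E (sub_fn w wh) x)\<^sup>2))"
proof -
  note K = K_plus_minus[OF E]
  let ?K1 = "K_plus \<T> E" and ?K2 = "K_minus \<T> E"
  define h where "h = diameter E"
  define \<nu> where "\<nu> = edge_normal \<T> E"
  define J where "J = (\<lambda>i j. Hw ?K1 i j - Hw ?K2 i j)"
  define q where "q = quadratic (cw ?K1 - cw ?K2) (bw ?K1 - bw ?K2) J"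
  obtain p p' where pq: "E = closed_segment p p'" "edge_path E = linepath p p'" "p \<noteq> p'" "diameter E = dist p p'"
    "norm \<nu> = 1" "\<nu> \<bullet> (p' - p) = 0"
    using interior_edge_geometry[OF E] unfolding \<nu>_def by metis
  define e where "e = p' - p"
  have path: "edge_path E t = p + t *\<^sub>R e" for t unfolding pq(2) linepath_def e_def by (simp add: algebra_simps)
  have e: "e \<noteq> 0" "\<nu> \<bullet> e = 0" and hn: "h = norm e"
    using pq by (auto simp: e_def h_def dist_norm norm_minus_commute)
  have h: "h > 0" using e(1) hn by simp
  have J: "J 1 2 = J 2 1" using wh K by (auto simp: J_def pieces_def)
  note ji = jump_identities[OF w wh E, folded \<nu>_def J_def, folded q_def]
  define J0 where "J0 = (LINT t:{0..1}|lebesgue. (q (p + t *\<^sub>R e))\<^sup>2)"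
  define J1 where "J1 = (LINT t:{0..1}|lebesgue. (\<Sum>i\<in>UNIV. partial [i] q (p + t *\<^sub>R e) * \<nu> $ i)\<^sup>2)"
  note qe = quadratic_edge_inequalities[of J e \<nu> "cw ?K1 - cw ?K2" "bw ?K1 - bw ?K2" p, OF J e(1) pq(5) e(2), folded q_def hn,
      folded J0_def J1_def]
  define s where "s = (\<Sum>i\<in>UNIV. \<Sum>j\<in>UNIV. J i j * \<nu> $ i * \<nu> $ j)"
  have hess: "edge_int E (\<lambda>x. (jump \<T> E (hess_normal \<T> E i wh) x)\<^sup>2) = h * (\<Sum>j\<in>UNIV. J i j * \<nu> $ j)\<^sup>2" for i
    unfolding ji(5) by (simp add: edge_int_def h_def set_lebesgue_integral_def J_def)
  have jw: "edge_int E (\<lambda>x. (jump \<T> E wh x)\<^sup>2) = h * J0" "edge_int E (\<lambda>x. (jump \<T> E (sub_fn w wh) x)\<^sup>2) = h * J0"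
    unfolding ji(1,3) by (simp_all add: edge_int_def path J0_def h_def)
  have jn: "edge_int E (\<lambda>x. (jump \<T> E (normal_deriv \<T> E (sub_fn w wh)) x)\<^sup>2) = h * J1"
    unfolding ji(2) by (simp add: edge_int_def path J1_def h_def del: partial.simps)
  have jd: "edge_int E (\<lambda>x. (jump \<T> E (pw_deriv \<T> [i] wh) x)\<^sup>2) = h * (LINT t:{0..1}|lebesgue. (partial [i] q (p + t *\<^sub>R e))\<^sup>2)" for i
    unfolding ji(4) by (simp add: edge_int_def path h_def del: partial.simps)
  have "edge_terms \<T> wh E = h\<^sup>2 * (\<Sum>i\<in>UNIV. (\<Sum>j\<in>UNIV. J i j * \<nu> $ j)\<^sup>2) + J0 / h\<^sup>2
      + (\<Sum>i\<in>UNIV. LINT t:{0..1}|lebesgue. (partial [i] q (p + t *\<^sub>R e))\<^sup>2)"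
    unfolding edge_terms_def hess jw jd h_def[symmetric] sum_distrib_left[symmetric]
    using h by (simp add: power2_eq_square power3_eq_cube mult.assoc del: partial.simps)
  also have "\<dots> \<le> (h\<^sup>2 * s\<^sup>2 + 12 * J1) + J0 / h\<^sup>2 + (J1 + 60 / h\<^sup>2 * J0)"
    using qe unfolding s_def by (intro add_mono order_refl)
  also have "\<dots> = h\<^sup>2 * s\<^sup>2 + 13 * J1 + 61 * (J0 / h\<^sup>2)" by simp
  also have "h\<^sup>2 * s\<^sup>2 \<le> edge_const \<kappa> B * (\<Sum>K\<in>{?K1, ?K2}. (err K)\<^sup>2 + diameter K ^ 4 * vol K)"
    using edge_estimate[OF E] unfolding h_def s_def J_def \<nu>_def .
  finally show ?thesis
    unfolding jw jn h_def[symmetric] using h by (simp add: power2_eq_square power3_eq_cube)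
qed

lemma vol_eq: 
  assumes K: "K \<in> \<T>"
  shows "vol K = (LINT x:K|lebesgue. (g x + r * vk_bracket (pw_deriv \<T>) yh zh x)\<^sup>2)"
  unfolding vol_def set_integral_triangle_interior[OF triangle[OF K], symmetric]
proof (rule set_integral_lebesgue_cong_AE)
  have d: "AE x in lebesgue. x \<in> interior K \<longrightarrow> pw_deriv \<T> [i, j] u x = H K i j" if "pieces u c b H" for u c b H i j
    using pieces_weak_deriv2[OF that K, of i j] by eventually_elim (simp add: pw_deriv_interior[OF K])
  show "AE x in lebesgue. x \<in> interior K \<longrightarrow> (g x + r * br (Hy K) (Hz K))\<^sup>2 = (g x + r * vk_bracket (pw_deriv \<T>) yh zh x)\<^sup>2"
    using d[OF yh, of 1 1] d[OF yh, of 1 2] d[OF yh, of 2 2] d[OF zh, of 1 1] d[OF zh, of 1 2] d[OF zh, of 2 2]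
    by eventually_elim (simp add: vk_bracket_br br_def)
qed

lemma osc_sum: "(\<Sum>K\<in>\<T>. diameter K ^ 4 * osc K) = osc_sq \<T> g"
  unfolding osc_sq_def osc_def by (intro sum.cong refl) (simp add: set_integral_triangle_interior[OF triangle])

text \<open>The squares of \<open>err\<close> sum to broken H^2 errors, up to a factor depending on
  \<open>M\<close>. The volume residuals re-enter through the edge estimate and are bounded first.
  The remaining jumps are parts of the dG norm after division by the stabilisation
  parameters.\<close>

lemma efficiency:
  assumes \<sigma>: "\<sigma>\<^sub>1 > 0" "\<sigma>\<^sub>2 > 0"
  shows "(\<Sum>K\<in>\<T>. diameter K ^ 4 * (LINT x:K|lebesgue. (g x + r * vk_bracket (pw_deriv \<T>) yh zh x)\<^sup>2))
      + (\<Sum>E\<in>interior_edges \<T>. edge_terms \<T> wh E)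
    \<le> total_const \<kappa> M B \<sigma>\<^sub>1 \<sigma>\<^sub>2 * ((dG_norm \<sigma>\<^sub>1 \<sigma>\<^sub>2 \<T> (sub_fn w wh))\<^sup>2
      + (\<Sum>K\<in>\<T>. seminorm_sq 2 (interior K) (sub_fn y yh)) + (\<Sum>K\<in>\<T>. seminorm_sq 2 (interior K) (sub_fn z zh))
      + osc_sq \<T> g)"
proof -
  let ?dG = "(dG_norm \<sigma>\<^sub>1 \<sigma>\<^sub>2 \<T> (sub_fn w wh))\<^sup>2"
  let ?S = "\<lambda>u. \<Sum>K\<in>\<T>. seminorm_sq 2 (interior K) u"
  define T where "T = ?dG + ?S (sub_fn y yh) + ?S (sub_fn z zh) + osc_sq \<T> g"
  have S0: "?S u \<ge> 0" for u by (intro sum_nonneg seminorm_sq_nonneg)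
  have o0: "osc_sq \<T> g \<ge> 0" unfolding osc_sum[symmetric]
    by (intro sum_nonneg mult_nonneg_nonneg osc_nonneg) (simp add: zero_le_even_power)
  have T0: "T \<ge> 0" "?dG \<le> T" unfolding T_def using S0[of "sub_fn y yh"] S0[of "sub_fn z zh"] o0 by simp_all
  have err_sq: "(err K)\<^sup>2 \<le> 3 * (seminorm_sq 2 (interior K) (sub_fn w wh)
      + M\<^sup>2 * (seminorm_sq 2 (interior K) (sub_fn y yh) + seminorm_sq 2 (interior K) (sub_fn z zh)))" for K
  proof -
    have three: "(a + b + c)\<^sup>2 \<le> 3 * (a\<^sup>2 + b\<^sup>2 + c\<^sup>2)" for a b c :: real
      using sum_squares_bound[of a b] sum_squares_bound[of a c] sum_squares_bound[of b c]
      by (simp add: power2_eq_square algebra_simps)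
    have "err K = sqrt (seminorm_sq 2 (interior K) (sub_fn w wh)) + M * sqrt (seminorm_sq 2 (interior K) (sub_fn y yh))
        + M * sqrt (seminorm_sq 2 (interior K) (sub_fn z zh))"
      by (simp add: err_def algebra_simps)
    then show ?thesis
      using three[of "sqrt (seminorm_sq 2 (interior K) (sub_fn w wh))" "M * sqrt (seminorm_sq 2 (interior K) (sub_fn y yh))"
          "M * sqrt (seminorm_sq 2 (interior K) (sub_fn z zh))"]
      by (simp add: power_mult_distrib seminorm_sq_nonneg algebra_simps)
  qed
  have "(\<Sum>K\<in>\<T>. (err K)\<^sup>2) \<le> (\<Sum>K\<in>\<T>. 3 * (seminorm_sq 2 (interior K) (sub_fn w wh)
      + M\<^sup>2 * (seminorm_sq 2 (interior K) (sub_fn y yh) + seminorm_sq 2 (interior K) (sub_fn z zh))))"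
    by (rule sum_mono[OF err_sq])
  also have "\<dots> = 3 * (?S (sub_fn w wh) + M\<^sup>2 * (?S (sub_fn y yh) + ?S (sub_fn z zh)))"
    by (simp only: sum_distrib_left[symmetric] sum.distrib)
  also have "\<dots> \<le> 3 * (T + M\<^sup>2 * T)"
  proof -
    have S: "?S (sub_fn w wh) \<le> T" using dG_norm_sq(1)[OF \<sigma>, of "sub_fn w wh"] T0(2) by linarith
    have "?S (sub_fn y yh) + ?S (sub_fn z zh) \<le> T"
      using o0 zero_le_power2[of "dG_norm \<sigma>\<^sub>1 \<sigma>\<^sub>2 \<T> (sub_fn w wh)"] unfolding T_def by linarith
    then have "M\<^sup>2 * (?S (sub_fn y yh) + ?S (sub_fn z zh)) \<le> M\<^sup>2 * T" by (rule mult_left_mono) simp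
    from add_mono[OF S this] show ?thesis by (rule mult_left_mono) simp
  qed
  finally have ee: "(\<Sum>K\<in>\<T>. (err K)\<^sup>2) \<le> 3 * (1 + M\<^sup>2) * T" by (simp add: algebra_simps)
  define V where "V = (\<Sum>K\<in>\<T>. diameter K ^ 4 * vol K)"
  have "V \<le> (\<Sum>K\<in>\<T>. vol_const \<kappa> B * ((err K)\<^sup>2 + diameter K ^ 4 * osc K))"
    unfolding V_def by (rule sum_mono[OF volume_estimate])
  also have "\<dots> = vol_const \<kappa> B * ((\<Sum>K\<in>\<T>. (err K)\<^sup>2) + osc_sq \<T> g)"
    by (simp only: sum_distrib_left[symmetric] sum.distrib osc_sum)
  also have "\<dots> \<le> vol_const \<kappa> B * (3 * (1 + M\<^sup>2) * T + T)"
  proof (rule mult_left_mono[OF _ vol_const_nonneg])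
    have "osc_sq \<T> g \<le> T"
      using S0[of "sub_fn y yh"] S0[of "sub_fn z zh"] zero_le_power2[of "dG_norm \<sigma>\<^sub>1 \<sigma>\<^sub>2 \<T> (sub_fn w wh)"]
      unfolding T_def by linarith
    with ee show "(\<Sum>K\<in>\<T>. (err K)\<^sup>2) + osc_sq \<T> g \<le> 3 * (1 + M\<^sup>2) * T + T" by linarith
  qed
  finally have V: "V \<le> vol_const \<kappa> B * (3 * (1 + M\<^sup>2) + 1) * T" by (simp add: algebra_simps)
  let ?N = "\<Sum>E\<in>interior_edges \<T>. 1 / diameter E * edge_int E (\<lambda>x. (jump \<T> E (normal_deriv \<T> E (sub_fn w wh)) x)\<^sup>2)"
  let ?J = "\<Sum>E\<in>interior_edges \<T>. 1 / diameter E ^ 3 * edge_int E (\<lambda>x. (jump \<T> E (sub_fn w wh) x)\<^sup>2)"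
  have N: "?N \<le> T / \<sigma>\<^sub>2"
    using dG_norm_sq(3)[OF \<sigma>, of "sub_fn w wh"] T0(2) \<sigma> by (simp only: pos_le_divide_eq mult.commute[of _ \<sigma>\<^sub>2])
  have J: "?J \<le> T / \<sigma>\<^sub>1"
    using dG_norm_sq(2)[OF \<sigma>, of "sub_fn w wh"] T0(2) \<sigma> by (simp only: pos_le_divide_eq mult.commute[of _ \<sigma>\<^sub>1])
  have "(\<Sum>E\<in>interior_edges \<T>. edge_terms \<T> wh E)
      \<le> (\<Sum>E\<in>interior_edges \<T>. edge_const \<kappa> B * (\<Sum>K\<in>{K_plus \<T> E, K_minus \<T> E}. (err K)\<^sup>2 + diameter K ^ 4 * vol K)
        + 13 * (1 / diameter E * edge_int E (\<lambda>x. (jump \<T> E (normal_deriv \<T> E (sub_fn w wh)) x)\<^sup>2))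
        + 61 * (1 / diameter E ^ 3 * edge_int E (\<lambda>x. (jump \<T> E (sub_fn w wh) x)\<^sup>2)))"
    by (rule sum_mono[OF edge_terms_le])
  also have "\<dots> = edge_const \<kappa> B * (\<Sum>E\<in>interior_edges \<T>. \<Sum>K\<in>{K_plus \<T> E, K_minus \<T> E}. (err K)\<^sup>2 + diameter K ^ 4 * vol K)
      + 13 * ?N + 61 * ?J"
    by (simp only: sum.distrib sum_distrib_left[symmetric])
  also have "\<dots> \<le> edge_const \<kappa> B * (8 * (\<Sum>K\<in>\<T>. (err K)\<^sup>2 + diameter K ^ 4 * vol K)) + 13 * (T / \<sigma>\<^sub>2) + 61 * (T / \<sigma>\<^sub>1)"
    by (intro add_mono mult_left_mono N J edge_patch_sum_le edge_const_nonneg add_nonneg_nonneg mult_nonneg_nonneg vol_nonneg) auto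
  also have "(\<Sum>K\<in>\<T>. (err K)\<^sup>2 + diameter K ^ 4 * vol K) = (\<Sum>K\<in>\<T>. (err K)\<^sup>2) + V"
    by (simp add: V_def sum.distrib)
  also have "edge_const \<kappa> B * (8 * ((\<Sum>K\<in>\<T>. (err K)\<^sup>2) + V)) + 13 * (T / \<sigma>\<^sub>2) + 61 * (T / \<sigma>\<^sub>1)
      \<le> edge_const \<kappa> B * (8 * (3 * (1 + M\<^sup>2) * T + vol_const \<kappa> B * (3 * (1 + M\<^sup>2) + 1) * T)) + 13 * (T / \<sigma>\<^sub>2) + 61 * (T / \<sigma>\<^sub>1)"
    using ee V by (intro add_mono mult_left_mono edge_const_nonneg) auto
  finally have "V + (\<Sum>E\<in>interior_edges \<T>. edge_terms \<T> wh E) \<le> vol_const \<kappa> B * (3 * (1 + M\<^sup>2) + 1) * T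
      + (edge_const \<kappa> B * (8 * (3 * (1 + M\<^sup>2) * T + vol_const \<kappa> B * (3 * (1 + M\<^sup>2) + 1) * T)) + 13 * (T / \<sigma>\<^sub>2) + 61 * (T / \<sigma>\<^sub>1))"
    using V by linarith
  also have "\<dots> = total_const \<kappa> M B \<sigma>\<^sub>1 \<sigma>\<^sub>2 * T"
    by (simp add: total_const_def algebra_simps)
  finally show ?thesis
    unfolding V_def T_def using vol_eq by simp
qed

end

lemma total_const_pos:
  assumes "\<sigma>\<^sub>1 > 0" "\<sigma>\<^sub>2 > 0"
  shows "total_const \<kappa> M B \<sigma>\<^sub>1 \<sigma>\<^sub>2 > 0"
  unfolding total_const_def using assms vol_const_nonneg edge_const_nonneg
  by (intro add_nonneg_pos add_nonneg_nonneg mult_nonneg_nonneg) auto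

section \<open>The weak equations of the two components\<close>

lemma is_weak_deriv_0: "is_weak_deriv D js (\<lambda>_. 0) (\<lambda>_. 0)"
  by (simp add: is_weak_deriv_def locally_integrable_def set_integrable_def set_lebesgue_integral_def)

lemma seminorm_sq_0: "open D \<Longrightarrow> seminorm_sq m D (\<lambda>_. 0) = 0"
  by (subst seminorm_sq_eq[where g = "\<lambda>_ _. 0"]) (simp_all add: is_weak_deriv_0 set_lebesgue_integral_def)

lemma test_functions_subset_Hk0:
  assumes "open D" "bounded D" "\<phi> \<in> test_functions D"
  shows "\<phi> \<in> Hk0 k D"
proof -
  have "\<phi> \<in> Hs (real k) D"
    by (rule smooth_Hs[OF assms(2) _ test_function_smooth[OF assms(3)]]) (use assms(1) in auto)
  moreover have "Hs_norm (real k) D (sub_fn \<phi> \<phi>) = 0"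
    by (simp add: Hs_norm_nat sub_fn_def seminorm_sq_0 assms(1))
  ultimately show ?thesis
    unfolding Hk0_def using assms(3) by (auto intro!: exI[of _ "\<lambda>_. \<phi>"])
qed

lemma zero_test_function: "(\<lambda>_. 0) \<in> test_functions D"
  by (rule test_functionI[OF smooth_const compact_empty]) auto

text \<open>The weak derivative of 0 is a choice as well and vanishes only almost
  everywhere.\<close>

lemma a_form_0_right:
  assumes "open D"
  shows "a_form D u (\<lambda>_. 0) = 0"
proof -
  have z: "AE x in lebesgue. x \<in> D \<longrightarrow> weak_deriv D [i, j] (\<lambda>_. 0) x = 0" for i j
    by (rule weak_deriv_AE_eq[OF assms is_weak_deriv_0])
  have "a_form D u (\<lambda>_. 0) = (LINT x:D|lebesgue. 0)"
    unfolding a_form_def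
  proof (rule set_integral_lebesgue_cong_AE)
    show "AE x in lebesgue. x \<in> D \<longrightarrow> (\<Sum>i\<in>UNIV. \<Sum>j\<in>UNIV. weak_deriv D [i, j] u x * weak_deriv D [i, j] (\<lambda>_. 0) x) = 0"
      using z[of 1 1] z[of 1 2] z[of 2 1] z[of 2 2] by eventually_elim (simp add: sum_2)
  qed
  then show ?thesis by (simp add: set_lebesgue_integral_def)
qed

lemma vk_bracket_commute: "vk_bracket D \<eta> \<zeta> = vk_bracket D \<zeta> \<eta>"
  by (simp add: vk_bracket_def algebra_simps)

text \<open>Tests with (\<phi>, 0) and (0, \<phi>). By symmetry of the bracket the two terms of the
  first component add up to a full bracket, while the second component keeps the half.\<close>

lemma regular_solution_equations:
  assumes "open \<Omega>" "bounded \<Omega>" "regular_solution \<Omega> f (u, v)" "\<phi> \<in> test_functions \<Omega>"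
  shows "a_form \<Omega> u \<phi> = (LINT x:\<Omega>|lebesgue. f x * \<phi> x)
      + 1 * (LINT x:\<Omega>|lebesgue. vk_bracket (weak_deriv \<Omega>) u v x * \<phi> x)"
    and "a_form \<Omega> v \<phi> = (LINT x:\<Omega>|lebesgue. 0 * \<phi> x)
      + (- 1 / 2) * (LINT x:\<Omega>|lebesgue. vk_bracket (weak_deriv \<Omega>) u u x * \<phi> x)"
proof -
  have X: "(\<phi>, \<lambda>_. 0) \<in> X_space \<Omega>" "(\<lambda>_. 0, \<phi>) \<in> X_space \<Omega>"
    using test_functions_subset_Hk0[OF assms(1,2)] zero_test_function assms(4) by (auto simp: X_space_def)
  have eq: "vec_A (a_form \<Omega>) (u, v) \<Phi> + vec_B (b_form \<Omega>) (u, v) (u, v) \<Phi> - L_form \<Omega> f \<Phi> = 0"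
    if "\<Phi> \<in> X_space \<Omega>" for \<Phi>
    using assms(3) that by (simp add: regular_solution_def)
  have b0: "b_form \<Omega> p q (\<lambda>_. 0) = 0" for p q by (simp add: b_form_def set_lebesgue_integral_def)
  have bc: "b_form \<Omega> v u \<phi> = b_form \<Omega> u v \<phi>" by (simp add: b_form_def vk_bracket_commute)
  show "a_form \<Omega> u \<phi> = (LINT x:\<Omega>|lebesgue. f x * \<phi> x)
      + 1 * (LINT x:\<Omega>|lebesgue. vk_bracket (weak_deriv \<Omega>) u v x * \<phi> x)"
    using eq[OF X(1)]
    by (simp add: vec_A_def vec_B_def L_form_def a_form_0_right[OF assms(1)] b0 bc) (simp add: b_form_def)
  show "a_form \<Omega> v \<phi> = (LINT x:\<Omega>|lebesgue. 0 * \<phi> x)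
      + (- 1 / 2) * (LINT x:\<Omega>|lebesgue. vk_bracket (weak_deriv \<Omega>) u u x * \<phi> x)"
    using eq[OF X(2)]
    by (simp add: vec_A_def vec_B_def L_form_def a_form_0_right[OF assms(1)] b0)
      (simp add: b_form_def set_lebesgue_integral_def)
qed

section \<open>Uniform bounds for the discrete Hessians and combination of the two equations\<close>

context meshed_domain
begin

text \<open>Writes uh as (uh - pu) + u - (u - pu): the first difference is controlled by the radius
  of the ball, the last by H^2 stability of the interpolation.\<close>

lemma discrete_seminorm_bound:
  assumes u: "u \<in> Hs (real 2) \<Omega>" and pieces: "pieces uh c b H" "pieces pu c' b' H'"
    and interp: "\<And>K. K \<in> \<T> \<Longrightarrow> Hs_norm (real 2) (interior K) (sub_fn u pu) \<le> C * Hs_norm (real 2) (interior K) u"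
    and \<sigma>: "\<sigma>\<^sub>1 > 0" "\<sigma>\<^sub>2 > 0" and R: "(dG_norm \<sigma>\<^sub>1 \<sigma>\<^sub>2 \<T> (sub_fn uh pu))\<^sup>2 \<le> R\<^sup>2" and K: "K \<in> \<T>"
  shows "seminorm_sq 2 (interior K) uh \<le> 2 * R\<^sup>2 + 4 * (1 + C\<^sup>2) * (Hs_norm (real 2) \<Omega> u)\<^sup>2"
proof -
  let ?S = "seminorm_sq 2 (interior K)"
  note H = Hs_on_triangle[OF u K] pieces_Hs[OF pieces(1) K, of 2] pieces_Hs[OF pieces(2) K, of 2]
  have d: "sub_fn uh pu \<in> Hs (real 2) (interior K)" "sub_fn u pu \<in> Hs (real 2) (interior K)"
    using Hs_lincomb[OF H(2,3), of 1 "-1"] Hs_lincomb[OF H(1,3), of 1 "-1"] by (simp_all add: sub_fn_def)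
  have uh: "?S uh \<le> 2 * ?S (sub_fn uh pu) + 2 * ?S pu"
    using seminorm_sq_lincomb_le[OF open_interior d(1) H(3), of 2 1 1] by (simp add: sub_fn_def)
  have pu: "?S pu \<le> 2 * ?S u + 2 * ?S (sub_fn u pu)"
    using seminorm_sq_lincomb_le[OF open_interior H(1) d(2), of 2 1 "-1"] by (simp add: sub_fn_def)
  have le: "?S w \<le> (Hs_norm (real 2) (interior K) w)\<^sup>2" for w
    unfolding Hs_norm_sq by (rule member_le_sum) (auto simp: seminorm_sq_nonneg)
  have N: "(Hs_norm (real 2) (interior K) u)\<^sup>2 \<le> (Hs_norm (real 2) \<Omega> u)\<^sup>2"
    unfolding Hs_norm_sq by (rule sum_mono[OF seminorm_sq_triangle_le[OF u _ K]]) auto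
  have "?S (sub_fn u pu) \<le> (C * Hs_norm (real 2) (interior K) u)\<^sup>2"
    by (rule order_trans[OF le power_mono[OF interp[OF K] Hs_norm_nonneg]])
  also have "\<dots> \<le> C\<^sup>2 * (Hs_norm (real 2) \<Omega> u)\<^sup>2"
    unfolding power_mult_distrib by (rule mult_left_mono[OF N]) simp
  finally have upu: "?S (sub_fn u pu) \<le> C\<^sup>2 * (Hs_norm (real 2) \<Omega> u)\<^sup>2" .
  have "?S (sub_fn uh pu) \<le> (\<Sum>K\<in>\<T>. seminorm_sq 2 (interior K) (sub_fn uh pu))"
    by (rule member_le_sum[OF K]) (auto simp: seminorm_sq_nonneg finite_mesh)
  also have "\<dots> \<le> R\<^sup>2" using dG_norm_sq(1)[OF \<sigma>] R by (rule order_trans)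
  finally have uhpu: "?S (sub_fn uh pu) \<le> R\<^sup>2" .
  have "a \<le> 2 * s' + 2 * (2 * n' + 2 * q')" if "a \<le> 2 * s + 2 * p" "p \<le> 2 * n + 2 * q" "s \<le> s'" "n \<le> n'" "q \<le> q'"
    for a s p n q s' n' q' :: real using that by (simp add: distrib_left)
  from this[OF uh pu uhpu order_trans[OF le N] upu] have "?S uh \<le> 2 * R\<^sup>2 + 2 * (2 * (Hs_norm (real 2) \<Omega> u)\<^sup>2 + 2 * (C\<^sup>2 * (Hs_norm (real 2) \<Omega> u)\<^sup>2))" .
  then show ?thesis by (simp add: algebra_simps)
qed

lemma edge_terms_nonneg: "E \<in> edges \<T> \<Longrightarrow> edge_terms \<T> u E \<ge> 0"
  unfolding edge_terms_def using edge_diameter_pos[of E]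
  by (intro add_nonneg_nonneg mult_nonneg_nonneg sum_nonneg edge_int_square_nonneg) auto

text \<open>One instance of the locale per component. The second equation carries -1/2 [u, u], whose
  square is a quarter of the estimator term; hence the weight 4 on its estimate. The resulting
  factors are at most 10, and 16 is taken for its square root.\<close>

lemma von_Karman_efficiency:
  assumes reg: "regular_solution \<Omega> f (u, v)" and f: "f \<in> L2 \<Omega>"
    and \<sigma>: "\<sigma>\<^sub>1 > 0" "\<sigma>\<^sub>2 > 0"
    and uh: "pieces uh cu bu Hu" and vh: "pieces vh cv bv Hv"
    and \<kappa>: "\<kappa> > 0" and inscribed: "\<And>K. K \<in> \<T> \<Longrightarrow> \<exists>x. cball x (\<kappa> * diameter K) \<subseteq> K"
    and small: "\<And>K. K \<in> \<T> \<Longrightarrow> diameter K \<le> 1"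
    and M: "M \<ge> 0" "\<And>K. K \<in> \<T> \<Longrightarrow> sqrt (seminorm_sq 2 (interior K) u) \<le> M"
      "\<And>K. K \<in> \<T> \<Longrightarrow> sqrt (seminorm_sq 2 (interior K) v) \<le> M"
      "\<And>K. K \<in> \<T> \<Longrightarrow> sqrt (seminorm_sq 2 (interior K) uh) \<le> M"
    and B: "B \<ge> 1" "profile B bump bump' bump''"
      "profile B (\<lambda>t. t * bump t) (\<lambda>t. bump t + t * bump' t) (\<lambda>t. 2 * bump' t + t * bump'' t)"
  shows "(\<Sum>K\<in>\<T>. eta_K_sq \<T> f (uh, vh) K) + (\<Sum>E\<in>interior_edges \<T>. eta_E_sq \<T> (uh, vh) E)
    \<le> (4 * sqrt (total_const \<kappa> M B \<sigma>\<^sub>1 \<sigma>\<^sub>2))\<^sup>2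
      * ((dG_norm_pair \<sigma>\<^sub>1 \<sigma>\<^sub>2 \<T> (sub_pair (u, v) (uh, vh)))\<^sup>2 + osc_sq \<T> f)"
proof -
  note eqs = regular_solution_equations[OF open_domain bounded_domain reg]
  have uv: "u \<in> Hk0 2 \<Omega>" "v \<in> Hk0 2 \<Omega>" using reg by (auto simp: regular_solution_def X_space_def)
  have r: "\<bar>1 :: real\<bar> \<le> 1" "\<bar>- 1 / 2 :: real\<bar> \<le> 1" by simp_all
  have zero: "(\<lambda>_. 0) \<in> L2 \<Omega>" by (simp add: L2_def set_borel_measurable_def set_integrable_def)
  interpret I: shape_regular_residual \<Omega> \<T> u u v f 1 uh uh vh cu cu cv bu bu bv Hu Hu Hv \<kappa> M B
    by unfold_locales (fact uv f r eqs uh vh \<kappa> inscribed small M B)+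
  interpret II: shape_regular_residual \<Omega> \<T> v u u "\<lambda>_. 0" "- 1 / 2" vh uh uh cv cu cu bv bu bu Hv Hu Hu \<kappa> M B
    by unfold_locales (fact uv zero r eqs uh vh \<kappa> inscribed small M B)+
  let ?G = "total_const \<kappa> M B \<sigma>\<^sub>1 \<sigma>\<^sub>2"
  let ?S = "\<lambda>w. \<Sum>K\<in>\<T>. seminorm_sq 2 (interior K) w"
  let ?d = "\<lambda>w. (dG_norm \<sigma>\<^sub>1 \<sigma>\<^sub>2 \<T> w)\<^sup>2"
  define V1 where "V1 = (\<Sum>K\<in>\<T>. diameter K ^ 4 * (LINT x:K|lebesgue. (f x + 1 * vk_bracket (pw_deriv \<T>) uh vh x)\<^sup>2))"
  define V2 where "V2 = (\<Sum>K\<in>\<T>. diameter K ^ 4 * (LINT x:K|lebesgue. (0 + (- 1 / 2) * vk_bracket (pw_deriv \<T>) uh uh x)\<^sup>2))"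
  define E1 where "E1 = (\<Sum>E\<in>interior_edges \<T>. edge_terms \<T> uh E)"
  define E2 where "E2 = (\<Sum>E\<in>interior_edges \<T>. edge_terms \<T> vh E)"
  have E2: "E2 \<ge> 0" unfolding E2_def using interior_edges_subset edge_terms_nonneg by (intro sum_nonneg) auto
  have K: "eta_K_sq \<T> f (uh, vh) K = diameter K ^ 4 * (LINT x:K|lebesgue. (f x + 1 * vk_bracket (pw_deriv \<T>) uh vh x)\<^sup>2)
      + 4 * (diameter K ^ 4 * (LINT x:K|lebesgue. (0 + (- 1 / 2) * vk_bracket (pw_deriv \<T>) uh uh x)\<^sup>2))" for K
  proof -
    have "(0 + (- 1 / 2) * t)\<^sup>2 = 1 / 4 * t\<^sup>2" for t :: real by (simp add: power2_eq_square)
    then show ?thesis unfolding eta_K_sq_def by (simp only: set_integral_mult_right) (simp add: algebra_simps)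
  qed
  have "(\<Sum>K\<in>\<T>. eta_K_sq \<T> f (uh, vh) K) + (\<Sum>E\<in>interior_edges \<T>. eta_E_sq \<T> (uh, vh) E) = V1 + 4 * V2 + E1 + E2"
    unfolding K eta_E_sq_edge_terms V1_def V2_def E1_def E2_def
    by (simp only: sum.distrib sum_distrib_left[symmetric] fst_conv snd_conv)
  also have "\<dots> \<le> (V1 + E1) + 4 * (V2 + E2)" using E2 by simp
  also have "\<dots> \<le> ?G * (?d (sub_fn u uh) + ?S (sub_fn u uh) + ?S (sub_fn v vh) + osc_sq \<T> f)
      + 4 * (?G * (?d (sub_fn v vh) + ?S (sub_fn u uh) + ?S (sub_fn u uh) + osc_sq \<T> (\<lambda>_. 0)))"
    unfolding V1_def V2_def E1_def E2_def by (intro add_mono mult_left_mono I.efficiency[OF \<sigma>] II.efficiency[OF \<sigma>]) simp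
  also have "\<dots> = ?G * ((?d (sub_fn u uh) + ?S (sub_fn u uh) + ?S (sub_fn v vh) + osc_sq \<T> f)
      + 4 * (?d (sub_fn v vh) + ?S (sub_fn u uh) + ?S (sub_fn u uh)))"
    by (simp add: osc_sq_def mean_on_def set_lebesgue_integral_def distrib_left)
  also have "\<dots> \<le> ?G * (16 * (?d (sub_fn u uh) + ?d (sub_fn v vh) + osc_sq \<T> f))"
  proof (rule mult_left_mono)
    have "osc_sq \<T> f \<ge> 0" unfolding osc_sq_def
      by (intro sum_nonneg mult_nonneg_nonneg set_integral_square_nonneg) (simp add: zero_le_even_power)
    then show "(?d (sub_fn u uh) + ?S (sub_fn u uh) + ?S (sub_fn v vh) + osc_sq \<T> f)
      + 4 * (?d (sub_fn v vh) + ?S (sub_fn u uh) + ?S (sub_fn u uh)) \<le> 16 * (?d (sub_fn u uh) + ?d (sub_fn v vh) + osc_sq \<T> f)"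
      using dG_norm_sq(1)[OF \<sigma>, of "sub_fn u uh"] dG_norm_sq(1)[OF \<sigma>, of "sub_fn v vh"]
        zero_le_power2[of "dG_norm \<sigma>\<^sub>1 \<sigma>\<^sub>2 \<T> (sub_fn u uh)"] zero_le_power2[of "dG_norm \<sigma>\<^sub>1 \<sigma>\<^sub>2 \<T> (sub_fn v vh)"]
      unfolding distrib_left by linarith
  qed (rule less_imp_le[OF total_const_pos[OF \<sigma>]])
  also have "\<dots> = (4 * sqrt ?G)\<^sup>2 * ((dG_norm_pair \<sigma>\<^sub>1 \<sigma>\<^sub>2 \<T> (sub_pair (u, v) (uh, vh)))\<^sup>2 + osc_sq \<T> f)"
    using total_const_pos[OF \<sigma>, of \<kappa> M B]
    by (simp add: power_mult_distrib dG_norm_pair_def sub_pair_def)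
  finally show ?thesis .
qed

end

text \<open>Every ingredient of the constant is fixed before the mesh: \<kappa> by shape regularity,
  \<open>B\<close> by the profiles, and \<open>M\<close> by \<Psi>, the interpolation constant and
  \<open>C\<^sub>1\<close>.\<close>

theorem theorem5p2:
  fixes \<Omega> :: "pt set" and \<alpha> \<sigma>\<^sub>1 :: real and f :: scalar_fn and \<Psi> :: pair_fn
    and \<TT> :: "mesh set" and P :: "mesh \<Rightarrow> scalar_fn \<Rightarrow> scalar_fn"
  assumes "polygonal_domain \<Omega>"
    and "1/2 < \<alpha>" and "\<alpha> \<le> 1" and "elliptic_regularity \<Omega> \<alpha>"
    and "f \<in> L2 \<Omega>"
    and "\<sigma>\<^sub>1 > 0"
    and "shape_regular_family \<Omega> \<TT>"
    and "interpolation_family \<Omega> \<alpha> \<sigma>\<^sub>1 \<TT> P"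
    and "regular_solution \<Omega> f \<Psi>"
  shows "\<exists>\<sigma>low>0. \<forall>\<sigma>\<^sub>2\<ge>\<sigma>low. \<forall>C\<^sub>1. mu_constant \<alpha> \<sigma>\<^sub>1 \<sigma>\<^sub>2 \<TT> P f \<Psi> C\<^sub>1 \<longrightarrow>
    (\<exists>h\<^sub>0>0. \<exists>Ceff>0. \<forall>\<T>\<in>\<TT>. mesh_size \<T> \<le> h\<^sub>0 \<longrightarrow>
      (\<forall>\<Psi>dG. local_solution \<Omega> \<sigma>\<^sub>1 \<sigma>\<^sub>2 \<T> f (interp_pair P \<T> \<Psi>)
                (2 * C\<^sub>1 * mesh_size \<T> powr \<alpha>) \<Psi>dG \<longrightarrow>
        (\<Sum>K\<in>\<T>. eta_K_sq \<T> f \<Psi>dG K) + (\<Sum>E\<in>interior_edges \<T>. eta_E_sq \<T> \<Psi>dG E)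
          \<le> Ceff\<^sup>2 * ((dG_norm_pair \<sigma>\<^sub>1 \<sigma>\<^sub>2 \<T> (sub_pair \<Psi> \<Psi>dG))\<^sup>2 + osc_sq \<T> f)))"
proof -
  obtain u v where \<Psi>: "\<Psi> = (u, v)" by (cases \<Psi>)
  have dom: "\<Omega> \<noteq> {}" "open \<Omega>" "bounded \<Omega>" "interior (closure \<Omega>) = \<Omega>"
    using assms(1) by (auto simp: polygonal_domain_def)
  obtain \<kappa> where meshes: "\<And>\<T>. \<T> \<in> \<TT> \<Longrightarrow> mesh_of \<Omega> \<T>" and \<kappa>: "\<kappa> > 0"
    and inscribed: "\<And>\<T> K. \<T> \<in> \<TT> \<Longrightarrow> K \<in> \<T> \<Longrightarrow> \<exists>z. cball z (\<kappa> * diameter K) \<subseteq> K"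
    using assms(7) unfolding shape_regular_family_def by metis
  note interpolation = assms(8)[unfolded interpolation_family_def]
  note clauses = interpolation[THEN conjunct1] interpolation[THEN conjunct2, THEN conjunct2, THEN conjunct1]
  \<comment> \<open>For q = s = 2 the power of the diameter has exponent 0, which leaves stability
    of the interpolation in H^2.\<close>
  obtain C where C: "\<forall>\<T>\<in>\<TT>. \<forall>\<phi>\<in>broken_Hs 2 \<T>. \<forall>K\<in>\<T>. Hs_norm 2 (interior K) (sub_fn \<phi> (P \<T> \<phi>))
      \<le> C * diameter K powr (min 3 2 - 2) * Hs_norm 2 (interior K) \<phi>"
    using clauses(2)[rule_format, of 2 2] by auto
  obtain B where B: "B \<ge> 1" "profile B bump bump' bump''"
    "profile B (\<lambda>t. t * bump t) (\<lambda>t. bump t + t * bump' t) (\<lambda>t. 2 * bump' t + t * bump'' t)"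
    by (rule bump_profiles)
  have uv: "u \<in> Hs (real 2) \<Omega>" "v \<in> Hs (real 2) \<Omega>"
    using assms(9) by (auto simp: \<Psi> regular_solution_def X_space_def Hk0_def)
  let ?N = "\<lambda>w. (Hs_norm (real 2) \<Omega> w)\<^sup>2"
  show ?thesis
  \<comment> \<open>The threshold 1 secures \<open>\<sigma>\<^sub>2 > 0\<close>.\<close>
  proof (rule exI[of _ 1], intro conjI allI impI)
    fix \<sigma>\<^sub>2 C\<^sub>1 :: real
    assume "1 \<le> \<sigma>\<^sub>2" and "mu_constant \<alpha> \<sigma>\<^sub>1 \<sigma>\<^sub>2 \<TT> P f \<Psi> C\<^sub>1"
    then have \<sigma>: "\<sigma>\<^sub>1 > 0" "\<sigma>\<^sub>2 > 0" and C1: "C\<^sub>1 > 0" using assms(6) by (auto simp: mu_constant_def)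
    \<comment> \<open>The bound of \<open>discrete_seminorm_bound\<close> with radius
      \<open>2 * C\<^sub>1\<close>, which dominates the radius of the ball as soon as the mesh size
      is at most 1.\<close>
    define L where "L = 2 * (2 * C\<^sub>1)\<^sup>2 + 4 * (1 + C\<^sup>2) * ?N u"
    have L: "L \<ge> 0" unfolding L_def by simp
    define M where "M = sqrt L + sqrt (?N u) + sqrt (?N v)"
    have Ms: "M \<ge> sqrt L" "M \<ge> sqrt (?N u)" "M \<ge> sqrt (?N v)" "M \<ge> 0"
      unfolding M_def using L by simp_all
    let ?Ceff = "4 * sqrt (total_const \<kappa> M B \<sigma>\<^sub>1 \<sigma>\<^sub>2)"
    have est: "(\<Sum>K\<in>\<T>. eta_K_sq \<T> f \<Psi>dG K) + (\<Sum>E\<in>interior_edges \<T>. eta_E_sq \<T> \<Psi>dG E)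
        \<le> ?Ceff\<^sup>2 * ((dG_norm_pair \<sigma>\<^sub>1 \<sigma>\<^sub>2 \<T> (sub_pair \<Psi> \<Psi>dG))\<^sup>2 + osc_sq \<T> f)"
      if T: "\<T> \<in> \<TT>" "mesh_size \<T> \<le> 1"
        and sol: "local_solution \<Omega> \<sigma>\<^sub>1 \<sigma>\<^sub>2 \<T> f (interp_pair P \<T> \<Psi>) (2 * C\<^sub>1 * mesh_size \<T> powr \<alpha>) \<Psi>dG" for \<T> \<Psi>dG
    proof -
      obtain uh vh where h: "\<Psi>dG = (uh, vh)" by (cases \<Psi>dG)
      interpret meshed_domain \<Omega> \<T> by unfold_locales (fact dom meshes[OF T(1)])+
      have size: "diameter K \<le> mesh_size \<T>" if "K \<in> \<T>" for K
        unfolding mesh_size_def using that finite_mesh by (intro Max_ge) auto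
      \<comment> \<open>\<open>mesh_size\<close> is a maximum over the triangles. A mesh without
        triangles has to be excluded to see that it is nonnegative, which the bound on its power
        requires.\<close>
      have "closure \<Omega> \<noteq> {}" using dom(1) by simp
      then have "\<T> \<noteq> {}" using meshes[OF T(1)] unfolding mesh_of_def by (metis Union_empty)
      then obtain K0 where "K0 \<in> \<T>" by blast
      then have pos: "mesh_size \<T> \<ge> 0" using size[of K0] triangle_diameter_pos[OF triangle[of K0]] by simp
      have small: "diameter K \<le> 1" if "K \<in> \<T>" for K using size[OF that] T(2) by simp
      have "mesh_size \<T> powr \<alpha> \<le> 1" using assms(2) pos T(2) by (intro powr_le1) auto
      then have "2 * C\<^sub>1 * mesh_size \<T> powr \<alpha> \<le> 2 * C\<^sub>1" using C1 by simp
      moreover have ball: "uh \<in> pw_polys 2 \<T>" "vh \<in> pw_polys 2 \<T>"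
        "dG_norm_pair \<sigma>\<^sub>1 \<sigma>\<^sub>2 \<T> (sub_pair (uh, vh) (P \<T> u, P \<T> v)) \<le> 2 * C\<^sub>1 * mesh_size \<T> powr \<alpha>"
        using sol unfolding local_solution_def dG_ball_def P2_def interp_pair_def h \<Psi> by auto
      ultimately have "dG_norm_pair \<sigma>\<^sub>1 \<sigma>\<^sub>2 \<T> (sub_pair (uh, vh) (P \<T> u, P \<T> v)) \<le> 2 * C\<^sub>1" by linarith
      then have "(dG_norm_pair \<sigma>\<^sub>1 \<sigma>\<^sub>2 \<T> (sub_pair (uh, vh) (P \<T> u, P \<T> v)))\<^sup>2 \<le> (2 * C\<^sub>1)\<^sup>2"
        by (intro power_mono) (simp_all add: dG_norm_pair_def)
      moreover have "(dG_norm \<sigma>\<^sub>1 \<sigma>\<^sub>2 \<T> (sub_fn uh (P \<T> u)))\<^sup>2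
          \<le> (dG_norm_pair \<sigma>\<^sub>1 \<sigma>\<^sub>2 \<T> (sub_pair (uh, vh) (P \<T> u, P \<T> v)))\<^sup>2"
        by (simp add: dG_norm_pair_def sub_pair_def)
      ultimately have R: "(dG_norm \<sigma>\<^sub>1 \<sigma>\<^sub>2 \<T> (sub_fn uh (P \<T> u)))\<^sup>2 \<le> (2 * C\<^sub>1)\<^sup>2"
        by (rule order_trans[rotated])
      have br: "u \<in> broken_Hs 2 \<T>" using Hs_on_triangle[OF uv(1)] by (simp add: broken_Hs_def)
      \<comment> \<open>\<open>x powr 0\<close> is 1 only for nonzero \<open>x\<close>, hence the
        appeal to the positive diameter.\<close>
      have interp: "Hs_norm (real 2) (interior K) (sub_fn u (P \<T> u)) \<le> C * Hs_norm (real 2) (interior K) u"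
        if "K \<in> \<T>" for K
        using C[rule_format, OF T(1) br that] triangle_diameter_pos[OF triangle[OF that]] by simp
      obtain cu bu Hu where uh: "pieces uh cu bu Hu" by (rule pw_polys_pieces[OF ball(1)])
      obtain cv bv Hv where vh: "pieces vh cv bv Hv" by (rule pw_polys_pieces[OF ball(2)])
      have "P \<T> u \<in> pw_polys 2 \<T>" using clauses(1)[rule_format, OF T(1) _ br] by simp
      then obtain cp bp Hp where Pu: "pieces (P \<T> u) cp bp Hp" by (rule pw_polys_pieces)
      have N: "sqrt (seminorm_sq 2 (interior K) w) \<le> sqrt (?N w)" if "w \<in> Hs (real 2) \<Omega>" "K \<in> \<T>" for w K
      proof -
        have "seminorm_sq 2 \<Omega> w \<le> ?N w" unfolding Hs_norm_sq by (rule member_le_sum) (auto simp: seminorm_sq_nonneg)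
        then show ?thesis using seminorm_sq_triangle_le[OF that(1) order_refl that(2)] by (intro real_sqrt_le_mono) linarith
      qed
      have M: "sqrt (seminorm_sq 2 (interior K) u) \<le> M" "sqrt (seminorm_sq 2 (interior K) v) \<le> M"
        "sqrt (seminorm_sq 2 (interior K) uh) \<le> M" if "K \<in> \<T>" for K
        using N[OF uv(1) that] N[OF uv(2) that] Ms
          real_sqrt_le_mono[OF discrete_seminorm_bound[OF uv(1) uh Pu interp \<sigma> R that, folded L_def]] by linarith+
      show ?thesis
        unfolding h \<Psi>
        by (rule von_Karman_efficiency[OF assms(9)[unfolded \<Psi>] assms(5) \<sigma> uh vh \<kappa> inscribed[OF T(1)] small Ms(4) M B])
    qed
    show "\<exists>h\<^sub>0>0. \<exists>Ceff>0. \<forall>\<T>\<in>\<TT>. mesh_size \<T> \<le> h\<^sub>0 \<longrightarrow>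
      (\<forall>\<Psi>dG. local_solution \<Omega> \<sigma>\<^sub>1 \<sigma>\<^sub>2 \<T> f (interp_pair P \<T> \<Psi>) (2 * C\<^sub>1 * mesh_size \<T> powr \<alpha>) \<Psi>dG \<longrightarrow>
        (\<Sum>K\<in>\<T>. eta_K_sq \<T> f \<Psi>dG K) + (\<Sum>E\<in>interior_edges \<T>. eta_E_sq \<T> \<Psi>dG E)
          \<le> Ceff\<^sup>2 * ((dG_norm_pair \<sigma>\<^sub>1 \<sigma>\<^sub>2 \<T> (sub_pair \<Psi> \<Psi>dG))\<^sup>2 + osc_sq \<T> f))"
      using total_const_pos[OF \<sigma>, of \<kappa> M B] est by (intro exI[of _ 1] exI[of _ ?Ceff] conjI ballI impI allI) simp_all
  qed simp
qed

end
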